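(* Let $T>0$ and let $(u,\theta)$ be a mild solution of the Boussinesq system, with data $(u_0,\theta_0)$, such that $$(u,\theta)\in C\bigl([0,T],L^3(\mathbb{R}^3)\bigr)\times Y_{q,\infty}$$ for some $3/2<q<3$. Then the data $(u_0,\theta_0)$ belong to $L^3(\mathbb{R}^3)\times B^{-3(1-1/q)}_{q,\infty,\infty}(\mathbb{R}^3)$ and uniquely determine $(u,\theta)$; that is, if $(\tilde u,\tilde\theta)\in C([0,T],L^3(\mathbb{R}^3))\times Y_{q,\infty}$ is another mild solution with the same data $(u_0,\theta_0)$, then $(\tilde u,\tilde\theta)=(u,\theta)$.
   Context: The unknowns are a velocity field $u$ with values in $\mathbb{R}^3$ and a scalar temperature $\theta$, functions of $x\in\mathbb{R}^3$ and time $t$. Let $e_3=(0,0,1)$ and let $\mathbb{P}$ denote the Leray projector onto divergence-free vector fields on $\mathbb{R}^3$; $e^{t\Delta}$ is the heat semigroup. A mild solution of the Boussinesq system with data $(u_0,\theta_0)$ is a pair $(u,\theta)$ satisfying the integral system $$\theta(t)=e^{t\Delta}\theta_0-\int_0^t e^{(t-s)\Delta}\nabla\cdot(\theta u)(s)\,ds,$$ $$u(t)=e^{t\Delta}u_0-\int_0^t e^{(t-s)\Delta}\mathbb{P}\nabla\cdot(u\otimes u)(s)\,ds+\int_0^t e^{(t-s)\Delta}\mathbb{P}\,\theta(s)e_3\,ds,\qquad \nabla\cdot u_0=0.$$ $L^{q,\infty}(\mathbb{R}^3)$ is the weak Lebesgue (Lorentz) space. $L^\infty_{\rm loc}((0,T),L^{q,\infty})$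 means essentially bounded in time with values in $L^{q,\infty}$ on compact subintervals of $(0,T)$. For $1<q<\infty$, $Y_{q,\infty}$ is the subspace of $L^\infty_{\rm loc}((0,T),L^{q,\infty}(\mathbb{R}^3))$ made of the functions $\theta$ such that $$\sup_{0<t<T}t^{\frac32(1-\frac1q)}\|\theta(t)\|_{L^{q,\infty}}<\infty\quad\text{and}\quad \lim_{t\to0}t^{\frac32(1-\frac1q)}\|\theta(t)\|_{L^{q,\infty}}=0.$$ For $\sigma>0$, $B^{-\sigma}_{q,\infty,\infty}(\mathbb{R}^3)$ is the space of tempered distributions $f$ such that, for some $T'>0$, $\sup_{0<t<T'}t^{\sigma/2}\|e^{t\Delta}f\|_{L^{q,\infty}}<\infty$. *)

theory Defs
  imports "HOL-Analysis.Analysis"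
begin

section \<open>Test functions and tempered distributions\<close>

definition partial :: "3 \<Rightarrow> (real^3 \<Rightarrow> real) \<Rightarrow> real^3 \<Rightarrow> real" where
  "partial k \<phi> x = frechet_derivative \<phi> (at x) (axis k 1)"

definition partials :: "3 list \<Rightarrow> (real^3 \<Rightarrow> real) \<Rightarrow> real^3 \<Rightarrow> real" where
  "partials ks \<phi> = fold partial ks \<phi>"

definition schwartz :: "(real^3 \<Rightarrow> real) set" where
  "schwartz = {\<phi>. \<forall>ks. (\<forall>x. partials ks \<phi> differentiable (at x)) \<and>
     (\<forall>n::nat. bounded (range (\<lambda>x. (1 + norm x) ^ n * partials ks \<phi> x)))}"

definition schwartz_seminorm :: "nat \<Rightarrow> (real^3 \<Rightarrow> real) \<Rightarrow> real" where
  "schwartz_seminorm N \<phi> =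
     (SUP (ks, x) \<in> {ks. length ks \<le> N} \<times> UNIV. (1 + norm x) ^ N * \<bar>partials ks \<phi> x\<bar>)"

text \<open>
  Distributions are real valued.  They are represented by functionals on all functions
  \<open>real^3 \<Rightarrow> real\<close>; for a tempered distribution only the values on Schwartz functions carry
  information.
\<close>

type_synonym dist = "(real^3 \<Rightarrow> real) \<Rightarrow> real"

definition tempered :: "dist \<Rightarrow> bool" where
  "tempered f \<longleftrightarrow>
     (\<forall>\<phi>\<in>schwartz. \<forall>\<psi>\<in>schwartz. \<forall>a b. f (\<lambda>x. a * \<phi> x + b * \<psi> x) = a * f \<phi> + b * f \<psi>) \<and>
     (\<exists>C N. \<forall>\<phi>\<in>schwartz. \<bar>f \<phi>\<bar> \<le> C * schwartz_seminorm N \<phi>)"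

definition regular :: "(real^3 \<Rightarrow> real) \<Rightarrow> dist" where
  "regular g \<phi> = (\<integral>x. g x * \<phi> x \<partial>lborel)"

definition dist_partial :: "3 \<Rightarrow> dist \<Rightarrow> dist" where
  "dist_partial k f \<phi> = - f (partial k \<phi>)"

definition dist_div :: "(3 \<Rightarrow> dist) \<Rightarrow> dist" where
  "dist_div F \<phi> = (\<Sum>k\<in>UNIV. dist_partial k (F k) \<phi>)"

definition divergence_free :: "(3 \<Rightarrow> dist) \<Rightarrow> bool" where
  "divergence_free F \<longleftrightarrow> (\<forall>\<phi>\<in>schwartz. dist_div F \<phi> = 0)"


section \<open>Heat semigroup and Leray projector\<close>

definition heat_kernel :: "real \<Rightarrow> real^3 \<Rightarrow> real" where
  "heat_kernel t x = (4 * pi * t) powr (-3/2) * exp (- (norm x)\<^sup>2 / (4 * t))"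

text \<open>
  For \<open>t > 0\<close> the distribution \<open>e\<^sup>t\<^sup>\<Delta> f\<close> is the smooth function
  obtained by convolving \<open>f\<close> with the heat kernel.
\<close>

definition heat :: "real \<Rightarrow> dist \<Rightarrow> real^3 \<Rightarrow> real" where
  "heat t f x = f (\<lambda>y. heat_kernel t (x - y))"

definition fourier :: "(real^3 \<Rightarrow> real) \<Rightarrow> real^3 \<Rightarrow> complex" where
  "fourier \<phi> \<xi> = (\<integral>x. cis (- (x \<bullet> \<xi>)) * complex_of_real (\<phi> x) \<partial>lborel)"

definition leray_symbol :: "3 \<Rightarrow> 3 \<Rightarrow> real^3 \<Rightarrow> real" where
  "leray_symbol i j \<xi> = (if i = j then 1 else 0) - \<xi> $ i * \<xi> $ j / (norm \<xi>)\<^sup>2"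

text \<open>
  Taking the real part discards nothing: the symbol is real and even, so the Fourier multiplier
  maps real functions to real functions.
\<close>

definition leray_test :: "3 \<Rightarrow> 3 \<Rightarrow> (real^3 \<Rightarrow> real) \<Rightarrow> real^3 \<Rightarrow> real" where
  "leray_test i j \<phi> x =
     Re (complex_of_real (1 / (2 * pi) ^ 3) *
         (\<integral>\<xi>. cis (x \<bullet> \<xi>) * complex_of_real (leray_symbol i j \<xi>) * fourier \<phi> \<xi> \<partial>lborel))"

text \<open>
  The Leray projector acts on distributions by duality; its symbol is symmetric and even, so it is
  its own transpose.  For Schwartz \<open>\<phi>\<close> the function \<open>leray_test i j \<phi>\<close> is smooth but need not be
  Schwartz: it decays like \<open>\<bar>x\<bar>\<^sup>-\<^sup>3\<close> and its first derivatives
  like \<open>\<bar>x\<bar>\<^sup>-\<^sup>4\<close>.  The projector is applied below only to functions in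
  \<open>L\<^sup>q\<^sup>,\<^sup>\<infinity>\<close> with \<open>1 < q < \<infinity>\<close> and to first derivatives of
  functions in \<open>L\<^sup>3\<^sup>/\<^sup>2\<close>.  As functionals these are given by absolutely convergent
  integrals on such functions too.
\<close>

definition leray :: "(3 \<Rightarrow> dist) \<Rightarrow> 3 \<Rightarrow> dist" where
  "leray F i \<phi> = (\<Sum>j\<in>UNIV. F j (leray_test i j \<phi>))"


section \<open>Function spaces\<close>

definition Lp_space :: "real \<Rightarrow> (real^3 \<Rightarrow> real^3) set" where
  "Lp_space p = {f \<in> borel_measurable lborel. integrable lborel (\<lambda>x. norm (f x) powr p)}"

definition Lp_norm :: "real \<Rightarrow> (real^3 \<Rightarrow> real^3) \<Rightarrow> real" where
  "Lp_norm p f = (\<integral>x. norm (f x) powr p \<partial>lborel) powr (1 / p)"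

definition C_Lp :: "real \<Rightarrow> real \<Rightarrow> (real \<Rightarrow> real^3 \<Rightarrow> real^3) set" where
  "C_Lp T p = {u. (\<forall>t\<in>{0..T}. u t \<in> Lp_space p) \<and>
     (\<forall>t\<in>{0..T}. ((\<lambda>s. Lp_norm p (\<lambda>x. u s x - u t x)) \<longlongrightarrow> 0) (at t within {0..T}))}"

definition dist_in_Lp :: "real \<Rightarrow> (3 \<Rightarrow> dist) \<Rightarrow> bool" where
  "dist_in_Lp p f \<longleftrightarrow>
     (\<exists>g\<in>Lp_space p. \<forall>i. \<forall>\<phi>\<in>schwartz. f i \<phi> = regular (\<lambda>x. g x $ i) \<phi>)"

definition ennreal_powr :: "ennreal \<Rightarrow> real \<Rightarrow> ennreal" where
  "ennreal_powr m a = (if m = top then top else ennreal (enn2real m powr a))"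

definition weak_norm :: "real \<Rightarrow> (real^3 \<Rightarrow> real) \<Rightarrow> ennreal" where
  "weak_norm q f =
     (SUP l\<in>{0<..}. ennreal l * ennreal_powr (emeasure lborel {x. l < \<bar>f x\<bar>}) (1 / q))"

text \<open>
  Elements of \<open>L_inf_loc_weak T q\<close> and of \<open>Y_space T q\<close> are jointly Borel measurable
  representatives on \<open>(0, T) \<times> \<real>\<^sup>3\<close>.  They matter only up to null sets of times, so suprema
  and limits in time are essential ones.
\<close>

definition L_inf_loc_weak :: "real \<Rightarrow> real \<Rightarrow> (real \<Rightarrow> real^3 \<Rightarrow> real) set" where
  "L_inf_loc_weak T q = {\<theta>.
     (\<lambda>(t, x). \<theta> t x) \<in> borel_measurable (restrict_space borel ({0<..<T} \<times> UNIV)) \<and>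
     (\<forall>a b. 0 < a \<and> a \<le> b \<and> b < T \<longrightarrow>
        (\<exists>C::real. AE t in lborel. t \<in> {a..b} \<longrightarrow> weak_norm q (\<theta> t) \<le> ennreal C))}"

definition Y_space :: "real \<Rightarrow> real \<Rightarrow> (real \<Rightarrow> real^3 \<Rightarrow> real) set" where
  "Y_space T q = {\<theta> \<in> L_inf_loc_weak T q.
     (\<exists>C::real. AE t in lborel. t \<in> {0<..<T} \<longrightarrow>
        ennreal (t powr (3/2 * (1 - 1/q))) * weak_norm q (\<theta> t) \<le> ennreal C) \<and>
     (\<forall>\<epsilon>>0::real. \<exists>\<delta>>0. AE t in lborel. t \<in> {0<..<T} \<and> t < \<delta> \<longrightarrow>
        ennreal (t powr (3/2 * (1 - 1/q))) * weak_norm q (\<theta> t) \<le> ennreal \<epsilon>)}"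

text \<open>\<open>Besov_Lorentz \<sigma> q\<close> is \<open>B\<^sup>-\<^sup>\<sigma>\<close> with indices \<open>q, \<infinity>, \<infinity>\<close>.\<close>

definition Besov_Lorentz :: "real \<Rightarrow> real \<Rightarrow> dist set" where
  "Besov_Lorentz \<sigma> q = {f. tempered f \<and>
     (\<exists>T'>0. (SUP t\<in>{0<..<T'}. ennreal (t powr (\<sigma> / 2)) * weak_norm q (heat t f)) < top)}"


section \<open>Mild solutions of the Boussinesq system\<close>

definition e3 :: "real^3" where
  "e3 = axis 3 1"

text \<open>The three Duhamel integrands at time \<open>s\<close>.  Row \<open>j\<close> of
  \<open>\<nabla> \<cdot> (u \<otimes> u)\<close> is \<open>\<Sum>k. \<partial>\<^sub>k (u\<^sub>k u\<^sub>j)\<close>.\<close>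

definition transport_term ::
  "(real \<Rightarrow> real^3 \<Rightarrow> real^3) \<Rightarrow> (real \<Rightarrow> real^3 \<Rightarrow> real) \<Rightarrow> real \<Rightarrow> real \<Rightarrow> real^3 \<Rightarrow> real" where
  "transport_term u \<theta> t s x =
     heat (t - s) (dist_div (\<lambda>k. regular (\<lambda>y. \<theta> s y * u s y $ k))) x"

definition convection_term ::
  "(real \<Rightarrow> real^3 \<Rightarrow> real^3) \<Rightarrow> 3 \<Rightarrow> real \<Rightarrow> real \<Rightarrow> real^3 \<Rightarrow> real" where
  "convection_term u i t s x =
     heat (t - s) (leray (\<lambda>j. dist_div (\<lambda>k. regular (\<lambda>y. u s y $ k * u s y $ j))) i) x"

definition buoyancy_term ::
  "(real \<Rightarrow> real^3 \<Rightarrow> real) \<Rightarrow> 3 \<Rightarrow> real \<Rightarrow> real \<Rightarrow> real^3 \<Rightarrow> real" where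
  "buoyancy_term \<theta> i t s x =
     heat (t - s) (leray (\<lambda>j. regular (\<lambda>y. \<theta> s y * e3 $ j)) i) x"

definition mild_solution ::
  "real \<Rightarrow> (3 \<Rightarrow> dist) \<Rightarrow> dist \<Rightarrow> (real \<Rightarrow> real^3 \<Rightarrow> real^3) \<Rightarrow> (real \<Rightarrow> real^3 \<Rightarrow> real) \<Rightarrow> bool" where
  "mild_solution T u0 \<theta>0 u \<theta> \<longleftrightarrow>
     (\<forall>i. tempered (u0 i)) \<and> tempered \<theta>0 \<and> divergence_free u0 \<and>
     (AE t in lborel. t \<in> {0<..<T} \<longrightarrow> (AE x in lborel.
        set_integrable lborel {0<..<t} (\<lambda>s. transport_term u \<theta> t s x) \<and>
        \<theta> t x = heat t \<theta>0 x - (LBINT s:{0<..<t}. transport_term u \<theta> t s x))) \<and>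
     (AE t in lborel. t \<in> {0<..<T} \<longrightarrow> (AE x in lborel. \<forall>i.
        set_integrable lborel {0<..<t} (\<lambda>s. convection_term u i t s x) \<and>
        set_integrable lborel {0<..<t} (\<lambda>s. buoyancy_term \<theta> i t s x) \<and>
        u t x $ i = heat t (u0 i) x
          - (LBINT s:{0<..<t}. convection_term u i t s x)
          + (LBINT s:{0<..<t}. buoyancy_term \<theta> i t s x)))"

end

theory Submission
  imports Defs "HOL-Probability.Probability" "HOL-Real_Asymp.Real_Asymp"
begin

text \<open>
  The weak Lebesgue quasi-norms are replaced by the testing condition
  \<open>\<integral>\<^sub>E |f| \<le> A |E|\<^sup>1\<^sup>-\<^sup>1\<^sup>/\<^sup>p\<close> over sets \<open>E\<close> of finite measure, and the kernels of
  \<open>e\<^sup>t\<^sup>\<Delta>\<nabla>\<close>, \<open>e\<^sup>t\<^sup>\<Delta>P\<nabla>\<close> and \<open>e\<^sup>t\<^sup>\<Delta>P\<close> are dominated by powers of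
  \<open>t + |x|\<^sup>2\<close>, which are superpositions of indicators of balls.  Testing on \<open>E\<close> and balancing the radius
  of the balls against \<open>|E|\<close> gives the critical estimate of Duhamel integrals without a loss in time.

  Let \<open>w\<close> and \<open>\<eta>\<close> be the differences of two solutions that agree up to time \<open>a\<close>.  After \<open>a\<close>, the
  velocities are split into a part that is small in \<open>L\<^sup>3\<close> and a bounded part, whose contribution gains a power
  of the elapsed time; the weighted norm of the temperature is small near \<open>a\<close>.  Hence a bound for a fixed
  combination of \<open>w\<close> and \<open>\<eta>\<close> on a short interval improves itself by a factor \<open>1/2\<close>, so both vanish
  there, and the set of such times \<open>a\<close> exhausts \<open>(0, T)\<close>.

  The statements on the data come from the same estimates: the mild equation bounds
  \<open>e\<^sup>t\<^sup>\<Delta>\<theta>\<^sub>0\<close> for small \<open>t\<close>, and testing \<open>e\<^sup>t\<^sup>\<Delta>u\<^sub>0 - u(0)\<close> against a Schwartz function and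
  letting \<open>t \<rightarrow> 0\<close> identifies \<open>u\<^sub>0\<close> with the value of \<open>u\<close> at time 0.
\<close>

section \<open>Fourier transforms of Gaussians\<close>

text \<open>The obstacle is criticality: the convection kernel maps L^(3/2) to L^3 with norm of
  order (t - s)^(-1), so the direct Duhamel estimate diverges logarithmically. Weak L^3 removes the
  divergence, but bounded functions are not dense there; smallness has to be drawn from the strong
  continuity of the velocities before passing to weak norms. The buoyancy term is critical too and
  carries no small factor, so the estimates of the two differences do not contract one by one; they
  do once the temperature difference is weighted by 4 K. The testing condition is preferred to the
  quasi-norm because it is additive and because Tonelli moves it through every integral without
  prior convergence. The projector is only ever applied, by duality, to heat kernels, whose images
  are Gaussian moments divided by |\<xi>|^2. For the velocity datum the convection term is measured
  in weak L^(3/2), where it gains a power of t, whereas the buoyancy term is small only through the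
  limit condition in \<open>Y_space\<close>.\<close>

lemma integral_iexp_gaussian:
  fixes a s :: real
  assumes s: "s > 0"
  shows "integrable lborel (\<lambda>x. cis (a * x) * complex_of_real (exp (- s * x\<^sup>2)))"
    and "(\<integral>x. cis (a * x) * complex_of_real (exp (- s * x\<^sup>2)) \<partial>lborel)
      = complex_of_real (sqrt (pi / s) * exp (- a\<^sup>2 / (4 * s)))"
proof -
  \<comment> \<open>The substitution x -> r x turns the standard normal density into a multiple of
    exp (- s x^2), so the value is read off from the known characteristic function.\<close>
  define r where "r = sqrt (2 * s)"
  have r: "r > 0" "r\<^sup>2 = 2 * s" using s by (auto simp: r_def)
  define g where "g = (\<lambda>x. complex_of_real (std_normal_density x) * iexp ((a / r) * x))"
  have m: "g \<in> borel_measurable borel"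
    unfolding g_def std_normal_density_def by measurable
  have ng: "norm (g x) = norm (std_normal_density x)" for x
    by (simp add: g_def norm_mult)
  have gi: "integrable lborel g"
    by (rule Bochner_Integration.integrable_bound[of _ std_normal_density])
      (use m integrable_normal_density[of 1 0] in \<open>auto simp: ng simp del: norm_of_real\<close>)
  have "integral\<^sup>L lborel g = char std_normal_distribution (a / r)"
    unfolding char_def g_def
    by (subst integral_density) (auto simp: scaleR_conv_of_real std_normal_density_def)
  hence gv: "integral\<^sup>L lborel g = complex_of_real (exp (- (a / r)\<^sup>2 / 2))"
    by (simp add: char_std_normal_distribution)
  have eq: "g (0 + r * x) = complex_of_real (1 / sqrt (2 * pi)) * (cis (a * x) * complex_of_real (exp (- s * x\<^sup>2)))" for x
    using r by (simp add: g_def std_normal_density_def power_mult_distrib cis_conv_exp field_simps)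
  have eq0: "cis (a * x) * complex_of_real (exp (- s * x\<^sup>2)) = complex_of_real (sqrt (2 * pi)) * g (0 + r * x)" for x
    unfolding eq by simp
  have "integrable lborel (\<lambda>x. g (0 + r * x))"
    using lborel_integrable_real_affine[OF gi, of r 0] r by simp
  hence i1: "integrable lborel (\<lambda>x. complex_of_real (sqrt (2 * pi)) * g (0 + r * x))" by (rule integrable_mult_right)
  show "integrable lborel (\<lambda>x. cis (a * x) * complex_of_real (exp (- s * x\<^sup>2)))"
    using i1 unfolding eq0 .
  have "integral\<^sup>L lborel g = r *\<^sub>R (\<integral>x. g (0 + r * x) \<partial>lborel)"
    using lborel_integral_real_affine[of r g 0] r by simp
  hence "complex_of_real (exp (- (a / r)\<^sup>2 / 2)) = r *\<^sub>R (complex_of_real (1 / sqrt (2 * pi)) * (\<integral>x. cis (a * x) * complex_of_real (exp (- s * x\<^sup>2)) \<partial>lborel))"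
    unfolding gv by (simp only: eq integral_mult_right_zero)
  hence "complex_of_real (exp (- (a\<^sup>2 / (4 * s)))) = complex_of_real r * (complex_of_real (1 / sqrt (2 * pi)) * (\<integral>x. cis (a * x) * complex_of_real (exp (- s * x\<^sup>2)) \<partial>lborel))"
    using r by (simp add: power_divide scaleR_conv_of_real)
  moreover have "sqrt (pi / s) * r = sqrt (2 * pi)"
    using s by (simp add: r_def real_sqrt_mult[symmetric])
  ultimately have "complex_of_real (sqrt (2*pi)) * complex_of_real (exp (- (a\<^sup>2 / (4 * s)))) = complex_of_real r * (\<integral>x. cis (a * x) * complex_of_real (exp (- s * x\<^sup>2)) \<partial>lborel)"
    by simp
  hence "complex_of_real (r * (sqrt (pi / s) * exp (- (a\<^sup>2 / (4 * s))))) = complex_of_real r * (\<integral>x. cis (a * x) * complex_of_real (exp (- s * x\<^sup>2)) \<partial>lborel)"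
    unfolding \<open>sqrt (pi / s) * r = sqrt (2 * pi)\<close>[symmetric] by (simp only: of_real_mult mult_ac)
  thus "(\<integral>x. cis (a * x) * complex_of_real (exp (- s * x\<^sup>2)) \<partial>lborel)
      = complex_of_real (sqrt (pi / s) * exp (- a\<^sup>2 / (4 * s)))"
    using r by simp
qed

text \<open>\<open>lborel\<close> is the image of the product measure over \<open>Basis\<close>, so
  Fubini for finite products applies; this reduces Gaussians to one dimension.\<close>

lemma integral_lborel_prod:
  fixes f :: "'b::euclidean_space \<Rightarrow> real \<Rightarrow> 'a::{real_normed_field,banach,second_countable_topology}"
  assumes f: "\<And>b. b \<in> Basis \<Longrightarrow> integrable lborel (f b)"
  shows "integrable lborel (\<lambda>x::'b. \<Prod>b\<in>Basis. f b (x \<bullet> b))"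
    and "integral\<^sup>L lborel (\<lambda>x::'b. \<Prod>b\<in>Basis. f b (x \<bullet> b)) = (\<Prod>b\<in>Basis. integral\<^sup>L lborel (f b))"
proof -
  interpret product_sigma_finite "\<lambda>_. lborel :: real measure" ..
  have [measurable]: "\<And>b. b \<in> Basis \<Longrightarrow> f b \<in> borel_measurable borel"
    using f by (auto dest!: borel_measurable_integrable)
  have s: "(\<Prod>b\<in>Basis. f b ((\<Sum>c\<in>Basis. x c *\<^sub>R c) \<bullet> b)) = (\<Prod>b\<in>Basis. f b (x b))" for x :: "'b \<Rightarrow> real"
    by (intro prod.cong) (auto simp: inner_sum_left inner_Basis if_distrib cong: if_cong)
  have m: "(\<lambda>x::'b. \<Prod>b\<in>Basis. f b (x \<bullet> b)) \<in> borel_measurable borel" by measurable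
  have m2: "(\<lambda>x. \<Sum>b\<in>Basis. x b *\<^sub>R b) \<in> measurable (\<Pi>\<^sub>M b\<in>Basis. lborel) (borel :: 'b measure)"
    by measurable
  show "integrable lborel (\<lambda>x::'b. \<Prod>b\<in>Basis. f b (x \<bullet> b))"
    apply (subst lborel_eq)
    apply (subst integrable_distr_eq[OF m2 m])
    unfolding s by (rule product_integrable_prod) (auto simp: f)
  show "integral\<^sup>L lborel (\<lambda>x::'b. \<Prod>b\<in>Basis. f b (x \<bullet> b)) = (\<Prod>b\<in>Basis. integral\<^sup>L lborel (f b))"
    apply (subst lborel_eq)
    apply (subst integral_distr[OF m2 m])
    unfolding s by (rule product_integral_prod) (auto simp: f)
qed

lemma prod_cis: "finite A \<Longrightarrow> (\<Prod>x\<in>A. cis (f x)) = cis (\<Sum>x\<in>A. f x)"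
  by (induction A rule: finite_induct) (auto simp: cis_mult)

lemma cis_gaussian_prod:
  fixes z x :: "'b::euclidean_space"
  shows "cis (z \<bullet> x) * complex_of_real (exp (- s * (norm x)\<^sup>2)) =
    (\<Prod>b\<in>Basis. cis ((z \<bullet> b) * (x \<bullet> b)) * complex_of_real (exp (- s * (x \<bullet> b)\<^sup>2)))"
proof -
  have "(norm x)\<^sup>2 = (\<Sum>b\<in>Basis. (x \<bullet> b)\<^sup>2)"
    by (subst power2_norm_eq_inner, subst euclidean_inner) (simp add: power2_eq_square)
  hence "exp (- s * (norm x)\<^sup>2) = (\<Prod>b\<in>Basis. exp (- s * (x \<bullet> b)\<^sup>2))"
    by (simp add: exp_sum[symmetric] sum_distrib_left sum_negf)
  moreover have "cis (z \<bullet> x) = (\<Prod>b\<in>Basis. cis ((z \<bullet> b) * (x \<bullet> b)))"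
    by (subst prod_cis) (auto simp: euclidean_inner[of z x])
  ultimately show ?thesis by (simp add: prod.distrib)
qed

lemma gaussian_fourier:
  fixes z :: "'b::euclidean_space"
  assumes s: "s > 0"
  shows "integrable lborel (\<lambda>x. cis (z \<bullet> x) * complex_of_real (exp (- s * (norm x)\<^sup>2)))"
    and "(\<integral>x. cis (z \<bullet> x) * complex_of_real (exp (- s * (norm x)\<^sup>2)) \<partial>lborel)
      = complex_of_real (sqrt (pi / s) ^ DIM('b) * exp (- (norm z)\<^sup>2 / (4 * s)))"
proof -
  show "integrable lborel (\<lambda>x. cis (z \<bullet> x) * complex_of_real (exp (- s * (norm x)\<^sup>2)))"
    unfolding cis_gaussian_prod using integral_iexp_gaussian(1)[OF s] by (intro integral_lborel_prod) auto
  have "(\<integral>x. cis (z \<bullet> x) * complex_of_real (exp (- s * (norm x)\<^sup>2)) \<partial>lborel)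
      = (\<Prod>b\<in>Basis. complex_of_real (sqrt (pi / s) * exp (- (z \<bullet> b)\<^sup>2 / (4 * s))))"
    unfolding cis_gaussian_prod
    using integral_iexp_gaussian[OF s] by (subst integral_lborel_prod(2)) auto
  also have "\<dots> = complex_of_real (\<Prod>b\<in>Basis. sqrt (pi / s) * exp (- (z \<bullet> b)\<^sup>2 / (4 * s)))"
    by simp
  also have "(\<Prod>b\<in>Basis. sqrt (pi / s) * exp (- (z \<bullet> b)\<^sup>2 / (4 * s))) = sqrt (pi / s) ^ DIM('b) * exp (- (norm z)\<^sup>2 / (4 * s))"
  proof -
    have "(norm z)\<^sup>2 = (\<Sum>b\<in>Basis. (z \<bullet> b)\<^sup>2)"
      by (subst power2_norm_eq_inner, subst euclidean_inner) (simp add: power2_eq_square)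
    thus ?thesis by (simp add: prod.distrib exp_sum[symmetric] sum_divide_distrib sum_negf)
  qed
  finally show "(\<integral>x. cis (z \<bullet> x) * complex_of_real (exp (- s * (norm x)\<^sup>2)) \<partial>lborel)
      = complex_of_real (sqrt (pi / s) ^ DIM('b) * exp (- (norm z)\<^sup>2 / (4 * s)))" .
qed

lemma integrable_gaussian:
  assumes "s > 0" shows "integrable lborel (\<lambda>x::'b::euclidean_space. exp (- s * (norm x)\<^sup>2))"
  using gaussian_fourier(1)[OF assms, of "0::'b"]
  by (simp add: complex_of_real_integrable_eq)

lemma power_exp_bounded:
  fixes c :: real assumes c: "c > 0"
  shows "\<exists>C\<ge>0. \<forall>u\<ge>0. (1 + u) ^ n * exp (- c * u) \<le> C"
proof -
  have "(\<lambda>u::real. (1 + u) ^ n * exp (- c * u)) \<in> borel_measurable borel" by measurable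
  have lim: "((\<lambda>u::real. (1 + u) ^ n * exp (- c * u)) \<longlongrightarrow> 0) at_top"
    using c by real_asymp
  then obtain K where K: "\<And>u. u \<ge> K \<Longrightarrow> (1 + u) ^ n * exp (- c * u) < 1"
    using order_tendstoD(2)[OF lim, of 1] unfolding eventually_at_top_linorder by auto
  have "\<exists>B. \<forall>u\<in>{0..K}. (1 + u) ^ n * exp (- c * u) \<le> B"
  proof -
    have "compact ((\<lambda>u::real. (1 + u) ^ n * exp (- c * u)) ` {0..K})"
      by (intro compact_continuous_image continuous_intros) auto
    from compact_imp_bounded[OF this] show ?thesis
      unfolding bounded_iff by (metis (mono_tags, lifting) image_eqI real_norm_def abs_le_D1)
  qed
  then obtain B where "\<forall>u\<in>{0..K}. (1 + u) ^ n * exp (- c * u) \<le> B" by auto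
  hence "(1 + u) ^ n * exp (- c * u) \<le> max 1 B" if "u \<ge> 0" for u
    using K[of u] that by (cases "u \<ge> K") (auto simp: le_max_iff_disj)
  thus ?thesis by (intro exI[of _ "max 1 B"]) auto
qed

text \<open>Half of the exponent absorbs the power, and the other half remains integrable.\<close>

lemma integrable_power_gaussian:
  assumes s: "s > 0"
  shows "integrable lborel (\<lambda>x::'b::euclidean_space. norm x ^ n * exp (- s * (norm x)\<^sup>2))"
proof -
  obtain C where C: "C \<ge> 0" "\<And>u. u \<ge> 0 \<Longrightarrow> (1 + u) ^ n * exp (- (s/2) * u) \<le> C"
    using power_exp_bounded[of "s/2" n] s by auto
  show ?thesis
  proof (rule Bochner_Integration.integrable_bound)
    show "integrable lborel (\<lambda>x::'b. C * exp (- (s/2) * (norm x)\<^sup>2))"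
      using integrable_gaussian[of "s/2", where 'b='b] s by (intro integrable_mult_right) auto
    show "AE x::'b in lborel. norm (norm x ^ n * exp (- s * (norm x)\<^sup>2)) \<le> norm (C * exp (- (s/2) * (norm x)\<^sup>2))"
    proof (rule AE_I2)
      fix x :: 'b
      have "norm x \<le> 1 + (norm x)\<^sup>2"
        using zero_le_power2[of "norm x - 1"] unfolding power2_diff by (smt (verit) norm_ge_zero one_power2 zero_le_power2)
      hence "norm x ^ n * exp (- (s/2) * (norm x)\<^sup>2) \<le> (1 + (norm x)\<^sup>2) ^ n * exp (- (s/2) * (norm x)\<^sup>2)"
        by (intro mult_right_mono power_mono) auto
      also have "\<dots> \<le> C" by (intro C) auto
      finally have "norm x ^ n * exp (- (s/2) * (norm x)\<^sup>2) * exp (- (s/2) * (norm x)\<^sup>2) \<le> C * exp (- (s/2) * (norm x)\<^sup>2)"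
        by (intro mult_right_mono) auto
      also have "norm x ^ n * exp (- (s/2) * (norm x)\<^sup>2) * exp (- (s/2) * (norm x)\<^sup>2) = norm x ^ n * exp (- s * (norm x)\<^sup>2)"
        by (simp add: mult.assoc exp_add[symmetric])
      finally show "norm (norm x ^ n * exp (- s * (norm x)\<^sup>2)) \<le> norm (C * exp (- (s/2) * (norm x)\<^sup>2))"
        using C(1) by simp
    qed
  qed auto
qed

section \<open>Cosine and sine transforms and their derivatives\<close>

definition cos_transform :: "('b::euclidean_space \<Rightarrow> real) \<Rightarrow> 'b \<Rightarrow> real" where
  "cos_transform g z = (\<integral>x. cos (z \<bullet> x) * g x \<partial>lborel)"

definition sin_transform :: "('b::euclidean_space \<Rightarrow> real) \<Rightarrow> 'b \<Rightarrow> real" where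
  "sin_transform g z = (\<integral>x. sin (z \<bullet> x) * g x \<partial>lborel)"

text \<open>Both are parts of one complex remainder: \<open>cis a\<close>, of modulus 1, times the
  second-order remainder of the exponential at i b.\<close>

lemma taylor_sin_cos:
  fixes a b :: real
  shows "\<bar>cos (a + b) - cos a + sin a * b\<bar> \<le> b\<^sup>2" "\<bar>sin (a + b) - sin a - cos a * b\<bar> \<le> b\<^sup>2"
proof -
  have n: "norm (cis b - (1 + \<i> * b)) \<le> b\<^sup>2"
  proof -
    have "norm (iexp b - (1 + \<i> * b)) \<le> b\<^sup>2 / 2"
      using iexp_approx1[of b 1] by (simp add: power2_eq_square)
    thus ?thesis using zero_le_power2[of b] unfolding cis_conv_exp by linarith
  qed
  have e: "cis (a + b) - cis a - \<i> * b * cis a = cis a * (cis b - (1 + \<i> * b))"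
    by (simp add: cis_mult[symmetric] ring_distribs)
  have nn: "norm (cis (a + b) - cis a - \<i> * b * cis a) \<le> b\<^sup>2"
    unfolding e norm_mult using n by simp
  have 1: "Re (cis (a + b) - cis a - \<i> * b * cis a) = cos (a + b) - cos a + sin a * b"
    by simp
  have 2: "Im (cis (a + b) - cis a - \<i> * b * cis a) = sin (a + b) - sin a - cos a * b"
    by simp
  show "\<bar>cos (a + b) - cos a + sin a * b\<bar> \<le> b\<^sup>2"
    using abs_Re_le_cmod[of "cis (a + b) - cis a - \<i> * b * cis a"] nn unfolding 1 by linarith
  show "\<bar>sin (a + b) - sin a - cos a * b\<bar> \<le> b\<^sup>2"
    using abs_Im_le_cmod[of "cis (a + b) - cis a - \<i> * b * cis a"] nn unfolding 2 by linarith
qed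

text \<open>With a remainder that is quadratic for all increments, differentiating under an integral
  sign only requires integrating a Taylor bound; no limit is exchanged with an integral.\<close>

lemma has_derivative_quadratic_remainder:
  fixes f :: "'a::real_normed_vector \<Rightarrow> 'b::real_normed_vector"
  assumes "bounded_linear f'" and "\<And>h. norm (f (x + h) - f x - f' h) \<le> C * (norm h)\<^sup>2"
  shows "(f has_derivative f') (at x)"
  unfolding has_derivative_at
proof (intro conjI assms)
  show "(\<lambda>h. norm (f (x + h) - f x - f' h) / norm h) \<midarrow>0\<rightarrow> 0"
  proof (rule Lim_null_comparison)
    show "\<forall>\<^sub>F h in at 0. norm (norm (f (x + h) - f x - f' h) / norm h) \<le> C * norm h"
    proof (rule always_eventually, rule allI)
      fix h :: 'a
      show "norm (norm (f (x + h) - f x - f' h) / norm h) \<le> C * norm h"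
        using assms(2)[of h] by (cases "h = 0") (auto simp: power2_eq_square divide_le_eq mult.assoc)
    qed
    show "(\<lambda>h::'a. C * norm h) \<midarrow>0\<rightarrow> 0"
      by (auto intro!: tendsto_eq_intros)
  qed
qed

lemma integrable_weighted_inner:
  fixes g :: "'b::euclidean_space \<Rightarrow> real"
  assumes "integrable lborel (\<lambda>x. norm x * g x)" "g \<in> borel_measurable borel"
    and k: "k \<in> borel_measurable borel" "\<And>x. \<bar>k x\<bar> \<le> 1"
  shows "integrable lborel (\<lambda>x. k x * (x \<bullet> h) * g x)"
proof (rule Bochner_Integration.integrable_bound)
  show "integrable lborel (\<lambda>x. norm h * (norm x * g x))" using assms by simp
  show "(\<lambda>x. k x * (x \<bullet> h) * g x) \<in> borel_measurable lborel" using assms by simp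
  show "AE x in lborel. norm (k x * (x \<bullet> h) * g x) \<le> norm (norm h * (norm x * g x))"
  proof (rule AE_I2)
    fix x :: 'b
    have "\<bar>x \<bullet> h\<bar> \<le> norm x * norm h" by (rule Cauchy_Schwarz_ineq2)
    hence "\<bar>k x\<bar> * \<bar>x \<bullet> h\<bar> \<le> 1 * (norm x * norm h)" using k(2) by (intro mult_mono) auto
    hence "\<bar>k x\<bar> * \<bar>x \<bullet> h\<bar> * \<bar>g x\<bar> \<le> (norm x * norm h) * \<bar>g x\<bar>" by (intro mult_right_mono) auto
    thus "norm (k x * (x \<bullet> h) * g x) \<le> norm (norm h * (norm x * g x))"
      by (simp add: abs_mult mult_ac)
  qed
qed

lemma integrable_bounded_mult:
  fixes g :: "'b::euclidean_space \<Rightarrow> real"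
  assumes "integrable lborel g" "k \<in> borel_measurable borel" "\<And>x. \<bar>k x\<bar> \<le> 1"
  shows "integrable lborel (\<lambda>x. k x * g x)"
  by (rule Bochner_Integration.integrable_bound[OF assms(1)])
     (use assms in \<open>auto simp: abs_mult intro!: mult_left_le_one_le AE_I2\<close>)

text \<open>The Taylor remainder of the trigonometric factor is at most (h . x)^2, and its integral
  against \<open>g\<close> is at most |h|^2 times the second absolute moment \<open>C\<close>. Hence
  the moments up to order two in the hypotheses.\<close>

lemma
  fixes g :: "'b::euclidean_space \<Rightarrow> real"
  assumes g0: "integrable lborel g" and g1: "integrable lborel (\<lambda>x. norm x * g x)"
    and g2: "integrable lborel (\<lambda>x. (norm x)\<^sup>2 * g x)"
  shows has_derivative_cos_transform:
      "(cos_transform g has_derivative (\<lambda>h. - sin_transform (\<lambda>x. (x \<bullet> h) * g x) z)) (at z)"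
    and has_derivative_sin_transform:
      "(sin_transform g has_derivative (\<lambda>h. cos_transform (\<lambda>x. (x \<bullet> h) * g x) z)) (at z)"
proof -
  have gm[measurable]: "g \<in> borel_measurable borel" using g0 by auto
  define C where "C = (\<integral>x. (norm x)\<^sup>2 * \<bar>g x\<bar> \<partial>lborel)"
  have g2': "integrable lborel (\<lambda>x. (norm x)\<^sup>2 * \<bar>g x\<bar>)"
    using integrable_abs[OF g2] by (simp add: abs_mult)
  have i0: "integrable lborel (\<lambda>x. cos (z \<bullet> x) * g x)" "integrable lborel (\<lambda>x. sin (z \<bullet> x) * g x)" for z
    by (intro integrable_bounded_mult g0; simp)+
  have i1: "integrable lborel (\<lambda>x. cos (z \<bullet> x) * (x \<bullet> h) * g x)" "integrable lborel (\<lambda>x. sin (z \<bullet> x) * (x \<bullet> h) * g x)" for z h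
    by (intro integrable_weighted_inner g1 gm; simp)+
  have bl: "bounded_linear (\<lambda>h. \<integral>x. k x * (x \<bullet> h) * g x \<partial>lborel)"
    if k: "\<And>h. integrable lborel (\<lambda>x. k x * (x \<bullet> h) * g x)" for k
    unfolding linear_conv_bounded_linear[symmetric]
  proof (rule linearI)
    fix b1 b2
    show "(\<integral>x. k x * (x \<bullet> (b1 + b2)) * g x \<partial>lborel) = (\<integral>x. k x * (x \<bullet> b1) * g x \<partial>lborel) + (\<integral>x. k x * (x \<bullet> b2) * g x \<partial>lborel)"
      using Bochner_Integration.integral_add[OF k[of b1] k[of b2]] by (simp add: inner_right_distrib ring_distribs)
  next
    fix c b
    show "(\<integral>x. k x * (x \<bullet> (c *\<^sub>R b)) * g x \<partial>lborel) = c *\<^sub>R (\<integral>x. k x * (x \<bullet> b) * g x \<partial>lborel)"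
      by (simp add: mult_ac flip: integral_mult_right_zero)
  qed
  have rem: "\<bar>r * g x\<bar> \<le> (norm h)\<^sup>2 * ((norm x)\<^sup>2 * \<bar>g x\<bar>)" if "\<bar>r\<bar> \<le> (h \<bullet> x)\<^sup>2" for r h x
  proof -
    have "(h \<bullet> x)\<^sup>2 \<le> (norm h * norm x)\<^sup>2"
      using Cauchy_Schwarz_ineq2[of h x] by (simp add: abs_le_square_iff[symmetric])
    hence "\<bar>r\<bar> * \<bar>g x\<bar> \<le> (norm h * norm x)\<^sup>2 * \<bar>g x\<bar>" using that by (intro mult_right_mono) auto
    thus ?thesis by (simp add: abs_mult power_mult_distrib mult_ac)
  qed
  have ib: "\<bar>\<integral>x. f x \<partial>lborel\<bar> \<le> C * (norm h)\<^sup>2"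
    if "\<And>x. \<bar>f x\<bar> \<le> (norm h)\<^sup>2 * ((norm x)\<^sup>2 * \<bar>g x\<bar>)" "integrable lborel f" for f h
  proof -
    have "\<bar>\<integral>x. f x \<partial>lborel\<bar> \<le> (\<integral>x. \<bar>f x\<bar> \<partial>lborel)" by (rule integral_abs_bound)
    also have "\<dots> \<le> (\<integral>x. (norm h)\<^sup>2 * ((norm x)\<^sup>2 * \<bar>g x\<bar>) \<partial>lborel)"
      using that g2' by (intro integral_mono) auto
    finally show ?thesis unfolding integral_mult_right_zero C_def by (simp only: mult.commute)
  qed
  show "(cos_transform g has_derivative (\<lambda>h. - sin_transform (\<lambda>x. (x \<bullet> h) * g x) z)) (at z)"
  proof (rule has_derivative_quadratic_remainder)
    show "bounded_linear (\<lambda>h. - sin_transform (\<lambda>x. (x \<bullet> h) * g x) z)"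
      unfolding sin_transform_def mult.assoc[symmetric] by (intro bounded_linear_minus bl i1)
    fix h
    have "cos_transform g (z + h) - cos_transform g z - - sin_transform (\<lambda>x. (x \<bullet> h) * g x) z
      = (\<integral>x. cos ((z + h) \<bullet> x) * g x - cos (z \<bullet> x) * g x + sin (z \<bullet> x) * (x \<bullet> h) * g x \<partial>lborel)"
      unfolding cos_transform_def sin_transform_def mult.assoc[symmetric] using i0 i1 by simp
    moreover have "\<bar>\<dots>\<bar> \<le> C * (norm h)\<^sup>2"
    proof (rule ib)
      fix x
      have "cos ((z + h) \<bullet> x) * g x - cos (z \<bullet> x) * g x + sin (z \<bullet> x) * (x \<bullet> h) * g x
        = (cos (z \<bullet> x + h \<bullet> x) - cos (z \<bullet> x) + sin (z \<bullet> x) * (h \<bullet> x)) * g x"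
        by (simp add: inner_add_left inner_commute[of x h] ring_distribs)
      thus "\<bar>cos ((z + h) \<bullet> x) * g x - cos (z \<bullet> x) * g x + sin (z \<bullet> x) * (x \<bullet> h) * g x\<bar> \<le> (norm h)\<^sup>2 * ((norm x)\<^sup>2 * \<bar>g x\<bar>)"
        using rem[OF taylor_sin_cos(1)[of "z \<bullet> x" "h \<bullet> x"]] by simp
    qed (intro Bochner_Integration.integrable_add Bochner_Integration.integrable_diff i0 i1)
    ultimately show "norm (cos_transform g (z + h) - cos_transform g z - - sin_transform (\<lambda>x. (x \<bullet> h) * g x) z) \<le> C * (norm h)\<^sup>2"
      by simp
  qed
  show "(sin_transform g has_derivative (\<lambda>h. cos_transform (\<lambda>x. (x \<bullet> h) * g x) z)) (at z)"
  proof (rule has_derivative_quadratic_remainder)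
    show "bounded_linear (\<lambda>h. cos_transform (\<lambda>x. (x \<bullet> h) * g x) z)"
      unfolding cos_transform_def mult.assoc[symmetric] by (intro bl i1)
    fix h
    have "sin_transform g (z + h) - sin_transform g z - cos_transform (\<lambda>x. (x \<bullet> h) * g x) z
      = (\<integral>x. sin ((z + h) \<bullet> x) * g x - sin (z \<bullet> x) * g x - cos (z \<bullet> x) * (x \<bullet> h) * g x \<partial>lborel)"
      unfolding cos_transform_def sin_transform_def mult.assoc[symmetric] using i0 i1 by simp
    moreover have "\<bar>\<dots>\<bar> \<le> C * (norm h)\<^sup>2"
    proof (rule ib)
      fix x
      have "sin ((z + h) \<bullet> x) * g x - sin (z \<bullet> x) * g x - cos (z \<bullet> x) * (x \<bullet> h) * g x
        = (sin (z \<bullet> x + h \<bullet> x) - sin (z \<bullet> x) - cos (z \<bullet> x) * (h \<bullet> x)) * g x"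
        by (simp add: inner_add_left inner_commute[of x h] ring_distribs)
      thus "\<bar>sin ((z + h) \<bullet> x) * g x - sin (z \<bullet> x) * g x - cos (z \<bullet> x) * (x \<bullet> h) * g x\<bar> \<le> (norm h)\<^sup>2 * ((norm x)\<^sup>2 * \<bar>g x\<bar>)"
        using rem[OF taylor_sin_cos(2)[of "z \<bullet> x" "h \<bullet> x"]] by simp
    qed (intro Bochner_Integration.integrable_add Bochner_Integration.integrable_diff i0 i1)
    ultimately show "norm (sin_transform g (z + h) - sin_transform g z - cos_transform (\<lambda>x. (x \<bullet> h) * g x) z) \<le> C * (norm h)\<^sup>2"
      by simp
  qed
qed

definition gaussian :: "real \<Rightarrow> 'b::euclidean_space \<Rightarrow> real" where
  "gaussian s x = exp (- s * (norm x)\<^sup>2)"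

lemma gaussian_pos [simp]: "gaussian s x > 0" "gaussian s x \<ge> 0" "\<bar>gaussian s x\<bar> = gaussian s x"
  by (auto simp: gaussian_def)

lemma borel_measurable_gaussian [measurable]: "gaussian s \<in> borel_measurable borel"
  unfolding gaussian_def by measurable

lemma integrable_poly_gaussian:
  fixes p :: "'b::euclidean_space \<Rightarrow> real"
  assumes s: "s > 0" and [measurable]: "p \<in> borel_measurable borel"
    and p: "\<And>x. \<bar>p x\<bar> \<le> K * norm x ^ m"
  shows "integrable lborel (\<lambda>x. norm x ^ n * (p x * gaussian s x))"
proof (rule Bochner_Integration.integrable_bound)
  show "integrable lborel (\<lambda>x::'b. K * (norm x ^ (n + m) * exp (- s * (norm x)\<^sup>2)))"
    by (intro integrable_mult_right integrable_power_gaussian s)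
  show "AE x in lborel. norm (norm x ^ n * (p x * gaussian s x)) \<le> norm (K * (norm x ^ (n + m) * exp (- s * (norm x)\<^sup>2)))"
  proof (rule AE_I2)
    fix x :: 'b
    have "norm x ^ n * (\<bar>p x\<bar> * gaussian s x) \<le> norm x ^ n * ((K * norm x ^ m) * gaussian s x)"
      by (intro mult_left_mono mult_right_mono p) auto
    also have "\<dots> = K * (norm x ^ (n + m) * exp (- s * (norm x)\<^sup>2))"
      by (simp add: gaussian_def power_add mult_ac)
    also have "\<dots> \<le> norm \<dots>" by (simp only: real_norm_def abs_ge_self)
    finally show "norm (norm x ^ n * (p x * gaussian s x)) \<le> norm (K * (norm x ^ (n + m) * exp (- s * (norm x)\<^sup>2)))"
      by (simp add: abs_mult)
  qed
qed auto

lemma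
  fixes p :: "'b::euclidean_space \<Rightarrow> real"
  assumes s: "s > 0" and p: "p \<in> borel_measurable borel" "\<And>x. \<bar>p x\<bar> \<le> K * norm x ^ m"
  shows has_derivative_cos_transform_gaussian:
      "(cos_transform (\<lambda>x. p x * gaussian s x) has_derivative
        (\<lambda>h. - sin_transform (\<lambda>x. (x \<bullet> h) * p x * gaussian s x) z)) (at z)"
    and has_derivative_sin_transform_gaussian:
      "(sin_transform (\<lambda>x. p x * gaussian s x) has_derivative
        (\<lambda>h. cos_transform (\<lambda>x. (x \<bullet> h) * p x * gaussian s x) z)) (at z)"
  using has_derivative_cos_transform[of "\<lambda>x. p x * gaussian s x" z]
    has_derivative_sin_transform[of "\<lambda>x. p x * gaussian s x" z]
    integrable_poly_gaussian[OF assms, of 0] integrable_poly_gaussian[OF assms, of 1] integrable_poly_gaussian[OF assms, of 2]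
  by (simp_all add: mult.assoc)

text \<open>The integral of \<open>gaussian s\<close> over three-dimensional space.\<close>

definition gauss_const :: "real \<Rightarrow> real" where "gauss_const s = sqrt (pi / s) ^ 3"

lemma abs_inner_power_bound: "\<bar>x \<bullet> h\<bar> \<le> norm h * norm x ^ 1" "norm x ^ m * norm x = norm x ^ Suc m" for x :: "'b::euclidean_space"
  using Cauchy_Schwarz_ineq2[of x h] by (auto simp: mult_ac)

lemma abs_inner2_bound: "\<bar>(x \<bullet> k) * (x \<bullet> h)\<bar> \<le> (norm h * norm k) * norm x ^ 2" for x :: "'b::euclidean_space"
  using mult_mono[OF Cauchy_Schwarz_ineq2[of x k] Cauchy_Schwarz_ineq2[of x h]]
  by (auto simp: mult_ac abs_mult power2_eq_square)

lemma has_derivative_gauss: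
  "((\<lambda>z::'b::euclidean_space. exp (- (norm z)\<^sup>2 / (4 * s))) has_derivative
     (\<lambda>h. - (z \<bullet> h) / (2 * s) * exp (- (norm z)\<^sup>2 / (4 * s)))) (at z)"
proof -
  have "((\<lambda>z::'b. - (z \<bullet> z) / (4 * s)) has_derivative (\<lambda>h. - (z \<bullet> h) / (2 * s))) (at z)"
  proof -
    have "((\<lambda>z::'b. z \<bullet> z) has_derivative (\<lambda>h. z \<bullet> h + h \<bullet> z)) (at z)"
      by (rule has_derivative_inner[OF has_derivative_ident has_derivative_ident])
    hence "((\<lambda>z::'b. - (z \<bullet> z) * inverse (4 * s)) has_derivative (\<lambda>h. - (z \<bullet> h + h \<bullet> z) * inverse (4 * s))) (at z)"
      by (intro has_derivative_mult_left has_derivative_minus)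
    moreover have "- (z \<bullet> h + h \<bullet> z) * inverse (4 * s) = - (z \<bullet> h) / (2 * s)" for h
      by (simp add: inner_commute[of h z] field_simps)
    ultimately show ?thesis by (simp only: divide_inverse)
  qed
  from has_derivative_exp[OF this] show ?thesis
    unfolding power2_norm_eq_inner by simp
qed

section \<open>Closed forms of the Gaussian transforms with up to three linear factors\<close>

context
  fixes s :: real
  assumes s: "s > 0"
begin

lemma cos_transform_gaussian:
  "cos_transform (gaussian s) z = gauss_const s * exp (- (norm z)\<^sup>2 / (4 * s))" for z :: "real^3"
proof -
  have "cos_transform (gaussian s) z = (\<integral>x. Re (cis (z \<bullet> x) * complex_of_real (exp (- s * (norm x)\<^sup>2))) \<partial>lborel)"
    by (simp add: cos_transform_def gaussian_def)
  also have "\<dots> = Re (\<integral>x. cis (z \<bullet> x) * complex_of_real (exp (- s * (norm x)\<^sup>2)) \<partial>lborel)"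
    using gaussian_fourier(1)[OF s, of z] by (rule integral_Re)
  finally show ?thesis unfolding gaussian_fourier(2)[OF s] by (simp add: gauss_const_def del: of_real_mult of_real_power)
qed

text \<open>Differentiation under the integral inserts a factor \<open>x \<bullet> h\<close>, while
  the closed form is differentiated directly; uniqueness of the derivative equates the two. The
  second and third moments repeat this.\<close>

lemma sin_transform_gaussian1:
  "sin_transform (\<lambda>x. (x \<bullet> h) * gaussian s x) z
    = gauss_const s * ((z \<bullet> h) / (2 * s)) * exp (- (norm z)\<^sup>2 / (4 * s))" for z :: "real^3"
proof -
  have 1: "(cos_transform (gaussian s) has_derivative (\<lambda>h. - sin_transform (\<lambda>x. (x \<bullet> h) * gaussian s x) z)) (at z)"
    using has_derivative_cos_transform_gaussian[OF s, of "\<lambda>_. 1" 1 0 z] by simp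
  have 2: "(cos_transform (gaussian s) has_derivative (\<lambda>h. gauss_const s * (- (z \<bullet> h) / (2 * s) * exp (- (norm z)\<^sup>2 / (4 * s))))) (at z)"
    unfolding cos_transform_gaussian[abs_def] by (intro has_derivative_mult_right has_derivative_gauss)
  show ?thesis using fun_cong[OF has_derivative_unique[OF 1 2], of h] by simp
qed

lemma cos_transform_gaussian2:
  "cos_transform (\<lambda>x. (x \<bullet> k) * (x \<bullet> h) * gaussian s x) z
    = gauss_const s * ((k \<bullet> h) / (2 * s) - (z \<bullet> h) * (z \<bullet> k) / (4 * s\<^sup>2)) * exp (- (norm z)\<^sup>2 / (4 * s))" for z :: "real^3"
proof -
  have 1: "(sin_transform (\<lambda>x. (x \<bullet> h) * gaussian s x) has_derivative
      (\<lambda>k. cos_transform (\<lambda>x. (x \<bullet> k) * (x \<bullet> h) * gaussian s x) z)) (at z)"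
    using has_derivative_sin_transform_gaussian[OF s _ abs_inner_power_bound(1)[of _ h]] by simp
  have 2: "(sin_transform (\<lambda>x. (x \<bullet> h) * gaussian s x) has_derivative
      (\<lambda>k. gauss_const s * ((z \<bullet> h) / (2 * s)) * (- (z \<bullet> k) / (2 * s) * exp (- (norm z)\<^sup>2 / (4 * s)))
        + gauss_const s * ((k \<bullet> h) / (2 * s)) * exp (- (norm z)\<^sup>2 / (4 * s)))) (at z)"
    unfolding sin_transform_gaussian1[abs_def]
  proof (rule has_derivative_mult[OF _ has_derivative_gauss])
    show "((\<lambda>z. gauss_const s * ((z \<bullet> h) / (2 * s))) has_derivative (\<lambda>k. gauss_const s * ((k \<bullet> h) / (2 * s)))) (at z)"
      using has_derivative_mult_right[OF has_derivative_mult_left[OF bounded_linear_imp_has_derivative[OF bounded_linear_inner_left[of h]]], of "gauss_const s" "inverse (2 * s)" "at z"]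
      by (simp only: divide_inverse)
  qed
  show ?thesis using fun_cong[OF has_derivative_unique[OF 1 2], of k] s
    by (simp add: field_simps power2_eq_square)
qed

lemma sin_transform_gaussian3:
  "sin_transform (\<lambda>x. (x \<bullet> l) * ((x \<bullet> k) * (x \<bullet> h)) * gaussian s x) z
    = gauss_const s * (((k \<bullet> h) * (z \<bullet> l) + (l \<bullet> h) * (z \<bullet> k) + (l \<bullet> k) * (z \<bullet> h)) / (4 * s\<^sup>2)
        - (z \<bullet> h) * (z \<bullet> k) * (z \<bullet> l) / (8 * s ^ 3)) * exp (- (norm z)\<^sup>2 / (4 * s))" for z :: "real^3"
proof -
  have 1: "(cos_transform (\<lambda>x. ((x \<bullet> k) * (x \<bullet> h)) * gaussian s x) has_derivative
      (\<lambda>l. - sin_transform (\<lambda>x. (x \<bullet> l) * ((x \<bullet> k) * (x \<bullet> h)) * gaussian s x) z)) (at z)"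
    using has_derivative_cos_transform_gaussian[OF s _ abs_inner2_bound[of _ k h]] by simp
  have 2: "(cos_transform (\<lambda>x. ((x \<bullet> k) * (x \<bullet> h)) * gaussian s x) has_derivative
      (\<lambda>l. gauss_const s * ((k \<bullet> h) / (2 * s) - (z \<bullet> h) * (z \<bullet> k) / (4 * s\<^sup>2)) * (- (z \<bullet> l) / (2 * s) * exp (- (norm z)\<^sup>2 / (4 * s)))
        + gauss_const s * (- ((l \<bullet> h) * (z \<bullet> k) + (z \<bullet> h) * (l \<bullet> k)) / (4 * s\<^sup>2)) * exp (- (norm z)\<^sup>2 / (4 * s)))) (at z)"
    unfolding cos_transform_gaussian2[abs_def]
  proof (rule has_derivative_mult[OF _ has_derivative_gauss])
    have "((\<lambda>z. (z \<bullet> h) * (z \<bullet> k)) has_derivative (\<lambda>l. (z \<bullet> h) * (l \<bullet> k) + (l \<bullet> h) * (z \<bullet> k))) (at z)"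
      by (intro has_derivative_mult bounded_linear_imp_has_derivative bounded_linear_inner_left)
    hence "((\<lambda>z. gauss_const s * ((k \<bullet> h) / (2 * s) - (z \<bullet> h) * (z \<bullet> k) * inverse (4 * s\<^sup>2))) has_derivative
      (\<lambda>l. gauss_const s * (0 - ((z \<bullet> h) * (l \<bullet> k) + (l \<bullet> h) * (z \<bullet> k)) * inverse (4 * s\<^sup>2)))) (at z)"
      by (intro has_derivative_mult_right has_derivative_diff has_derivative_const has_derivative_mult_left)
    thus "((\<lambda>z. gauss_const s * ((k \<bullet> h) / (2 * s) - (z \<bullet> h) * (z \<bullet> k) / (4 * s\<^sup>2))) has_derivative
      (\<lambda>l. gauss_const s * (- ((l \<bullet> h) * (z \<bullet> k) + (z \<bullet> h) * (l \<bullet> k)) / (4 * s\<^sup>2)))) (at z)"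
      by (simp only: divide_inverse add.commute diff_0 mult_minus_left)
  qed
  show ?thesis using fun_cong[OF has_derivative_unique[OF 1 2], of l] s
    by (simp add: field_simps power2_eq_square power3_eq_cube)
qed

end

section \<open>Pointwise decay of the Gaussian transforms\<close>

lemma gauss_const_eq: "s > 0 \<Longrightarrow> gauss_const s = sqrt pi ^ 3 * s powr (-3/2)"
  by (simp add: gauss_const_def real_sqrt_divide power_divide powr_minus_divide powr_half_sqrt[symmetric] powr_power)

text \<open>With \<open>u = |z|\<^sup>2 / s\<close> every such expression is \<open>s\<^sup>-\<^sup>m\<close> times a function of \<open>u\<close>, and the Gaussian beats any power of \<open>1 + u\<close>.\<close>

lemma scaled_exp_bound:
  "\<exists>C\<ge>0. \<forall>s>0. \<forall>r\<ge>0. s powr (- real m / 2) * ((1 + r\<^sup>2 / s) ^ n * exp (- (r\<^sup>2) / (4 * s))) \<le> C * (s + r\<^sup>2) powr (- real m / 2)"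
proof -
  obtain C where C: "C \<ge> 0" "\<And>u. u \<ge> 0 \<Longrightarrow> (1 + u) ^ (n + m) * exp (- (1/4) * (u::real)) \<le> C"
    using power_exp_bounded[of "1/4" "n + m"] by auto
  show ?thesis
  proof (intro exI[of _ C] conjI C allI impI)
    fix s r :: real assume s: "s > 0" and r: "r \<ge> 0"
    define u where "u = r\<^sup>2 / s"
    have u: "u \<ge> 0" "r\<^sup>2 = s * u" using s by (auto simp: u_def)
    have "(1 + u) powr (real m / 2) \<le> (1 + u) powr (real m)" using u by (intro powr_mono) auto
    hence "(1 + u) powr (real m / 2) \<le> (1 + u) ^ m" using u by (simp add: powr_realpow)
    hence "(1 + u) ^ n * (1 + u) powr (real m / 2) * exp (- (1/4) * u) \<le> (1 + u) ^ n * (1 + u) ^ m * exp (- (1/4) * u)"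
      using u by (intro mult_right_mono mult_left_mono) auto
    also have "\<dots> \<le> C" using C(2)[of u] u by (simp add: power_add)
    finally have "(1 + u) ^ n * exp (- (1/4) * u) \<le> C * (1 + u) powr (- real m / 2)"
      using u by (simp add: powr_minus_divide field_simps)
    hence "s powr (- real m / 2) * ((1 + u) ^ n * exp (- (1/4) * u)) \<le> s powr (- real m / 2) * (C * (1 + u) powr (- real m / 2))"
      by (intro mult_left_mono) auto
    also have "\<dots> = C * (s + s * u) powr (- real m / 2)"
      using s u by (simp add: powr_mult[symmetric] ring_distribs)
    finally show "s powr (- real m / 2) * ((1 + r\<^sup>2 / s) ^ n * exp (- (r\<^sup>2) / (4 * s))) \<le> C * (s + r\<^sup>2) powr (- real m / 2)"
      using s u by (simp add: u_def[symmetric])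
  qed
qed

text \<open>In the variable v = r / sqrt s this is v <= 1 + v^2. A factor of length thus costs
  s^(1/2) and one power of the weight used in \<open>scaled_exp_bound\<close>.\<close>

lemma norm_le_sqrt_weight:
  fixes r s :: real
  assumes "s > 0" "r \<ge> 0"
  shows "r \<le> s powr (1/2) * (1 + r\<^sup>2 / s)"
proof -
  define v where "v = r / sqrt s"
  have v: "r = sqrt s * v" "v \<ge> 0" "r\<^sup>2 / s = v\<^sup>2" using assms by (auto simp: v_def power_divide)
  have "v \<le> 1 + v\<^sup>2" using zero_le_power2[of "v - 1"] v(2) unfolding power2_diff by simp
  thus ?thesis using v assms by (simp add: powr_half_sqrt)
qed

lemma gauss_const_bound:
  fixes z :: "real^3"
  assumes "s > 0" "A \<le> K * s powr (- real m / 2) * (1 + (norm z)\<^sup>2 / s) ^ n"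
  shows "gauss_const s * A * exp (- (norm z)\<^sup>2 / (4 * s))
     \<le> sqrt pi ^ 3 * K * (s powr (- real (m + 3) / 2) * ((1 + (norm z)\<^sup>2 / s) ^ n * exp (- (norm z)\<^sup>2 / (4 * s))))"
proof -
  have "gauss_const s * A * exp (- (norm z)\<^sup>2 / (4 * s)) \<le> gauss_const s * (K * s powr (- real m / 2) * (1 + (norm z)\<^sup>2 / s) ^ n) * exp (- (norm z)\<^sup>2 / (4 * s))"
    using assms by (intro mult_right_mono mult_left_mono) (auto simp: gauss_const_def)
  also have "\<dots> = sqrt pi ^ 3 * K * ((s powr (-3/2) * s powr (- real m / 2)) * ((1 + (norm z)\<^sup>2 / s) ^ n * exp (- (norm z)\<^sup>2 / (4 * s))))"
    using assms by (simp add: gauss_const_eq mult_ac)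
  also have "s powr (-3/2) * s powr (- real m / 2) = s powr (- real (m + 3) / 2)"
    by (simp add: powr_add[symmetric] field_simps)
  finally show ?thesis .
qed

text \<open>\<open>A\<close> carries the dimension s^(- m / 2); together with the s^(- 3 / 2) of
  \<open>gauss_const\<close> this makes a decay of order m + 3. The index \<open>i\<close> lets one
  constant serve all components.\<close>

lemma gauss_family_bound:
  assumes A: "\<And>i s z. s > 0 \<Longrightarrow> \<bar>A i s z\<bar> \<le> K * s powr (- real m / 2) * (1 + (norm z)\<^sup>2 / s) ^ n"
    and "K \<ge> 0"
  shows "\<exists>C\<ge>0. \<forall>i. \<forall>s>0. \<forall>z::real^3. \<bar>gauss_const s * A i s z * exp (- (norm z)\<^sup>2 / (4 * s))\<bar> \<le> C * (s + (norm z)\<^sup>2) powr (- real (m + 3) / 2)"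
proof -
  obtain C where C: "C \<ge> 0" "\<And>s r. s > 0 \<Longrightarrow> r \<ge> 0 \<Longrightarrow> s powr (- real (m+3) / 2) * ((1 + r\<^sup>2 / s) ^ n * exp (- (r\<^sup>2) / (4 * s))) \<le> C * (s + r\<^sup>2) powr (- real (m+3) / 2)"
    using scaled_exp_bound[of "m+3" n] by auto
  show ?thesis
  proof (intro exI[of _ "sqrt pi ^ 3 * K * C"] conjI allI impI)
    show "sqrt pi ^ 3 * K * C \<ge> 0" using C assms by simp
    fix i and s :: real and z :: "real^3" assume s: "s > 0"
    have "\<bar>gauss_const s * A i s z * exp (- (norm z)\<^sup>2 / (4 * s))\<bar> = gauss_const s * \<bar>A i s z\<bar> * exp (- (norm z)\<^sup>2 / (4 * s))"
      using s by (simp add: abs_mult gauss_const_def)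
    also have "\<dots> \<le> sqrt pi ^ 3 * K * (s powr (- real (m + 3) / 2) * ((1 + (norm z)\<^sup>2 / s) ^ n * exp (- (norm z)\<^sup>2 / (4 * s))))"
      by (rule gauss_const_bound[OF s A[OF s]])
    also have "\<dots> \<le> sqrt pi ^ 3 * K * (C * (s + (norm z)\<^sup>2) powr (- real (m+3) / 2))"
      using assms by (intro mult_left_mono C s) auto
    finally show "\<bar>gauss_const s * A i s z * exp (- (norm z)\<^sup>2 / (4 * s))\<bar> \<le> sqrt pi ^ 3 * K * C * (s + (norm z)\<^sup>2) powr (- real (m + 3) / 2)"
      by (simp add: mult_ac)
  qed
qed

lemma powr_neg_halves:
  fixes s :: real assumes "s > 0"
  shows "s powr (- real 2 / 2) = 1 / s" "s powr (1/2) / s\<^sup>2 = s powr (- real 3 / 2)" "s powr (1/2) / s = s powr (- real 1 / 2)"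
proof -
  show "s powr (- real 2 / 2) = 1 / s" using assms by (simp add: powr_minus_divide)
  have "s powr (1/2) / s\<^sup>2 = s powr (1/2) / s powr 2" using assms by simp
  also have "\<dots> = s powr (1/2 - 2)" by (rule powr_diff[symmetric])
  finally show "s powr (1/2) / s\<^sup>2 = s powr (- real 3 / 2)" by simp
  have "s powr (1/2) / s = s powr (1/2) / s powr 1" using assms by simp
  also have "\<dots> = s powr (1/2 - 1)" by (rule powr_diff[symmetric])
  finally show "s powr (1/2) / s = s powr (- real 1 / 2)" by simp
qed

lemma cos_gaussian_bound:
  "\<exists>C\<ge>0. \<forall>s>0. \<forall>z::real^3. \<bar>cos_transform (gaussian s) z\<bar> \<le> C * (s + (norm z)\<^sup>2) powr (- 3/2)"
proof -
  have "\<exists>C\<ge>0. \<forall>i::unit. \<forall>s>0. \<forall>z::real^3. \<bar>gauss_const s * 1 * exp (- (norm z)\<^sup>2 / (4 * s))\<bar> \<le> C * (s + (norm z)\<^sup>2) powr (- real (0 + 3) / 2)"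
    by (rule gauss_family_bound[of "\<lambda>_ _ _. 1" 1 0 0]) auto
  thus ?thesis by (simp add: cos_transform_gaussian)
qed

lemma abs_axis_inner: "\<bar>z \<bullet> axis i (1::real)\<bar> \<le> norm z" "\<bar>(axis j (1::real) :: real^3) \<bullet> axis i 1\<bar> \<le> 1" for z :: "real^3"
proof -
  show "\<bar>z \<bullet> axis i (1::real)\<bar> \<le> norm z" for z :: "real^3" by (simp add: inner_axis component_le_norm_cart)
  from this[of "axis j 1"] show "\<bar>(axis j (1::real) :: real^3) \<bullet> axis i 1\<bar> \<le> 1" by simp
qed

text \<open>Each linear factor raises the decay by one order: as powers of s + |z|^2 the exponents
  are -3/2, -2, -5/2 and -3 for zero to three factors. The last two cases feed
  \<open>riesz_gaussian_bound\<close>, which gives one power back.\<close>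

lemma sin_gaussian1_bound:
  "\<exists>C\<ge>0. \<forall>i. \<forall>s>0. \<forall>z::real^3. \<bar>sin_transform (\<lambda>x. (x \<bullet> axis i 1) * gaussian s x) z\<bar> \<le> C * (s + (norm z)\<^sup>2) powr (-2)"
proof -
  have "\<exists>C\<ge>0. \<forall>i::3. \<forall>s>0. \<forall>z::real^3. \<bar>gauss_const s * ((z \<bullet> axis i 1) / (2 * s)) * exp (- (norm z)\<^sup>2 / (4 * s))\<bar> \<le> C * (s + (norm z)\<^sup>2) powr (- real (1 + 3) / 2)"
  proof (rule gauss_family_bound[of _ 1 1 1])
    fix i :: 3 and s :: real and z :: "real^3" assume s: "s > 0"
    have "\<bar>(z \<bullet> axis i 1) / (2 * s)\<bar> \<le> norm z / s" using s abs_axis_inner(1)[of z i]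
      by (auto simp: abs_mult field_simps)
    also have "\<dots> \<le> (s powr (1/2) * (1 + (norm z)\<^sup>2 / s)) / s"
      using s by (intro divide_right_mono norm_le_sqrt_weight) auto
    also have "\<dots> = (s powr (1/2) / s) * (1 + (norm z)\<^sup>2 / s)" by simp
    finally show "\<bar>(z \<bullet> axis i 1) / (2 * s)\<bar> \<le> 1 * s powr (- real 1 / 2) * (1 + (norm z)\<^sup>2 / s) ^ 1"
      unfolding powr_neg_halves[OF s] by simp
  qed auto
  thus ?thesis by (simp add: sin_transform_gaussian1)
qed

lemma cos_gaussian2_bound:
  "\<exists>C\<ge>0. \<forall>i j. \<forall>s>0. \<forall>z::real^3. \<bar>cos_transform (\<lambda>x. (x \<bullet> axis i 1) * (x \<bullet> axis j 1) * gaussian s x) z\<bar> \<le> C * (s + (norm z)\<^sup>2) powr (-5/2)"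
proof -
  define A :: "3 \<times> 3 \<Rightarrow> real \<Rightarrow> real^3 \<Rightarrow> real" where
    "A = (\<lambda>(i,j) s z. (axis i (1::real) \<bullet> axis j 1) / (2 * s) - (z \<bullet> axis j 1) * (z \<bullet> axis i 1) / (4 * s\<^sup>2))"
  have "\<exists>C\<ge>0. \<forall>i::3\<times>3. \<forall>s>0. \<forall>z::real^3. \<bar>gauss_const s * A i s z * exp (- (norm z)\<^sup>2 / (4 * s))\<bar> \<le> C * (s + (norm z)\<^sup>2) powr (- real (2 + 3) / 2)"
  proof (rule gauss_family_bound[of _ 1 2 1])
    fix p :: "3 \<times> 3" and s :: real and z :: "real^3" assume s: "s > 0"
    obtain i j where p: "p = (i, j)" by (cases p)
    have "\<bar>A p s z\<bar> \<le> \<bar>(axis i (1::real) \<bullet> axis j 1) / (2 * s)\<bar> + \<bar>(z \<bullet> axis j 1) * (z \<bullet> axis i 1) / (4 * s\<^sup>2)\<bar>"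
      unfolding A_def p prod.case by (rule abs_triangle_ineq4)
    also have "\<bar>(axis i (1::real) \<bullet> axis j 1) / (2 * s)\<bar> \<le> 1 / s"
      using s abs_axis_inner(2)[of i j] by (auto simp: field_simps)
    also have "\<bar>(z \<bullet> axis j 1) * (z \<bullet> axis i 1) / (4 * s\<^sup>2)\<bar> \<le> (norm z)\<^sup>2 / s\<^sup>2"
    proof -
      have "\<bar>(z \<bullet> axis j 1)\<bar> * \<bar>(z \<bullet> axis i 1)\<bar> \<le> norm z * norm z"
        by (intro mult_mono abs_axis_inner) auto
      hence "\<bar>(z \<bullet> axis j 1)\<bar> * \<bar>(z \<bullet> axis i 1)\<bar> \<le> 4 * (norm z)\<^sup>2" using zero_le_power2[of "norm z"] unfolding power2_eq_square by linarith
      thus ?thesis using s by (simp add: abs_mult field_simps)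
    qed
    finally show "\<bar>A p s z\<bar> \<le> 1 * s powr (- real 2 / 2) * (1 + (norm z)\<^sup>2 / s) ^ 1"
      unfolding powr_neg_halves[OF s] using s by (simp add: field_simps power2_eq_square)
  qed auto
  thus ?thesis by (simp add: cos_transform_gaussian2 A_def)
qed

lemma sin_gaussian3_bound:
  "\<exists>C\<ge>0. \<forall>i j k. \<forall>s>0. \<forall>z::real^3. \<bar>sin_transform (\<lambda>x. (x \<bullet> axis k 1) * ((x \<bullet> axis i 1) * (x \<bullet> axis j 1)) * gaussian s x) z\<bar> \<le> C * (s + (norm z)\<^sup>2) powr (-3)"
proof -
  define A :: "3 \<times> 3 \<times> 3 \<Rightarrow> real \<Rightarrow> real^3 \<Rightarrow> real" where
    "A = (\<lambda>(k,i,j) s z. (((axis i (1::real) \<bullet> axis j 1) * (z \<bullet> axis k 1) + (axis k (1::real) \<bullet> axis j 1) * (z \<bullet> axis i 1) + (axis k (1::real) \<bullet> axis i 1) * (z \<bullet> axis j 1)) / (4 * s\<^sup>2)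
        - (z \<bullet> axis j 1) * (z \<bullet> axis i 1) * (z \<bullet> axis k 1) / (8 * s ^ 3)))"
  have "\<exists>C\<ge>0. \<forall>i::3\<times>3\<times>3. \<forall>s>0. \<forall>z::real^3. \<bar>gauss_const s * A i s z * exp (- (norm z)\<^sup>2 / (4 * s))\<bar> \<le> C * (s + (norm z)\<^sup>2) powr (- real (3 + 3) / 2)"
  proof (rule gauss_family_bound[of _ 1 3 2])
    fix p :: "3 \<times> 3 \<times> 3" and s :: real and z :: "real^3" assume s: "s > 0"
    obtain k i j where p: "p = (k, i, j)" by (cases p)
    define X where "X = (axis i (1::real) \<bullet> axis j 1) * (z \<bullet> axis k 1) + (axis k (1::real) \<bullet> axis j 1) * (z \<bullet> axis i 1) + (axis k (1::real) \<bullet> axis i 1) * (z \<bullet> axis j 1)"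
    define Y where "Y = (z \<bullet> axis j 1) * (z \<bullet> axis i 1) * (z \<bullet> axis k 1)"
    have m: "\<bar>(axis i (1::real) \<bullet> axis j 1) * (z \<bullet> axis k 1)\<bar> \<le> 1 * norm z" for i j k :: 3
      unfolding abs_mult by (intro mult_mono abs_axis_inner) auto
    have X: "\<bar>X\<bar> \<le> 3 * norm z" unfolding X_def using m[of i j k] m[of k j i] m[of k i j] by linarith
    have "\<bar>Y\<bar> \<le> norm z * norm z * norm z" unfolding Y_def abs_mult by (intro mult_mono abs_axis_inner) auto
    hence Y: "\<bar>Y\<bar> \<le> norm z * (norm z)\<^sup>2" by (simp add: power2_eq_square mult_ac)
    have "\<bar>A p s z\<bar> \<le> \<bar>X / (4 * s\<^sup>2)\<bar> + \<bar>Y / (8 * s ^ 3)\<bar>"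
      unfolding A_def p prod.case X_def Y_def by (rule abs_triangle_ineq4)
    also have "\<dots> \<le> norm z / s\<^sup>2 + norm z * (norm z)\<^sup>2 / s ^ 3"
    proof (rule add_mono)
      have "\<bar>X\<bar> \<le> 4 * norm z" using X norm_ge_zero[of z] by linarith
      thus "\<bar>X / (4 * s\<^sup>2)\<bar> \<le> norm z / s\<^sup>2" using s by (simp add: abs_mult field_simps)
      have "\<bar>Y\<bar> \<le> 8 * (norm z * (norm z)\<^sup>2)" using Y mult_nonneg_nonneg[OF norm_ge_zero[of z] zero_le_power2[of "norm z"]] by linarith
      thus "\<bar>Y / (8 * s ^ 3)\<bar> \<le> norm z * (norm z)\<^sup>2 / s ^ 3" using s by (simp add: abs_mult field_simps)
    qed
    \<comment> \<open>Only |z| / s^2 times one weight is left; |z| itself costs s^(1/2) and a second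
      weight, which explains the exponent 2 passed to \<open>gauss_family_bound\<close>.\<close>
    also have "\<dots> = (norm z) * ((1 + (norm z)\<^sup>2 / s) / s\<^sup>2)"
      using s by (simp add: field_simps power2_eq_square power3_eq_cube)
    also have "\<dots> \<le> (s powr (1/2) * (1 + (norm z)\<^sup>2 / s)) * ((1 + (norm z)\<^sup>2 / s) / s\<^sup>2)"
      using s by (intro mult_right_mono norm_le_sqrt_weight) auto
    also have "\<dots> = (s powr (1/2) / s\<^sup>2) * (1 + (norm z)\<^sup>2 / s) ^ 2" by (simp add: power2_eq_square)
    finally show "\<bar>A p s z\<bar> \<le> 1 * s powr (- real 3 / 2) * (1 + (norm z)\<^sup>2 / s) ^ 2"
      unfolding powr_neg_halves[OF s] by simp
  qed auto
  then obtain C where "C \<ge> 0" "\<And>p s z. s > 0 \<Longrightarrow> \<bar>gauss_const s * A p s z * exp (- (norm z)\<^sup>2 / (4 * s))\<bar> \<le> C * (s + (norm z)\<^sup>2) powr (-3)"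
    by auto
  from this(1) this(2)[of _ "(k, i, j)" for k i j] show ?thesis
    unfolding A_def prod.case by (intro exI[of _ C]) (simp add: sin_transform_gaussian3)
qed

section \<open>Removal of the singular factor of the Leray symbol\<close>

lemma nn_integral_powr_tail:
  fixes b \<kappa> :: real
  assumes "\<kappa> > 1" "t + R > 0"
  shows "(\<integral>\<^sup>+s. ennreal ((s + R) powr (- \<kappa>)) * indicator {t..} s \<partial>lborel) = ennreal ((t + R) powr (1 - \<kappa>) / (\<kappa> - 1))"
proof -
  have lim: "((\<lambda>s. - ((s + R) powr (1 - \<kappa>)) / (\<kappa> - 1)) \<longlongrightarrow> 0) at_top"
    using assms by real_asymp
  have "(\<integral>\<^sup>+s. ennreal ((s + R) powr (- \<kappa>)) * indicator {t..} s \<partial>lborel) = ennreal (0 - (- ((t + R) powr (1 - \<kappa>)) / (\<kappa> - 1)))"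
  proof (rule nn_integral_FTC_atLeast[OF _ _ _ lim])
    fix s assume "t \<le> s"
    hence "((\<lambda>s. (s + R) powr (1 - \<kappa>)) has_real_derivative (1 - \<kappa>) * (s + R) powr ((1 - \<kappa>) - of_nat 1) * 1) (at s)"
      using assms by (intro DERIV_fun_powr) (auto intro!: derivative_eq_intros)
    from DERIV_cdivide[OF DERIV_minus[OF this], of "\<kappa> - 1"]
    show "((\<lambda>s. - ((s + R) powr (1 - \<kappa>)) / (\<kappa> - 1)) has_real_derivative (s + R) powr (- \<kappa>)) (at s)"
      by (rule DERIV_cong) (use assms in \<open>simp add: field_simps\<close>)
  qed auto
  thus ?thesis by simp
qed

lemma exp_tail_integral:
  fixes a t :: real assumes a: "a > 0"
  shows "has_bochner_integral lborel (\<lambda>s. indicator {t..} s * exp (- s * a)) (exp (- t * a) / a)"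
proof (rule has_bochner_integral_nn_integral)
  have lim: "((\<lambda>s. - exp (- s * a) / a) \<longlongrightarrow> 0) at_top"
    using a by real_asymp
  have "(\<integral>\<^sup>+s. ennreal (exp (- s * a)) * indicator {t..} s \<partial>lborel) = ennreal (0 - (- exp (- t * a) / a))"
    by (rule nn_integral_FTC_atLeast[OF _ _ _ lim]) (use a in \<open>auto intro!: derivative_eq_intros\<close>)
  thus "(\<integral>\<^sup>+s. ennreal (indicator {t..} s * exp (- s * a)) \<partial>lborel) = ennreal (exp (- t * a) / a)"
    by (simp add: ennreal_mult' ennreal_indicator mult.commute)
qed (use a in auto)

text \<open>The singular factor is removed by \<open>exp (- t |x|\<^sup>2) / |x|\<^sup>2 = \<integral>\<^sub>t\<^sup>\<infinity> exp (- s |x|\<^sup>2) ds\<close>.\<close>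

lemma riesz_gaussian_bound:
  fixes p k :: "real^3 \<Rightarrow> real"
  assumes t: "t > 0" and R: "R \<ge> 0" and \<kappa>: "\<kappa> > 1"
    and [measurable]: "p \<in> borel_measurable borel" "k \<in> borel_measurable borel"
    and k: "\<And>x. \<bar>k x\<bar> \<le> 1" and p: "\<And>x. \<bar>p x\<bar> \<le> K * norm x ^ (m + 2)"
    and bound: "\<And>s. s \<ge> t \<Longrightarrow> \<bar>\<integral>x. k x * (p x * gaussian s x) \<partial>lborel\<bar> \<le> C * (s + R) powr (- \<kappa>)"
    and C: "C \<ge> 0"
  shows "\<bar>\<integral>x. k x * (p x / (norm x)\<^sup>2 * gaussian t x) \<partial>lborel\<bar> \<le> C / (\<kappa> - 1) * (t + R) powr (1 - \<kappa>)"
proof -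
  \<comment> \<open>Integrating \<open>F\<close> over \<open>s\<close> first reproduces the singular
    integrand; integrating over \<open>x\<close> first meets the hypothesis \<open>bound\<close>.
    Fubini is applied between the two.\<close>
  define F where "F = (\<lambda>x s. indicator {t..} s * (k x * (p x * gaussian s x)))"
  have [measurable]: "(\<lambda>(x,s). F x s) \<in> borel_measurable (lborel \<Otimes>\<^sub>M lborel)"
    unfolding F_def gaussian_def by measurable
  have Fx: "has_bochner_integral lborel (F x) (k x * (p x / (norm x)\<^sup>2 * gaussian t x))" for x
  \<comment> \<open>The exponential tail formula needs |x| > 0. At the origin the bound on
    \<open>p\<close> forces \<open>p x = 0\<close>, and both sides vanish.\<close>
  proof (cases "x = 0")
    case True
    hence "p x = 0" using p[of x] by simp
    thus ?thesis by (simp add: F_def has_bochner_integral_zero)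
  next
    case False
    hence a: "(norm x)\<^sup>2 > 0" by simp
    show ?thesis
      using has_bochner_integral_mult_right[OF exp_tail_integral[OF a, of t], of "k x * p x"]
      by (simp add: F_def gaussian_def mult_ac)
  qed
  have absF: "(\<lambda>s. norm (F x s)) = (\<lambda>s. indicator {t..} s * (\<bar>k x\<bar> * (\<bar>p x\<bar> * gaussian s x)))" for x
    by (auto simp: F_def abs_mult)
  have nFx: "has_bochner_integral lborel (\<lambda>s. norm (F x s)) (\<bar>k x\<bar> * (\<bar>p x\<bar> / (norm x)\<^sup>2 * gaussian t x))" for x
  proof (cases "x = 0")
    case True
    hence "p x = 0" using p[of x] by simp
    thus ?thesis by (simp add: F_def has_bochner_integral_zero)
  next
    case False
    hence a: "(norm x)\<^sup>2 > 0" by simp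
    show ?thesis
      using has_bochner_integral_mult_right[OF exp_tail_integral[OF a, of t], of "\<bar>k x\<bar> * \<bar>p x\<bar>"]
      unfolding absF by (simp add: gaussian_def mult_ac)
  qed
  have int: "integrable (lborel \<Otimes>\<^sub>M lborel) (\<lambda>(x,s). F x s)"
  proof (rule lborel_pair.Fubini_integrable)
    show "AE x in lborel. integrable lborel (\<lambda>y. case (x, y) of (x, s) \<Rightarrow> F x s)"
      using Fx by (auto simp: has_bochner_integral_iff)
    have "integrable lborel (\<lambda>x. \<bar>k x\<bar> * (\<bar>p x\<bar> / (norm x)\<^sup>2 * gaussian t x))"
    proof (rule integrable_bounded_mult)
      have "\<bar>\<bar>p x\<bar> / (norm x)\<^sup>2\<bar> \<le> \<bar>K\<bar> * norm x ^ m" for x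
      proof -
        have "\<bar>p x\<bar> \<le> \<bar>K\<bar> * norm x ^ (m + 2)"
          using p[of x] mult_right_mono[OF abs_ge_self[of K], of "norm x ^ (m + 2)"] by simp
        thus ?thesis by (cases "x = 0") (simp_all add: divide_le_eq power_add mult_ac power2_eq_square)
      qed
      from integrable_poly_gaussian[OF t _ this, of 0]
      show "integrable lborel (\<lambda>x. \<bar>p x\<bar> / (norm x)\<^sup>2 * gaussian t x)" by simp
    qed (use k in auto)
    thus "integrable lborel (\<lambda>x. LBINT y. norm (case (x, y) of (x, s) \<Rightarrow> F x s))"
      by (simp only: prod.case has_bochner_integral_integral_eq[OF nFx])
  qed measurable
  have "(\<integral>x. k x * (p x / (norm x)\<^sup>2 * gaussian t x) \<partial>lborel) = (\<integral>x. integral\<^sup>L lborel (F x) \<partial>lborel)"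
    by (simp only: has_bochner_integral_integral_eq[OF Fx])
  also have "\<dots> = (\<integral>s. \<integral>x. F x s \<partial>lborel \<partial>lborel)"
    using lborel_pair.Fubini_integral[OF int] by simp
  finally have eq: "(\<integral>x. k x * (p x / (norm x)\<^sup>2 * gaussian t x) \<partial>lborel) = (\<integral>s. \<integral>x. F x s \<partial>lborel \<partial>lborel)" .
  have "ennreal \<bar>\<integral>s. \<integral>x. F x s \<partial>lborel \<partial>lborel\<bar> \<le> (\<integral>\<^sup>+s. ennreal \<bar>\<integral>x. F x s \<partial>lborel\<bar> \<partial>lborel)"
    using integral_norm_bound_ennreal[OF lborel_pair.integrable_snd[OF int]] by simp
  also have "\<dots> \<le> (\<integral>\<^sup>+s. ennreal C * (ennreal ((s + R) powr (- \<kappa>)) * indicator {t..} s) \<partial>lborel)"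
  proof (rule nn_integral_mono)
    fix s
    show "ennreal \<bar>\<integral>x. F x s \<partial>lborel\<bar> \<le> ennreal C * (ennreal ((s + R) powr (- \<kappa>)) * indicator {t..} s)"
      using bound[of s] C by (auto simp: F_def indicator_def ennreal_mult[symmetric] intro!: ennreal_leI)
  qed
  also have "\<dots> = ennreal C * ennreal ((t + R) powr (1 - \<kappa>) / (\<kappa> - 1))"
    using t R \<kappa> by (subst nn_integral_cmult) (auto simp: nn_integral_powr_tail)
  also have "\<dots> = ennreal (C / (\<kappa> - 1) * (t + R) powr (1 - \<kappa>))"
    using C \<kappa> by (simp add: ennreal_mult[symmetric])
  finally show ?thesis unfolding eq
    using C \<kappa> by (subst (asm) ennreal_le_iff) auto
qed

lemma nn_integral_lborel_translate:
  fixes c :: "'b::euclidean_space"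
  assumes [measurable]: "f \<in> borel_measurable borel"
  shows "(\<integral>\<^sup>+y. f (c + y) \<partial>lborel) = (\<integral>\<^sup>+y. f y \<partial>lborel)"
  by (subst (2) lborel_distr_plus[symmetric, of c]) (simp add: nn_integral_distr)

lemma integral_lborel_translate:
  fixes c :: "'b::euclidean_space" and f :: "'b \<Rightarrow> 'c::{banach, second_countable_topology}"
  assumes [measurable]: "f \<in> borel_measurable borel"
  shows "(\<integral>y. f (c + y) \<partial>lborel) = (\<integral>y. f y \<partial>lborel)"
  by (subst (2) lborel_distr_plus[symmetric, of c]) (simp add: integral_distr)

section \<open>Pointwise bounds for the heat and Leray kernels\<close>

abbreviation heat_kernel_at :: "real \<Rightarrow> real^3 \<Rightarrow> real^3 \<Rightarrow> real" where
  "heat_kernel_at t x \<equiv> \<lambda>y. heat_kernel t (x - y)"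

text \<open>The heat kernel is the inverse Fourier transform of its symbol
  \<open>gaussian t\<close>. With both sides in closed form only the constants are compared, by (4
  pi)^(3/2) = 8 pi^(3/2).\<close>

lemma heat_kernel_cos_transform:
  "t > 0 \<Longrightarrow> heat_kernel t z = 1 / (2 * pi) ^ 3 * cos_transform (gaussian t) z"
proof -
  assume t: "t > 0"
  have "(4 * pi * t) powr (-3/2) = (4 * pi) powr (-3/2) * t powr (-3/2)"
    using t by (simp add: powr_mult)
  also have "(4 * pi) powr (-3/2) = 1 / (2 * pi) ^ 3 * sqrt pi ^ 3"
  proof -
    have "(4 * pi) powr (3/2) = ((4 * pi) powr (1/2)) ^ 3"
      using powr_powr[of "4 * pi" "1/2" 3] by simp
    also have "(4 * pi) powr (1/2) = 2 * sqrt pi" by (simp add: powr_half_sqrt real_sqrt_mult)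
    finally have 1: "(4 * pi) powr (3/2) = 8 * sqrt pi ^ 3" by (simp add: power_mult_distrib)
    have 2: "sqrt pi ^ 3 * sqrt pi ^ 3 = pi ^ 3" by (simp flip: power_mult_distrib)
    show ?thesis using 1 2 by (simp add: powr_minus_divide field_simps power_mult_distrib)
  qed
  finally show ?thesis using t
    by (simp add: heat_kernel_def cos_transform_gaussian gauss_const_eq)
qed

lemma heat_kernel_commute: "heat_kernel t (x - y) = heat_kernel t (y - x)"
  by (simp add: heat_kernel_def norm_minus_commute)

lemma heat_kernel_nonneg [simp]: "heat_kernel t z \<ge> 0"
  by (simp add: heat_kernel_def)

lemma borel_measurable_heat_kernel [measurable]:
  assumes [measurable]: "f \<in> borel_measurable M" "g \<in> borel_measurable M"
  shows "(\<lambda>x. heat_kernel (f x) (g x)) \<in> borel_measurable M"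
  unfolding heat_kernel_def by measurable

lemma borel_measurable_cis [measurable]: "cis \<in> borel_measurable borel"
  by (intro borel_measurable_continuous_onI continuous_intros)

lemma fourier_heat_kernel:
  assumes t: "t > 0"
  shows "fourier (heat_kernel_at t x) \<xi> = cis (- (x \<bullet> \<xi>)) * complex_of_real (gaussian t \<xi>)"
proof -
  define c where "c = complex_of_real ((4 * pi * t) powr (-3/2))"
  have "fourier (heat_kernel_at t x) \<xi> = (\<integral>w. cis (- ((x + w) \<bullet> \<xi>)) * complex_of_real (heat_kernel t (x - (x + w))) \<partial>lborel)"
    unfolding fourier_def by (subst integral_lborel_translate[of _ x]) auto
  also have "\<dots> = (\<integral>w. cis (- (x \<bullet> \<xi>)) * c * (cis ((- \<xi>) \<bullet> w) * complex_of_real (exp (- (1 / (4 * t)) * (norm w)\<^sup>2))) \<partial>lborel)"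
  proof (intro Bochner_Integration.integral_cong refl)
    fix w
    have "cis (- ((x + w) \<bullet> \<xi>)) = cis (- (x \<bullet> \<xi>)) * cis ((- \<xi>) \<bullet> w)"
      by (simp add: cis_mult inner_add_left inner_commute[of \<xi> w])
    moreover have "complex_of_real (heat_kernel t (x - (x + w))) = c * complex_of_real (exp (- (1 / (4 * t)) * (norm w)\<^sup>2))"
      by (simp add: heat_kernel_def c_def)
    ultimately show "cis (- ((x + w) \<bullet> \<xi>)) * complex_of_real (heat_kernel t (x - (x + w))) = cis (- (x \<bullet> \<xi>)) * c * (cis ((- \<xi>) \<bullet> w) * complex_of_real (exp (- (1 / (4 * t)) * (norm w)\<^sup>2)))"
      by (simp only: mult_ac)
  qed
  also have "\<dots> = cis (- (x \<bullet> \<xi>)) * (c * complex_of_real (sqrt (pi / (1 / (4 * t))) ^ DIM(real^3) * exp (- (norm (- \<xi>))\<^sup>2 / (4 * (1 / (4 * t))))))"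
    using t unfolding integral_mult_right_zero by (subst gaussian_fourier(2)) auto
  also have "sqrt (pi / (1 / (4 * t))) ^ DIM(real^3) = (4 * pi * t) powr (3/2)"
    using t by (simp add: powr_half_sqrt[symmetric] powr_power mult_ac)
  also have "c * complex_of_real ((4 * pi * t) powr (3/2) * exp (- (norm (- \<xi>))\<^sup>2 / (4 * (1 / (4 * t))))) = complex_of_real (gaussian t \<xi>)"
    using t by (simp add: c_def gaussian_def powr_minus_divide mult_ac)
  finally show ?thesis .
qed

lemma borel_measurable_leray_symbol [measurable]: "leray_symbol i j \<in> borel_measurable borel"
  unfolding leray_symbol_def by measurable

lemma leray_symbol_bound: "\<bar>leray_symbol i j \<xi>\<bar> \<le> 2 * norm \<xi> ^ 0"
proof -
  have "\<bar>\<xi> $ i * \<xi> $ j\<bar> \<le> norm \<xi> * norm \<xi>"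
    unfolding abs_mult by (intro mult_mono component_le_norm_cart) auto
  hence "\<bar>\<xi> $ i * \<xi> $ j / (norm \<xi>)\<^sup>2\<bar> \<le> 1" by (auto simp: divide_le_eq power2_eq_square)
  moreover have "\<bar>(if i = j then 1 else 0) - r\<bar> \<le> 2" if "\<bar>r\<bar> \<le> 1" for r :: real using that by auto
  ultimately show ?thesis unfolding leray_symbol_def by simp
qed

lemma integrable_cis_gaussian:
  assumes "t > 0" shows "integrable lborel (\<lambda>\<xi>. cis (z \<bullet> \<xi>) * complex_of_real (leray_symbol i j \<xi> * gaussian t \<xi>))"
proof (rule Bochner_Integration.integrable_bound)
  show "integrable lborel (\<lambda>\<xi>. leray_symbol i j \<xi> * gaussian t \<xi>)"
    using integrable_poly_gaussian[OF assms borel_measurable_leray_symbol leray_symbol_bound, of 0] by simp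
qed (auto simp: norm_mult)

text \<open>The Fourier transform of a translated heat kernel is a phase times a Gaussian, so the
  multiplier acts explicitly. Every use of the projector in the mild equations is of this
  kind.\<close>

lemma leray_test_heat_kernel:
  assumes t: "t > 0"
  shows "leray_test i j (heat_kernel_at t x) y = 1 / (2 * pi) ^ 3 * cos_transform (\<lambda>\<xi>. leray_symbol i j \<xi> * gaussian t \<xi>) (y - x)"
proof -
  have "cis (y \<bullet> \<xi>) * complex_of_real (leray_symbol i j \<xi>) * fourier (heat_kernel_at t x) \<xi>
    = cis ((y - x) \<bullet> \<xi>) * complex_of_real (leray_symbol i j \<xi> * gaussian t \<xi>)" for \<xi>
  proof -
    have "cis ((y - x) \<bullet> \<xi>) = cis (y \<bullet> \<xi>) * cis (- (x \<bullet> \<xi>))" by (simp add: cis_mult inner_diff_left)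
    thus ?thesis unfolding fourier_heat_kernel[OF t] of_real_mult by (simp only: mult_ac)
  qed
  hence "leray_test i j (heat_kernel_at t x) y = Re (complex_of_real (1 / (2 * pi) ^ 3) *
    (\<integral>\<xi>. cis ((y - x) \<bullet> \<xi>) * complex_of_real (leray_symbol i j \<xi> * gaussian t \<xi>) \<partial>lborel))"
    unfolding leray_test_def by (simp only:)
  also have "\<dots> = 1 / (2 * pi) ^ 3 * (\<integral>\<xi>. Re (cis ((y - x) \<bullet> \<xi>) * complex_of_real (leray_symbol i j \<xi> * gaussian t \<xi>)) \<partial>lborel)"
    by (subst integral_Re[OF integrable_cis_gaussian[OF t]]) (simp del: of_real_mult of_real_divide of_real_power)
  finally show ?thesis by (simp add: cos_transform_def)
qed

lemma
  assumes t: "t > 0"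
  shows differentiable_leray_test_heat_kernel: "leray_test i j (heat_kernel_at t x) differentiable (at y)"
    and partial_leray_test_heat_kernel: "partial k (leray_test i j (heat_kernel_at t x)) y
      = - 1 / (2 * pi) ^ 3 * sin_transform (\<lambda>\<xi>. (\<xi> \<bullet> axis k 1) * leray_symbol i j \<xi> * gaussian t \<xi>) (y - x)"
proof -
  have "(cos_transform (\<lambda>\<xi>. leray_symbol i j \<xi> * gaussian t \<xi>) has_derivative
      (\<lambda>h. - sin_transform (\<lambda>\<xi>. (\<xi> \<bullet> h) * leray_symbol i j \<xi> * gaussian t \<xi>) (y - x))) (at (y - x))"
    by (rule has_derivative_cos_transform_gaussian[OF t borel_measurable_leray_symbol leray_symbol_bound])
  moreover have "((\<lambda>y. y - x) has_derivative (\<lambda>h. h)) (at y)" by (auto intro!: derivative_eq_intros)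
  ultimately have "((\<lambda>y. cos_transform (\<lambda>\<xi>. leray_symbol i j \<xi> * gaussian t \<xi>) (y - x)) has_derivative
      (\<lambda>h. - sin_transform (\<lambda>\<xi>. (\<xi> \<bullet> h) * leray_symbol i j \<xi> * gaussian t \<xi>) (y - x))) (at y)"
    using has_derivative_compose by blast
  from has_derivative_mult_right[OF this, of "1 / (2 * pi) ^ 3"]
  have d: "(leray_test i j (heat_kernel_at t x) has_derivative
      (\<lambda>h. 1 / (2 * pi) ^ 3 * - sin_transform (\<lambda>\<xi>. (\<xi> \<bullet> h) * leray_symbol i j \<xi> * gaussian t \<xi>) (y - x))) (at y)"
    unfolding leray_test_heat_kernel[OF t, symmetric] .
  thus "leray_test i j (heat_kernel_at t x) differentiable (at y)" by (auto simp: differentiable_def)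
  show "partial k (leray_test i j (heat_kernel_at t x)) y
      = - 1 / (2 * pi) ^ 3 * sin_transform (\<lambda>\<xi>. (\<xi> \<bullet> axis k 1) * leray_symbol i j \<xi> * gaussian t \<xi>) (y - x)"
    unfolding partial_def frechet_derivative_at[OF d, symmetric] by simp
qed

lemma partial_heat_kernel:
  assumes t: "t > 0"
  shows "partial k (heat_kernel_at t x) y = 1 / (2 * pi) ^ 3 * sin_transform (\<lambda>\<xi>. (\<xi> \<bullet> axis k 1) * gaussian t \<xi>) (x - y)"
proof -
  have "(cos_transform (gaussian t) has_derivative (\<lambda>h. - sin_transform (\<lambda>\<xi>. (\<xi> \<bullet> h) * gaussian t \<xi>) (x - y))) (at (x - y))"
    using has_derivative_cos_transform_gaussian[OF t, of "\<lambda>_. 1" 1 0 "x - y"] by simp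
  moreover have "((\<lambda>y. x - y) has_derivative (\<lambda>h. - h)) (at y)" by (auto intro!: derivative_eq_intros)
  ultimately have "((\<lambda>y. cos_transform (gaussian t) (x - y)) has_derivative
      (\<lambda>h. - sin_transform (\<lambda>\<xi>. (\<xi> \<bullet> - h) * gaussian t \<xi>) (x - y))) (at y)"
    using has_derivative_compose[of "\<lambda>y. x - y" "\<lambda>h. - h" y UNIV "cos_transform (gaussian t)"] by blast
  from has_derivative_mult_right[OF this, of "1 / (2 * pi) ^ 3"]
  have d: "((heat_kernel_at t x) has_derivative
      (\<lambda>h. 1 / (2 * pi) ^ 3 * - sin_transform (\<lambda>\<xi>. (\<xi> \<bullet> - h) * gaussian t \<xi>) (x - y))) (at y)"
    by (simp only: heat_kernel_cos_transform[OF t])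
  show ?thesis
    unfolding partial_def frechet_derivative_at[OF d, symmetric] by (simp add: sin_transform_def)
qed

lemma borel_measurable_trig_transform_gaussian:
  assumes "s > 0" "p \<in> borel_measurable borel" "\<And>x. \<bar>p x\<bar> \<le> K * norm x ^ m"
  shows "sin_transform (\<lambda>x. p x * gaussian s x) \<in> borel_measurable borel"
    and "cos_transform (\<lambda>x. p x * gaussian s x) \<in> borel_measurable borel"
proof -
  have "sin_transform (\<lambda>x. p x * gaussian s x) differentiable (at z)" "cos_transform (\<lambda>x. p x * gaussian s x) differentiable (at z)" for z
    unfolding differentiable_def
    using has_derivative_sin_transform_gaussian[OF assms] has_derivative_cos_transform_gaussian[OF assms] by blast+
  thus "sin_transform (\<lambda>x. p x * gaussian s x) \<in> borel_measurable borel"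
    and "cos_transform (\<lambda>x. p x * gaussian s x) \<in> borel_measurable borel"
    by (auto intro!: borel_measurable_continuous_onI differentiable_imp_continuous_on simp: differentiable_on_def differentiable_at_withinI)
qed

text \<open>The kernel \<open>\<integral>\<^bsub>\<rho>\<^sup>2 > \<tau> + |z|\<^sup>2\<^esub> n \<rho>\<^sup>-\<^sup>n\<^sup>-\<^sup>1 d\<rho>\<close>, a superposition of indicators of balls.\<close>

definition ball_kernel :: "real \<Rightarrow> real \<Rightarrow> real^3 \<Rightarrow> real" where
  "ball_kernel n \<tau> z = (\<tau> + (norm z)\<^sup>2) powr (- n / 2)"

lemma partial_heat_kernel_bound:
  "\<exists>C\<ge>0. \<forall>k. \<forall>t>0. \<forall>x y. \<bar>partial k (heat_kernel_at t x) y\<bar> \<le> C * ball_kernel 4 t (x - y)"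
proof -
  obtain C where "C \<ge> 0" "\<And>i s z. s > 0 \<Longrightarrow> \<bar>sin_transform (\<lambda>x. (x \<bullet> axis i 1) * gaussian s x) z\<bar> \<le> C * (s + (norm (z::real^3))\<^sup>2) powr (-2)"
    using sin_gaussian1_bound by blast
  thus ?thesis
    by (intro exI[of _ "1 / (2 * pi) ^ 3 * C"])
      (auto simp: partial_heat_kernel ball_kernel_def abs_mult divide_right_mono)
qed

text \<open>The identity part of the symbol gives the heat kernel. The other part has two linear
  factors, hence exponent -5/2, and removing 1 / |\<xi>|^2 returns it to -3/2. The projector thus
  destroys the Gaussian decay but keeps the parabolic scaling.\<close>

lemma leray_test_heat_kernel_bound:
  "\<exists>C\<ge>0. \<forall>i j. \<forall>t>0. \<forall>x y. \<bar>leray_test i j (heat_kernel_at t x) y\<bar> \<le> C * ball_kernel 3 t (x - y)"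
proof -
  obtain C1 where C1: "C1 \<ge> 0" "\<And>s z. s > 0 \<Longrightarrow> \<bar>cos_transform (gaussian s) (z::real^3)\<bar> \<le> C1 * (s + (norm z)\<^sup>2) powr (- 3/2)"
    using cos_gaussian_bound by blast
  obtain C2 where C2: "C2 \<ge> 0" "\<And>i j s z. s > 0 \<Longrightarrow> \<bar>cos_transform (\<lambda>x. (x \<bullet> axis i 1) * (x \<bullet> axis j 1) * gaussian s x) (z::real^3)\<bar> \<le> C2 * (s + (norm z)\<^sup>2) powr (-5/2)"
    using cos_gaussian2_bound by blast
  have main: "\<bar>cos_transform (\<lambda>\<xi>. leray_symbol i j \<xi> * gaussian t \<xi>) z\<bar> \<le> (C1 + C2) * (t + (norm z)\<^sup>2) powr (-3/2)"
    if t: "t > 0" for i j t and z :: "real^3"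
  proof -
    define p where "p = (\<lambda>x::real^3. (x \<bullet> axis i 1) * (x \<bullet> axis j 1))"
    have pb: "\<bar>p x\<bar> \<le> 1 * norm x ^ (0 + 2)" for x
      using abs_inner2_bound[of x "axis i 1" "axis j 1"] by (simp add: p_def power2_eq_square)
    have [measurable]: "p \<in> borel_measurable borel" unfolding p_def by measurable
    have ri: "\<bar>\<integral>x. cos (z \<bullet> x) * (p x / (norm x)\<^sup>2 * gaussian t x) \<partial>lborel\<bar> \<le> C2 / (5/2 - 1) * (t + (norm z)\<^sup>2) powr (1 - 5/2)"
      by (rule riesz_gaussian_bound[OF t _ _ _ _ _ pb])
         (use t C2 in \<open>auto simp: p_def cos_transform_def\<close>)
    have pq: "\<bar>p x / (norm x)\<^sup>2\<bar> \<le> 1 * norm x ^ 0" for x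
      using pb[of x] by (auto simp: divide_le_eq power2_eq_square)
    have "integrable lborel (\<lambda>x. p x / (norm x)\<^sup>2 * gaussian t x)"
      using integrable_poly_gaussian[OF t _ pq, of 0] by simp
    hence i1: "integrable lborel (\<lambda>x. cos (z \<bullet> x) * (p x / (norm x)\<^sup>2 * gaussian t x))"
      by (rule integrable_bounded_mult) auto
    have i2: "integrable lborel (\<lambda>x. cos (z \<bullet> x) * gaussian t x)"
      using integrable_poly_gaussian[OF t, of "\<lambda>_. 1" 1 0 0] by (intro integrable_bounded_mult) auto
    have "cos_transform (\<lambda>\<xi>. leray_symbol i j \<xi> * gaussian t \<xi>) z =
       (\<integral>x. (if i = j then 1 else 0) * (cos (z \<bullet> x) * gaussian t x) - cos (z \<bullet> x) * (p x / (norm x)\<^sup>2 * gaussian t x) \<partial>lborel)"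
      unfolding cos_transform_def p_def by (intro Bochner_Integration.integral_cong) (auto simp: leray_symbol_def inner_axis ring_distribs)
    also have "\<dots> = (if i = j then 1 else 0) * cos_transform (gaussian t) z - (\<integral>x. cos (z \<bullet> x) * (p x / (norm x)\<^sup>2 * gaussian t x) \<partial>lborel)"
      using i1 i2 by (simp add: cos_transform_def)
    also have "\<bar>\<dots>\<bar> \<le> \<bar>cos_transform (gaussian t) z\<bar> + \<bar>\<integral>x. cos (z \<bullet> x) * (p x / (norm x)\<^sup>2 * gaussian t x) \<partial>lborel\<bar>"
      by auto
    also have "\<dots> \<le> C1 * (t + (norm z)\<^sup>2) powr (- 3/2) + C2 / (5/2 - 1) * (t + (norm z)\<^sup>2) powr (1 - 5/2)"
      by (intro add_mono C1 ri t)
    also have "C2 / (5/2 - 1) * (t + (norm z)\<^sup>2) powr (1 - 5/2) \<le> C2 * (t + (norm z)\<^sup>2) powr (-3/2)"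
      using C2(1) by (simp add: mult_right_mono)
    finally show ?thesis by (simp add: ring_distribs)
  qed
  show ?thesis
  proof (intro exI[of _ "1 / (2 * pi) ^ 3 * (C1 + C2)"] conjI allI impI)
    fix i j :: 3 and t :: real and x y :: "real^3" assume t: "t > 0"
    show "\<bar>leray_test i j (heat_kernel_at t x) y\<bar> \<le> 1 / (2 * pi) ^ 3 * (C1 + C2) * ball_kernel 3 t (x - y)"
      using main[OF t, of i j "y - x"] unfolding ball_kernel_def norm_minus_commute[of x y]
      by (simp add: leray_test_heat_kernel[OF t] abs_mult divide_right_mono)
  qed (use C1 C2 in simp)
qed

text \<open>The derivative adds a third linear factor, and the exponent -3 becomes -2 once the
  singular factor is removed. This is the order of the gradient of the heat kernel itself, so
  convection and transport share one majorant.\<close>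

lemma partial_leray_test_heat_kernel_bound:
  "\<exists>C\<ge>0. \<forall>i j k. \<forall>t>0. \<forall>x y. \<bar>partial k (leray_test i j (heat_kernel_at t x)) y\<bar> \<le> C * ball_kernel 4 t (x - y)"
proof -
  obtain C1 where C1: "C1 \<ge> 0" "\<And>i s z. s > 0 \<Longrightarrow> \<bar>sin_transform (\<lambda>x. (x \<bullet> axis i 1) * gaussian s x) z\<bar> \<le> C1 * (s + (norm (z::real^3))\<^sup>2) powr (-2)"
    using sin_gaussian1_bound by blast
  obtain C2 where C2: "C2 \<ge> 0" "\<And>i j k s z. s > 0 \<Longrightarrow> \<bar>sin_transform (\<lambda>x. (x \<bullet> axis k 1) * ((x \<bullet> axis i 1) * (x \<bullet> axis j 1)) * gaussian s x) (z::real^3)\<bar> \<le> C2 * (s + (norm z)\<^sup>2) powr (-3)"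
    using sin_gaussian3_bound by blast
  have main: "\<bar>sin_transform (\<lambda>\<xi>. (\<xi> \<bullet> axis k 1) * leray_symbol i j \<xi> * gaussian t \<xi>) z\<bar> \<le> (C1 + C2) * (t + (norm z)\<^sup>2) powr (-2)"
    if t: "t > 0" for i j k t and z :: "real^3"
  proof -
    define p where "p = (\<lambda>x::real^3. (x \<bullet> axis k 1) * ((x \<bullet> axis i 1) * (x \<bullet> axis j 1)))"
    have pb: "\<bar>p x\<bar> \<le> 1 * norm x ^ (1 + 2)" for x
    proof -
      have "\<bar>p x\<bar> \<le> norm x * (norm x * norm x)"
        unfolding p_def abs_mult by (intro mult_mono abs_axis_inner) auto
      thus ?thesis by (simp add: power3_eq_cube)
    qed
    have [measurable]: "p \<in> borel_measurable borel" unfolding p_def by measurable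
    have ri: "\<bar>\<integral>x. sin (z \<bullet> x) * (p x / (norm x)\<^sup>2 * gaussian t x) \<partial>lborel\<bar> \<le> C2 / (3 - 1) * (t + (norm z)\<^sup>2) powr (1 - 3)"
      by (rule riesz_gaussian_bound[OF t _ _ _ _ _ pb])
         (use t C2 in \<open>auto simp: p_def sin_transform_def\<close>)
    have pq: "\<bar>p x / (norm x)\<^sup>2\<bar> \<le> 1 * norm x ^ 1" for x
      using pb[of x] by (cases "x = 0") (auto simp: divide_le_eq power2_eq_square power3_eq_cube)
    have "integrable lborel (\<lambda>x. p x / (norm x)\<^sup>2 * gaussian t x)"
      using integrable_poly_gaussian[OF t _ pq, of 0] by simp
    hence i1: "integrable lborel (\<lambda>x. sin (z \<bullet> x) * (p x / (norm x)\<^sup>2 * gaussian t x))"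
      by (rule integrable_bounded_mult) auto
    have aq: "\<bar>x \<bullet> axis k 1\<bar> \<le> 1 * norm x ^ 1" for x :: "real^3" using abs_axis_inner(1)[of x k] by simp
    have "integrable lborel (\<lambda>x::real^3. (x \<bullet> axis k 1) * gaussian t x)"
      using integrable_poly_gaussian[OF t _ aq, of 0] by simp
    hence i2: "integrable lborel (\<lambda>x. sin (z \<bullet> x) * ((x \<bullet> axis k 1) * gaussian t x))"
      by (rule integrable_bounded_mult) auto
    have "sin_transform (\<lambda>\<xi>. (\<xi> \<bullet> axis k 1) * leray_symbol i j \<xi> * gaussian t \<xi>) z =
       (\<integral>x. (if i = j then 1 else 0) * (sin (z \<bullet> x) * ((x \<bullet> axis k 1) * gaussian t x)) - sin (z \<bullet> x) * (p x / (norm x)\<^sup>2 * gaussian t x) \<partial>lborel)"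
      unfolding sin_transform_def p_def by (intro Bochner_Integration.integral_cong) (auto simp: leray_symbol_def inner_axis ring_distribs)
    also have "\<dots> = (if i = j then 1 else 0) * sin_transform (\<lambda>x. (x \<bullet> axis k 1) * gaussian t x) z - (\<integral>x. sin (z \<bullet> x) * (p x / (norm x)\<^sup>2 * gaussian t x) \<partial>lborel)"
      using i1 i2 by (simp add: sin_transform_def)
    also have "\<bar>\<dots>\<bar> \<le> \<bar>sin_transform (\<lambda>x. (x \<bullet> axis k 1) * gaussian t x) z\<bar> + \<bar>\<integral>x. sin (z \<bullet> x) * (p x / (norm x)\<^sup>2 * gaussian t x) \<partial>lborel\<bar>"
      by auto
    also have "\<dots> \<le> C1 * (t + (norm z)\<^sup>2) powr (-2) + C2 / (3 - 1) * (t + (norm z)\<^sup>2) powr (1 - 3)"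
      by (intro add_mono C1 ri t)
    also have "C2 / (3 - 1) * (t + (norm z)\<^sup>2) powr (1 - 3) \<le> C2 * (t + (norm z)\<^sup>2) powr (-2)"
      using C2(1) by (simp add: mult_right_mono)
    finally show ?thesis by (simp add: ring_distribs)
  qed
  show ?thesis
  proof (intro exI[of _ "1 / (2 * pi) ^ 3 * (C1 + C2)"] conjI allI impI)
    fix i j k :: 3 and t :: real and x y :: "real^3" assume t: "t > 0"
    show "\<bar>partial k (leray_test i j (heat_kernel_at t x)) y\<bar> \<le> 1 / (2 * pi) ^ 3 * (C1 + C2) * ball_kernel 4 t (x - y)"
      using main[OF t, of k i j "y - x"] unfolding ball_kernel_def norm_minus_commute[of x y]
      by (simp add: partial_leray_test_heat_kernel[OF t] abs_mult divide_right_mono)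
  qed (use C1 C2 in simp)
qed

lemma
  assumes t: "t > 0"
  shows borel_measurable_partial_heat_kernel: "partial k (heat_kernel_at t x) \<in> borel_measurable borel"
    and borel_measurable_leray_test_heat_kernel: "leray_test i j (heat_kernel_at t x) \<in> borel_measurable borel"
    and borel_measurable_partial_leray_test_heat_kernel: "partial k (leray_test i j (heat_kernel_at t x)) \<in> borel_measurable borel"
proof -
  have aq: "\<bar>x \<bullet> axis k 1\<bar> \<le> 1 * norm x ^ 1" for x :: "real^3" using abs_axis_inner(1)[of x k] by simp
  have [measurable]: "sin_transform (\<lambda>\<xi>. (\<xi> \<bullet> axis k 1) * gaussian t \<xi>) \<in> borel_measurable (borel :: (real^3) measure)"
    by (rule borel_measurable_trig_transform_gaussian(1)[OF t _ aq]) simp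
  show "partial k (heat_kernel_at t x) \<in> borel_measurable borel"
    unfolding partial_heat_kernel[OF t, abs_def] by measurable
  have [measurable]: "cos_transform (\<lambda>\<xi>. leray_symbol i j \<xi> * gaussian t \<xi>) \<in> borel_measurable borel"
    by (rule borel_measurable_trig_transform_gaussian(2)[OF t _ leray_symbol_bound]) simp
  show "leray_test i j (heat_kernel_at t x) \<in> borel_measurable borel"
    unfolding leray_test_heat_kernel[OF t, abs_def] by measurable
  have q: "\<bar>(\<xi> \<bullet> axis k 1) * leray_symbol i j \<xi>\<bar> \<le> 2 * norm \<xi> ^ 1" for \<xi>
    using mult_mono[OF abs_axis_inner(1)[of \<xi> k] leray_symbol_bound[of i j \<xi>]] by (simp add: abs_mult mult_ac)
  have [measurable]: "sin_transform (\<lambda>\<xi>. (\<xi> \<bullet> axis k 1) * leray_symbol i j \<xi> * gaussian t \<xi>) \<in> borel_measurable borel"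
    by (rule borel_measurable_trig_transform_gaussian(1)[OF t _ q]) measurable
  show "partial k (leray_test i j (heat_kernel_at t x)) \<in> borel_measurable borel"
    unfolding partial_leray_test_heat_kernel[OF t, abs_def] by measurable
qed

section \<open>Duhamel integrals in weak Lebesgue spaces\<close>

abbreviation mass :: "(real^3) set \<Rightarrow> (real^3 \<Rightarrow> ennreal) \<Rightarrow> ennreal" where
  "mass E f \<equiv> \<integral>\<^sup>+x. indicator E x * f x \<partial>lborel"

text \<open>For p > 1 this is membership in weak L^p up to constants. In contrast to the quasi-norm
  it is additive in \<open>f\<close>, and for functions with values in \<open>ennreal\<close>
  nothing has to be known about convergence.\<close>

definition marcinkiewicz :: "real \<Rightarrow> real \<Rightarrow> (real^3 \<Rightarrow> ennreal) \<Rightarrow> bool" where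
  "marcinkiewicz p A f \<longleftrightarrow> (\<forall>E\<in>sets borel. emeasure lborel E < \<infinity> \<longrightarrow>
     mass E f \<le> ennreal (A * measure lborel E powr (1 - 1 / p)))"

lemma marcinkiewiczD:
  "marcinkiewicz p A f \<Longrightarrow> E \<in> sets borel \<Longrightarrow> emeasure lborel E < \<infinity> \<Longrightarrow>
     mass E f \<le> ennreal (A * measure lborel E powr (1 - 1 / p))"
  by (auto simp: marcinkiewicz_def)

lemma marcinkiewicz_mono:
  assumes "marcinkiewicz p A f" "A \<le> B" "\<And>x. g x \<le> f x" shows "marcinkiewicz p B g"
  unfolding marcinkiewicz_def
proof (intro ballI impI)
  fix E :: "(real^3) set" assume E: "E \<in> sets borel" "emeasure lborel E < \<infinity>"
  have "mass E g \<le> mass E f"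
    by (intro nn_integral_mono mult_left_mono assms) auto
  also have "\<dots> \<le> ennreal (A * measure lborel E powr (1 - 1 / p))" by (rule marcinkiewiczD[OF assms(1) E])
  also have "\<dots> \<le> ennreal (B * measure lborel E powr (1 - 1 / p))"
    by (intro ennreal_leI mult_right_mono assms) auto
  finally show "mass E g \<le> ennreal (B * measure lborel E powr (1 - 1 / p))" .
qed

lemma measure_cball_3: "\<rho> \<ge> 0 \<Longrightarrow> measure lborel (cball (x::real^3) \<rho>) = unit_ball_vol 3 * \<rho> ^ 3"
  using content_cball[of \<rho> x] by simp

lemma unit_ball_vol_3_pos: "unit_ball_vol 3 > 0" by (rule unit_ball_vol_pos) simp

lemma indicator_ball_integral:
  assumes "marcinkiewicz r A f" "\<rho> \<ge> 0"
  shows "mass (cball x \<rho>) f \<le> ennreal (A * (unit_ball_vol 3 * \<rho> ^ 3) powr (1 - 1 / r))"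
  using marcinkiewiczD[OF assms(1) _ emeasure_lborel_cball_finite, of x \<rho>] assms(2)
  by (simp add: measure_cball_3)

text \<open>For each centre in \<open>E\<close> the function is tested on the ball, and the result
  is integrated over \<open>E\<close>.\<close>

lemma double_ball_integral1:
  assumes f: "marcinkiewicz r A f" and "\<rho> \<ge> 0" "A \<ge> 0" and E: "E \<in> sets borel" "emeasure lborel E < \<infinity>"
  shows "mass E (\<lambda>x. mass (cball x \<rho>) f)
     \<le> ennreal (A * (measure lborel E * (unit_ball_vol 3 * \<rho> ^ 3) powr (1 - 1 / r)))"
proof -
  have "mass E (\<lambda>x. mass (cball x \<rho>) f)
     \<le> (\<integral>\<^sup>+x. ennreal (A * (unit_ball_vol 3 * \<rho> ^ 3) powr (1 - 1 / r)) * indicator E x \<partial>lborel)"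
    by (subst mult.commute) (intro nn_integral_mono mult_right_mono indicator_ball_integral assms, auto)
  also have "\<dots> = ennreal (A * (unit_ball_vol 3 * \<rho> ^ 3) powr (1 - 1 / r)) * emeasure lborel E"
    using E by (simp add: nn_integral_cmult_indicator)
  also have "emeasure lborel E = ennreal (measure lborel E)"
    using E by (simp add: emeasure_eq_ennreal_measure)
  finally show ?thesis using assms by (simp add: ennreal_mult'[symmetric] mult_ac)
qed

lemma emeasure_translate:
  fixes E :: "'b::euclidean_space set"
  assumes [measurable]: "E \<in> sets borel"
  shows "{w. w - z \<in> E} \<in> sets borel" "emeasure lborel {w. w - z \<in> E} = emeasure lborel E"
proof -
  show m[measurable]: "{w. w - z \<in> E} \<in> sets borel" by measurable
  have "emeasure lborel {w. w - z \<in> E} = (\<integral>\<^sup>+w. indicator {w. w - z \<in> E} w \<partial>lborel)" by simp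
  also have "\<dots> = (\<integral>\<^sup>+w. indicator {w. w - z \<in> E} (z + w) \<partial>lborel)"
    by (rule nn_integral_lborel_translate[symmetric]) measurable
  also have "\<dots> = (\<integral>\<^sup>+w. indicator E w \<partial>lborel)" by (simp add: indicator_def)
  finally show "emeasure lborel {w. w - z \<in> E} = emeasure lborel E" by simp
qed

lemma cball_in_sets_borel [measurable]: "cball c r \<in> sets borel"
  by simp

text \<open>After exchanging the integrals the function is tested on the translates of
  \<open>E\<close>, one for each shift in the ball; translation preserves measure.\<close>

lemma double_ball_integral2:
  assumes f: "marcinkiewicz r A f" and "\<rho> \<ge> 0" "A \<ge> 0" and [measurable]: "E \<in> sets borel" "f \<in> borel_measurable borel"
    and E: "emeasure lborel E < \<infinity>"
  shows "mass E (\<lambda>x. mass (cball x \<rho>) f)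
     \<le> ennreal (A * (unit_ball_vol 3 * \<rho> ^ 3 * measure lborel E powr (1 - 1 / r)))"
proof -
  have "mass E (\<lambda>x. mass (cball x \<rho>) f)
      = (\<integral>\<^sup>+x. \<integral>\<^sup>+z. indicator E x * (indicator (cball 0 \<rho>) z * f (x + z)) \<partial>lborel \<partial>lborel)"
  proof (rule nn_integral_cong)
    fix x :: "real^3"
    have "mass (cball x \<rho>) f = (\<integral>\<^sup>+z. indicator (cball x \<rho>) (x + z) * f (x + z) \<partial>lborel)"
      by (rule nn_integral_lborel_translate[symmetric]) measurable
    also have "\<dots> = (\<integral>\<^sup>+z. indicator (cball 0 \<rho>) z * f (x + z) \<partial>lborel)"
      by (simp add: indicator_def dist_norm)
    finally show "indicator E x * mass (cball x \<rho>) f = (\<integral>\<^sup>+z. indicator E x * (indicator (cball 0 \<rho>) z * f (x + z)) \<partial>lborel)"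
      by (simp add: nn_integral_cmult)
  qed
  also have "\<dots> = (\<integral>\<^sup>+z. \<integral>\<^sup>+x. indicator E x * (indicator (cball 0 \<rho>) z * f (x + z)) \<partial>lborel \<partial>lborel)"
    by (rule lborel_pair.Fubini') measurable
  also have "\<dots> \<le> (\<integral>\<^sup>+z. ennreal (A * measure lborel E powr (1 - 1 / r)) * indicator (cball 0 \<rho> :: (real^3) set) z \<partial>lborel)"
  proof (rule nn_integral_mono)
    fix z :: "real^3"
    note [measurable] = emeasure_translate(1)[OF \<open>E \<in> sets borel\<close>, of z]
    have "mass E (\<lambda>x. indicator (cball 0 \<rho>) z * f (x + z))
       = indicator (cball 0 \<rho>) z * (\<integral>\<^sup>+x. indicator {w. w - z \<in> E} (z + x) * f (z + x) \<partial>lborel)"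
      by (subst nn_integral_cmult[symmetric]) (auto simp: mult_ac add.commute indicator_def intro!: nn_integral_cong)
    also have "(\<integral>\<^sup>+x. indicator {w. w - z \<in> E} (z + x) * f (z + x) \<partial>lborel) = (\<integral>\<^sup>+w. indicator {w. w - z \<in> E} w * f w \<partial>lborel)"
      by (rule nn_integral_lborel_translate) measurable
    also have "\<dots> \<le> ennreal (A * measure lborel {w. w - z \<in> E} powr (1 - 1 / r))"
      using E by (intro marcinkiewiczD[OF f]) (auto simp: emeasure_translate)
    also have "measure lborel {w. w - z \<in> E} = measure lborel E"
      by (simp add: measure_def emeasure_translate)
    finally show "mass E (\<lambda>x. indicator (cball 0 \<rho>) z * f (x + z)) \<le> ennreal (A * measure lborel E powr (1 - 1 / r)) * indicator (cball 0 \<rho>) z"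
      by (auto simp: indicator_def split: if_splits)
  qed
  also have "\<dots> = ennreal (A * measure lborel E powr (1 - 1 / r)) * emeasure lborel (cball 0 \<rho> :: (real^3) set)"
    by (simp add: nn_integral_cmult_indicator)
  also have "emeasure lborel (cball 0 \<rho> :: (real^3) set) = ennreal (unit_ball_vol 3 * \<rho> ^ 3)"
    using emeasure_cball[OF \<open>\<rho> \<ge> 0\<close>, of "0 :: real^3"] by simp
  finally show ?thesis using assms by (simp add: ennreal_mult'[symmetric] mult_ac)
qed

text \<open>The better of the two testing bounds for a set of measure \<open>m\<close>: testing on
  balls wins when the ball has larger measure than the set, testing on translates of the set when it
  has smaller.\<close>

definition overlap :: "real \<Rightarrow> real \<Rightarrow> real \<Rightarrow> real" where
  "overlap r m \<rho> = min (m * (unit_ball_vol 3 * \<rho> ^ 3) powr (1 - 1 / r)) (unit_ball_vol 3 * \<rho> ^ 3 * m powr (1 - 1 / r))"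

lemma double_ball_integral:
  assumes f: "marcinkiewicz r A f" and "\<rho> \<ge> 0" "A \<ge> 0" and "E \<in> sets borel" "f \<in> borel_measurable borel"
    and E: "emeasure lborel E < \<infinity>"
  shows "mass E (\<lambda>x. mass (cball x \<rho>) f)
     \<le> ennreal (A * overlap r (measure lborel E) \<rho>)"
  unfolding overlap_def using double_ball_integral1[OF f assms(2,3,4) E] double_ball_integral2[OF f assms(2-6)]
  by (auto simp: min_def)

lemma overlap_nonneg: "m \<ge> 0 \<Longrightarrow> \<rho> \<ge> 0 \<Longrightarrow> overlap r m \<rho> \<ge> 0"
  unfolding overlap_def using unit_ball_vol_3_pos by auto

section \<open>Layer representation of Duhamel integrals\<close>

abbreviation ball_layer :: "real \<Rightarrow> real \<Rightarrow> real^3 \<Rightarrow> real \<Rightarrow> real^3 \<Rightarrow> ennreal" where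
  "ball_layer n \<tau> x \<rho> y \<equiv> ennreal (n * \<rho> powr (- n - 1)) * (indicator {0<..} \<rho> * indicator {\<rho>. \<tau> \<le> \<rho>\<^sup>2} \<rho> * indicator (cball x \<rho>) y)"

text \<open>The condition \<rho>^2 >= \<tau> + |z|^2 is weakened to the pair \<rho>^2 >= \<tau> and
  |z| <= \<rho>. This costs equality but decouples time from space.\<close>

lemma ball_kernel_layers:
  assumes "\<tau> > 0" "n > 0"
  shows "ennreal (ball_kernel n \<tau> z) \<le> (\<integral>\<^sup>+\<rho>. ball_layer n \<tau> 0 \<rho> z \<partial>lborel)"
proof -
  define c where "c = sqrt (\<tau> + (norm z)\<^sup>2)"
  have c: "c > 0" using assms by (auto simp: c_def add_pos_nonneg)
  have "ennreal (ball_kernel n \<tau> z) = ennreal (n * (c powr (- n) / n))"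
    using assms c by (simp add: ball_kernel_def c_def powr_half_sqrt[symmetric] powr_powr add_nonneg_nonneg)
  also have "\<dots> = ennreal n * (\<integral>\<^sup>+\<rho>. ennreal ((\<rho> + 0) powr (- (n + 1))) * indicator {c..} \<rho> \<partial>lborel)"
    using c assms by (subst nn_integral_powr_tail) (auto simp: ennreal_mult[symmetric])
  also have "\<dots> = (\<integral>\<^sup>+\<rho>. ennreal (n * \<rho> powr (- n - 1)) * indicator {c..} \<rho> \<partial>lborel)"
    using assms by (subst nn_integral_cmult[symmetric]) (auto simp: ennreal_mult mult_ac)
  also have "\<dots> \<le> (\<integral>\<^sup>+\<rho>. ball_layer n \<tau> 0 \<rho> z \<partial>lborel)"
  proof (intro nn_integral_mono mult_left_mono)
    fix \<rho> :: real
    show "indicator {c..} \<rho> \<le> (indicator {0<..} \<rho> * indicator {\<rho>. \<tau> \<le> \<rho>\<^sup>2} \<rho> * indicator (cball 0 \<rho>) z :: ennreal)"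
    proof (cases "\<rho> \<ge> c")
      case True
      hence "\<rho>\<^sup>2 \<ge> c\<^sup>2" using c by (intro power_mono) auto
      hence *: "\<rho>\<^sup>2 \<ge> \<tau> + (norm z)\<^sup>2" using assms by (simp add: c_def)
      hence "\<tau> \<le> \<rho>\<^sup>2" using zero_le_power2[of "norm z"] by linarith
      moreover have "(norm z)\<^sup>2 \<le> \<rho>\<^sup>2" using * assms by linarith
      hence "norm z \<le> \<rho>" using True c by (intro power2_le_imp_le[of "norm z"]) auto
      ultimately show ?thesis using True c by simp
    qed simp
  qed auto
  finally show ?thesis .
qed

text \<open>Common majorant of all Duhamel terms: order 4 when a derivative falls on the kernel,
  order 3 for the buoyancy.\<close>

definition duhamel :: "real \<Rightarrow> real \<Rightarrow> (real \<Rightarrow> real^3 \<Rightarrow> ennreal) \<Rightarrow> real^3 \<Rightarrow> ennreal" where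
  "duhamel n t f x = (\<integral>\<^sup>+s. \<integral>\<^sup>+y. indicator {0<..<t} s * ennreal (ball_kernel n (t - s) (x - y)) * f s y \<partial>lborel \<partial>lborel)"

lemma borel_measurable_ball_kernel [measurable]:
  "(\<lambda>(\<tau>, z). ball_kernel n \<tau> z) \<in> borel_measurable (borel \<Otimes>\<^sub>M borel)"
  unfolding ball_kernel_def by measurable

lemma borel_measurable_ball_kernel' [measurable (raw)]:
  assumes [measurable]: "f \<in> borel_measurable M" "g \<in> borel_measurable M"
  shows "(\<lambda>x. ball_kernel n (f x) (g x)) \<in> borel_measurable M"
  unfolding ball_kernel_def by measurable

abbreviation jointly_borel :: "(real \<Rightarrow> real^3 \<Rightarrow> 'a::topological_space) \<Rightarrow> bool" where
  "jointly_borel f \<equiv> (\<lambda>(s, y). f s y) \<in> borel_measurable (borel \<Otimes>\<^sub>M borel)"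

abbreviation window_mass :: "real \<Rightarrow> (real^3) set \<Rightarrow> (real \<Rightarrow> real^3 \<Rightarrow> ennreal) \<Rightarrow> real \<Rightarrow> ennreal" where
  "window_mass t E f \<rho> \<equiv> \<integral>\<^sup>+s. indicator {0<..<t} s * indicator {\<rho>. t - s \<le> \<rho>\<^sup>2} \<rho> * mass E (\<lambda>x. mass (cball x \<rho>) (f s)) \<partial>lborel"

text \<open>Tonelli brings the radius to the outside. What remains for each \<rho> is a time window
  of length \<rho>^2 before \<open>t\<close> and the double integral over \<open>E\<close> and balls
  of radius \<rho>.\<close>

lemma duhamel_layers:
  assumes n: "n > 0" and [measurable]: "jointly_borel f" "E \<in> sets borel"
  shows "mass E (duhamel n t f) \<le>
    (\<integral>\<^sup>+\<rho>. ennreal (n * \<rho> powr (- n - 1)) * indicator {0<..} \<rho> *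
      window_mass t E f \<rho> \<partial>lborel)"
proof -
  define H where "H = (\<lambda>x s y \<rho>. indicator E x * (indicator {0<..<t} s * (ball_layer n (t - s) x \<rho> y) * f s y))"
  have cb: "indicator (cball x \<rho>) y = indicator {u::real. u \<le> \<rho>} (dist x y)" for x y :: "real^3" and \<rho>
    by (simp add: indicator_def)
  have td: "indicator {\<rho>. t - s \<le> \<rho>\<^sup>2} \<rho> = indicator {u::real. u \<le> 0} (t - s - \<rho>\<^sup>2)" for s \<rho> :: real
    by (simp add: indicator_def)
  have Hm[measurable]: "(\<lambda>p. H (f1 p) (f2 p) (f3 p) (f4 p)) \<in> borel_measurable M"
    if [measurable]: "f1 \<in> borel_measurable M" "f2 \<in> borel_measurable M" "f3 \<in> borel_measurable M" "f4 \<in> borel_measurable M"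
    for M :: "'z measure" and f1 f2 f3 f4
  proof -
    have [measurable]: "(\<lambda>p. f (f2 p) (f3 p)) \<in> borel_measurable M"
      using measurable_compose[OF measurable_Pair[OF that(2,3)] assms(2)] by simp
    have [measurable]: "(\<lambda>p. indicator (cball (f1 p) (f4 p)) (f3 p) :: ennreal) \<in> borel_measurable M"
      unfolding indicator_def mem_cball by measurable
    have [measurable]: "(\<lambda>p. indicator {\<rho>. t - f2 p \<le> \<rho>\<^sup>2} (f4 p) :: ennreal) \<in> borel_measurable M"
      unfolding indicator_def mem_Collect_eq by measurable
    show ?thesis unfolding H_def by measurable
  qed
  have "mass E (duhamel n t f) \<le> (\<integral>\<^sup>+x. \<integral>\<^sup>+s. \<integral>\<^sup>+y. \<integral>\<^sup>+\<rho>. H x s y \<rho> \<partial>lborel \<partial>lborel \<partial>lborel \<partial>lborel)"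
  proof (rule nn_integral_mono)
    fix x
    have "duhamel n t f x \<le> (\<integral>\<^sup>+s. \<integral>\<^sup>+y. \<integral>\<^sup>+\<rho>. indicator {0<..<t} s * (ball_layer n (t - s) x \<rho> y) * f s y \<partial>lborel \<partial>lborel \<partial>lborel)"
      unfolding duhamel_def
    proof (intro nn_integral_mono)
      fix s y
      show "indicator {0<..<t} s * ennreal (ball_kernel n (t - s) (x - y)) * f s y
        \<le> (\<integral>\<^sup>+\<rho>. indicator {0<..<t} s * (ball_layer n (t - s) x \<rho> y) * f s y \<partial>lborel)"
      proof (cases "s \<in> {0<..<t}")
        case True
        have "(\<integral>\<^sup>+\<rho>. indicator {0<..<t} s * (ball_layer n (t - s) x \<rho> y) * f s y \<partial>lborel)
          = (\<integral>\<^sup>+\<rho>. ball_layer n (t - s) 0 \<rho> (x - y) * f s y \<partial>lborel)"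
          using True by (intro nn_integral_cong) (simp add: indicator_def dist_norm norm_minus_commute)
        also have "\<dots> = (\<integral>\<^sup>+\<rho>. ball_layer n (t - s) 0 \<rho> (x - y) \<partial>lborel) * f s y"
          by (rule nn_integral_multc) (simp add: indicator_def)
        also have "\<dots> \<ge> ennreal (ball_kernel n (t - s) (x - y)) * f s y"
          using True n by (intro mult_right_mono ball_kernel_layers) auto
        finally show ?thesis using True by simp
      qed simp
    qed
    hence "indicator E x * duhamel n t f x \<le> indicator E x * (\<integral>\<^sup>+s. \<integral>\<^sup>+y. \<integral>\<^sup>+\<rho>. indicator {0<..<t} s * (ball_layer n (t - s) x \<rho> y) * f s y \<partial>lborel \<partial>lborel \<partial>lborel)"
      by (rule mult_left_mono) simp
    also have "\<dots> = (\<integral>\<^sup>+s. \<integral>\<^sup>+y. \<integral>\<^sup>+\<rho>. H x s y \<rho> \<partial>lborel \<partial>lborel \<partial>lborel)"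
      by (cases "x \<in> E") (auto simp: H_def)
    finally show "indicator E x * duhamel n t f x \<le> (\<integral>\<^sup>+s. \<integral>\<^sup>+y. \<integral>\<^sup>+\<rho>. H x s y \<rho> \<partial>lborel \<partial>lborel \<partial>lborel)" .
  qed
  also have "\<dots> = (\<integral>\<^sup>+x. \<integral>\<^sup>+s. \<integral>\<^sup>+\<rho>. \<integral>\<^sup>+y. H x s y \<rho> \<partial>lborel \<partial>lborel \<partial>lborel \<partial>lborel)"
    by (intro nn_integral_cong lborel_pair.Fubini') measurable
  also have "\<dots> = (\<integral>\<^sup>+x. \<integral>\<^sup>+\<rho>. \<integral>\<^sup>+s. \<integral>\<^sup>+y. H x s y \<rho> \<partial>lborel \<partial>lborel \<partial>lborel \<partial>lborel)"
    by (intro nn_integral_cong lborel_pair.Fubini') measurable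
  also have "\<dots> = (\<integral>\<^sup>+\<rho>. \<integral>\<^sup>+x. \<integral>\<^sup>+s. \<integral>\<^sup>+y. H x s y \<rho> \<partial>lborel \<partial>lborel \<partial>lborel \<partial>lborel)"
    by (intro lborel_pair.Fubini') measurable
  also have "\<dots> = (\<integral>\<^sup>+\<rho>. \<integral>\<^sup>+s. \<integral>\<^sup>+x. \<integral>\<^sup>+y. H x s y \<rho> \<partial>lborel \<partial>lborel \<partial>lborel \<partial>lborel)"
    by (intro nn_integral_cong lborel_pair.Fubini') measurable
  also have "\<dots> = (\<integral>\<^sup>+\<rho>. ennreal (n * \<rho> powr (- n - 1)) * indicator {0<..} \<rho> *
      window_mass t E f \<rho> \<partial>lborel)"
  proof (rule nn_integral_cong)
    fix \<rho> :: real
    have [measurable]: "(\<lambda>(x::real^3, y). indicator (cball x \<rho>) y :: ennreal) \<in> borel_measurable (borel \<Otimes>\<^sub>M borel)"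
      unfolding indicator_def mem_cball by measurable
    have e1: "(\<integral>\<^sup>+y. H x s y \<rho> \<partial>lborel) = (ennreal (n * \<rho> powr (- n - 1)) * indicator {0<..} \<rho>) * (indicator {0<..<t} s * indicator {\<rho>. t - s \<le> \<rho>\<^sup>2} \<rho> * (indicator E x * mass (cball x \<rho>) (f s)))" for x s
      unfolding H_def by (simp add: nn_integral_cmult[symmetric] mult_ac)
    show "(\<integral>\<^sup>+s. \<integral>\<^sup>+x. \<integral>\<^sup>+y. H x s y \<rho> \<partial>lborel \<partial>lborel \<partial>lborel) = ennreal (n * \<rho> powr (- n - 1)) * indicator {0<..} \<rho> *
      window_mass t E f \<rho>"
      unfolding e1 td by (simp add: nn_integral_cmult)
  qed
  finally show ?thesis .
qed

text \<open>The weight of the temperature norm, restarted at time \<open>a\<close>. It is 0 up to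
  \<open>a\<close> because differences of solutions are already known to vanish there.\<close>

definition time_weight :: "real \<Rightarrow> real \<Rightarrow> real \<Rightarrow> real" where
  "time_weight a \<beta> s = (if s > a then (s - a) powr (- \<beta>) else 0)"

lemma time_weight_nonneg [simp]: "time_weight a \<beta> s \<ge> 0"
  by (simp add: time_weight_def)

lemma borel_measurable_time_weight [measurable]: "time_weight a \<beta> \<in> borel_measurable borel"
  unfolding time_weight_def[abs_def] by measurable

lemma nn_integral_powr_from_0:
  assumes "\<beta> < 1" "h \<ge> 0"
  shows "(\<integral>\<^sup>+x. indicator {0..h} x * ennreal (x powr (- \<beta>)) \<partial>lborel) = ennreal (h powr (1 - \<beta>) / (1 - \<beta>))"
proof -
  have "((\<lambda>x. x powr (- \<beta>)) has_integral (h powr (- \<beta> + 1) / (- \<beta> + 1))) {0..h}"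
    using assms by (intro has_integral_powr_from_0) auto
  hence "((\<lambda>x. indicator {0..h} x * x powr (- \<beta>)) has_integral (h powr (- \<beta> + 1) / (- \<beta> + 1))) UNIV"
    by (subst (asm) has_integral_restrict_UNIV[symmetric]) (rule has_integral_eq[rotated], assumption, simp add: indicator_def)
  from nn_integral_has_integral_lborel[OF _ _ this]
  have "(\<integral>\<^sup>+x. ennreal (indicator {0..h} x * x powr (- \<beta>)) \<partial>lborel) = ennreal (h powr (1 - \<beta>) / (1 - \<beta>))"
    by (simp add: add.commute)
  thus ?thesis by (simp add: ennreal_mult' ennreal_indicator)
qed

text \<open>If the window is longer than half of t - a, the whole weight is integrated; otherwise
  the window stays away from the singularity at \<open>a\<close>, and the weight there is comparable
  to its value at \<open>t\<close>.\<close>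

lemma nn_integral_time_weight:
  assumes at: "0 \<le> a" "a < t" and \<beta>: "0 \<le> \<beta>" "\<beta> < 1" and \<rho>: "\<rho> > 0"
  shows "(\<integral>\<^sup>+s. indicator {0<..<t} s * indicator {s. t - s \<le> \<rho>\<^sup>2} s * ennreal (time_weight a \<beta> s) \<partial>lborel)
    \<le> ennreal (2 / (1 - \<beta>) * (t - a) powr (- \<beta>) * min (\<rho>\<^sup>2) (t - a))"
proof -
  define h where "h = t - a"
  have h: "h > 0" using at by (simp add: h_def)
  have "(\<integral>\<^sup>+s. indicator {0<..<t} s * indicator {s. t - s \<le> \<rho>\<^sup>2} s * ennreal (time_weight a \<beta> s) \<partial>lborel)
    = (\<integral>\<^sup>+s. indicator {0<..<t} (a + s) * indicator {s. t - s \<le> \<rho>\<^sup>2} (a + s) * ennreal (time_weight a \<beta> (a + s)) \<partial>lborel)"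
    by (rule nn_integral_lborel_translate[symmetric]) measurable
  also have "\<dots> \<le> (\<integral>\<^sup>+s. indicator {0<..<h} s * indicator {s. h - s \<le> \<rho>\<^sup>2} s * ennreal (s powr (- \<beta>)) \<partial>lborel)"
    by (intro nn_integral_mono) (auto simp: indicator_def time_weight_def h_def)
  also have "\<dots> \<le> ennreal (2 / (1 - \<beta>) * h powr (- \<beta>) * min (\<rho>\<^sup>2) h)"
  proof (cases "\<rho>\<^sup>2 \<ge> h / 2")
    case True
    have "(\<integral>\<^sup>+s. indicator {0<..<h} s * indicator {s. h - s \<le> \<rho>\<^sup>2} s * ennreal (s powr (- \<beta>)) \<partial>lborel)
      \<le> (\<integral>\<^sup>+s. indicator {0..h} s * ennreal (s powr (- \<beta>)) \<partial>lborel)"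
      by (intro nn_integral_mono) (auto simp: indicator_def)
    also have "\<dots> = ennreal (h powr (1 - \<beta>) / (1 - \<beta>))" using h \<beta> by (intro nn_integral_powr_from_0) auto
    also have "h powr (1 - \<beta>) / (1 - \<beta>) = 2 / (1 - \<beta>) * h powr (- \<beta>) * (h / 2)"
      using h by (simp add: powr_diff powr_minus field_simps)
    also have "ennreal \<dots> \<le> ennreal (2 / (1 - \<beta>) * h powr (- \<beta>) * min (\<rho>\<^sup>2) h)"
      using \<beta> True h by (intro ennreal_leI mult_left_mono) auto
    finally show ?thesis .
  next
    case False
    have "(\<integral>\<^sup>+s. indicator {0<..<h} s * indicator {s. h - s \<le> \<rho>\<^sup>2} s * ennreal (s powr (- \<beta>)) \<partial>lborel)
      \<le> (\<integral>\<^sup>+s. ennreal (2 * h powr (- \<beta>)) * indicator {h - \<rho>\<^sup>2..h} s \<partial>lborel)"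
    proof (intro nn_integral_mono)
      fix s
      show "indicator {0<..<h} s * indicator {s. h - s \<le> \<rho>\<^sup>2} s * ennreal (s powr (- \<beta>)) \<le> ennreal (2 * h powr (- \<beta>)) * indicator {h - \<rho>\<^sup>2..h} s"
      proof (cases "s \<in> {0<..<h} \<and> h - s \<le> \<rho>\<^sup>2")
        case True
        hence "s \<ge> h / 2" using False by auto
        hence "s powr (- \<beta>) \<le> (h / 2) powr (- \<beta>)" using \<beta> h by (intro powr_mono2') auto
        also have "\<dots> = 2 powr \<beta> * h powr (- \<beta>)" using h by (simp add: powr_divide powr_minus field_simps)
        also have "\<dots> \<le> 2 powr 1 * h powr (- \<beta>)" using \<beta> by (intro mult_right_mono powr_mono) auto
        finally show ?thesis using True by (auto simp: indicator_def intro!: ennreal_leI)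
      qed (auto simp: indicator_def)
    qed
    also have "\<dots> = ennreal (2 * h powr (- \<beta>) * \<rho>\<^sup>2)"
      by (simp add: nn_integral_cmult_indicator ennreal_mult[symmetric])
    also have "\<dots> \<le> ennreal (2 / (1 - \<beta>) * h powr (- \<beta>) * min (\<rho>\<^sup>2) h)"
    proof (rule ennreal_leI)
      have "2 \<le> 2 / (1 - \<beta>)" using \<beta> by (simp add: field_simps)
      hence "2 * (h powr (- \<beta>) * \<rho>\<^sup>2) \<le> 2 / (1 - \<beta>) * (h powr (- \<beta>) * \<rho>\<^sup>2)"
        by (intro mult_right_mono) auto
      moreover have "min (\<rho>\<^sup>2) h = \<rho>\<^sup>2" using False h by simp
      ultimately show "2 * h powr (- \<beta>) * \<rho>\<^sup>2 \<le> 2 / (1 - \<beta>) * h powr (- \<beta>) * min (\<rho>\<^sup>2) h" by simp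
    qed
    finally show ?thesis .
  qed
  finally show ?thesis by (simp add: h_def)
qed

text \<open>For a fixed radius the space part is at most \<open>overlap\<close> and the time part is
  controlled by \<open>nn_integral_time_weight\<close>. All mapping properties below are evaluations
  of the remaining integral over radii.\<close>

lemma duhamel_master:
  assumes n: "n > 0" and [measurable]: "jointly_borel f" "E \<in> sets borel"
    and at: "0 \<le> a" "a < t" and \<beta>: "0 \<le> \<beta>" "\<beta> < 1" and A: "A \<ge> 0"
    and f: "AE s\<in>{0<..<t} in lborel. marcinkiewicz r (A * time_weight a \<beta> s) (f s)"
    and E: "emeasure lborel E < \<infinity>"
  shows "mass E (duhamel n t f) \<le>
    ennreal (n * A * (2 / (1 - \<beta>)) * (t - a) powr (- \<beta>)) *
      (\<integral>\<^sup>+\<rho>. indicator {0<..} \<rho> * ennreal (\<rho> powr (- n - 1) * min (\<rho>\<^sup>2) (t - a) * overlap r (measure lborel E) \<rho>) \<partial>lborel)"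
proof -
  define m where "m = measure lborel E"
  have "mass E (duhamel n t f) \<le>
    (\<integral>\<^sup>+\<rho>. ennreal (n * \<rho> powr (- n - 1)) * indicator {0<..} \<rho> *
      window_mass t E f \<rho> \<partial>lborel)"
    by (rule duhamel_layers) (use n in measurable)
  also have "\<dots> \<le> (\<integral>\<^sup>+\<rho>. ennreal (n * A * (2 / (1 - \<beta>)) * (t - a) powr (- \<beta>)) * (indicator {0<..} \<rho> * ennreal (\<rho> powr (- n - 1) * min (\<rho>\<^sup>2) (t - a) * overlap r m \<rho>)) \<partial>lborel)"
  proof (rule nn_integral_mono)
    fix \<rho> :: real
    show "ennreal (n * \<rho> powr (- n - 1)) * indicator {0<..} \<rho> *
      window_mass t E f \<rho>
      \<le> ennreal (n * A * (2 / (1 - \<beta>)) * (t - a) powr (- \<beta>)) * (indicator {0<..} \<rho> * ennreal (\<rho> powr (- n - 1) * min (\<rho>\<^sup>2) (t - a) * overlap r m \<rho>))"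
    proof (cases "\<rho> > 0")
      case True
      have "window_mass t E f \<rho>
        \<le> (\<integral>\<^sup>+s. ennreal (A * overlap r m \<rho>) * (indicator {0<..<t} s * indicator {s. t - s \<le> \<rho>\<^sup>2} s * ennreal (time_weight a \<beta> s)) \<partial>lborel)"
      proof (rule nn_integral_mono_AE, use f in eventually_elim)
        fix s
        assume s: "s \<in> {0<..<t} \<longrightarrow> marcinkiewicz r (A * time_weight a \<beta> s) (f s)"
        show "indicator {0<..<t} s * indicator {\<rho>. t - s \<le> \<rho>\<^sup>2} \<rho> * mass E (\<lambda>x. mass (cball x \<rho>) (f s))
          \<le> ennreal (A * overlap r m \<rho>) * (indicator {0<..<t} s * indicator {s. t - s \<le> \<rho>\<^sup>2} s * ennreal (time_weight a \<beta> s))"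
        proof (cases "s \<in> {0<..<t} \<and> t - s \<le> \<rho>\<^sup>2")
          case T: True
          have "f s \<in> borel_measurable borel" by measurable
          hence "mass E (\<lambda>x. mass (cball x \<rho>) (f s)) \<le> ennreal (A * time_weight a \<beta> s * overlap r m \<rho>)"
            unfolding m_def using s T True A E by (intro double_ball_integral) auto
          also have "\<dots> = ennreal (A * overlap r m \<rho>) * ennreal (time_weight a \<beta> s)"
            using A True by (subst ennreal_mult[symmetric]) (auto simp: m_def mult_ac intro!: mult_nonneg_nonneg overlap_nonneg)
          finally show ?thesis using T by simp
        qed (auto simp: indicator_def)
      qed
      also have "\<dots> = ennreal (A * overlap r m \<rho>) * (\<integral>\<^sup>+s. indicator {0<..<t} s * indicator {s. t - s \<le> \<rho>\<^sup>2} s * ennreal (time_weight a \<beta> s) \<partial>lborel)"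
        by (rule nn_integral_cmult) measurable
      also have "\<dots> \<le> ennreal (A * overlap r m \<rho>) * ennreal (2 / (1 - \<beta>) * (t - a) powr (- \<beta>) * min (\<rho>\<^sup>2) (t - a))"
        by (intro mult_left_mono nn_integral_time_weight at \<beta> True) simp
      finally have "ennreal (n * \<rho> powr (- n - 1)) * window_mass t E f \<rho>
        \<le> ennreal (n * \<rho> powr (- n - 1)) * (ennreal (A * overlap r m \<rho>) * ennreal (2 / (1 - \<beta>) * (t - a) powr (- \<beta>) * min (\<rho>\<^sup>2) (t - a)))"
        by (rule mult_left_mono) simp
      also have "\<dots> = ennreal (n * A * (2 / (1 - \<beta>)) * (t - a) powr (- \<beta>)) * ennreal (\<rho> powr (- n - 1) * min (\<rho>\<^sup>2) (t - a) * overlap r m \<rho>)"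
      proof -
        have "overlap r m \<rho> \<ge> 0" using True by (intro overlap_nonneg) (auto simp: m_def)
        thus ?thesis using n A \<beta> at by (simp add: ennreal_mult[symmetric] mult_ac)
      qed
      finally show ?thesis using True by simp
    qed simp
  qed
  also have "\<dots> = ennreal (n * A * (2 / (1 - \<beta>)) * (t - a) powr (- \<beta>)) *
      (\<integral>\<^sup>+\<rho>. indicator {0<..} \<rho> * ennreal (\<rho> powr (- n - 1) * min (\<rho>\<^sup>2) (t - a) * overlap r m \<rho>) \<partial>lborel)"
    unfolding overlap_def by (rule nn_integral_cmult) measurable
  finally show ?thesis by (simp add: m_def)
qed

section \<open>Integrals over radii and the resulting mapping properties\<close>

lemma nn_integral_powr_head:
  assumes "\<gamma> > -1" "h \<ge> 0"
  shows "(\<integral>\<^sup>+x. indicator {0..h} x * ennreal (x powr \<gamma>) \<partial>lborel) = ennreal (h powr (\<gamma> + 1) / (\<gamma> + 1))"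
  using nn_integral_powr_from_0[of "- \<gamma>" h] assms by (simp add: add.commute)

lemma nn_integral_powr_tail0:
  assumes "\<kappa> > 1" "h > 0"
  shows "(\<integral>\<^sup>+x. indicator {h..} x * ennreal (x powr (- \<kappa>)) \<partial>lborel) = ennreal (h powr (1 - \<kappa>) / (\<kappa> - 1))"
  using nn_integral_powr_tail[of \<kappa> h 0] assms by (simp add: mult.commute)

lemma nn_integral_split_powr:
  assumes le: "\<And>x. x > 0 \<Longrightarrow> x \<le> R \<Longrightarrow> g x \<le> c * x powr \<gamma>" "\<And>x. x \<ge> R \<Longrightarrow> g x \<le> d * x powr (- \<kappa>)"
    and "c \<ge> 0" "d \<ge> 0" "\<gamma> > -1" "\<kappa> > 1" "R > 0"
  shows "(\<integral>\<^sup>+x. indicator {0<..} x * ennreal (g x) \<partial>lborel) \<le> ennreal (c * (R powr (\<gamma> + 1) / (\<gamma> + 1)) + d * (R powr (1 - \<kappa>) / (\<kappa> - 1)))"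
proof -
  have "(\<integral>\<^sup>+x. indicator {0<..} x * ennreal (g x) \<partial>lborel) \<le> (\<integral>\<^sup>+x. ennreal c * (indicator {0..R} x * ennreal (x powr \<gamma>)) + ennreal d * (indicator {R..} x * ennreal (x powr (- \<kappa>))) \<partial>lborel)"
  proof (rule nn_integral_mono)
    fix x
    show "indicator {0<..} x * ennreal (g x) \<le> ennreal c * (indicator {0..R} x * ennreal (x powr \<gamma>)) + ennreal d * (indicator {R..} x * ennreal (x powr (- \<kappa>)))"
    proof (cases "x > 0")
      case True
      show ?thesis
      proof (cases "x \<le> R")
        case T: True
        have "ennreal (g x) \<le> ennreal (c * x powr \<gamma>)" by (intro ennreal_leI le True T)
        also have "\<dots> = ennreal c * (indicator {0..R} x * ennreal (x powr \<gamma>))" using T True assms by (simp add: ennreal_mult)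
        finally show ?thesis using True by (simp add: add_increasing2)
      next
        case F: False
        have "ennreal (g x) \<le> ennreal (d * x powr (- \<kappa>))" using F by (intro ennreal_leI le) auto
        thus ?thesis using F True assms by (simp add: ennreal_mult)
      qed
    qed simp
  qed
  also have "\<dots> = ennreal c * (\<integral>\<^sup>+x. indicator {0..R} x * ennreal (x powr \<gamma>) \<partial>lborel) + ennreal d * (\<integral>\<^sup>+x. indicator {R..} x * ennreal (x powr (- \<kappa>)) \<partial>lborel)"
    by (simp add: nn_integral_add nn_integral_cmult)
  also have "\<dots> = ennreal c * ennreal (R powr (\<gamma> + 1) / (\<gamma> + 1)) + ennreal d * ennreal (R powr (1 - \<kappa>) / (\<kappa> - 1))"
    using assms by (simp add: nn_integral_powr_head nn_integral_powr_tail0)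
  also have "\<dots> = ennreal (c * (R powr (\<gamma> + 1) / (\<gamma> + 1)) + d * (R powr (1 - \<kappa>) / (\<kappa> - 1)))"
    using assms by (simp add: ennreal_mult[symmetric] ennreal_plus[symmetric] del: ennreal_plus)
  finally show ?thesis .
qed

lemma nn_integral_null_emeasure:
  assumes "emeasure lborel E = 0" "E \<in> sets borel" shows "mass E f = 0"
proof -
  have "AE x in lborel. x \<notin> E" using assms by (auto simp: AE_iff_null_sets[symmetric] null_sets_def intro!: AE_not_in)
  hence "mass E f = (\<integral>\<^sup>+x. 0 * f x \<partial>lborel)"
    by (intro nn_integral_cong_AE) (rule eventually_mono, assumption, simp)
  thus ?thesis by simp
qed

text \<open>The critical estimate chooses a radius that is a power of |E|, so null sets are settled
  apart.\<close>

lemma marcinkiewiczI_pos: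
  assumes "\<And>E. E \<in> sets borel \<Longrightarrow> emeasure lborel E < \<infinity> \<Longrightarrow> measure lborel E > 0 \<Longrightarrow>
     mass E f \<le> ennreal (A * measure lborel E powr (1 - 1 / p))"
  shows "marcinkiewicz p A f"
  unfolding marcinkiewicz_def
proof (intro ballI impI)
  fix E :: "(real^3) set" assume E: "E \<in> sets borel" "emeasure lborel E < \<infinity>"
  show "mass E f \<le> ennreal (A * measure lborel E powr (1 - 1 / p))"
  proof (cases "measure lborel E = 0")
    case True
    hence "emeasure lborel E = 0" using E by (simp add: emeasure_eq_ennreal_measure)
    thus ?thesis using E by (simp add: nn_integral_null_emeasure)
  next
    case False
    thus ?thesis using E by (intro assms) (auto simp: zero_less_measure_iff measure_nonneg less_le)
  qed
qed

text \<open>The constant does not depend on the restart time \<open>a\<close>, so that one constant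
  serves all restarts of the uniqueness argument.\<close>

definition duhamel_bound :: "real \<Rightarrow> real \<Rightarrow> real \<Rightarrow> real \<Rightarrow> real \<Rightarrow> real \<Rightarrow> bool" where
  "duhamel_bound n r p \<beta> \<kappa> C \<longleftrightarrow> C \<ge> 0 \<and> (\<forall>a t A f. 0 \<le> a \<longrightarrow> a < t \<longrightarrow> A \<ge> 0 \<longrightarrow> jointly_borel f \<longrightarrow>
     (AE s\<in>{0<..<t} in lborel. marcinkiewicz r (A * time_weight a \<beta> s) (f s)) \<longrightarrow>
     marcinkiewicz p (C * A * (t - a) powr \<kappa>) (duhamel n t f))"

lemmas duhamel_boundD = duhamel_bound_def[THEN iffD1, THEN conjunct1] duhamel_bound_def[THEN iffD1, THEN conjunct2, rule_format]

text \<open>The endpoint estimate: the two halves of the overlap bound balance at \<open>\<rho> = |E|\<^sup>1\<^sup>/\<^sup>3\<close>,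
  which replaces real interpolation in Meyer's bilinear estimate.\<close>

lemma duhamel_endpoint:
  assumes p: "1 / r = 1 / p + 1 / 3" "r > 1" "p > 0" and \<beta>: "0 \<le> \<beta>" "\<beta> < 1"
  shows "\<exists>C. duhamel_bound 4 r p \<beta> (- \<beta>) C"
proof -
  define v where "v = unit_ball_vol 3"
  have v: "v > 0" unfolding v_def by (rule unit_ball_vol_3_pos)
  define K where "K = v + v powr (1 - 1 / r) / (3 / r - 1)"
  have "1 / r > 1 / 3" using p by simp
  hence r3: "3 / r > 1" by simp
  have K: "K \<ge> 0" using v r3 by (simp add: K_def)
  show ?thesis
    unfolding duhamel_bound_def
  proof (intro exI[of _ "4 * (2 / (1 - \<beta>)) * K"] conjI allI impI)
    show "0 \<le> 4 * (2 / (1 - \<beta>)) * K" using K \<beta> by simp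
    fix a t A :: real and f
    assume at: "0 \<le> a" "a < t" "A \<ge> 0" and m: "jointly_borel f"
      and f: "AE s\<in>{0<..<t} in lborel. marcinkiewicz r (A * time_weight a \<beta> s) (f s)"
    show "marcinkiewicz p (4 * (2 / (1 - \<beta>)) * K * A * (t - a) powr (- \<beta>)) (duhamel 4 t f)"
    proof (rule marcinkiewiczI_pos)
      fix E :: "(real^3) set" assume E: "E \<in> sets borel" "emeasure lborel E < \<infinity>" "measure lborel E > 0"
      define e where "e = measure lborel E"
      have e: "e > 0" using E by (simp add: e_def)
      define R where "R = e powr (1/3)"
      have R: "R > 0" using e by (simp add: R_def)
      have vp: "(v * \<rho> ^ 3) powr (1 - 1/r) = v powr (1 - 1/r) * \<rho> powr (3 - 3 / r)" if "\<rho> > 0" for \<rho>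
      proof -
        have "(v * \<rho> ^ 3) powr (1 - 1/r) = v powr (1 - 1/r) * (\<rho> powr 3) powr (1 - 1/r)"
          using that v by (simp add: powr_mult)
        thus ?thesis by (simp add: powr_powr ring_distribs)
      qed
      have "(\<integral>\<^sup>+\<rho>. indicator {0<..} \<rho> * ennreal (\<rho> powr (- 4 - 1) * min (\<rho>\<^sup>2) (t - a) * overlap r e \<rho>) \<partial>lborel)
        \<le> ennreal (v * e powr (1 - 1/r) * (R powr (0 + 1) / (0 + 1)) + e * v powr (1 - 1/r) * (R powr (1 - 3 / r) / (3 / r - 1)))"
      \<comment> \<open>Both halves use only \<rho>^2 from the time window. Below \<open>R\<close>
        the powers -5 + 2 + 3 cancel to a constant; above \<open>R\<close> the exponent - 3 / r is
        less than -1 because 1 / r > 1 / 3.\<close>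
      proof (rule nn_integral_split_powr)
        fix \<rho> :: real assume \<rho>: "\<rho> > 0" "\<rho> \<le> R"
        have "\<rho> powr (- 4 - 1) * min (\<rho>\<^sup>2) (t - a) * overlap r e \<rho> \<le> \<rho> powr (- 4 - 1) * \<rho>\<^sup>2 * (v * \<rho> ^ 3 * e powr (1 - 1 / r))"
          using at \<rho> e by (intro mult_mono mult_left_mono mult_nonneg_nonneg overlap_nonneg) (auto simp: overlap_def v_def)
        also have "\<dots> = (\<rho> powr (-4-1) * \<rho> powr 2 * \<rho> powr 3) * (v * e powr (1 - 1/r))"
          using \<rho> by (simp add: mult_ac)
        also have "\<rho> powr (-4-1) * \<rho> powr 2 * \<rho> powr 3 = \<rho> powr 0"
          by (simp only: powr_add[symmetric]) simp
        finally show "\<rho> powr (- 4 - 1) * min (\<rho>\<^sup>2) (t - a) * overlap r e \<rho> \<le> v * e powr (1 - 1 / r) * \<rho> powr 0"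
          by (simp add: mult_ac)
      next
        fix \<rho> :: real assume \<rho>: "\<rho> \<ge> R"
        hence \<rho>0: "\<rho> > 0" using R by simp
        have "\<rho> powr (- 4 - 1) * min (\<rho>\<^sup>2) (t - a) * overlap r e \<rho> \<le> \<rho> powr (- 4 - 1) * \<rho>\<^sup>2 * (e * (v powr (1 - 1/r) * \<rho> powr (3 - 3 / r)))"
          using at \<rho>0 e vp[OF \<rho>0] by (intro mult_mono mult_left_mono mult_nonneg_nonneg overlap_nonneg) (auto simp: overlap_def v_def)
        also have "\<dots> = (\<rho> powr (-4-1) * \<rho> powr 2 * \<rho> powr (3 - 3/r)) * (e * v powr (1 - 1/r))"
          using \<rho>0 by (simp add: mult_ac)
        also have "\<rho> powr (-4-1) * \<rho> powr 2 * \<rho> powr (3 - 3/r) = \<rho> powr (- (3 / r))"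
          by (simp only: powr_add[symmetric]) simp
        finally show "\<rho> powr (- 4 - 1) * min (\<rho>\<^sup>2) (t - a) * overlap r e \<rho> \<le> e * v powr (1 - 1 / r) * \<rho> powr (- (3 / r))"
          by (simp add: mult_ac)
      qed (use v e r3 R in auto)
      also have "v * e powr (1 - 1/r) * (R powr (0 + 1) / (0 + 1)) + e * v powr (1 - 1/r) * (R powr (1 - 3 / r) / (3 / r - 1)) = K * e powr (1 - 1 / p)"
      proof -
        have 1: "e powr (1 - 1/r) * R = e powr (1 - 1 / p)"
          unfolding R_def powr_add[symmetric] using p(1) by simp
        have "e * R powr (1 - 3 / r) = e powr (1 + 1/3 * (1 - 3 / r))"
          using e by (simp add: R_def powr_powr powr_add)
        also have "1 + 1/3 * (1 - 3 / r) = 1 - 1 / p" using p(1) by (simp add: algebra_simps)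
        finally have 2: "e * R powr (1 - 3 / r) = e powr (1 - 1 / p)" .
        have "v * e powr (1 - 1/r) * (R powr (0 + 1) / (0 + 1)) + e * v powr (1 - 1/r) * (R powr (1 - 3 / r) / (3 / r - 1))
          = v * (e powr (1 - 1/r) * R) + v powr (1 - 1/r) / (3 / r - 1) * (e * R powr (1 - 3 / r))"
          using R by simp
        thus ?thesis unfolding 1 2 K_def by (simp add: ring_distribs)
      qed
      finally have J: "(\<integral>\<^sup>+\<rho>. indicator {0<..} \<rho> * ennreal (\<rho> powr (- 4 - 1) * min (\<rho>\<^sup>2) (t - a) * overlap r e \<rho>) \<partial>lborel) \<le> ennreal (K * e powr (1 - 1 / p))" .
      have "mass E (duhamel 4 t f) \<le>
        ennreal (4 * A * (2 / (1 - \<beta>)) * (t - a) powr (- \<beta>)) *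
        (\<integral>\<^sup>+\<rho>. indicator {0<..} \<rho> * ennreal (\<rho> powr (- 4 - 1) * min (\<rho>\<^sup>2) (t - a) * overlap r e \<rho>) \<partial>lborel)"
        unfolding e_def by (rule duhamel_master[OF _ m E(1) at(1,2) \<beta> at(3) f E(2)]) simp
      also have "\<dots> \<le> ennreal (4 * A * (2 / (1 - \<beta>)) * (t - a) powr (- \<beta>)) * ennreal (K * e powr (1 - 1 / p))"
        by (intro mult_left_mono J) simp
      also have "\<dots> = ennreal (4 * (2 / (1 - \<beta>)) * K * A * (t - a) powr (- \<beta>) * e powr (1 - 1 / p))"
        using at \<beta> K by (simp add: ennreal_mult[symmetric] mult_ac)
      finally show "mass E (duhamel 4 t f) \<le> ennreal (4 * (2 / (1 - \<beta>)) * K * A * (t - a) powr (- \<beta>) * measure lborel E powr (1 - 1 / p))"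
        by (simp add: e_def)
    qed
  qed
qed

lemma min_le_powr: "a > 0 \<Longrightarrow> b > 0 \<Longrightarrow> 0 \<le> \<theta> \<Longrightarrow> \<theta> \<le> 1 \<Longrightarrow> min a b \<le> a powr \<theta> * b powr (1 - \<theta>)" for a b :: real
proof -
  assume *: "a > 0" "b > 0" "0 \<le> \<theta>" "\<theta> \<le> 1"
  have "min a b = min a b powr \<theta> * min a b powr (1 - \<theta>)" using * by (simp add: powr_add[symmetric])
  also have "\<dots> \<le> a powr \<theta> * b powr (1 - \<theta>)" using * by (intro mult_mono powr_mono2) auto
  finally show ?thesis .
qed

text \<open>Here the time window decides: the integrand is \<rho>^(- \<gamma>) min (\<rho>^2, t -
  a), split at \<rho> = sqrt (t - a). The condition \<gamma> < 3 is convergence at 0 and \<gamma> >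
  1 convergence at infinity.\<close>

lemma duhamel_subcritical:
  assumes r: "r > 1" "r \<le> p" and n: "n > 0" and \<gamma>: "\<gamma> = n - 2 + 3 * (1 / r - 1 / p)" "1 < \<gamma>" "\<gamma> < 3" and \<beta>: "0 \<le> \<beta>" "\<beta> < 1"
  shows "\<exists>C. duhamel_bound n r p \<beta> ((3 - \<gamma>) / 2 - \<beta>) C"
proof -
  define v where "v = unit_ball_vol 3"
  have v: "v > 0" unfolding v_def by (rule unit_ball_vol_3_pos)
  \<comment> \<open>Interpolating the two bounds in \<open>overlap\<close> with this exponent makes
    |E| enter exactly with the power 1 - 1 / p that the conclusion demands.\<close>
  define \<theta> where "\<theta> = 1 - r / p"
  have \<theta>: "0 \<le> \<theta>" "\<theta> \<le> 1" "1 - \<theta> = r / p" using r by (auto simp: \<theta>_def)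
  define w where "w = v powr ((1 - 1 / r) * \<theta>) * v powr (1 - \<theta>)"
  define K where "K = w * (1 / (3 - \<gamma>) + 1 / (\<gamma> - 1))"
  have w: "w \<ge> 0" by (simp add: w_def)
  have K: "K \<ge> 0" using w \<gamma> by (simp add: K_def)
  show ?thesis
    unfolding duhamel_bound_def
  proof (intro exI[of _ "n * (2 / (1 - \<beta>)) * K"] conjI allI impI)
    show "0 \<le> n * (2 / (1 - \<beta>)) * K" using K \<beta> n by simp
    fix a t A :: real and f
    assume at: "0 \<le> a" "a < t" "A \<ge> 0" and m: "jointly_borel f"
      and f: "AE s\<in>{0<..<t} in lborel. marcinkiewicz r (A * time_weight a \<beta> s) (f s)"
    define h where "h = t - a"
    have h: "h > 0" using at by (simp add: h_def)
    show "marcinkiewicz p (n * (2 / (1 - \<beta>)) * K * A * (t - a) powr ((3 - \<gamma>) / 2 - \<beta>)) (duhamel n t f)"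
    proof (rule marcinkiewiczI_pos)
      fix E :: "(real^3) set" assume E: "E \<in> sets borel" "emeasure lborel E < \<infinity>" "measure lborel E > 0"
      define e where "e = measure lborel E"
      have e: "e > 0" using E by (simp add: e_def)
      define R where "R = sqrt h"
      have R: "R > 0" "R powr x = h powr (x / 2)" for x using h by (simp_all add: R_def powr_half_sqrt[symmetric] powr_powr)
      have ov: "overlap r e \<rho> \<le> w * e powr (1 - 1 / p) * \<rho> powr (3 - 3 * (1 / r - 1 / p))" if \<rho>: "\<rho> > 0" for \<rho>
      proof -
        have "overlap r e \<rho> \<le> (e * (v * \<rho> ^ 3) powr (1 - 1 / r)) powr \<theta> * (v * \<rho> ^ 3 * e powr (1 - 1 / r)) powr (1 - \<theta>)"
          unfolding overlap_def v_def[symmetric] using v e \<rho> \<theta> by (intro min_le_powr) auto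
        also have "\<dots> = (e powr \<theta> * (v powr ((1 - 1 / r) * \<theta>) * (\<rho> powr 3) powr ((1 - 1 / r) * \<theta>)))
            * (v powr (1 - \<theta>) * (\<rho> powr 3) powr (1 - \<theta>) * e powr ((1 - 1 / r) * (1 - \<theta>)))"
          using v e \<rho> by (simp add: powr_mult powr_powr)
        also have "\<dots> = w * (e powr \<theta> * e powr ((1 - 1 / r) * (1 - \<theta>))) * (\<rho> powr (3 * ((1 - 1 / r) * \<theta>)) * \<rho> powr (3 * (1 - \<theta>)))"
          by (simp add: w_def powr_powr mult_ac)
        also have "e powr \<theta> * e powr ((1 - 1 / r) * (1 - \<theta>)) = e powr (1 - 1 / p)"
        proof -
          have "\<theta> + (1 - 1 / r) * (1 - \<theta>) = 1 - 1 / p"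
            unfolding \<theta>(3) using r by (simp add: \<theta>_def field_simps)
          thus ?thesis by (simp only: powr_add[symmetric])
        qed
        also have "\<rho> powr (3 * ((1 - 1 / r) * \<theta>)) * \<rho> powr (3 * (1 - \<theta>)) = \<rho> powr (3 - 3 * (1 / r - 1 / p))"
        proof -
          have "3 * ((1 - 1 / r) * \<theta>) + 3 * (1 - \<theta>) = 3 - 3 * (1 / r - 1 / p)"
            unfolding \<theta>(3) using r by (simp add: \<theta>_def field_simps)
          thus ?thesis by (simp only: powr_add[symmetric])
        qed
        finally show ?thesis .
      qed
      have g: "\<rho> powr (- n - 1) * L * overlap r e \<rho> \<le> (\<rho> powr (- \<gamma>) * L) * (w * e powr (1 - 1 / p))" if \<rho>: "\<rho> > 0" and L: "L \<ge> 0" for \<rho> L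
      proof -
        have "\<rho> powr (- n - 1) * L * overlap r e \<rho> \<le> \<rho> powr (- n - 1) * L * (w * e powr (1 - 1 / p) * \<rho> powr (3 - 3 * (1 / r - 1 / p)))"
          using L by (intro mult_left_mono ov \<rho>) auto
        also have "\<dots> = (\<rho> powr (- n - 1) * \<rho> powr (3 - 3 * (1 / r - 1 / p))) * L * (w * e powr (1 - 1 / p))" by (simp add: mult_ac)
        also have "\<rho> powr (- n - 1) * \<rho> powr (3 - 3 * (1 / r - 1 / p)) = \<rho> powr (- \<gamma>)"
          unfolding powr_add[symmetric] \<gamma>(1) by (simp add: algebra_simps)
        finally show ?thesis .
      qed
      have "(\<integral>\<^sup>+\<rho>. indicator {0<..} \<rho> * ennreal (\<rho> powr (- n - 1) * min (\<rho>\<^sup>2) h * overlap r e \<rho>) \<partial>lborel)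
        \<le> ennreal (w * e powr (1 - 1 / p) * (R powr ((2 - \<gamma>) + 1) / ((2 - \<gamma>) + 1)) + h * (w * e powr (1 - 1 / p)) * (R powr (1 - \<gamma>) / (\<gamma> - 1)))"
      proof (rule nn_integral_split_powr)
        fix \<rho> :: real assume \<rho>: "\<rho> > 0" "\<rho> \<le> R"
        have "\<rho> powr (- n - 1) * min (\<rho>\<^sup>2) h * overlap r e \<rho> \<le> \<rho> powr (- n - 1) * \<rho>\<^sup>2 * overlap r e \<rho>"
          using \<rho> e by (intro mult_right_mono mult_left_mono overlap_nonneg) auto
        also have "\<dots> \<le> (\<rho> powr (- \<gamma>) * \<rho>\<^sup>2) * (w * e powr (1 - 1 / p))" by (rule g) (use \<rho> in auto)
        also have "\<rho> powr (- \<gamma>) * \<rho>\<^sup>2 = \<rho> powr (2 - \<gamma>)"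
          using \<rho> powr_add[of \<rho> "- \<gamma>" 2] by simp
        finally show "\<rho> powr (- n - 1) * min (\<rho>\<^sup>2) h * overlap r e \<rho> \<le> w * e powr (1 - 1 / p) * \<rho> powr (2 - \<gamma>)"
          by (simp add: mult_ac)
      next
        fix \<rho> :: real assume "\<rho> \<ge> R"
        hence \<rho>: "\<rho> > 0" using R(1) by simp
        have "\<rho> powr (- n - 1) * min (\<rho>\<^sup>2) h * overlap r e \<rho> \<le> \<rho> powr (- n - 1) * h * overlap r e \<rho>"
          using \<rho> e by (intro mult_right_mono mult_left_mono overlap_nonneg) auto
        also have "\<dots> \<le> (\<rho> powr (- \<gamma>) * h) * (w * e powr (1 - 1 / p))" by (rule g) (use \<rho> h in auto)
        finally show "\<rho> powr (- n - 1) * min (\<rho>\<^sup>2) h * overlap r e \<rho> \<le> h * (w * e powr (1 - 1 / p)) * \<rho> powr (- \<gamma>)"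
          by (simp add: mult_ac)
      qed (use w e \<gamma> R h in auto)
      also have "w * e powr (1 - 1 / p) * (R powr ((2 - \<gamma>) + 1) / ((2 - \<gamma>) + 1)) + h * (w * e powr (1 - 1 / p)) * (R powr (1 - \<gamma>) / (\<gamma> - 1))
        = K * h powr ((3 - \<gamma>) / 2) * e powr (1 - 1 / p)"
      proof -
        have "h * h powr ((1 - \<gamma>) / 2) = h powr (1 + (1 - \<gamma>) / 2)" using h by (simp add: powr_add)
        also have "1 + (1 - \<gamma>) / 2 = (3 - \<gamma>) / 2" by (simp add: field_simps)
        finally have 1: "h * h powr ((1 - \<gamma>) / 2) = h powr ((3 - \<gamma>) / 2)" .
        have 2: "2 - \<gamma> + 1 = 3 - \<gamma>" by simp
        have "w * e powr (1 - 1 / p) * (R powr (3 - \<gamma>) / (3 - \<gamma>)) + h * (w * e powr (1 - 1 / p)) * (R powr (1 - \<gamma>) / (\<gamma> - 1))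
          = w * e powr (1 - 1 / p) * (h powr ((3 - \<gamma>) / 2) * (1 / (3 - \<gamma>)) + (h * h powr ((1 - \<gamma>) / 2)) * (1 / (\<gamma> - 1)))"
          unfolding R(2) by (simp add: ring_distribs)
        also have "\<dots> = K * h powr ((3 - \<gamma>) / 2) * e powr (1 - 1 / p)"
          unfolding 1 K_def by (simp only: ring_distribs mult_ac)
        finally show ?thesis unfolding 2 .
      qed
      finally have J: "(\<integral>\<^sup>+\<rho>. indicator {0<..} \<rho> * ennreal (\<rho> powr (- n - 1) * min (\<rho>\<^sup>2) h * overlap r e \<rho>) \<partial>lborel) \<le> ennreal (K * h powr ((3 - \<gamma>) / 2) * e powr (1 - 1 / p))" .
      have "mass E (duhamel n t f) \<le>
        ennreal (n * A * (2 / (1 - \<beta>)) * h powr (- \<beta>)) *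
        (\<integral>\<^sup>+\<rho>. indicator {0<..} \<rho> * ennreal (\<rho> powr (- n - 1) * min (\<rho>\<^sup>2) h * overlap r e \<rho>) \<partial>lborel)"
        unfolding e_def h_def by (rule duhamel_master[OF n m E(1) at(1,2) \<beta> at(3) f E(2)])
      also have "\<dots> \<le> ennreal (n * A * (2 / (1 - \<beta>)) * h powr (- \<beta>)) * ennreal (K * h powr ((3 - \<gamma>) / 2) * e powr (1 - 1 / p))"
        by (intro mult_left_mono J) simp
      also have "\<dots> = ennreal (n * (2 / (1 - \<beta>)) * K * A * (h powr ((3 - \<gamma>) / 2) * h powr (- \<beta>)) * e powr (1 - 1 / p))"
        using at \<beta> K n by (simp add: ennreal_mult[symmetric] mult_ac)
      also have "h powr ((3 - \<gamma>) / 2) * h powr (- \<beta>) = h powr ((3 - \<gamma>) / 2 - \<beta>)" by (simp add: powr_add[symmetric])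
      finally show "mass E (duhamel n t f) \<le> ennreal (n * (2 / (1 - \<beta>)) * K * A * (t - a) powr ((3 - \<gamma>) / 2 - \<beta>) * measure lborel E powr (1 - 1 / p))"
        by (simp add: e_def h_def)
    qed
  qed
qed

section \<open>Weak Lebesgue bounds and the testing condition\<close>

definition weak_bound :: "real \<Rightarrow> real \<Rightarrow> (real^3 \<Rightarrow> real) \<Rightarrow> bool" where
  "weak_bound p A f \<longleftrightarrow> (\<forall>l>0. emeasure lborel {x. l < \<bar>f x\<bar>} \<le> ennreal ((A / l) powr p))"

lemma weak_boundD: "weak_bound p A f \<Longrightarrow> l > 0 \<Longrightarrow> emeasure lborel {x. l < \<bar>f x\<bar>} \<le> ennreal ((A / l) powr p)"
  by (auto simp: weak_bound_def)

lemma weak_bound_mono: "weak_bound p A f \<Longrightarrow> A \<le> B \<Longrightarrow> A \<ge> 0 \<Longrightarrow> p > 0 \<Longrightarrow> weak_bound p B f"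
  unfolding weak_bound_def
proof (intro allI impI)
  fix l :: real
  assume *: "\<forall>l>0. emeasure lborel {x. l < \<bar>f x\<bar>} \<le> ennreal ((A / l) powr p)" "A \<le> B" "A \<ge> 0" "p > 0" "l > 0"
  hence "emeasure lborel {x. l < \<bar>f x\<bar>} \<le> ennreal ((A / l) powr p)" by simp
  also have "\<dots> \<le> ennreal ((B / l) powr p)" using * by (intro ennreal_leI powr_mono2 divide_right_mono) auto
  finally show "emeasure lborel {x. l < \<bar>f x\<bar>} \<le> ennreal ((B / l) powr p)" .
qed

text \<open>A finite quasi-norm excludes superlevel sets of infinite measure; after this step only
  real numbers occur, and no root of a measure has to be taken.\<close>

lemma weak_norm_le_imp_weak_bound:
  assumes "weak_norm q f \<le> ennreal C" "C \<ge> 0" "q > 0"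
  shows "weak_bound q C f"
  unfolding weak_bound_def
proof (intro allI impI)
  fix l :: real assume l: "l > 0"
  define m where "m = emeasure lborel {x. l < \<bar>f x\<bar>}"
  have le: "ennreal l * ennreal_powr m (1 / q) \<le> ennreal C"
    using assms(1) l unfolding weak_norm_def m_def by (auto simp: SUP_le_iff)
  have "m \<noteq> top"
  proof
    assume "m = top"
    hence "ennreal l * ennreal_powr m (1 / q) = top" using l by (simp add: ennreal_powr_def ennreal_mult_top)
    thus False using le by (simp add: top_unique)
  qed
  then obtain r where r: "m = ennreal r" "r \<ge> 0" by (cases m) auto
  have "l * r powr (1 / q) \<le> C"
    using le l r assms by (simp add: ennreal_powr_def ennreal_mult[symmetric])
  hence "r powr (1 / q) \<le> C / l" using l by (simp add: field_simps)
  hence "(r powr (1 / q)) powr q \<le> (C / l) powr q" using assms by (intro powr_mono2) auto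
  hence "r \<le> (C / l) powr q" using r assms by (simp add: powr_powr)
  thus "emeasure lborel {x. l < \<bar>f x\<bar>} \<le> ennreal ((C / l) powr q)"
    using r unfolding m_def by (auto intro: ennreal_leI)
qed

lemma weak_bound_imp_weak_norm_le:
  assumes "weak_bound q C f" "C \<ge> 0" "q > 0"
  shows "weak_norm q f \<le> ennreal C"
  unfolding weak_norm_def
proof (intro SUP_least)
  fix l :: real assume "l \<in> {0<..}" hence l: "l > 0" by simp
  define m where "m = emeasure lborel {x. l < \<bar>f x\<bar>}"
  have le: "m \<le> ennreal ((C / l) powr q)" using weak_boundD[OF assms(1) l] by (simp add: m_def)
  then obtain r where r: "m = ennreal r" "r \<ge> 0" by (cases m) (auto simp: top_unique)
  have "r \<le> (C / l) powr q" using le r by simp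
  hence "r powr (1 / q) \<le> ((C / l) powr q) powr (1 / q)" using r assms by (intro powr_mono2) auto
  also have "\<dots> = C / l" using assms l by (simp add: powr_powr)
  finally have "l * r powr (1 / q) \<le> C" using l by (simp add: field_simps)
  thus "ennreal l * ennreal_powr (emeasure lborel {x. l < \<bar>f x\<bar>}) (1 / q) \<le> ennreal C"
    using l r unfolding m_def[symmetric] by (simp add: ennreal_powr_def ennreal_mult[symmetric] ennreal_leI)
qed

text \<open>Testing on a superlevel set and dividing by a power of its measure gives the bound with
  constant 1. Since that measure might be infinite, the test sets are first cut by balls, which then
  exhaust the space.\<close>

lemma marcinkiewicz_imp_weak_bound:
  assumes f: "marcinkiewicz q A (\<lambda>x. ennreal \<bar>f x\<bar>)" and [measurable]: "f \<in> borel_measurable borel" and A: "A \<ge> 0" and q: "q > 1"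
  shows "weak_bound q A f"
  unfolding weak_bound_def
proof (intro allI impI)
  fix l :: real assume l: "l > 0"
  define B where "B = {x. l < \<bar>f x\<bar>}"
  have [measurable]: "B \<in> sets borel" unfolding B_def by measurable
  have fin: "emeasure lborel E \<le> ennreal ((A / l) powr q)" if E: "E \<in> sets borel" "emeasure lborel E < \<infinity>" "E \<subseteq> B" for E
  proof -
    define m where "m = measure lborel E"
    have em: "emeasure lborel E = ennreal m" using E by (simp add: m_def emeasure_eq_ennreal_measure)
    have m0: "m \<ge> 0" by (simp add: m_def)
    have "ennreal (l * m) = (\<integral>\<^sup>+x. ennreal l * indicator E x \<partial>lborel)"
      using E l m0 by (simp add: nn_integral_cmult_indicator em ennreal_mult)
    also have "\<dots> \<le> mass E (\<lambda>x. ennreal \<bar>f x\<bar>)"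
      using E(3) by (intro nn_integral_mono) (auto simp: indicator_def B_def intro!: ennreal_leI)
    also have "\<dots> \<le> ennreal (A * m powr (1 - 1 / q))" unfolding m_def by (rule marcinkiewiczD[OF f E(1,2)])
    finally have le: "l * m \<le> A * m powr (1 - 1 / q)" using A by (subst (asm) ennreal_le_iff) auto
    have "m \<le> (A / l) powr q"
    proof (cases "m = 0")
      case False
      hence m: "m > 0" using m0 by simp
      have "l * m = l * m powr (1 / q) * m powr (1 - 1 / q)" using m by (simp add: powr_add[symmetric] mult.assoc)
      hence "(l * m powr (1 / q)) * m powr (1 - 1 / q) \<le> A * m powr (1 - 1 / q)" using le by linarith
      hence "l * m powr (1 / q) \<le> A" by (rule mult_right_le_imp_le) (use m in simp)
      hence "m powr (1 / q) \<le> A / l" using l by (simp add: field_simps)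
      hence "(m powr (1 / q)) powr q \<le> (A / l) powr q" using q by (intro powr_mono2) auto
      thus ?thesis using m q by (simp add: powr_powr)
    qed simp
    thus ?thesis unfolding em by (rule ennreal_leI)
  qed
  have "emeasure lborel B = emeasure lborel (\<Union>n::nat. B \<inter> cball 0 (real n))"
  proof -
    have "B = (\<Union>n::nat. B \<inter> cball 0 (real n))" using real_arch_simple by fastforce
    thus ?thesis by simp
  qed
  also have "\<dots> = (SUP n::nat. emeasure lborel (B \<inter> cball 0 (real n)))"
    by (intro SUP_emeasure_incseq[symmetric]) (auto simp: incseq_def)
  also have "\<dots> \<le> ennreal ((A / l) powr q)"
  proof (intro SUP_least fin)
    fix n :: nat
    have "emeasure lborel (B \<inter> cball 0 (real n)) \<le> emeasure lborel (cball (0 :: real^3) (real n))"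
      by (intro emeasure_mono) auto
    thus "emeasure lborel (B \<inter> cball 0 (real n)) < \<infinity>" using emeasure_lborel_cball_finite le_less_trans by blast
  qed auto
  finally show "emeasure lborel {x. l < \<bar>f x\<bar>} \<le> ennreal ((A / l) powr q)" unfolding B_def .
qed

text \<open>Chebyshev's inequality; it is the passage from strong to weak L^3.\<close>

lemma weak_bound_of_power_integral:
  assumes [measurable]: "f \<in> borel_measurable borel" and p: "p > 0" and A: "A \<ge> 0"
    and le: "(\<integral>\<^sup>+x. ennreal (\<bar>f x\<bar> powr p) \<partial>lborel) \<le> ennreal (A powr p)"
  shows "weak_bound p A f"
  unfolding weak_bound_def
proof (intro allI impI)
  fix l :: real assume l: "l > 0"
  have "ennreal (l powr p) * emeasure lborel {x. l < \<bar>f x\<bar>} = (\<integral>\<^sup>+x. ennreal (l powr p) * indicator {x. l < \<bar>f x\<bar>} x \<partial>lborel)"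
    by (subst nn_integral_cmult_indicator) auto
  also have "\<dots> \<le> (\<integral>\<^sup>+x. ennreal (\<bar>f x\<bar> powr p) \<partial>lborel)"
    using l p by (intro nn_integral_mono) (auto simp: indicator_def intro!: ennreal_leI powr_mono2)
  also note le
  also have "ennreal (A powr p) = ennreal (l powr p) * ennreal ((A / l) powr p)"
    using l A by (simp add: ennreal_mult[symmetric] powr_divide)
  finally show "emeasure lborel {x. l < \<bar>f x\<bar>} \<le> ennreal ((A / l) powr p)"
    using l by (subst (asm) ennreal_mult_le_mult_iff) auto
qed

text \<open>A dyadic layer cake: if 2^j < x <= 2^(j+1), the summand of index j alone already exceeds
  x^a.\<close>

lemma dyadic_powr_bound:
  fixes x a :: real
  assumes x: "x \<ge> 0" and a: "a > 0"
  shows "ennreal (x powr a) \<le> 1 + (\<Sum>j. ennreal (2 powr (a * (real j + 1))) * indicator {2 ^ j<..} x)"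
proof (cases "x \<le> 1")
  case True
  hence "x powr a \<le> 1 powr a" using x a by (intro powr_mono2) auto
  hence "ennreal (x powr a) \<le> 1" by simp
  thus ?thesis by (simp add: add_increasing2)
next
  case False
  define P where "P = (\<lambda>n::nat. x \<le> 2 ^ n)"
  have "\<exists>n. P n" using real_arch_pow[of 2 x] unfolding P_def by (auto intro: less_imp_le)
  then obtain n where n: "P n" "\<And>k. k < n \<Longrightarrow> \<not> P k" using exists_least_iff[of P] by auto
  have "n \<noteq> 0" using n(1) False by (auto simp: P_def intro: ccontr)
  then obtain j where j: "n = Suc j" by (cases n) auto
  have xj: "2 ^ j < x" "x \<le> 2 ^ Suc j" using n(2)[of j] n(1) j by (auto simp: P_def)
  have "x powr a \<le> (2 ^ Suc j) powr a" using xj x a by (intro powr_mono2) auto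
  also have "\<dots> = 2 powr (a * (real j + 1))"
    by (subst powr_realpow[symmetric]) (simp_all add: powr_powr mult.commute add.commute)
  finally have "ennreal (x powr a) \<le> ennreal (2 powr (a * (real j + 1))) * indicator {2 ^ j<..} x"
    using xj by (auto intro: ennreal_leI)
  also have "\<dots> \<le> (\<Sum>j. ennreal (2 powr (a * (real j + 1))) * indicator {2 ^ j<..} x)"
  proof -
    define F where "F = (\<lambda>j. ennreal (2 powr (a * (real j + 1))) * indicator {2 ^ j<..} x)"
    have "F j \<le> suminf F" using sum_le_suminf[of F "{j}"] by simp
    thus ?thesis unfolding F_def .
  qed
  finally show ?thesis by (simp add: add_increasing)
qed

text \<open>The 1 accounts for values below the first dyadic level; the rest is the geometric series
  of the levels 2^j, whose ratio is 2^(a-p).\<close>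

definition dyadic_const :: "real \<Rightarrow> real \<Rightarrow> real" where
  "dyadic_const a p = 1 + 2 powr a / (1 - 2 powr (a - p))"

lemma two_powr_less_one: "x < 0 \<Longrightarrow> 2 powr x < (1::real)"
  using powr_less_mono[of x 0 2] by simp

lemma dyadic_const_pos: "0 < a \<Longrightarrow> a < p \<Longrightarrow> dyadic_const a p > 0"
  unfolding dyadic_const_def using two_powr_less_one[of "a - p"]
  by (intro add_pos_nonneg divide_nonneg_nonneg) auto

text \<open>After rescaling by \<open>A\<close> and |E|, the level 2^j is exceeded on a set of
  measure at most |E| 2^(- p j), which is summable against 2^(a j) for a < p. Values below level 1
  are counted by |E| itself.\<close>

lemma weak_bound_power_integral:
  assumes f: "weak_bound p A f" and [measurable]: "f \<in> borel_measurable borel" "E \<in> sets borel" and A: "A > 0"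
    and a: "0 < a" "a < p" and m: "m > 0" "emeasure lborel E = ennreal m"
  shows "mass E (\<lambda>x. ennreal ((\<bar>f x\<bar> * m powr (1 / p) / A) powr a)) \<le> ennreal (dyadic_const a p * m)"
proof -
  define g where "g = (\<lambda>x. \<bar>f x\<bar> * m powr (1 / p) / A)"
  have [measurable]: "g \<in> borel_measurable borel" unfolding g_def by measurable
  have g: "g x \<ge> 0" for x using A by (simp add: g_def)
  define r where "r = 2 powr (a - p)"
  have r: "0 < r" "r < 1" using a two_powr_less_one[of "a - p"] by (auto simp: r_def)
  have lev: "emeasure lborel {x. 2 ^ j < g x} \<le> ennreal (m * (2 powr (- p)) ^ j)" for j :: nat
  proof -
    have "{x. 2 ^ j < g x} = {x. 2 ^ j * A / m powr (1 / p) < \<bar>f x\<bar>}" using A m by (auto simp: g_def field_simps)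
    hence "emeasure lborel {x. 2 ^ j < g x} \<le> ennreal ((A / (2 ^ j * A / m powr (1 / p))) powr p)"
      using weak_boundD[OF f, of "2 ^ j * A / m powr (1 / p)"] A m by simp
    also have "A / (2 ^ j * A / m powr (1 / p)) = m powr (1 / p) / 2 ^ j" using A by simp
    also have "\<dots> powr p = m * (2 powr (- p)) ^ j"
      using m a by (simp add: powr_divide powr_powr powr_realpow[symmetric] powr_minus_divide mult.commute power_one_over)
    finally show ?thesis .
  qed
  have "mass E (\<lambda>x. ennreal (g x powr a)) \<le> (\<integral>\<^sup>+x. indicator E x + (\<Sum>j. ennreal (2 powr (a * (real j + 1))) * indicator {x. 2 ^ j < g x} x) \<partial>lborel)"
  proof (intro nn_integral_mono)
    fix x
    show "indicator E x * ennreal (g x powr a) \<le> indicator E x + (\<Sum>j. ennreal (2 powr (a * (real j + 1))) * indicator {x. 2 ^ j < g x} x)"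
      using dyadic_powr_bound[OF g a(1), of x] by (cases "x \<in> E") (simp_all add: indicator_def)
  qed
  also have "\<dots> = emeasure lborel E + (\<Sum>j. ennreal (2 powr (a * (real j + 1))) * emeasure lborel {x. 2 ^ j < g x})"
    by (simp add: nn_integral_add nn_integral_suminf nn_integral_cmult_indicator)
  also have "\<dots> \<le> ennreal m + (\<Sum>j. ennreal (m * 2 powr a * r ^ j))"
    unfolding m(2)
  proof (intro add_left_mono suminf_le)
    fix j :: nat
    have "ennreal (2 powr (a * (real j + 1))) * emeasure lborel {x. 2 ^ j < g x} \<le> ennreal (2 powr (a * (real j + 1))) * ennreal (m * (2 powr (- p)) ^ j)"
      by (intro mult_left_mono lev) simp
    also have "\<dots> = ennreal (2 powr (a * (real j + 1)) * (m * (2 powr (- p)) ^ j))"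
      using m by (simp add: ennreal_mult)
    also have "2 powr (a * (real j + 1)) * (m * (2 powr (- p)) ^ j) = m * 2 powr a * r ^ j"
      by (simp add: r_def powr_realpow[symmetric] powr_powr powr_add[symmetric] algebra_simps)
    finally show "ennreal (2 powr (a * (real j + 1))) * emeasure lborel {x. 2 ^ j < g x} \<le> ennreal (m * 2 powr a * r ^ j)" .
  qed auto
  also have "(\<Sum>j. ennreal (m * 2 powr a * r ^ j)) = ennreal (m * 2 powr a * (1 / (1 - r)))"
    using m r by (intro suminf_ennreal_eq sums_mult geometric_sums) auto
  also have "ennreal m + \<dots> = ennreal (dyadic_const a p * m)"
    using m r by (subst ennreal_plus[symmetric]) (auto simp: dyadic_const_def r_def[symmetric] algebra_simps)
  finally show ?thesis unfolding g_def .
qed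

lemma weak_bound_imp_marcinkiewicz:
  assumes f: "weak_bound p A f" and "f \<in> borel_measurable borel" and A: "A > 0" and p: "p > 1"
  shows "marcinkiewicz p (dyadic_const 1 p * A) (\<lambda>x. ennreal \<bar>f x\<bar>)"
proof (rule marcinkiewiczI_pos)
  fix E :: "(real^3) set" assume E: "E \<in> sets borel" "emeasure lborel E < \<infinity>" "measure lborel E > 0"
  define m where "m = measure lborel E"
  have m: "m > 0" "emeasure lborel E = ennreal m" using E by (auto simp: m_def emeasure_eq_ennreal_measure)
  note [measurable] = E(1) assms(2)
  define c where "c = A / m powr (1 / p)"
  have c: "c > 0" using A m by (simp add: c_def)
  have "mass E (\<lambda>x. ennreal \<bar>f x\<bar>) = (\<integral>\<^sup>+x. ennreal c * (indicator E x * ennreal ((\<bar>f x\<bar> * m powr (1 / p) / A) powr 1)) \<partial>lborel)"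
  proof (rule nn_integral_cong)
    fix x
    have "\<bar>f x\<bar> = c * ((\<bar>f x\<bar> * m powr (1 / p) / A) powr 1)" using A m by (simp add: c_def)
    hence "ennreal \<bar>f x\<bar> = ennreal c * ennreal ((\<bar>f x\<bar> * m powr (1 / p) / A) powr 1)"
      using c by (subst ennreal_mult[symmetric]) auto
    thus "indicator E x * ennreal \<bar>f x\<bar> = ennreal c * (indicator E x * ennreal ((\<bar>f x\<bar> * m powr (1 / p) / A) powr 1))"
      by (simp add: mult_ac)
  qed
  also have "\<dots> = ennreal c * mass E (\<lambda>x. ennreal ((\<bar>f x\<bar> * m powr (1 / p) / A) powr 1))"
    by (rule nn_integral_cmult) measurable
  also have "\<dots> \<le> ennreal c * ennreal (dyadic_const 1 p * m)"
    using assms m E by (intro mult_left_mono weak_bound_power_integral) auto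
  also have "\<dots> = ennreal (dyadic_const 1 p * A * (m / m powr (1 / p)))"
    using c m dyadic_const_pos[of 1 p] p by (subst ennreal_mult[symmetric]) (auto simp: c_def mult_ac)
  also have "m / m powr (1 / p) = m powr (1 - 1 / p)" using m by (simp add: powr_diff)
  finally show "mass E (\<lambda>x. ennreal \<bar>f x\<bar>) \<le> ennreal (dyadic_const 1 p * A * measure lborel E powr (1 - 1 / p))"
    by (simp add: m_def)
qed

text \<open>The usual factors 1 / a and 1 / b are given up, so that comparing \<open>y\<close> with
  x^(a-1) is enough.\<close>

lemma young_simple:
  fixes x y a b :: real
  assumes "x \<ge> 0" "y \<ge> 0" "a > 1" "b > 1" "1 / a + 1 / b = 1"
  shows "x * y \<le> x powr a + y powr b"
proof (cases "x = 0 \<or> y = 0")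
  case False
  hence x: "x > 0" "y > 0" using assms by auto
  show ?thesis
  proof (cases "y \<le> x powr (a - 1)")
    case True
    hence "x * y \<le> x * x powr (a - 1)" using x by (intro mult_left_mono) auto
    also have "\<dots> = x powr a" using x by (simp add: powr_mult_base)
    finally show ?thesis by (simp add: add_increasing2)
  next
    case F: False
    have ab: "(a - 1) * (b - 1) = 1" using assms by (simp add: field_simps)
    have "(x powr (a - 1)) powr (b - 1) \<le> y powr (b - 1)" using F assms x by (intro powr_mono2) auto
    hence "x \<le> y powr (b - 1)" using x ab by (simp add: powr_powr)
    hence "x * y \<le> y powr (b - 1) * y" using x by (intro mult_right_mono) auto
    also have "\<dots> = y powr b" using x powr_mult_base[of y "b - 1"] by (simp add: mult.commute)
    finally show ?thesis by (simp add: add_increasing)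
  qed
qed auto

definition product_bound :: "real \<Rightarrow> real \<Rightarrow> real \<Rightarrow> real \<Rightarrow> bool" where
  "product_bound p s r C \<longleftrightarrow> C > 0 \<and> (\<forall>A B f g. weak_bound p A f \<longrightarrow> weak_bound s B g \<longrightarrow> A > 0 \<longrightarrow> B > 0 \<longrightarrow> f \<in> borel_measurable borel \<longrightarrow> g \<in> borel_measurable borel
    \<longrightarrow> marcinkiewicz r (C * A * B) (\<lambda>x. ennreal (\<bar>f x\<bar> * \<bar>g x\<bar>)))"

lemmas product_boundD = product_bound_def[THEN iffD1, THEN conjunct1] product_bound_def[THEN iffD1, THEN conjunct2, rule_format]

text \<open>Hoelder's inequality for weak spaces: after rescaling by \<open>|E|\<close>, Young's inequality with exponents below
  the critical ones reduces the product to the previous moment bound.\<close>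

lemma weak_bound_mult:
  assumes r: "1 / r = 1 / p + 1 / s" and ps: "p > 0" "s > 0" "1 / p + 1 / s < 1"
  shows "\<exists>C. product_bound p s r C"
proof -
  \<comment> \<open>Half of the slack in 1 / p + 1 / s < 1. Adding it to both reciprocals makes
    \<open>a\<close> and \<open>b\<close> conjugate while keeping a < p and b < s, as the moment
    bound requires.\<close>
  define d where "d = (1 - 1 / p - 1 / s) / 2"
  have d: "d > 0" using ps by (simp add: d_def)
  define a where "a = 1 / (1 / p + d)"
  define b where "b = 1 / (1 / s + d)"
  have sl: "P + (1 - P - S) / 2 < 1" "S + (1 - P - S) / 2 < 1" if "P > 0" "S > 0" "P + S < 1" for P S :: real
    using that by (simp_all add: field_simps)
  have sl2: "P + (1 - P - S) / 2 + (S + (1 - P - S) / 2) = 1" for P S :: real by (simp add: field_simps)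
  have pi: "1 / p > 0" "1 / s > 0" using ps by auto
  have a: "0 < a" "a < p" "1 < a" "1 / a = 1 / p + d"
  proof -
    show "0 < a" "1 / a = 1 / p + d" using add_pos_pos[OF pi(1) d] unfolding a_def by simp_all
    have "1 / p + d < 1" unfolding d_def by (intro sl pi ps)
    thus "1 < a" using add_pos_pos[OF pi(1) d] unfolding a_def by (subst less_divide_eq_1_pos) auto
    have "1 / a > 1 / p" unfolding \<open>1 / a = 1 / p + d\<close> using d by simp
    thus "a < p" using \<open>0 < a\<close> ps by (simp add: field_simps)
  qed
  have b: "0 < b" "b < s" "1 < b" "1 / b = 1 / s + d"
  proof -
    show "0 < b" "1 / b = 1 / s + d" using add_pos_pos[OF pi(2) d] unfolding b_def by simp_all
    have "1 / s + d < 1" unfolding d_def by (intro sl pi ps)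
    thus "1 < b" using add_pos_pos[OF pi(2) d] unfolding b_def by (subst less_divide_eq_1_pos) auto
    have "1 / b > 1 / s" unfolding \<open>1 / b = 1 / s + d\<close> using d by simp
    thus "b < s" using \<open>0 < b\<close> ps by (simp add: field_simps)
  qed
  have ab: "1 / a + 1 / b = 1" unfolding a(4) b(4) d_def by (rule sl2)
  define C where "C = dyadic_const a p + dyadic_const b s"
  have C: "C > 0" unfolding C_def using dyadic_const_pos[OF a(1,2)] dyadic_const_pos[OF b(1,2)] by simp
  show ?thesis
    unfolding product_bound_def
  proof (intro exI[of _ C] conjI allI impI C)
    fix A B :: real and f g
    assume f: "weak_bound p A f" and g: "weak_bound s B g" and AB: "A > 0" "B > 0" and [measurable]: "f \<in> borel_measurable borel" "g \<in> borel_measurable borel"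
    show "marcinkiewicz r (C * A * B) (\<lambda>x. ennreal (\<bar>f x\<bar> * \<bar>g x\<bar>))"
    proof (rule marcinkiewiczI_pos)
      fix E :: "(real^3) set" assume E: "E \<in> sets borel" "emeasure lborel E < \<infinity>" "measure lborel E > 0"
      define m where "m = measure lborel E"
      have m: "m > 0" "emeasure lborel E = ennreal m" using E by (auto simp: m_def emeasure_eq_ennreal_measure)
      note [measurable] = E(1)
      \<comment> \<open>This factor restores the scaling that is taken out of \<open>F\<close> and
        \<open>G\<close>.\<close>
      define c where "c = A * B * m powr (- 1 / r)"
      have c: "c > 0" using AB m by (simp add: c_def)
      define F where "F = (\<lambda>x. \<bar>f x\<bar> * m powr (1 / p) / A)"
      define G where "G = (\<lambda>x. \<bar>g x\<bar> * m powr (1 / s) / B)"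
      have FG: "F x \<ge> 0" "G x \<ge> 0" for x using AB by (auto simp: F_def G_def)
      have [measurable]: "F \<in> borel_measurable borel" "G \<in> borel_measurable borel" unfolding F_def G_def by measurable
      have mm: "m powr (- 1 / r) * (m powr (1 / p) * m powr (1 / s)) = 1"
        using m r by (simp add: powr_add[symmetric])
      have eq: "\<bar>f x\<bar> * \<bar>g x\<bar> = c * (F x * G x)" for x
      proof -
        have "c * (F x * G x) = (m powr (- 1 / r) * (m powr (1 / p) * m powr (1 / s))) * (\<bar>f x\<bar> * \<bar>g x\<bar>)"
          using AB by (simp add: c_def F_def G_def)
        thus ?thesis unfolding mm by simp
      qed
      have "mass E (\<lambda>x. ennreal (\<bar>f x\<bar> * \<bar>g x\<bar>)) \<le> (\<integral>\<^sup>+x. ennreal c * (indicator E x * ennreal (F x powr a) + indicator E x * ennreal (G x powr b)) \<partial>lborel)"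
      proof (rule nn_integral_mono)
        fix x
        have "ennreal (\<bar>f x\<bar> * \<bar>g x\<bar>) \<le> ennreal (c * (F x powr a + G x powr b))"
          unfolding eq using c a b ab FG by (intro ennreal_leI mult_left_mono young_simple) auto
        also have "\<dots> = ennreal c * (ennreal (F x powr a) + ennreal (G x powr b))"
          using c by (simp add: ennreal_mult)
        finally show "indicator E x * ennreal (\<bar>f x\<bar> * \<bar>g x\<bar>) \<le> ennreal c * (indicator E x * ennreal (F x powr a) + indicator E x * ennreal (G x powr b))"
          by (auto simp: indicator_def)
      qed
      also have "\<dots> = ennreal c * (mass E (\<lambda>x. ennreal (F x powr a)) + mass E (\<lambda>x. ennreal (G x powr b)))"
        by (simp add: nn_integral_cmult nn_integral_add)
      also have "\<dots> \<le> ennreal c * (ennreal (dyadic_const a p * m) + ennreal (dyadic_const b s * m))"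
        unfolding F_def G_def using f g AB a b m E
        by (intro mult_left_mono add_mono weak_bound_power_integral) auto
      also have "\<dots> = ennreal (C * A * B * (m * m powr (- 1 / r)))"
        using c m dyadic_const_pos[OF a(1,2)] dyadic_const_pos[OF b(1,2)]
        by (subst ennreal_plus[symmetric], simp, simp, subst ennreal_mult[symmetric], simp, simp)
           (simp add: C_def c_def ring_distribs mult_ac)
      also have "m * m powr (- 1 / r) = m powr (1 - 1 / r)" using m powr_mult_base[of m "-1 / r"] by simp
      finally show "mass E (\<lambda>x. ennreal (\<bar>f x\<bar> * \<bar>g x\<bar>)) \<le> ennreal (C * A * B * measure lborel E powr (1 - 1 / r))"
        by (simp add: m_def)
    qed
  qed
qed

section \<open>Spatial potentials at a fixed time\<close>

abbreviation ball_potential :: "real \<Rightarrow> real \<Rightarrow> (real^3 \<Rightarrow> ennreal) \<Rightarrow> real^3 \<Rightarrow> ennreal" where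
  "ball_potential n \<tau> f x \<equiv> \<integral>\<^sup>+y. ennreal (ball_kernel n \<tau> (x - y)) * f y \<partial>lborel"

text \<open>For \<tau> > 0 only radii \<rho> >= sqrt \<tau> occur, so the sole condition is
  convergence at infinity, that is n - 2 + 3 / r > 1. The bound yields the absolute convergence of
  the spatial integrals in the mild equations.\<close>

lemma nn_integral_ball_kernel_le:
  assumes \<tau>: "\<tau> > 0" and n: "n > 0" "n + 3 / r > 3"
  obtains C where "C \<ge> 0" "\<And>A f x. marcinkiewicz r A f \<Longrightarrow> f \<in> borel_measurable borel \<Longrightarrow> A \<ge> 0 \<Longrightarrow>
    ball_potential n \<tau> f x \<le> ennreal (C * A)"
proof -
  define v where "v = unit_ball_vol 3"
  have v: "v > 0" unfolding v_def by (rule unit_ball_vol_3_pos)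
  define h where "h = sqrt \<tau>"
  have h: "h > 0" using \<tau> by (simp add: h_def)
  define C where "C = n * v powr (1 - 1 / r) * (h powr (1 - (n - 2 + 3 / r)) / ((n - 2 + 3 / r) - 1))"
  have C: "C \<ge> 0" using n by (simp add: C_def)
  have "ball_potential n \<tau> f x \<le> ennreal (C * A)"
    if f: "marcinkiewicz r A f" and [measurable]: "f \<in> borel_measurable borel" and A: "A \<ge> 0" for A f x
  proof -
    have [measurable]: "(\<lambda>(y, \<rho>). indicator (cball 0 \<rho>) (x - y) :: ennreal) \<in> borel_measurable (borel \<Otimes>\<^sub>M borel)"
      unfolding indicator_def mem_cball dist_norm by measurable
    have "ball_potential n \<tau> f x
      \<le> (\<integral>\<^sup>+y. (\<integral>\<^sup>+\<rho>. ball_layer n \<tau> 0 \<rho> (x - y) \<partial>lborel) * f y \<partial>lborel)"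
      by (intro nn_integral_mono mult_right_mono ball_kernel_layers \<tau> n) auto
    also have "\<dots> = (\<integral>\<^sup>+y. \<integral>\<^sup>+\<rho>. ball_layer n \<tau> 0 \<rho> (x - y) * f y \<partial>lborel \<partial>lborel)"
      by (intro nn_integral_cong nn_integral_multc[symmetric]) measurable
    also have "\<dots> = (\<integral>\<^sup>+\<rho>. \<integral>\<^sup>+y. ball_layer n \<tau> 0 \<rho> (x - y) * f y \<partial>lborel \<partial>lborel)"
      by (rule lborel_pair.Fubini') measurable
    also have "\<dots> \<le> (\<integral>\<^sup>+\<rho>. ennreal (n * A * v powr (1 - 1 / r)) * (indicator {h..} \<rho> * ennreal (\<rho> powr (- (n - 2 + 3 / r)))) \<partial>lborel)"
    proof (rule nn_integral_mono)
      fix \<rho> :: real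
      show "(\<integral>\<^sup>+y. ball_layer n \<tau> 0 \<rho> (x - y) * f y \<partial>lborel)
        \<le> ennreal (n * A * v powr (1 - 1 / r)) * (indicator {h..} \<rho> * ennreal (\<rho> powr (- (n - 2 + 3 / r))))"
      proof (cases "\<rho> > 0 \<and> \<tau> \<le> \<rho>\<^sup>2")
        case True
        hence \<rho>: "\<rho> > 0" "\<rho> \<ge> h" using \<tau> by (auto simp: h_def intro: real_le_lsqrt)
        have "(\<integral>\<^sup>+y. ball_layer n \<tau> 0 \<rho> (x - y) * f y \<partial>lborel)
          = (\<integral>\<^sup>+y. ennreal (n * \<rho> powr (- n - 1)) * (indicator (cball x \<rho>) y * f y) \<partial>lborel)"
          using True by (intro nn_integral_cong) (simp add: indicator_def dist_norm norm_minus_commute)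
        also have "\<dots> = ennreal (n * \<rho> powr (- n - 1)) * mass (cball x \<rho>) f"
          by (rule nn_integral_cmult) measurable
        also have "\<dots> \<le> ennreal (n * \<rho> powr (- n - 1)) * ennreal (A * (unit_ball_vol 3 * \<rho> ^ 3) powr (1 - 1 / r))"
          using \<rho> by (intro mult_left_mono indicator_ball_integral[OF f]) auto
        also have "\<dots> = ennreal (n * \<rho> powr (- n - 1) * (A * (v * \<rho> ^ 3) powr (1 - 1 / r)))"
          using n A by (subst ennreal_mult) (auto simp: v_def)
        also have "(v * \<rho> ^ 3) powr (1 - 1 / r) = v powr (1 - 1 / r) * \<rho> powr (3 - 3 / r)"
        proof -
          have "(v * \<rho> ^ 3) powr (1 - 1/r) = v powr (1 - 1/r) * (\<rho> powr 3) powr (1 - 1/r)"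
            using \<rho> v by (simp add: powr_mult)
          thus ?thesis by (simp add: powr_powr ring_distribs)
        qed
        also have "n * \<rho> powr (- n - 1) * (A * (v powr (1 - 1 / r) * \<rho> powr (3 - 3 / r))) = n * A * v powr (1 - 1 / r) * (\<rho> powr (- n - 1) * \<rho> powr (3 - 3 / r))" by simp
        also have "\<rho> powr (- n - 1) * \<rho> powr (3 - 3 / r) = \<rho> powr (- (n - 2 + 3 / r))"
          unfolding powr_add[symmetric] by (simp add: algebra_simps)
        finally show ?thesis using \<rho> n A v by (simp add: ennreal_mult)
      qed auto
    qed
    also have "\<dots> = ennreal (n * A * v powr (1 - 1 / r)) * (\<integral>\<^sup>+\<rho>. indicator {h..} \<rho> * ennreal (\<rho> powr (- (n - 2 + 3 / r))) \<partial>lborel)"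
      by (rule nn_integral_cmult) measurable
    also have "\<dots> = ennreal (n * A * v powr (1 - 1 / r)) * ennreal (h powr (1 - (n - 2 + 3 / r)) / ((n - 2 + 3 / r) - 1))"
      using h n by (subst nn_integral_powr_tail0) auto
    also have "\<dots> = ennreal (C * A)" using n A by (subst ennreal_mult[symmetric]) (auto simp: C_def mult_ac)
    finally show ?thesis .
  qed
  thus thesis using that C by blast
qed

lemma nn_integral_ball_kernel_finite:
  assumes f: "marcinkiewicz r A f" and [measurable]: "f \<in> borel_measurable borel" and \<tau>: "\<tau> > 0" and n: "n > 0" "n + 3 / r > 3" and A: "A \<ge> 0"
  shows "ball_potential n \<tau> f x < \<infinity>"
proof -
  obtain C where "C \<ge> 0" "\<And>A f x. marcinkiewicz r A f \<Longrightarrow> f \<in> borel_measurable borel \<Longrightarrow> A \<ge> 0 \<Longrightarrow> ball_potential n \<tau> f x \<le> ennreal (C * A)"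
    using nn_integral_ball_kernel_le[OF \<tau> n] by blast
  from this(2)[OF f assms(2) A, of x] show ?thesis by (rule le_less_trans) simp
qed

lemma marcinkiewicz_add:
  assumes f: "marcinkiewicz p A f" "marcinkiewicz p B g" and [measurable]: "f \<in> borel_measurable borel" "g \<in> borel_measurable borel"
    and AB: "A \<ge> 0" "B \<ge> 0"
  shows "marcinkiewicz p (A + B) (\<lambda>x. f x + g x)"
  unfolding marcinkiewicz_def
proof (intro ballI impI)
  fix E :: "(real^3) set" assume E[measurable]: "E \<in> sets borel" and Ef: "emeasure lborel E < \<infinity>"
  have "mass E (\<lambda>x. f x + g x) = mass E f + mass E g"
    by (simp add: distrib_left nn_integral_add)
  also have "\<dots> \<le> ennreal (A * measure lborel E powr (1 - 1 / p)) + ennreal (B * measure lborel E powr (1 - 1 / p))"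
    by (intro add_mono marcinkiewiczD f E Ef)
  also have "\<dots> = ennreal ((A + B) * measure lborel E powr (1 - 1 / p))"
    using AB by (subst ennreal_plus[symmetric]) (auto simp: ring_distribs)
  finally show "mass E (\<lambda>x. f x + g x) \<le> ennreal ((A + B) * measure lborel E powr (1 - 1 / p))" .
qed

lemma marcinkiewicz_cmult:
  assumes f: "marcinkiewicz p A f" and [measurable]: "f \<in> borel_measurable borel" and c: "c \<ge> 0"
  shows "marcinkiewicz p (c * A) (\<lambda>x. ennreal c * f x)"
  unfolding marcinkiewicz_def
proof (intro ballI impI)
  fix E :: "(real^3) set" assume E[measurable]: "E \<in> sets borel" and Ef: "emeasure lborel E < \<infinity>"
  have "mass E (\<lambda>x. ennreal c * f x) = ennreal c * mass E f"
    by (subst nn_integral_cmult[symmetric]) (auto simp: mult_ac)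
  also have "\<dots> \<le> ennreal c * ennreal (A * measure lborel E powr (1 - 1 / p))"
    by (intro mult_left_mono marcinkiewiczD f E Ef) simp
  also have "\<dots> = ennreal (c * A * measure lborel E powr (1 - 1 / p))"
    using c by (simp add: ennreal_mult'[symmetric] mult_ac)
  finally show "mass E (\<lambda>x. ennreal c * f x) \<le> ennreal (c * A * measure lborel E powr (1 - 1 / p))" .
qed

lemma marcinkiewicz_mono_AE:
  assumes "marcinkiewicz p A f" "A \<le> B" "AE x in lborel. g x \<le> f x" shows "marcinkiewicz p B g"
  unfolding marcinkiewicz_def
proof (intro ballI impI)
  fix E :: "(real^3) set" assume E: "E \<in> sets borel" "emeasure lborel E < \<infinity>"
  have "mass E g \<le> mass E f"
    using assms(3) by (intro nn_integral_mono_AE) (auto elim!: eventually_mono intro!: mult_left_mono)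
  also have "\<dots> \<le> ennreal (A * measure lborel E powr (1 - 1 / p))" by (rule marcinkiewiczD[OF assms(1) E])
  also have "\<dots> \<le> ennreal (B * measure lborel E powr (1 - 1 / p))"
    by (intro ennreal_leI mult_right_mono assms) auto
  finally show "mass E g \<le> ennreal (B * measure lborel E powr (1 - 1 / p))" .
qed

section \<open>The nonlinear terms\<close>

text \<open>A divergent Bochner integral has the value 0, so the two integrals may be subtracted
  under the integral sign only after \<open>fin\<close> has made both converge absolutely.\<close>

lemma kernel_integral_diff:
  fixes g g' \<kappa> b h :: "real^3 \<Rightarrow> real"
  assumes [measurable]: "\<kappa> \<in> borel_measurable borel" "g \<in> borel_measurable borel" "g' \<in> borel_measurable borel" "b \<in> borel_measurable borel"
    and \<kappa>: "\<And>y. \<bar>\<kappa> y\<bar> \<le> C * b y" and C: "C \<ge> 0" and b: "\<And>y. b y \<ge> 0"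
    and fin: "(\<integral>\<^sup>+y. ennreal (b y) * ennreal \<bar>g y\<bar> \<partial>lborel) < \<infinity>" "(\<integral>\<^sup>+y. ennreal (b y) * ennreal \<bar>g' y\<bar> \<partial>lborel) < \<infinity>"
    and h: "\<And>y. \<bar>g y - g' y\<bar> \<le> h y"
  shows "ennreal \<bar>(\<integral>y. g y * \<kappa> y \<partial>lborel) - (\<integral>y. g' y * \<kappa> y \<partial>lborel)\<bar> \<le> ennreal C * (\<integral>\<^sup>+y. ennreal (b y) * ennreal (h y) \<partial>lborel)"
proof -
  have ptw: "ennreal (norm (f y * \<kappa> y)) \<le> ennreal C * (ennreal (b y) * ennreal \<bar>f y\<bar>)" for f y
  proof -
    have "\<bar>f y * \<kappa> y\<bar> \<le> C * (b y * \<bar>f y\<bar>)"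
      using mult_left_mono[OF \<kappa>[of y], of "\<bar>f y\<bar>"] by (simp add: abs_mult mult_ac)
    thus ?thesis using C b[of y] by (simp add: ennreal_mult[symmetric] ennreal_leI)
  qed
  have int: "integrable lborel (\<lambda>y. f y * \<kappa> y)" if [measurable]: "f \<in> borel_measurable borel" and f: "(\<integral>\<^sup>+y. ennreal (b y) * ennreal \<bar>f y\<bar> \<partial>lborel) < \<infinity>" for f
  proof (rule integrableI_bounded)
    have "(\<integral>\<^sup>+y. ennreal (norm (f y * \<kappa> y)) \<partial>lborel) \<le> (\<integral>\<^sup>+y. ennreal C * (ennreal (b y) * ennreal \<bar>f y\<bar>) \<partial>lborel)"
      by (intro nn_integral_mono ptw)
    also have "\<dots> = ennreal C * (\<integral>\<^sup>+y. ennreal (b y) * ennreal \<bar>f y\<bar> \<partial>lborel)" by (rule nn_integral_cmult) measurable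
    also have "\<dots> < \<infinity>" using f by (simp add: ennreal_mult_less_top)
    finally show "(\<integral>\<^sup>+y. ennreal (norm (f y * \<kappa> y)) \<partial>lborel) < \<infinity>" .
  qed measurable
  have i: "integrable lborel (\<lambda>y. g y * \<kappa> y)" "integrable lborel (\<lambda>y. g' y * \<kappa> y)" by (intro int fin; measurable)+
  have "(\<integral>y. g y * \<kappa> y \<partial>lborel) - (\<integral>y. g' y * \<kappa> y \<partial>lborel) = (\<integral>y. (g y - g' y) * \<kappa> y \<partial>lborel)"
    using i by (simp add: ring_distribs)
  moreover have "integrable lborel (\<lambda>y. (g y - g' y) * \<kappa> y)" using i by (simp add: ring_distribs)
  ultimately have "ennreal \<bar>(\<integral>y. g y * \<kappa> y \<partial>lborel) - (\<integral>y. g' y * \<kappa> y \<partial>lborel)\<bar> \<le> (\<integral>\<^sup>+y. ennreal (norm ((g y - g' y) * \<kappa> y)) \<partial>lborel)"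
    using integral_norm_bound_ennreal by force
  also have "\<dots> \<le> (\<integral>\<^sup>+y. ennreal C * (ennreal (b y) * ennreal \<bar>g y - g' y\<bar>) \<partial>lborel)"
    by (intro nn_integral_mono ptw[of "\<lambda>y. g y - g' y"])
  also have "\<dots> = ennreal C * (\<integral>\<^sup>+y. ennreal (b y) * ennreal \<bar>g y - g' y\<bar> \<partial>lborel)"
    by (rule nn_integral_cmult) measurable
  also have "\<dots> \<le> ennreal C * (\<integral>\<^sup>+y. ennreal (b y) * ennreal (h y) \<partial>lborel)"
    by (intro mult_left_mono nn_integral_mono ennreal_leI h) auto
  finally show ?thesis .
qed

lemma ennreal_abs_sum_le:
  fixes f :: "'a \<Rightarrow> real"
  assumes "\<And>i. i \<in> I \<Longrightarrow> ennreal \<bar>f i\<bar> \<le> c" "finite I"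
  shows "ennreal \<bar>\<Sum>i\<in>I. f i\<bar> \<le> of_nat (card I) * c"
proof -
  have "ennreal \<bar>\<Sum>i\<in>I. f i\<bar> \<le> ennreal (\<Sum>i\<in>I. \<bar>f i\<bar>)" by (intro ennreal_leI sum_abs)
  also have "\<dots> = (\<Sum>i\<in>I. ennreal \<bar>f i\<bar>)" by (simp add: sum_ennreal)
  also have "\<dots> \<le> of_nat (card I) * c" by (rule sum_bounded_above) (rule assms)
  finally show ?thesis .
qed

lemma ball_kernel_nonneg [simp]: "ball_kernel n \<tau> z \<ge> 0"
  by (simp add: ball_kernel_def)

lemma finite_kernel_mono:
  fixes g h :: "real^3 \<Rightarrow> real"
  assumes "(\<integral>\<^sup>+y. ennreal (b y) * ennreal (h y) \<partial>lborel) < \<infinity>" "\<And>y. \<bar>g y\<bar> \<le> h y"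
  shows "(\<integral>\<^sup>+y. ennreal (b y) * ennreal \<bar>g y\<bar> \<partial>lborel) < \<infinity>"
  by (rule le_less_trans[OF nn_integral_mono assms(1)]) (intro mult_left_mono ennreal_leI assms(2), simp)

text \<open>By duality the derivative falls on the heat kernel, with a sign; for the other two terms
  the projector falls on it as well.\<close>

lemma transport_term_eq:
  "transport_term u \<theta> t s x = - (\<Sum>k\<in>UNIV. \<integral>y. (\<theta> s y * u s y $ k) * partial k (heat_kernel_at (t - s) x) y \<partial>lborel)"
  by (simp add: transport_term_def heat_def dist_div_def dist_partial_def regular_def sum_negf)

lemma convection_term_eq:
  "convection_term u i t s x = - (\<Sum>(j,k)\<in>UNIV. \<integral>y. (u s y $ k * u s y $ j) * partial k (leray_test i j (heat_kernel_at (t - s) x)) y \<partial>lborel)"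
  unfolding convection_term_def heat_def leray_def dist_div_def dist_partial_def regular_def
  by (simp add: sum_negf sum.cartesian_product UNIV_Times_UNIV[symmetric] del: UNIV_Times_UNIV)

lemma buoyancy_term_eq:
  "buoyancy_term \<theta> i t s x = (\<Sum>j\<in>UNIV. \<integral>y. (\<theta> s y * e3 $ j) * leray_test i j (heat_kernel_at (t - s) x) y \<partial>lborel)"
  unfolding buoyancy_term_def heat_def leray_def regular_def by simp

lemma vec_nth_measurable [measurable (raw)]:
  "f \<in> borel_measurable M \<Longrightarrow> (\<lambda>x. f x $ (k::'n::finite)) \<in> borel_measurable M" for f :: "'z \<Rightarrow> real^'n"
  using borel_measurable_inner[of f M "\<lambda>_. axis k 1"] by (simp add: inner_axis)

text \<open>The product is split as (\<theta> - \<theta>') u + \<theta>' (u - u'). Because of this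
  asymmetry \<open>admissible\<close> asks for smallness of the second temperature only. The factor
  3 counts the components.\<close>

lemma transport_term_diff:
  assumes C: "C \<ge> 0" "\<And>k t x y. t > 0 \<Longrightarrow> \<bar>partial k (heat_kernel_at t x) y\<bar> \<le> C * ball_kernel 4 t (x - y)"
    and st: "s < t" and [measurable]: "\<theta> s \<in> borel_measurable borel" "u s \<in> borel_measurable borel" "\<theta>' s \<in> borel_measurable borel" "u' s \<in> borel_measurable borel"
    and fin: "ball_potential 4 (t - s) (\<lambda>y. ennreal (\<bar>\<theta> s y\<bar> * norm (u s y))) x < \<infinity>"
      "ball_potential 4 (t - s) (\<lambda>y. ennreal (\<bar>\<theta>' s y\<bar> * norm (u' s y))) x < \<infinity>"
  shows "ennreal \<bar>transport_term u \<theta> t s x - transport_term u' \<theta>' t s x\<bar> \<le>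
    ennreal (3 * C) * ball_potential 4 (t - s) (\<lambda>y. ennreal (\<bar>\<theta> s y - \<theta>' s y\<bar> * norm (u s y) + \<bar>\<theta>' s y\<bar> * norm (u s y - u' s y))) x"
proof -
  define I where "I = ball_potential 4 (t - s) (\<lambda>y. ennreal (\<bar>\<theta> s y - \<theta>' s y\<bar> * norm (u s y) + \<bar>\<theta>' s y\<bar> * norm (u s y - u' s y))) x"
  have "ennreal \<bar>\<Sum>k\<in>(UNIV::3 set). (\<integral>y. (\<theta>' s y * u' s y $ k) * partial k (heat_kernel_at (t - s) x) y \<partial>lborel) -
     (\<integral>y. (\<theta> s y * u s y $ k) * partial k (heat_kernel_at (t - s) x) y \<partial>lborel)\<bar> \<le> of_nat (card (UNIV :: 3 set)) * (ennreal C * I)"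
  proof (rule ennreal_abs_sum_le)
    fix k :: 3
    show "ennreal \<bar>(\<integral>y. (\<theta>' s y * u' s y $ k) * partial k (heat_kernel_at (t - s) x) y \<partial>lborel) -
     (\<integral>y. (\<theta> s y * u s y $ k) * partial k (heat_kernel_at (t - s) x) y \<partial>lborel)\<bar> \<le> ennreal C * I"
      unfolding I_def
    proof (rule kernel_integral_diff)
      show "ball_potential 4 (t - s) (\<lambda>y. ennreal \<bar>\<theta>' s y * u' s y $ k\<bar>) x < \<infinity>"
        by (rule finite_kernel_mono[OF fin(2)]) (simp add: abs_mult mult_left_mono component_le_norm_cart)
      show "ball_potential 4 (t - s) (\<lambda>y. ennreal \<bar>\<theta> s y * u s y $ k\<bar>) x < \<infinity>"
        by (rule finite_kernel_mono[OF fin(1)]) (simp add: abs_mult mult_left_mono component_le_norm_cart)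
      fix y
      have "\<theta>' s y * u' s y $ k - \<theta> s y * u s y $ k = - ((\<theta> s y - \<theta>' s y) * u s y $ k) - \<theta>' s y * (u s y - u' s y) $ k"
        by (simp add: algebra_simps)
      also have "\<bar>\<dots>\<bar> \<le> \<bar>(\<theta> s y - \<theta>' s y) * u s y $ k\<bar> + \<bar>\<theta>' s y * (u s y - u' s y) $ k\<bar>"
        by linarith
      also have "\<dots> \<le> \<bar>\<theta> s y - \<theta>' s y\<bar> * norm (u s y) + \<bar>\<theta>' s y\<bar> * norm (u s y - u' s y)"
        unfolding abs_mult by (intro add_mono mult_left_mono component_le_norm_cart) auto
      finally show "\<bar>\<theta>' s y * u' s y $ k - \<theta> s y * u s y $ k\<bar> \<le> \<bar>\<theta> s y - \<theta>' s y\<bar> * norm (u s y) + \<bar>\<theta>' s y\<bar> * norm (u s y - u' s y)" .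
    qed (use st C borel_measurable_partial_heat_kernel in auto)
  qed simp
  also have "(\<Sum>k\<in>(UNIV::3 set). (\<integral>y. (\<theta>' s y * u' s y $ k) * partial k (heat_kernel_at (t - s) x) y \<partial>lborel) -
     (\<integral>y. (\<theta> s y * u s y $ k) * partial k (heat_kernel_at (t - s) x) y \<partial>lborel)) = transport_term u \<theta> t s x - transport_term u' \<theta>' t s x"
    by (simp add: transport_term_eq sum_subtractf)
  finally show ?thesis
    using C by (simp add: I_def ennreal_mult mult.assoc)
qed

text \<open>Both parts of the split product contain the velocity difference, once with either
  solution; 9 counts the pairs of indices.\<close>

lemma convection_term_diff:
  assumes C: "C \<ge> 0" "\<And>i j k t x y. t > 0 \<Longrightarrow> \<bar>partial k (leray_test i j (heat_kernel_at t x)) y\<bar> \<le> C * ball_kernel 4 t (x - y)"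
    and st: "s < t" and [measurable]: "u s \<in> borel_measurable borel" "u' s \<in> borel_measurable borel"
    and fin: "ball_potential 4 (t - s) (\<lambda>y. ennreal (norm (u s y) * norm (u s y))) x < \<infinity>"
      "ball_potential 4 (t - s) (\<lambda>y. ennreal (norm (u' s y) * norm (u' s y))) x < \<infinity>"
  shows "ennreal \<bar>convection_term u i t s x - convection_term u' i t s x\<bar> \<le>
    ennreal (9 * C) * ball_potential 4 (t - s) (\<lambda>y. ennreal (norm (u s y - u' s y) * norm (u s y) + norm (u s y - u' s y) * norm (u' s y))) x"
proof -
  define I where "I = ball_potential 4 (t - s) (\<lambda>y. ennreal (norm (u s y - u' s y) * norm (u s y) + norm (u s y - u' s y) * norm (u' s y))) x"
  define F where "F = (\<lambda>(j::3, k::3). (\<integral>y. (u' s y $ k * u' s y $ j) * partial k (leray_test i j (heat_kernel_at (t - s) x)) y \<partial>lborel) -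
     (\<integral>y. (u s y $ k * u s y $ j) * partial k (leray_test i j (heat_kernel_at (t - s) x)) y \<partial>lborel))"
  have "ennreal \<bar>\<Sum>p\<in>(UNIV::(3\<times>3) set). F p\<bar> \<le> of_nat (card (UNIV :: (3\<times>3) set)) * (ennreal C * I)"
  proof (rule ennreal_abs_sum_le)
    fix p :: "3 \<times> 3"
    obtain j k where p: "p = (j, k)" by (cases p)
    show "ennreal \<bar>F p\<bar> \<le> ennreal C * I"
      unfolding I_def F_def p prod.case
    proof (rule kernel_integral_diff)
      show "ball_potential 4 (t - s) (\<lambda>y. ennreal \<bar>u' s y $ k * u' s y $ j\<bar>) x < \<infinity>"
        by (rule finite_kernel_mono[OF fin(2)]) (auto simp: abs_mult intro!: mult_mono component_le_norm_cart)
      show "ball_potential 4 (t - s) (\<lambda>y. ennreal \<bar>u s y $ k * u s y $ j\<bar>) x < \<infinity>"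
        by (rule finite_kernel_mono[OF fin(1)]) (auto simp: abs_mult intro!: mult_mono component_le_norm_cart)
      fix y
      have "u' s y $ k * u' s y $ j - u s y $ k * u s y $ j = - ((u s y - u' s y) $ k * u s y $ j) - (u s y - u' s y) $ j * u' s y $ k"
        by (simp add: algebra_simps)
      also have "\<bar>\<dots>\<bar> \<le> \<bar>(u s y - u' s y) $ k * u s y $ j\<bar> + \<bar>(u s y - u' s y) $ j * u' s y $ k\<bar>"
        by linarith
      also have "\<dots> \<le> norm (u s y - u' s y) * norm (u s y) + norm (u s y - u' s y) * norm (u' s y)"
        unfolding abs_mult by (intro add_mono mult_mono component_le_norm_cart) auto
      finally show "\<bar>u' s y $ k * u' s y $ j - u s y $ k * u s y $ j\<bar> \<le> norm (u s y - u' s y) * norm (u s y) + norm (u s y - u' s y) * norm (u' s y)" .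
    qed (use st C borel_measurable_partial_leray_test_heat_kernel in auto)
  qed simp
  also have "(\<Sum>p\<in>(UNIV::(3\<times>3) set). F p) = convection_term u i t s x - convection_term u' i t s x"
    unfolding convection_term_eq F_def by (simp add: sum_subtractf split_def)
  finally show ?thesis
    using C by (simp add: I_def ennreal_mult mult.assoc)
qed

lemma buoyancy_term_diff:
  assumes C: "C \<ge> 0" "\<And>i j t x y. t > 0 \<Longrightarrow> \<bar>leray_test i j (heat_kernel_at t x) y\<bar> \<le> C * ball_kernel 3 t (x - y)"
    and st: "s < t" and [measurable]: "\<theta> s \<in> borel_measurable borel" "\<theta>' s \<in> borel_measurable borel"
    and fin: "ball_potential 3 (t - s) (\<lambda>y. ennreal \<bar>\<theta> s y\<bar>) x < \<infinity>"
      "ball_potential 3 (t - s) (\<lambda>y. ennreal \<bar>\<theta>' s y\<bar>) x < \<infinity>"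
  shows "ennreal \<bar>buoyancy_term \<theta> i t s x - buoyancy_term \<theta>' i t s x\<bar> \<le>
    ennreal (3 * C) * ball_potential 3 (t - s) (\<lambda>y. ennreal \<bar>\<theta> s y - \<theta>' s y\<bar>) x"
proof -
  have e: "\<bar>e3 $ j\<bar> \<le> 1" for j by (simp add: e3_def axis_def)
  have em: "\<bar>a * e3 $ j\<bar> \<le> \<bar>a\<bar>" for a j using mult_left_mono[OF e[of j], of "\<bar>a\<bar>"] by (simp add: abs_mult)
  define I where "I = ball_potential 3 (t - s) (\<lambda>y. ennreal \<bar>\<theta> s y - \<theta>' s y\<bar>) x"
  have "ennreal \<bar>\<Sum>j\<in>(UNIV::3 set). (\<integral>y. (\<theta> s y * e3 $ j) * leray_test i j (heat_kernel_at (t - s) x) y \<partial>lborel) -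
     (\<integral>y. (\<theta>' s y * e3 $ j) * leray_test i j (heat_kernel_at (t - s) x) y \<partial>lborel)\<bar> \<le> of_nat (card (UNIV :: 3 set)) * (ennreal C * I)"
  proof (rule ennreal_abs_sum_le)
    fix j :: 3
    show "ennreal \<bar>(\<integral>y. (\<theta> s y * e3 $ j) * leray_test i j (heat_kernel_at (t - s) x) y \<partial>lborel) -
     (\<integral>y. (\<theta>' s y * e3 $ j) * leray_test i j (heat_kernel_at (t - s) x) y \<partial>lborel)\<bar> \<le> ennreal C * I"
      unfolding I_def
    proof (rule kernel_integral_diff)
      show "ball_potential 3 (t - s) (\<lambda>y. ennreal \<bar>\<theta> s y * e3 $ j\<bar>) x < \<infinity>"
        by (rule finite_kernel_mono[OF fin(1)]) (rule em)
      show "ball_potential 3 (t - s) (\<lambda>y. ennreal \<bar>\<theta>' s y * e3 $ j\<bar>) x < \<infinity>"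
        by (rule finite_kernel_mono[OF fin(2)]) (rule em)
      fix y
      show "\<bar>\<theta> s y * e3 $ j - \<theta>' s y * e3 $ j\<bar> \<le> \<bar>\<theta> s y - \<theta>' s y\<bar>"
        using em[of "\<theta> s y - \<theta>' s y" j] by (simp add: ring_distribs)
    qed (use st C borel_measurable_leray_test_heat_kernel in auto)
  qed simp
  also have "(\<Sum>j\<in>(UNIV::3 set). (\<integral>y. (\<theta> s y * e3 $ j) * leray_test i j (heat_kernel_at (t - s) x) y \<partial>lborel) -
     (\<integral>y. (\<theta>' s y * e3 $ j) * leray_test i j (heat_kernel_at (t - s) x) y \<partial>lborel)) = buoyancy_term \<theta> i t s x - buoyancy_term \<theta>' i t s x"
    by (simp add: buoyancy_term_eq sum_subtractf)
  finally show ?thesis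
    using C by (simp add: I_def ennreal_mult mult.assoc)
qed

section \<open>Strong L^3 norms and jointly measurable representatives\<close>

lemma Lp_space3D:
  assumes "f \<in> Lp_space 3"
  shows "f \<in> borel_measurable borel" "integrable lborel (\<lambda>x. norm (f x) powr 3)"
  using assms by (auto simp: Lp_space_def)

lemma nn_integral_Lp3:
  assumes "f \<in> Lp_space 3"
  shows "(\<integral>\<^sup>+x. ennreal (norm (f x) powr 3) \<partial>lborel) = ennreal (Lp_norm 3 f powr 3)"
proof -
  have "(\<integral>\<^sup>+x. ennreal (norm (f x) powr 3) \<partial>lborel) = ennreal (\<integral>x. norm (f x) powr 3 \<partial>lborel)"
    using Lp_space3D[OF assms] by (intro nn_integral_eq_integral) auto
  also have "(\<integral>x. norm (f x) powr 3 \<partial>lborel) = Lp_norm 3 f powr 3"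
    by (simp only: Lp_norm_def powr_powr) (simp add: integral_nonneg_AE)
  finally show ?thesis .
qed

lemma Lp_norm_nonneg [simp]: "Lp_norm p f \<ge> 0"
  by (simp add: Lp_norm_def)

lemma Lp_space3_diff:
  assumes f: "f \<in> Lp_space 3" and g: "g \<in> Lp_space 3"
  shows "(\<lambda>x. f x - g x) \<in> Lp_space 3"
proof -
  note [measurable] = Lp_space3D(1)[OF f] Lp_space3D(1)[OF g]
  have "integrable lborel (\<lambda>x. norm (f x - g x) powr 3)"
  proof (rule Bochner_Integration.integrable_bound)
    show "integrable lborel (\<lambda>x. 8 * norm (f x) powr 3 + 8 * norm (g x) powr 3)"
      using Lp_space3D(2)[OF f] Lp_space3D(2)[OF g] by simp
    show "AE x in lborel. norm (norm (f x - g x) powr 3) \<le> norm (8 * norm (f x) powr 3 + 8 * norm (g x) powr 3)"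
    proof (rule AE_I2)
      fix x
      define M where "M = max (norm (f x)) (norm (g x))"
      have "norm (f x - g x) \<le> 2 * M" using norm_triangle_ineq4[of "f x" "g x"] unfolding M_def by simp
      hence "norm (f x - g x) powr 3 \<le> (2 * M) powr 3" by (intro powr_mono2) auto
      also have "\<dots> = 8 * M powr 3" by (simp add: powr_mult M_def le_max_iff_disj)
      also have "\<dots> \<le> 8 * norm (f x) powr 3 + 8 * norm (g x) powr 3" by (simp add: M_def max_def)
      finally show "norm (norm (f x - g x) powr 3) \<le> norm (8 * norm (f x) powr 3 + 8 * norm (g x) powr 3)" by simp
    qed
  qed measurable
  thus ?thesis by (simp add: Lp_space_def)
qed

lemma Lp3_weak_bound:
  assumes f: "f \<in> Lp_space 3" and le: "Lp_norm 3 f \<le> A"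
  shows "weak_bound 3 A (\<lambda>x. norm (f x))"
proof (rule weak_bound_of_power_integral)
  note [measurable] = Lp_space3D(1)[OF f]
  show "(\<lambda>x. norm (f x)) \<in> borel_measurable borel" by measurable
  show "A \<ge> 0" using le Lp_norm_nonneg[of 3 f] by linarith
  show "(\<integral>\<^sup>+x. ennreal (\<bar>norm (f x)\<bar> powr 3) \<partial>lborel) \<le> ennreal (A powr 3)"
    unfolding abs_norm_cancel nn_integral_Lp3[OF f] using le by (intro ennreal_leI powr_mono2) auto
qed simp

lemma C_LpD:
  assumes "u \<in> C_Lp T 3" "t \<in> {0..T}"
  shows "u t \<in> Lp_space 3" "u t \<in> borel_measurable borel" "((\<lambda>s. Lp_norm 3 (\<lambda>x. u s x - u t x)) \<longlongrightarrow> 0) (at t within {0..T})"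
  using assms Lp_space3D unfolding C_Lp_def by auto

lemma C_Lp_near:
  assumes u: "u \<in> C_Lp T 3" and t: "t \<in> {0..T}" and e: "e > 0"
  shows "\<exists>d>0. \<forall>s\<in>{0..T}. \<bar>s - t\<bar> < d \<longrightarrow> Lp_norm 3 (\<lambda>x. u s x - u t x) \<le> e"
proof -
  have "\<forall>\<^sub>F s in at t within {0..T}. Lp_norm 3 (\<lambda>x. u s x - u t x) < e"
    using C_LpD(3)[OF u t] e by (rule order_tendstoD(2))
  then obtain d where d: "d > 0" "\<And>s. s \<in> {0..T} \<Longrightarrow> s \<noteq> t \<Longrightarrow> dist s t < d \<Longrightarrow> Lp_norm 3 (\<lambda>x. u s x - u t x) < e"
    unfolding eventually_at by blast
  have "Lp_norm 3 (\<lambda>x. u s x - u t x) \<le> e" if "s \<in> {0..T}" "\<bar>s - t\<bar> < d" for s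
  proof (cases "s = t")
    case True
    thus ?thesis using e by (simp add: Lp_norm_def)
  next
    case False
    thus ?thesis using d(2)[of s] that by (simp add: dist_real_def)
  qed
  thus ?thesis using d(1) by blast
qed

text \<open>Encodes a step function in time: the value belongs to the first node of the list whose
  neighbourhood contains \<open>s\<close>. Recursion along the list makes joint measurability an
  induction.\<close>

fun first_match :: "('a \<Rightarrow> 'b \<Rightarrow> bool) \<Rightarrow> ('a \<Rightarrow> 'c::zero) \<Rightarrow> 'a list \<Rightarrow> 'b \<Rightarrow> 'c" where
  "first_match P f [] s = 0"
| "first_match P f (t # ts) s = (if P t s then f t else first_match P f ts s)"

lemma first_match_witness:
  "\<exists>t\<in>set ts. P t s \<Longrightarrow> \<exists>t\<in>set ts. P t s \<and> (\<forall>x. first_match P (\<lambda>t. f t x) ts s = f t x)"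
  by (induction ts) auto

text \<open>Continuity in L^3 gives every time a neighbourhood on which the function moves by at
  most \<open>e\<close>; finitely many of them cover the compact time interval. Members of
  \<open>C_Lp\<close> are measurable only time by time, while Tonelli needs joint
  measurability.\<close>

lemma step_approximation:
  assumes u: "u \<in> C_Lp T 3" and e: "e > 0"
  shows "\<exists>g. jointly_borel g \<and>
    (\<forall>s\<in>{0..T}. (\<integral>\<^sup>+x. ennreal (norm (g s x - u s x) ^ 3) \<partial>lborel) \<le> ennreal (e ^ 3))"
proof -
  have "\<forall>t\<in>{0..T}. \<exists>d>0. \<forall>s\<in>{0..T}. \<bar>s - t\<bar> < d \<longrightarrow> Lp_norm 3 (\<lambda>x. u s x - u t x) \<le> e"
    using C_Lp_near[OF u _ e] by blast
  from bchoice[OF this] obtain d where dd: "\<forall>t\<in>{0..T}. d t > 0 \<and> (\<forall>s\<in>{0..T}. \<bar>s - t\<bar> < d t \<longrightarrow> Lp_norm 3 (\<lambda>x. u s x - u t x) \<le> e)" ..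
  have d: "\<And>t. t \<in> {0..T} \<Longrightarrow> d t > 0"
    "\<And>t s. t \<in> {0..T} \<Longrightarrow> s \<in> {0..T} \<Longrightarrow> \<bar>s - t\<bar> < d t \<Longrightarrow> Lp_norm 3 (\<lambda>x. u s x - u t x) \<le> e"
    using dd by blast+
  have "{0..T} \<subseteq> (\<Union>t\<in>{0..T}. ball t (d t))"
  proof
    fix t assume t: "t \<in> {0..T}"
    thus "t \<in> (\<Union>t\<in>{0..T}. ball t (d t))" using d(1)[OF t] by (intro UN_I[of t]) simp_all
  qed
  then obtain F where F: "F \<subseteq> {0..T}" "finite F" "{0..T} \<subseteq> (\<Union>t\<in>F. ball t (d t))"
    by (rule compactE_image[OF compact_Icc open_ball])
  obtain ts where ts: "set ts = F" using finite_list[OF F(2)] by blast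
  define P where "P = (\<lambda>t s. \<bar>s - t\<bar> < d t)"
  define g where "g = (\<lambda>ts s x. first_match P (\<lambda>t. u t x) ts s)"
  have meas: "set ts \<subseteq> {0..T} \<Longrightarrow> (\<lambda>(s, x). g ts s x) \<in> borel_measurable (borel \<Otimes>\<^sub>M borel)" for ts
  proof (induction ts)
    case (Cons t ts)
    have [measurable]: "u t \<in> borel_measurable borel" using Cons.prems C_LpD(2)[OF u, of t] by simp
    have [measurable]: "(\<lambda>(s, x). g ts s x) \<in> borel_measurable (borel \<Otimes>\<^sub>M borel)" using Cons by simp
    have "(\<lambda>(s, x). g (t # ts) s x) = (\<lambda>(s, x). if \<bar>s - t\<bar> < d t then u t x else g ts s x)"
      by (rule ext) (simp add: g_def P_def split: prod.split)
    also have "\<dots> \<in> borel_measurable (borel \<Otimes>\<^sub>M borel)" by measurable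
    finally show ?case .
  qed (simp add: g_def)
  have "(\<integral>\<^sup>+x. ennreal (norm (g ts s x - u s x) ^ 3) \<partial>lborel) \<le> ennreal (e ^ 3)" if s: "s \<in> {0..T}" for s
  proof -
    obtain t0 where "t0 \<in> F" "s \<in> ball t0 (d t0)" using F(3) s by blast
    hence "\<exists>t\<in>set ts. P t s" unfolding P_def ts by (intro bexI[of _ t0]) (simp_all add: dist_real_def abs_minus_commute)
    hence "\<exists>t\<in>set ts. P t s \<and> (\<forall>x. g ts s x = u t x)"
      unfolding g_def by (rule first_match_witness)
    then obtain t where t: "t \<in> set ts" "P t s" "\<And>x. g ts s x = u t x" by blast
    have tT: "t \<in> {0..T}" using t(1) ts F(1) by blast
    have "(\<integral>\<^sup>+x. ennreal (norm (g ts s x - u s x) ^ 3) \<partial>lborel) = (\<integral>\<^sup>+x. ennreal (norm (u s x - u t x) powr 3) \<partial>lborel)"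
      by (simp add: t(3) norm_minus_commute)
    also have "\<dots> = ennreal (Lp_norm 3 (\<lambda>x. u s x - u t x) powr 3)"
      by (rule nn_integral_Lp3) (intro Lp_space3_diff C_LpD[OF u] s tT)
    also have "\<dots> \<le> ennreal (e powr 3)"
      using d(2)[OF tT s] t(2) by (intro ennreal_leI powr_mono2) (auto simp: P_def)
    finally show ?thesis using e by simp
  qed
  thus ?thesis using meas[of ts] ts F(1) by blast
qed

text \<open>Step approximations with L^3 errors 2^(- n) have summable cubes of errors, so at every
  time they converge almost everywhere in space. Their pointwise limit inherits joint
  measurability.\<close>

lemma C_Lp_representative:
  assumes u: "u \<in> C_Lp T 3"
  obtains v where "jointly_borel v" "\<And>s. s \<in> {0..T} \<Longrightarrow> AE x in lborel. v s x = u s x"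
proof -
  have "\<forall>n::nat. \<exists>g. jointly_borel g \<and>
    (\<forall>s\<in>{0..T}. (\<integral>\<^sup>+x. ennreal (norm (g s x - u s x) ^ 3) \<partial>lborel) \<le> ennreal (((1/2) ^ n) ^ 3))"
    using step_approximation[OF u] by simp
  from choice[OF this] obtain g where gg: "\<forall>n::nat. (\<lambda>(s, x). g n s x) \<in> borel_measurable (borel \<Otimes>\<^sub>M borel) \<and>
    (\<forall>s\<in>{0..T}. (\<integral>\<^sup>+x. ennreal (norm (g n s x - u s x) ^ 3) \<partial>lborel) \<le> ennreal (((1/2) ^ n) ^ 3))" ..
  have g: "\<And>n::nat. (\<lambda>(s, x). g n s x) \<in> borel_measurable (borel \<Otimes>\<^sub>M borel)"
    "\<And>n s. s \<in> {0..T} \<Longrightarrow> (\<integral>\<^sup>+x. ennreal (norm (g n s x - u s x) ^ 3) \<partial>lborel) \<le> ennreal (((1/2) ^ n) ^ 3)"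
    using gg by blast+
  note [measurable] = g(1)
  define v where "v = (\<lambda>s x. lim (\<lambda>n. g n s x))"
  show thesis
  proof
    have "(\<lambda>p. lim (\<lambda>n. (case p of (s, x) \<Rightarrow> g n s x))) \<in> borel_measurable (borel \<Otimes>\<^sub>M borel)"
      by (rule borel_measurable_lim_metric) (rule g)
    thus "jointly_borel v" by (simp add: v_def split_def)
    fix s assume s: "s \<in> {0..T}"
    note [measurable] = C_LpD(2)[OF u s]
    have [measurable]: "g n s \<in> borel_measurable borel" for n by measurable
    have "(\<integral>\<^sup>+x. (\<Sum>n. ennreal (norm (g n s x - u s x) ^ 3)) \<partial>lborel) = (\<Sum>n. \<integral>\<^sup>+x. ennreal (norm (g n s x - u s x) ^ 3) \<partial>lborel)"
      by (rule nn_integral_suminf) measurable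
    also have "\<dots> \<le> (\<Sum>n. ennreal ((1/8) ^ n))"
    proof (rule suminf_le)
      fix n
      have "((1/2::real) ^ n) ^ 3 = ((1/2) ^ 3) ^ n" by (simp only: power_mult[symmetric] mult.commute)
      also have "(1/2::real) ^ 3 = 1/8" by (simp add: power_divide)
      finally show "(\<integral>\<^sup>+x. ennreal (norm (g n s x - u s x) ^ 3) \<partial>lborel) \<le> ennreal ((1/8) ^ n)"
        using g(2)[OF s, of n] by simp
    qed auto
    also have "\<dots> = ennreal (1 / (1 - 1/8))"
      by (intro suminf_ennreal_eq geometric_sums) auto
    finally have "(\<integral>\<^sup>+x. (\<Sum>n. ennreal (norm (g n s x - u s x) ^ 3)) \<partial>lborel) \<noteq> \<infinity>"
      by (auto simp: top_unique)
    hence "AE x in lborel. (\<Sum>n. ennreal (norm (g n s x - u s x) ^ 3)) \<noteq> \<infinity>"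
      by (intro nn_integral_noteq_infinite) measurable
    thus "AE x in lborel. v s x = u s x"
    proof eventually_elim
      case (elim x)
      hence "summable (\<lambda>n. norm (g n s x - u s x) ^ 3)" by (intro summable_suminf_not_top) auto
      hence "(\<lambda>n. norm (g n s x - u s x) ^ 3) \<longlonglongrightarrow> 0" by (rule summable_LIMSEQ_zero)
      hence "(\<lambda>n. root 3 (norm (g n s x - u s x) ^ 3)) \<longlonglongrightarrow> root 3 0" by (intro tendsto_real_root)
      hence "(\<lambda>n. norm (g n s x - u s x)) \<longlonglongrightarrow> 0" by (simp add: real_root_power_cancel)
      hence "(\<lambda>n. g n s x) \<longlonglongrightarrow> u s x" by (simp add: tendsto_norm_zero_iff LIM_zero_iff)
      thus ?case unfolding v_def by (rule limI)
    qed
  qed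
qed

lemma L_inf_loc_weak_extend_measurable:
  assumes "\<theta> \<in> L_inf_loc_weak T q"
  shows "(\<lambda>(s, x). if s \<in> {0<..<T} then \<theta> s x else 0) \<in> borel_measurable (borel \<Otimes>\<^sub>M borel)"
proof -
  have "(\<lambda>(t, x). \<theta> t x) \<in> borel_measurable (restrict_space borel ({0<..<T} \<times> UNIV))"
    using assms by (simp add: L_inf_loc_weak_def)
  moreover have "{0<..<T} \<times> (UNIV :: (real^3) set) \<in> sets borel"
    by (intro borel_open open_Times) auto
  ultimately have "(\<lambda>p. if p \<in> {0<..<T} \<times> UNIV then (case p of (t, x) \<Rightarrow> \<theta> t x) else 0) \<in> borel_measurable borel"
    by (subst (asm) measurable_restrict_space_iff[of _ _ 0]) auto
  moreover have "(\<lambda>p. if p \<in> {0<..<T} \<times> UNIV then (case p of (t, x) \<Rightarrow> \<theta> t x) else 0) = (\<lambda>(s, x). if s \<in> {0<..<T} then \<theta> s x else 0)"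
    by (rule ext) (simp split: prod.split)
  ultimately show ?thesis unfolding borel_prod by simp
qed

lemma
  assumes st: "s < t" and [measurable]: "u s \<in> borel_measurable borel" "v s \<in> borel_measurable borel" "\<theta> s \<in> borel_measurable borel"
    and ae: "AE x in lborel. v s x = u s x"
  shows transport_term_cong: "transport_term v \<theta> t s x = transport_term u \<theta> t s x"
    and convection_term_cong: "convection_term v i t s x = convection_term u i t s x"
proof -
  have [measurable]: "partial k (heat_kernel_at (t - s) x) \<in> borel_measurable borel" for k
    by (rule borel_measurable_partial_heat_kernel) (use st in simp)
  have [measurable]: "partial k (leray_test i j (heat_kernel_at (t - s) x)) \<in> borel_measurable borel" for k j
    by (rule borel_measurable_partial_leray_test_heat_kernel) (use st in simp)
  have "(\<integral>y. (\<theta> s y * v s y $ k) * partial k (heat_kernel_at (t - s) x) y \<partial>lborel) =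
    (\<integral>y. (\<theta> s y * u s y $ k) * partial k (heat_kernel_at (t - s) x) y \<partial>lborel)" for k
    using ae by (intro integral_cong_AE) (measurable, auto elim!: eventually_mono)
  thus "transport_term v \<theta> t s x = transport_term u \<theta> t s x" unfolding transport_term_eq by simp
  have "(\<integral>y. (v s y $ k * v s y $ j) * partial k (leray_test i j (heat_kernel_at (t - s) x)) y \<partial>lborel) =
    (\<integral>y. (u s y $ k * u s y $ j) * partial k (leray_test i j (heat_kernel_at (t - s) x)) y \<partial>lborel)" for k j
    using ae by (intro integral_cong_AE) (measurable, auto elim!: eventually_mono)
  thus "convection_term v i t s x = convection_term u i t s x" unfolding convection_term_eq by simp
qed

section \<open>The mild equations and their differences\<close>

abbreviation temperature_eq :: "dist \<Rightarrow> (real \<Rightarrow> real^3 \<Rightarrow> real^3) \<Rightarrow> (real \<Rightarrow> real^3 \<Rightarrow> real) \<Rightarrow> real \<Rightarrow> bool" where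
  "temperature_eq \<theta>0 u \<theta> t \<equiv> (AE x in lborel.
        set_integrable lborel {0<..<t} (\<lambda>s. transport_term u \<theta> t s x) \<and>
        \<theta> t x = heat t \<theta>0 x - (LBINT s:{0<..<t}. transport_term u \<theta> t s x))"

abbreviation velocity_eq :: "(3 \<Rightarrow> dist) \<Rightarrow> (real \<Rightarrow> real^3 \<Rightarrow> real^3) \<Rightarrow> (real \<Rightarrow> real^3 \<Rightarrow> real) \<Rightarrow> real \<Rightarrow> bool" where
  "velocity_eq u0 u \<theta> t \<equiv> (AE x in lborel. \<forall>i.
        set_integrable lborel {0<..<t} (\<lambda>s. convection_term u i t s x) \<and>
        set_integrable lborel {0<..<t} (\<lambda>s. buoyancy_term \<theta> i t s x) \<and>
        u t x $ i = heat t (u0 i) x - (LBINT s:{0<..<t}. convection_term u i t s x) + (LBINT s:{0<..<t}. buoyancy_term \<theta> i t s x))"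

text \<open>The integrands at time \<open>s\<close> see the velocity only up to null sets of space,
  so it may be exchanged for its jointly measurable representative.\<close>

lemma mild_solution_cong:
  assumes mild: "mild_solution T u0 \<theta>0 u \<theta>"
    and u: "\<And>s. s \<in> {0<..<T} \<Longrightarrow> u s \<in> borel_measurable borel" "\<And>s. s \<in> {0<..<T} \<Longrightarrow> v s \<in> borel_measurable borel"
      "\<And>s. s \<in> {0<..<T} \<Longrightarrow> AE x in lborel. v s x = u s x"
    and \<theta>: "\<And>s. s \<in> {0<..<T} \<Longrightarrow> \<theta> s \<in> borel_measurable borel" "\<And>s. s \<in> {0<..<T} \<Longrightarrow> \<theta>' s = \<theta> s"
  shows "mild_solution T u0 \<theta>0 v \<theta>'"
proof -
  have 1: "transport_term v \<theta>' t s x = transport_term u \<theta> t s x"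
    "convection_term v i t s x = convection_term u i t s x"
    "buoyancy_term \<theta>' i t s x = buoyancy_term \<theta> i t s x" if "t \<in> {0<..<T}" "s \<in> {0<..<t}" for t s x i
  proof -
    have s: "s \<in> {0<..<T}" "s < t" using that by auto
    have "transport_term v \<theta>' t s x = transport_term v \<theta> t s x" by (simp add: transport_term_def \<theta>(2)[OF s(1)])
    thus "transport_term v \<theta>' t s x = transport_term u \<theta> t s x"
      using transport_term_cong[of s t u v \<theta> x] s u \<theta> by simp
    show "convection_term v i t s x = convection_term u i t s x"
      using convection_term_cong[of s t u v \<theta> i x] s u \<theta> by simp
    show "buoyancy_term \<theta>' i t s x = buoyancy_term \<theta> i t s x" by (simp add: buoyancy_term_def \<theta>(2)[OF s(1)])
  qed
  have si: "set_integrable lborel {0<..<t} (\<lambda>s. transport_term v \<theta>' t s x) = set_integrable lborel {0<..<t} (\<lambda>s. transport_term u \<theta> t s x)"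
    "set_integrable lborel {0<..<t} (\<lambda>s. convection_term v i t s x) = set_integrable lborel {0<..<t} (\<lambda>s. convection_term u i t s x)"
    "set_integrable lborel {0<..<t} (\<lambda>s. buoyancy_term \<theta>' i t s x) = set_integrable lborel {0<..<t} (\<lambda>s. buoyancy_term \<theta> i t s x)"
    "(LBINT s:{0<..<t}. transport_term v \<theta>' t s x) = (LBINT s:{0<..<t}. transport_term u \<theta> t s x)"
    "(LBINT s:{0<..<t}. convection_term v i t s x) = (LBINT s:{0<..<t}. convection_term u i t s x)"
    "(LBINT s:{0<..<t}. buoyancy_term \<theta>' i t s x) = (LBINT s:{0<..<t}. buoyancy_term \<theta> i t s x)"
    if t: "t \<in> {0<..<T}" for t x i
    by (rule set_integrable_cong[OF refl refl] set_lebesgue_integral_cong; use 1[OF t] in simp)+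
  show ?thesis
    unfolding mild_solution_def
  proof (intro conjI)
    show "AE t\<in>{0<..<T} in lborel. (AE x in lborel.
        set_integrable lborel {0<..<t} (\<lambda>s. transport_term v \<theta>' t s x) \<and>
        \<theta>' t x = heat t \<theta>0 x - (LBINT s:{0<..<t}. transport_term v \<theta>' t s x))"
    proof -
      have "AE t\<in>{0<..<T} in lborel. temperature_eq \<theta>0 u \<theta> t"
        using mild by (simp add: mild_solution_def)
      thus ?thesis by eventually_elim (auto simp: si \<theta>(2))
    qed
    show "AE t\<in>{0<..<T} in lborel. (AE x in lborel. \<forall>i.
        set_integrable lborel {0<..<t} (\<lambda>s. convection_term v i t s x) \<and>
        set_integrable lborel {0<..<t} (\<lambda>s. buoyancy_term \<theta>' i t s x) \<and>
        v t x $ i = heat t (u0 i) x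
          - (LBINT s:{0<..<t}. convection_term v i t s x)
          + (LBINT s:{0<..<t}. buoyancy_term \<theta>' i t s x))"
    proof -
      have "AE t\<in>{0<..<T} in lborel. (AE x in lborel. \<forall>i.
        set_integrable lborel {0<..<t} (\<lambda>s. convection_term u i t s x) \<and>
        set_integrable lborel {0<..<t} (\<lambda>s. buoyancy_term \<theta> i t s x) \<and>
        u t x $ i = heat t (u0 i) x
          - (LBINT s:{0<..<t}. convection_term u i t s x)
          + (LBINT s:{0<..<t}. buoyancy_term \<theta> i t s x))"
        using mild by (simp add: mild_solution_def)
      thus ?thesis
      proof eventually_elim
        case (elim t)
        show ?case
        proof
          assume t: "t \<in> {0<..<T}"
          have ae: "AE x in lborel. \<forall>i. set_integrable lborel {0<..<t} (\<lambda>s. convection_term u i t s x) \<and>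
            set_integrable lborel {0<..<t} (\<lambda>s. buoyancy_term \<theta> i t s x) \<and>
            u t x $ i = heat t (u0 i) x - (LBINT s:{0<..<t}. convection_term u i t s x) + (LBINT s:{0<..<t}. buoyancy_term \<theta> i t s x)"
            using elim t by blast
          show "AE x in lborel. \<forall>i.
            set_integrable lborel {0<..<t} (\<lambda>s. convection_term v i t s x) \<and>
            set_integrable lborel {0<..<t} (\<lambda>s. buoyancy_term \<theta>' i t s x) \<and>
            v t x $ i = heat t (u0 i) x - (LBINT s:{0<..<t}. convection_term v i t s x) + (LBINT s:{0<..<t}. buoyancy_term \<theta>' i t s x)"
            using ae u(3)[OF t] by eventually_elim (simp add: si[OF t])
        qed
      qed
    qed
  qed (use mild in \<open>auto simp: mild_solution_def\<close>)
qed

text \<open>Integrability in time is part of the notion of a mild solution, which justifies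
  subtracting the time integrals; the majorant of the difference may be infinite.\<close>

lemma time_integral_diff:
  assumes g: "set_integrable lborel {0<..<t} g" "set_integrable lborel {0<..<t} g'"
    and F[measurable]: "jointly_borel F" and C: "C \<ge> 0"
    and le: "AE s\<in>{0<..<t} in lborel. ennreal \<bar>g s - g' s\<bar> \<le> ennreal C * ball_potential n (t - s) (F s) x"
  shows "ennreal \<bar>(LBINT s:{0<..<t}. g s) - (LBINT s:{0<..<t}. g' s)\<bar> \<le> ennreal C * duhamel n t F x"
proof -
  have i: "integrable lborel (\<lambda>s. indicator {0<..<t} s *\<^sub>R (g s - g' s))"
    using set_integral_diff(1)[OF g] by (simp add: set_integrable_def)
  have "(LBINT s:{0<..<t}. g s) - (LBINT s:{0<..<t}. g' s) = (\<integral>s. indicator {0<..<t} s *\<^sub>R (g s - g' s) \<partial>lborel)"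
    using set_integral_diff(2)[OF g] by (simp add: set_lebesgue_integral_def)
  hence "ennreal \<bar>(LBINT s:{0<..<t}. g s) - (LBINT s:{0<..<t}. g' s)\<bar> \<le> (\<integral>\<^sup>+s. ennreal (norm (indicator {0<..<t} s *\<^sub>R (g s - g' s))) \<partial>lborel)"
    using integral_norm_bound_ennreal[OF i] by simp
  also have "\<dots> \<le> (\<integral>\<^sup>+s. ennreal C * (\<integral>\<^sup>+y. indicator {0<..<t} s * ennreal (ball_kernel n (t - s) (x - y)) * F s y \<partial>lborel) \<partial>lborel)"
  proof (rule nn_integral_mono_AE, use le in eventually_elim)
    fix s assume *: "s \<in> {0<..<t} \<longrightarrow> ennreal \<bar>g s - g' s\<bar> \<le> ennreal C * ball_potential n (t - s) (F s) x"
    show "ennreal (norm (indicator {0<..<t} s *\<^sub>R (g s - g' s))) \<le> ennreal C * (\<integral>\<^sup>+y. indicator {0<..<t} s * ennreal (ball_kernel n (t - s) (x - y)) * F s y \<partial>lborel)"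
      using * by (cases "s \<in> {0<..<t}") simp_all
  qed
  also have "\<dots> = ennreal C * duhamel n t F x"
    unfolding duhamel_def by (rule nn_integral_cmult) measurable
  finally show ?thesis .
qed

lemma borel_measurable_duhamel [measurable]:
  assumes [measurable]: "jointly_borel F"
  shows "duhamel n t F \<in> borel_measurable borel"
  unfolding duhamel_def[abs_def] by measurable

lemma duhamel_add:
  assumes [measurable]: "jointly_borel F" "jointly_borel G"
  shows "duhamel n t (\<lambda>s y. F s y + G s y) x = duhamel n t F x + duhamel n t G x"
  unfolding duhamel_def distrib_left by (simp add: nn_integral_add)

lemma duhamel_mono:
  assumes "\<And>s y. F s y \<le> G s y" shows "duhamel n t F x \<le> duhamel n t G x"
  unfolding duhamel_def by (intro nn_integral_mono mult_left_mono assms) simp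

text \<open>The power of t in \<open>Y_space\<close>; it makes the weighted norm invariant under the
  scaling of the system.\<close>

definition decay :: "real \<Rightarrow> real" where "decay q = 3/2 * (1 - 1/q)"

text \<open>The Hoelder exponent of a product of a weak L^q function with a weak L^3
  function.\<close>

definition prod_exponent :: "real \<Rightarrow> real" where "prod_exponent q = 1 / (1 / q + 1 / 3)"

text \<open>The bound q > 3/2 makes the exponent of the product \<theta> u exceed 1. The bound q < 3
  makes the singularity t^(- decay) integrable and puts the buoyancy into the subcritical range, 3 /
  q > 1.\<close>

lemma exponent_facts:
  assumes "3/2 < q" "q < 3"
  shows "0 \<le> decay q" "decay q < 1" "decay q > 0" "1 / prod_exponent q = 1 / q + 1 / 3" "prod_exponent q > 1" "1 / q + 1 / 3 < 1" "q > 1" "q > 0"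
    "1 < 3 / q" "3 / q < 2"
proof -
  have q: "1 / q < 2 / 3" "1 / q > 1 / 3" using assms by (auto simp: field_simps)
  show "0 \<le> decay q" "decay q < 1" "decay q > 0" using q by (auto simp: decay_def)
  show "1 / prod_exponent q = 1 / q + 1 / 3" by (simp add: prod_exponent_def)
  show s: "1 / q + 1 / 3 < 1" using q by simp
  have "1 / q + 1 / 3 > 0" using q by simp
  thus "prod_exponent q > 1" using s by (simp add: prod_exponent_def)
  show "q > 1" "q > 0" using assms by auto
  show "1 < 3 / q" "3 / q < 2" using q by auto
qed

lemma ennreal_powr_mult_le_imp_weak_bound:
  assumes "ennreal (t powr b) * weak_norm q f \<le> ennreal C" "t > 0" "C \<ge> 0" "q > 0"
  shows "weak_bound q (C * t powr (- b)) f"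
proof (rule weak_norm_le_imp_weak_bound)
  have "weak_norm q f = ennreal (t powr (- b)) * (ennreal (t powr b) * weak_norm q f)"
    using assms by (simp add: mult.assoc[symmetric] ennreal_mult[symmetric] powr_minus)
  also have "\<dots> \<le> ennreal (t powr (- b)) * ennreal C" using assms by (intro mult_left_mono) auto
  also have "\<dots> = ennreal (C * t powr (- b))" using assms by (simp add: ennreal_mult[symmetric] mult.commute)
  finally show "weak_norm q f \<le> ennreal (C * t powr (- b))" .
qed (use assms in auto)

text \<open>The L^3 mass above height n tends to 0 by dominated convergence. In weak L^3 this fails,
  for example for 1 / |x|; here strong integrability of the velocities enters.\<close>

lemma L3_truncation:
  assumes f: "f \<in> Lp_space 3" and e: "e > 0"
  shows "\<exists>M>0. \<exists>v. v \<in> borel_measurable borel \<and> (\<forall>x. norm (v x) \<le> M) \<and> weak_bound 3 e (\<lambda>x. norm (f x - v x))"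
proof -
  note [measurable] = Lp_space3D(1)[OF f]
  define g where "g = (\<lambda>(n::nat) x. if norm (f x) \<le> real n then 0 else norm (f x) powr 3)"
  have "(\<lambda>n. \<integral>x. g n x \<partial>lborel) \<longlonglongrightarrow> (\<integral>x. 0 \<partial>(lborel :: (real^3) measure))"
  proof (rule integral_dominated_convergence)
    show "integrable lborel (\<lambda>x. norm (f x) powr 3)" by (rule Lp_space3D(2)[OF f])
    show "AE x in lborel. (\<lambda>n. g n x) \<longlonglongrightarrow> 0"
    proof (rule AE_I2)
      fix x
      obtain N where N: "norm (f x) \<le> real N" using real_arch_simple by blast
      have "\<forall>\<^sub>F n in sequentially. g n x = 0"
        using eventually_ge_at_top[of N] by eventually_elim (use N in \<open>auto simp: g_def\<close>)
      thus "(\<lambda>n. g n x) \<longlonglongrightarrow> 0" by (rule tendsto_eventually)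
    qed
    show "AE x in lborel. norm (g n x) \<le> norm (f x) powr 3" for n by (auto simp: g_def)
    show "g n \<in> borel_measurable lborel" for n unfolding g_def by measurable
  qed simp
  hence "\<forall>\<^sub>F n in sequentially. (\<integral>x. g n x \<partial>lborel) < e powr 3"
    using e by (intro order_tendstoD(2)) auto
  then obtain n0 where "\<forall>n\<ge>n0. (\<integral>x. g n x \<partial>lborel) < e powr 3" unfolding eventually_sequentially by blast
  then obtain n where n: "(\<integral>x. g n x \<partial>lborel) < e powr 3" "n > 0"
    using le_add1[of n0 1] by (metis add_gr_0 zero_less_one)
  define v where "v = (\<lambda>x. if norm (f x) \<le> real n then f x else 0)"
  have [measurable]: "v \<in> borel_measurable borel" unfolding v_def by measurable
  have gi: "integrable lborel (g n)"
    by (rule Bochner_Integration.integrable_bound[OF Lp_space3D(2)[OF f]]) (auto simp: g_def)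
  have "(\<integral>\<^sup>+x. ennreal (\<bar>norm (f x - v x)\<bar> powr 3) \<partial>lborel) = (\<integral>\<^sup>+x. ennreal (g n x) \<partial>lborel)"
    by (intro nn_integral_cong) (auto simp: g_def v_def)
  also have "\<dots> = ennreal (\<integral>x. g n x \<partial>lborel)" using gi by (intro nn_integral_eq_integral) (auto simp: g_def)
  also have "\<dots> \<le> ennreal (e powr 3)" using n by (intro ennreal_leI) simp
  finally have "weak_bound 3 e (\<lambda>x. norm (f x - v x))" using e by (intro weak_bound_of_power_integral) auto
  moreover have "norm (v x) \<le> real n" for x by (simp add: v_def)
  ultimately show ?thesis using n(2) by (intro exI[of _ "real n"] conjI exI[of _ v]) auto
qed

section \<open>Uniqueness\<close>

text \<open>Joint measurability on the whole time axis is added to the hypotheses of the theorem;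
  \<open>mild_flow_representative\<close> provides it.\<close>

locale mild_flow =
  fixes T q :: real and u0 :: "3 \<Rightarrow> dist" and \<theta>0 :: dist
    and u :: "real \<Rightarrow> real^3 \<Rightarrow> real^3" and \<theta> :: "real \<Rightarrow> real^3 \<Rightarrow> real"
  assumes T: "T > 0" and q: "3/2 < q" "q < 3"
    and mild: "mild_solution T u0 \<theta>0 u \<theta>"
    and u_C: "u \<in> C_Lp T 3" and \<theta>_Y: "\<theta> \<in> Y_space T q"
    and u_meas [measurable]: "jointly_borel u"
    and \<theta>_meas [measurable]: "jointly_borel \<theta>"
begin

lemmas q_facts = exponent_facts[OF q]

lemma slice_measurable [measurable]: "u s \<in> borel_measurable borel" "\<theta> s \<in> borel_measurable borel"
  by measurable

lemma \<theta>_decay: "\<exists>C>0. AE s\<in>{0<..<T} in lborel. weak_bound q (C * s powr (- decay q)) (\<theta> s)"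
proof -
  obtain C :: real where C: "AE t\<in>{0<..<T} in lborel. ennreal (t powr decay q) * weak_norm q (\<theta> t) \<le> ennreal C"
    using \<theta>_Y unfolding Y_space_def decay_def by blast
  define D where "D = max C 1"
  have "AE s\<in>{0<..<T} in lborel. weak_bound q (D * s powr (- decay q)) (\<theta> s)"
    using C
  proof eventually_elim
    case (elim t)
    show ?case
    proof
      assume t: "t \<in> {0<..<T}"
      have "ennreal (t powr decay q) * weak_norm q (\<theta> t) \<le> ennreal C" using elim t by blast
      also have "\<dots> \<le> ennreal D" by (intro ennreal_leI) (simp add: D_def)
      finally show "weak_bound q (D * t powr (- decay q)) (\<theta> t)"
        by (rule ennreal_powr_mult_le_imp_weak_bound) (use t q_facts in \<open>auto simp: D_def\<close>)
    qed
  qed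
  thus ?thesis by (intro exI[of _ D]) (auto simp: D_def)
qed

text \<open>At a = 0 this is the limit condition in \<open>Y_space\<close>. For a > 0 the
  temperature is bounded near \<open>a\<close> while (s - a)^(- decay) blows up, so smallness is
  free on a short interval.\<close>

lemma \<theta>_small:
  assumes a: "0 \<le> a" "a < T" and e: "e > 0"
  shows "\<exists>d>0. AE s in lborel. a < s \<and> s < a + d \<and> s < T \<longrightarrow> weak_bound q (e * (s - a) powr (- decay q)) (\<theta> s)"
proof (cases "a = 0")
  case True
  obtain d where d: "d > 0" "AE t in lborel. t \<in> {0<..<T} \<and> t < d \<longrightarrow> ennreal (t powr decay q) * weak_norm q (\<theta> t) \<le> ennreal e"
    using \<theta>_Y e unfolding Y_space_def decay_def by blast
  have "AE s in lborel. a < s \<and> s < a + d \<and> s < T \<longrightarrow> weak_bound q (e * (s - a) powr (- decay q)) (\<theta> s)"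
    using d(2) by eventually_elim (use True q_facts e in \<open>auto intro: ennreal_powr_mult_le_imp_weak_bound\<close>)
  thus ?thesis using d(1) by blast
next
  case False
  define b where "b = (a + T) / 2"
  have b: "0 < a" "a < b" "b < T" using a False by (auto simp: b_def)
  obtain C :: real where C: "AE t\<in>{a..b} in lborel. weak_norm q (\<theta> t) \<le> ennreal C"
  proof -
    have "\<forall>a b. 0 < a \<and> a \<le> b \<and> b < T \<longrightarrow> (\<exists>C::real. AE t\<in>{a..b} in lborel. weak_norm q (\<theta> t) \<le> ennreal C)"
      using \<theta>_Y unfolding Y_space_def L_inf_loc_weak_def by blast
    hence "\<exists>C::real. AE t\<in>{a..b} in lborel. weak_norm q (\<theta> t) \<le> ennreal C" using b less_imp_le by blast
    thus thesis using that by blast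
  qed
  define D where "D = max C 1"
  have D: "D > 0" by (simp add: D_def)
  \<comment> \<open>The second entry is the length at which D d^(decay) equals
    \<open>e\<close>.\<close>
  define d where "d = min (b - a) ((e / D) powr (1 / decay q))"
  have d: "d > 0" using b e D by (simp add: d_def)
  have "AE s in lborel. a < s \<and> s < a + d \<and> s < T \<longrightarrow> weak_bound q (e * (s - a) powr (- decay q)) (\<theta> s)"
    using C
  proof eventually_elim
    case (elim t)
    show ?case
    proof
      assume t: "a < t \<and> t < a + d \<and> t < T"
      hence "t \<in> {a..b}" by (auto simp: d_def)
      hence "weak_norm q (\<theta> t) \<le> ennreal C" using elim by blast
      also have "\<dots> \<le> ennreal D" by (intro ennreal_leI) (simp add: D_def)
      finally have w: "weak_bound q D (\<theta> t)" using D q_facts by (intro weak_norm_le_imp_weak_bound) auto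
      have "(t - a) powr decay q \<le> ((e / D) powr (1 / decay q)) powr decay q"
        using t q_facts by (intro powr_mono2) (auto simp: d_def)
      also have "\<dots> = e / D" using q_facts e D by (simp add: powr_powr)
      finally have "D \<le> e * (t - a) powr (- decay q)" using t D by (simp add: powr_minus field_simps)
      thus "weak_bound q (e * (t - a) powr (- decay q)) (\<theta> t)"
        by (rule weak_bound_mono[OF w]) (use D q_facts in auto)
    qed
  qed
  thus ?thesis using d by blast
qed

lemma u_near:
  assumes a: "a \<in> {0..T}" and e: "e > 0"
  shows "\<exists>d>0. \<forall>s\<in>{0..T}. \<bar>s - a\<bar> < d \<longrightarrow> weak_bound 3 e (\<lambda>x. norm (u s x - u a x))"
proof -
  obtain d where d: "d > 0" "\<forall>s\<in>{0..T}. \<bar>s - a\<bar> < d \<longrightarrow> Lp_norm 3 (\<lambda>x. u s x - u a x) \<le> e"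
    using C_Lp_near[OF u_C a e] by blast
  thus ?thesis
    using C_LpD(1)[OF u_C] a by (intro exI[of _ d]) (auto intro!: Lp3_weak_bound[of "\<lambda>x. u _ x - u a x"] Lp_space3_diff)
qed

lemma u_weak: "s \<in> {0..T} \<Longrightarrow> \<exists>A>0. weak_bound 3 A (\<lambda>x. norm (u s x))"
  using Lp3_weak_bound[OF C_LpD(1)[OF u_C], of s "max 1 (Lp_norm 3 (u s))"] by (intro exI[of _ "max 1 (Lp_norm 3 (u s))"]) auto

lemma u_square_kernel_finite:
  assumes s: "s \<in> {0..T}" and st: "s < t"
  shows "ball_potential 4 (t - s) (\<lambda>y. ennreal (norm (u s y) * norm (u s y))) x < \<infinity>"
proof -
  obtain A where A: "A > 0" "weak_bound 3 A (\<lambda>x. norm (u s x))" using u_weak[OF s] by blast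
  obtain C where "product_bound 3 3 (3/2) C" using weak_bound_mult[of "3/2" 3 3] by auto
  note C = product_boundD[OF this]
  have "C > 0" "marcinkiewicz (3/2) (C * A * A) (\<lambda>x. ennreal (\<bar>norm (u s x)\<bar> * \<bar>norm (u s x)\<bar>))"
    using C(1) C(2)[OF A(2) A(2) A(1) A(1)] by simp_all
  thus ?thesis using nn_integral_ball_kernel_finite[of "3/2" "C * A * A" "\<lambda>x. ennreal (norm (u s x) * norm (u s x))" "t - s" 4 x] st A by simp
qed

text \<open>The weak bounds hold for almost every \<open>s\<close>, and the exceptional set is
  independent of \<open>t\<close> and \<open>x\<close>; this uniformity is what the comparison at a
  fixed later time needs.\<close>

lemma \<theta>_kernel_finite:
  "AE s\<in>{0<..<T} in lborel. (\<forall>t x. s < t \<longrightarrow>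
     ball_potential 4 (t - s) (\<lambda>y. ennreal (\<bar>\<theta> s y\<bar> * norm (u s y))) x < \<infinity> \<and>
     ball_potential 3 (t - s) (\<lambda>y. ennreal \<bar>\<theta> s y\<bar>) x < \<infinity>)"
proof -
  obtain C where C: "C > 0" "AE s\<in>{0<..<T} in lborel. weak_bound q (C * s powr (- decay q)) (\<theta> s)"
    using \<theta>_decay by blast
  obtain K where "product_bound q 3 (prod_exponent q) K" using weak_bound_mult[of "prod_exponent q" q 3] q_facts by auto
  note K = product_boundD[OF this]
  show ?thesis
    using C(2)
  proof eventually_elim
    case (elim s)
    show ?case
    proof (intro impI allI)
      fix t x assume s: "s \<in> {0<..<T}" and st: "s < t"
      define D where "D = C * s powr (- decay q)"
      have D: "D > 0" "weak_bound q D (\<theta> s)" using elim s C by (auto simp: D_def)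
      obtain A where A: "A > 0" "weak_bound 3 A (\<lambda>x. norm (u s x))" using u_weak[of s] s by auto
      have m1: "marcinkiewicz (prod_exponent q) (K * D * A) (\<lambda>x. ennreal (\<bar>\<theta> s x\<bar> * \<bar>norm (u s x)\<bar>))"
        using D A by (intro K) auto
      have m2: "marcinkiewicz q (dyadic_const 1 q * D) (\<lambda>x. ennreal \<bar>\<theta> s x\<bar>)"
        using D q_facts by (intro weak_bound_imp_marcinkiewicz) auto
      have p: "4 + 3 / prod_exponent q > 3" using q_facts(5) by (simp add: add_pos_pos)
      have dc: "dyadic_const 1 q > 0" using q_facts by (intro dyadic_const_pos) auto
      show "ball_potential 4 (t - s) (\<lambda>y. ennreal (\<bar>\<theta> s y\<bar> * norm (u s y))) x < \<infinity> \<and>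
        ball_potential 3 (t - s) (\<lambda>y. ennreal \<bar>\<theta> s y\<bar>) x < \<infinity>"
        using nn_integral_ball_kernel_finite[OF m1, of "t - s" 4 x] nn_integral_ball_kernel_finite[OF m2, of "t - s" 3 x] st D A K(1) q_facts p dc
        by simp
    qed
  qed
qed

end

section \<open>Vanishing, domination and sums of weak bounds\<close>

lemma marcinkiewicz_zero: "AE x in lborel. f x = 0 \<Longrightarrow> marcinkiewicz p 0 f"
  by (rule marcinkiewicz_mono_AE[of p 0 "\<lambda>_. 0"]) (auto simp: marcinkiewicz_def)

lemma weak_bound_mono_AE:
  assumes g: "weak_bound p A g" and le: "AE x in lborel. \<bar>f x\<bar> \<le> \<bar>g x\<bar>" and [measurable]: "f \<in> borel_measurable borel" "g \<in> borel_measurable borel"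
  shows "weak_bound p A f"
  unfolding weak_bound_def
proof (intro allI impI)
  fix l :: real assume l: "l > 0"
  have "emeasure lborel {x. l < \<bar>f x\<bar>} \<le> emeasure lborel {x. l < \<bar>g x\<bar>}"
  proof (rule emeasure_mono_AE)
    show "AE x in lborel. x \<in> {x. l < \<bar>f x\<bar>} \<longrightarrow> x \<in> {x. l < \<bar>g x\<bar>}"
      using le by eventually_elim auto
  qed simp
  also have "\<dots> \<le> ennreal ((A / l) powr p)" by (rule weak_boundD[OF g l])
  finally show "emeasure lborel {x. l < \<bar>f x\<bar>} \<le> ennreal ((A / l) powr p)" .
qed

text \<open>A factor 2 comes from halving the level, and another from 2 c^p <= (2 c)^p, which uses p
  >= 1.\<close>

lemma weak_bound_add:
  assumes f: "weak_bound p A f" and g: "weak_bound p B g" and AB: "A \<ge> 0" "B \<ge> 0" and p: "p \<ge> 1"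
    and [measurable]: "f \<in> borel_measurable borel" "g \<in> borel_measurable borel"
  shows "weak_bound p (4 * (A + B)) (\<lambda>x. \<bar>f x\<bar> + \<bar>g x\<bar>)"
  unfolding weak_bound_def
proof (intro allI impI)
  fix l :: real assume l: "l > 0"
  define c where "c = (A + B) / (l / 2)"
  have c: "c \<ge> 0" using AB l by (simp add: c_def)
  have "emeasure lborel {x. l < \<bar>\<bar>f x\<bar> + \<bar>g x\<bar>\<bar>} \<le> emeasure lborel ({x. l / 2 < \<bar>f x\<bar>} \<union> {x. l / 2 < \<bar>g x\<bar>})"
    by (rule emeasure_mono) auto
  also have "\<dots> \<le> emeasure lborel {x. l / 2 < \<bar>f x\<bar>} + emeasure lborel {x. l / 2 < \<bar>g x\<bar>}"
    by (rule emeasure_subadditive) auto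
  also have "\<dots> \<le> ennreal ((A / (l / 2)) powr p) + ennreal ((B / (l / 2)) powr p)"
    using l by (intro add_mono weak_boundD[OF f] weak_boundD[OF g]) auto
  also have "\<dots> \<le> ennreal (c powr p) + ennreal (c powr p)"
    using AB l p unfolding c_def by (intro add_mono ennreal_leI powr_mono2 divide_right_mono) auto
  also have "\<dots> = ennreal (2 * c powr p)" by (subst ennreal_plus[symmetric]) auto
  also have "\<dots> \<le> ennreal (2 powr p * c powr p)"
    using p powr_mono[of 1 p 2] by (intro ennreal_leI mult_right_mono) auto
  also have "2 powr p * c powr p = (4 * (A + B) / l) powr p"
    using c by (simp add: powr_mult[symmetric] c_def)
  finally show "emeasure lborel {x. l < \<bar>\<bar>f x\<bar> + \<bar>g x\<bar>\<bar>} \<le> ennreal ((4 * (A + B) / l) powr p)" .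
qed

lemma weak_bound_vanish:
  assumes f: "\<And>e. e > 0 \<Longrightarrow> \<exists>A\<le>e. A \<ge> 0 \<and> weak_bound p A f" and [measurable]: "f \<in> borel_measurable borel" and p: "p > 0"
  shows "AE x in lborel. f x = 0"
proof -
  have "AE x in lborel. \<not> 1 / real (Suc n) < \<bar>f x\<bar>" for n
  proof -
    define l where "l = 1 / real (Suc n)"
    have l: "l > 0" by (simp add: l_def)
    have "emeasure lborel {x. l < \<bar>f x\<bar>} \<le> ennreal d" if d: "d > 0" for d
    proof -
      have pos: "l * d powr (1 / p) > 0" using l d by simp
      from f[OF pos] obtain A where A: "A \<le> l * d powr (1 / p)" "A \<ge> 0" "weak_bound p A f" by blast
      have "A / l \<le> d powr (1 / p)" using A(1) l by (simp add: divide_le_eq mult.commute)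
      hence "(A / l) powr p \<le> (d powr (1 / p)) powr p" using A(2) l p by (intro powr_mono2) simp_all
      also have "\<dots> = d" using d p by (simp add: powr_powr)
      finally have "ennreal ((A / l) powr p) \<le> ennreal d" by (rule ennreal_leI)
      with weak_boundD[OF A(3) l] show ?thesis by (rule order_trans)
    qed
    note small = this
    have "emeasure lborel {x. l < \<bar>f x\<bar>} \<le> 0"
    proof (rule ennreal_le_epsilon)
      fix e :: real assume "e > 0"
      from small[OF this] show "emeasure lborel {x. l < \<bar>f x\<bar>} \<le> 0 + ennreal e" by (simp only: add_0)
    qed
    hence "emeasure lborel {x. l < \<bar>f x\<bar>} = 0" by (simp only: le_zero_eq)
    moreover have "{x. l < \<bar>f x\<bar>} \<in> sets lborel" by measurable
    ultimately have "{x. l < \<bar>f x\<bar>} \<in> null_sets lborel" by (rule null_setsI)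
    from AE_not_in[OF this] show ?thesis unfolding l_def mem_Collect_eq .
  qed
  hence "AE x in lborel. \<forall>n. \<not> 1 / real (Suc n) < \<bar>f x\<bar>" unfolding AE_all_countable by blast
  thus ?thesis
  proof eventually_elim
    case (elim x)
    show ?case
    proof (rule ccontr)
      assume "f x \<noteq> 0"
      hence "0 < \<bar>f x\<bar>" by simp
      from reals_Archimedean[OF this] obtain n where "inverse (real (Suc n)) < \<bar>f x\<bar>" ..
      thus False using elim[rule_format, of n] unfolding inverse_eq_divide by blast
    qed
  qed
qed

lemma AE_lborel_obtain:
  fixes a b :: real
  assumes "AE s\<in>{a<..<b} in lborel. P s" "a < b"
  obtains s where "s \<in> {a<..<b}" "P s"
proof -
  have "\<not> (\<forall>s\<in>{a<..<b}. \<not> P s)"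
  proof
    assume none: "\<forall>s\<in>{a<..<b}. \<not> P s"
    have "AE s in lborel. s \<notin> {a<..<b}" using assms(1) by eventually_elim (use none in blast)
    hence "{a<..<b} \<in> null_sets lborel" by (subst AE_iff_null_sets) auto
    thus False using assms(2) by (auto simp: null_sets_def)
  qed
  thus thesis using that by blast
qed

text \<open>The two data may differ: comparison with the zero solution, whose data vanish, later
  yields the information on the data themselves.\<close>

locale mild_flows =
  A: mild_flow T q u0 \<theta>0 u \<theta> + B: mild_flow T q u0' \<theta>0' u' \<theta>'
  for T q u0 \<theta>0 u \<theta> u0' \<theta>0' u' \<theta>'
begin

definition w :: "real \<Rightarrow> real^3 \<Rightarrow> real" where "w s x = norm (u s x - u' s x)"
definition \<eta> :: "real \<Rightarrow> real^3 \<Rightarrow> real" where "\<eta> s x = \<bar>\<theta> s x - \<theta>' s x\<bar>"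

lemma w_nonneg [simp]: "w s x \<ge> 0" and \<eta>_nonneg [simp]: "\<eta> s x \<ge> 0"
  by (auto simp: w_def \<eta>_def)

lemma w_measurable [measurable]: "jointly_borel w"
  unfolding w_def using A.u_meas B.u_meas by measurable

lemma \<eta>_measurable [measurable]: "jointly_borel \<eta>"
  unfolding \<eta>_def using A.\<theta>_meas B.\<theta>_meas by measurable

lemma slices [measurable]: "w s \<in> borel_measurable borel" "\<eta> s \<in> borel_measurable borel"
  by measurable

text \<open>Pointwise majorants of the differences of u \<otimes> u and of \<theta> u, in the form
  in which \<open>convection_term_diff\<close> and \<open>transport_term_diff\<close> produce
  them.\<close>

definition fc :: "real \<Rightarrow> real^3 \<Rightarrow> ennreal" where
  "fc s y = ennreal (w s y * norm (u s y) + w s y * norm (u' s y))"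
definition ft :: "real \<Rightarrow> real^3 \<Rightarrow> ennreal" where
  "ft s y = ennreal (\<eta> s y * norm (u s y) + \<bar>\<theta>' s y\<bar> * w s y)"

lemma f_measurable [measurable]:
  "jointly_borel fc" "jointly_borel ft"
proof -
  note [measurable] = A.u_meas B.u_meas A.\<theta>_meas B.\<theta>_meas
  show "jointly_borel fc" "jointly_borel ft"
    unfolding fc_def ft_def by measurable
qed

abbreviation deviation_bound :: "real \<Rightarrow> real \<Rightarrow> bool" where
  "deviation_bound C t \<equiv> (AE x in lborel.
     (\<forall>i. ennreal \<bar>(u t x - u' t x) $ i - (heat t (u0 i) x - heat t (u0' i) x)\<bar> \<le> ennreal C * (duhamel 4 t fc x + duhamel 3 t (\<lambda>s y. ennreal (\<eta> s y)) x)) \<and>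
     ennreal \<bar>\<theta> t x - \<theta>' t x - (heat t \<theta>0 x - heat t \<theta>0' x)\<bar> \<le> ennreal C * duhamel 4 t ft x)"

text \<open>The mild equations are subtracted, the heat flows of the data are moved to the left, and
  each remaining time integral is dominated by \<open>time_integral_diff\<close>. Weak bounds hold
  for almost every \<open>s\<close>, which suffices under the time integral.\<close>

lemma deviation:
  "\<exists>C>0. AE t\<in>{0<..<T} in lborel. deviation_bound C t"
proof -
  note [measurable] = A.slice_measurable B.slice_measurable
  obtain Kt where Kt: "Kt \<ge> 0" "\<And>k t x y. t > 0 \<Longrightarrow> \<bar>partial k (heat_kernel_at t x) y\<bar> \<le> Kt * ball_kernel 4 t (x - y)"
    using partial_heat_kernel_bound by blast
  obtain Kc where Kc: "Kc \<ge> 0" "\<And>i j k t x y. t > 0 \<Longrightarrow> \<bar>partial k (leray_test i j (heat_kernel_at t x)) y\<bar> \<le> Kc * ball_kernel 4 t (x - y)"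
    using partial_leray_test_heat_kernel_bound by blast
  obtain Kb where Kb: "Kb \<ge> 0" "\<And>i j t x y. t > 0 \<Longrightarrow> \<bar>leray_test i j (heat_kernel_at t x) y\<bar> \<le> Kb * ball_kernel 3 t (x - y)"
    using leray_test_heat_kernel_bound by blast
  define Ct Cc Cb where "Ct = 3 * Kt" and "Cc = 9 * Kc" and "Cb = 3 * Kb"
  have nn: "Ct \<ge> 0" "Cc \<ge> 0" "Cb \<ge> 0" using Kt(1) Kc(1) Kb(1) by (simp_all add: Ct_def Cc_def Cb_def)
  note Ct = nn(1) transport_term_diff[OF Kt, folded Ct_def]
   and Cc = nn(2) convection_term_diff[OF Kc, folded Cc_def]
   and Cb = nn(3) buoyancy_term_diff[OF Kb, folded Cb_def]
  define C where "C = Cc + Cb + Ct + 1"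
  have C: "C > 0" using Ct(1) Cc(1) Cb(1) by (simp add: C_def)
  have m1: "AE t\<in>{0<..<T} in lborel. temperature_eq \<theta>0 u \<theta> t"
    and m2: "AE t\<in>{0<..<T} in lborel. velocity_eq u0 u \<theta> t"
    and m1': "AE t\<in>{0<..<T} in lborel. temperature_eq \<theta>0' u' \<theta>' t"
    and m2': "AE t\<in>{0<..<T} in lborel. velocity_eq u0' u' \<theta>' t"
    using A.mild B.mild by (simp_all only: mild_solution_def)
  have "AE t\<in>{0<..<T} in lborel. deviation_bound C t"
    using m1 m2 m1' m2'
  proof eventually_elim
    case (elim t)
    show ?case
    proof
      assume t: "t \<in> {0<..<T}"
      have fin: "AE s\<in>{0<..<t} in lborel. (\<forall>x.
          ball_potential 4 (t - s) (\<lambda>y. ennreal (\<bar>\<theta> s y\<bar> * norm (u s y))) x < \<infinity> \<and>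
          ball_potential 4 (t - s) (\<lambda>y. ennreal (\<bar>\<theta>' s y\<bar> * norm (u' s y))) x < \<infinity> \<and>
          ball_potential 3 (t - s) (\<lambda>y. ennreal \<bar>\<theta> s y\<bar>) x < \<infinity> \<and>
          ball_potential 3 (t - s) (\<lambda>y. ennreal \<bar>\<theta>' s y\<bar>) x < \<infinity>)"
        using A.\<theta>_kernel_finite B.\<theta>_kernel_finite by eventually_elim (use t in auto)
      have T1: "ennreal \<bar>(LBINT s:{0<..<t}. transport_term u \<theta> t s x) - (LBINT s:{0<..<t}. transport_term u' \<theta>' t s x)\<bar> \<le> ennreal Ct * duhamel 4 t ft x"
        if "set_integrable lborel {0<..<t} (\<lambda>s. transport_term u \<theta> t s x)" "set_integrable lborel {0<..<t} (\<lambda>s. transport_term u' \<theta>' t s x)" for x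
      proof (rule time_integral_diff[OF that f_measurable(2) Ct(1)])
        show "AE s\<in>{0<..<t} in lborel. ennreal \<bar>transport_term u \<theta> t s x - transport_term u' \<theta>' t s x\<bar> \<le> ennreal Ct * ball_potential 4 (t - s) (ft s) x"
          using fin unfolding ft_def w_def \<eta>_def by eventually_elim (intro impI Ct; simp)
      qed
      have T2: "ennreal \<bar>(LBINT s:{0<..<t}. convection_term u i t s x) - (LBINT s:{0<..<t}. convection_term u' i t s x)\<bar> \<le> ennreal Cc * duhamel 4 t fc x"
        if "set_integrable lborel {0<..<t} (\<lambda>s. convection_term u i t s x)" "set_integrable lborel {0<..<t} (\<lambda>s. convection_term u' i t s x)" for x i
      proof (rule time_integral_diff[OF that f_measurable(1) Cc(1)])
        show "AE s\<in>{0<..<t} in lborel. ennreal \<bar>convection_term u i t s x - convection_term u' i t s x\<bar> \<le> ennreal Cc * ball_potential 4 (t - s) (fc s) x"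
          unfolding fc_def w_def using t by (intro AE_I2 impI Cc A.u_square_kernel_finite B.u_square_kernel_finite) auto
      qed
      have T3: "ennreal \<bar>(LBINT s:{0<..<t}. buoyancy_term \<theta> i t s x) - (LBINT s:{0<..<t}. buoyancy_term \<theta>' i t s x)\<bar> \<le> ennreal Cb * duhamel 3 t (\<lambda>s y. ennreal (\<eta> s y)) x"
        if "set_integrable lborel {0<..<t} (\<lambda>s. buoyancy_term \<theta> i t s x)" "set_integrable lborel {0<..<t} (\<lambda>s. buoyancy_term \<theta>' i t s x)" for x i
      proof (rule time_integral_diff[OF that _ Cb(1)])
        show "AE s\<in>{0<..<t} in lborel. ennreal \<bar>buoyancy_term \<theta> i t s x - buoyancy_term \<theta>' i t s x\<bar> \<le> ennreal Cb * ball_potential 3 (t - s) (\<lambda>y. ennreal (\<eta> s y)) x"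
          using fin unfolding \<eta>_def by eventually_elim (intro impI Cb; simp)
      qed measurable
      have a: "temperature_eq \<theta>0 u \<theta> t" "velocity_eq u0 u \<theta> t" "temperature_eq \<theta>0' u' \<theta>' t" "velocity_eq u0' u' \<theta>' t"
        using elim t by blast+
      show "deviation_bound C t"
        using a
      proof eventually_elim
        case (elim x)
        define D where "D = duhamel 4 t fc x + duhamel 3 t (\<lambda>s y. ennreal (\<eta> s y)) x"
        have "\<theta> t x - \<theta>' t x - (heat t \<theta>0 x - heat t \<theta>0' x) = (LBINT s:{0<..<t}. transport_term u' \<theta>' t s x) - (LBINT s:{0<..<t}. transport_term u \<theta> t s x)"
          using elim(1,3) by simp
        hence "ennreal \<bar>\<theta> t x - \<theta>' t x - (heat t \<theta>0 x - heat t \<theta>0' x)\<bar> \<le> ennreal Ct * duhamel 4 t ft x" using T1[of x] elim by (simp add: abs_minus_commute)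
        also have "\<dots> \<le> ennreal C * duhamel 4 t ft x"
          using Cc(1) Cb(1) by (intro mult_right_mono ennreal_leI) (auto simp: C_def)
        finally have 1: "ennreal \<bar>\<theta> t x - \<theta>' t x - (heat t \<theta>0 x - heat t \<theta>0' x)\<bar> \<le> ennreal C * duhamel 4 t ft x" .
        have "ennreal \<bar>(u t x - u' t x) $ i - (heat t (u0 i) x - heat t (u0' i) x)\<bar> \<le> ennreal C * D" for i
        proof -
          define a where "a = (LBINT s:{0<..<t}. convection_term u i t s x) - (LBINT s:{0<..<t}. convection_term u' i t s x)"
          define b where "b = (LBINT s:{0<..<t}. buoyancy_term \<theta> i t s x) - (LBINT s:{0<..<t}. buoyancy_term \<theta>' i t s x)"
          have "(u t x - u' t x) $ i - (heat t (u0 i) x - heat t (u0' i) x) = b - a" unfolding a_def b_def using elim(2,4) by simp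
          hence "\<bar>(u t x - u' t x) $ i - (heat t (u0 i) x - heat t (u0' i) x)\<bar> \<le> \<bar>a\<bar> + \<bar>b\<bar>" by simp
          hence "ennreal \<bar>(u t x - u' t x) $ i - (heat t (u0 i) x - heat t (u0' i) x)\<bar> \<le> ennreal \<bar>a\<bar> + ennreal \<bar>b\<bar>"
            by (subst ennreal_plus[symmetric]) (auto intro!: ennreal_leI simp del: ennreal_plus)
          also have "\<dots> \<le> ennreal Cc * duhamel 4 t fc x + ennreal Cb * duhamel 3 t (\<lambda>s y. ennreal (\<eta> s y)) x"
            unfolding a_def b_def using elim by (intro add_mono T2 T3) auto
          also have "\<dots> \<le> ennreal Cc * D + ennreal Cb * D"
            unfolding D_def by (intro add_mono mult_left_mono) (auto simp: add_increasing add_increasing2)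
          also have "\<dots> = ennreal (Cc + Cb) * D" using Cc(1) Cb(1) by (simp add: ring_distribs)
          also have "\<dots> \<le> ennreal C * D" using Ct(1) by (intro mult_right_mono ennreal_leI) (auto simp: C_def)
          finally show ?thesis .
        qed
        thus ?case using 1 unfolding D_def by blast
      qed
    qed
  qed
  thus ?thesis using C by blast
qed

end

section \<open>Two solutions with the same data\<close>

locale mild_pair = mild_flows T q u0 \<theta>0 u \<theta> u0 \<theta>0 u' \<theta>' for T q u0 \<theta>0 u \<theta> u' \<theta>'
begin

abbreviation dominated :: "real \<Rightarrow> real \<Rightarrow> bool" where
  "dominated C t \<equiv> (AE x in lborel.
     ennreal (w t x) \<le> ennreal C * (duhamel 4 t fc x + duhamel 3 t (\<lambda>s y. ennreal (\<eta> s y)) x) \<and>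
     ennreal (\<eta> t x) \<le> ennreal C * duhamel 4 t ft x)"

text \<open>Equal data make their heat flows cancel; the factor 3 is the cost of passing from
  components to the Euclidean norm.\<close>

lemma domination:
  "\<exists>C>0. AE t\<in>{0<..<T} in lborel. dominated C t"
proof -
  obtain C where C: "C > 0" "AE t\<in>{0<..<T} in lborel. deviation_bound C t"
    using deviation by blast
  have "AE t\<in>{0<..<T} in lborel. dominated (3 * C) t"
    using C(2)
  proof eventually_elim
    case (elim t)
    show ?case
    proof
      assume "t \<in> {0<..<T}"
      note elim[rule_format, OF this]
      thus "dominated (3 * C) t"
      proof eventually_elim
        case (elim x)
        define D where "D = duhamel 4 t fc x + duhamel 3 t (\<lambda>s y. ennreal (\<eta> s y)) x"
        have "ennreal (w t x) \<le> ennreal \<bar>\<Sum>i\<in>UNIV. \<bar>(u t x - u' t x) $ i\<bar>\<bar>"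
          unfolding w_def using norm_le_l1_cart[of "u t x - u' t x"] by (intro ennreal_leI) (simp add: sum_nonneg)
        also have "\<dots> \<le> of_nat (card (UNIV :: 3 set)) * (ennreal C * D)"
          by (rule ennreal_abs_sum_le) (use elim in \<open>auto simp: D_def\<close>)
        also have "\<dots> = ennreal (3 * C) * D" using C by (simp add: ennreal_mult mult.assoc)
        finally have 1: "ennreal (w t x) \<le> ennreal (3 * C) * D" .
        have "ennreal (\<eta> t x) \<le> ennreal C * duhamel 4 t ft x" using elim by (simp add: \<eta>_def)
        also have "\<dots> \<le> ennreal (3 * C) * duhamel 4 t ft x" using C by (intro mult_right_mono ennreal_leI) auto
        finally show ?case using 1 unfolding D_def by blast
      qed
    qed
  qed
  thus ?thesis using C by (intro exI[of _ "3 * C"]) auto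
qed


text \<open>\<open>e\<close> measures everything small after time \<open>a\<close>: the unbounded
  remainders of the two velocities at \<open>a\<close>, their drift since \<open>a\<close>, and the
  weighted second temperature. \<open>M\<close> bounds the truncated parts.\<close>

definition admissible :: "real \<Rightarrow> real \<Rightarrow> real \<Rightarrow> real \<Rightarrow> bool" where
  "admissible a h e M \<longleftrightarrow> 0 \<le> a \<and> h > 0 \<and> a + h \<le> T \<and> e > 0 \<and> M > 0 \<and>
     (\<exists>v. v \<in> borel_measurable borel \<and> (\<forall>x. norm (v x) \<le> M) \<and> weak_bound 3 e (\<lambda>x. norm (u a x - v x))) \<and>
     (\<exists>v. v \<in> borel_measurable borel \<and> (\<forall>x. norm (v x) \<le> M) \<and> weak_bound 3 e (\<lambda>x. norm (u' a x - v x))) \<and>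
     (\<forall>s. a < s \<and> s < a + h \<longrightarrow> weak_bound 3 e (\<lambda>x. norm (u s x - u a x)) \<and> weak_bound 3 e (\<lambda>x. norm (u' s x - u' a x))) \<and>
     (AE s in lborel. a < s \<and> s < a + h \<longrightarrow> weak_bound q (e * (s - a) powr (- decay q)) (\<theta>' s))"

text \<open>The weight is counted from \<open>a\<close> as in \<open>\<theta>_small\<close>, so that
  every restart looks like the start at time 0.\<close>

definition valid :: "real \<Rightarrow> real \<Rightarrow> real \<Rightarrow> real \<Rightarrow> bool" where
  "valid a h X Y \<longleftrightarrow> (AE s in lborel. a < s \<and> s < a + h \<longrightarrow> weak_bound 3 X (w s) \<and> weak_bound q (Y * (s - a) powr (- decay q)) (\<eta> s))"

definition vanish :: "real \<Rightarrow> bool" where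
  "vanish a \<longleftrightarrow> (AE s\<in>{0<..<a} in lborel. (AE x in lborel. w s x = 0 \<and> \<eta> s x = 0))"

text \<open>All coefficients are small, through \<open>e\<close> or through M sqrt h, except that of
  Y in the velocity bound. It comes from the buoyancy, which is scale invariant and meets no small
  factor; so the coefficient matrix is nearly triangular and not small.\<close>

lemma step:
  "\<exists>K>0. \<forall>a h e M X Y. admissible a h e M \<longrightarrow> vanish a \<longrightarrow> X > 0 \<longrightarrow> Y > 0 \<longrightarrow> valid a h X Y \<longrightarrow>
     valid a h (K * ((e + M * sqrt h) * X + Y)) (K * ((e + M * sqrt h) * Y + e * X))"
proof -
  note [measurable] = A.u_meas B.u_meas A.\<theta>_meas B.\<theta>_meas A.slice_measurable B.slice_measurable
  note qf = A.q_facts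
  let ?\<beta> = "decay q"
  let ?r = "prod_exponent q"
  obtain C where C: "C > 0" and dom: "AE t\<in>{0<..<T} in lborel. dominated C t" using domination by blast
  obtain P1 where "product_bound 3 3 (3/2) P1" using weak_bound_mult[of "3/2" 3 3] by auto
  note P1 = product_boundD[OF this]
  obtain P2 where "product_bound q 3 ?r P2" using weak_bound_mult[of ?r q 3] qf by auto
  note P2 = product_boundD[OF this]
  define D3 where "D3 = dyadic_const 1 3"
  define Dq where "Dq = dyadic_const 1 q"
  have D: "D3 > 0" "Dq > 0" using dyadic_const_pos[of 1 3] dyadic_const_pos[of 1 q] qf by (auto simp: D3_def Dq_def)
  \<comment> \<open>\<open>K1\<close> and \<open>K2\<close> treat the critical products without gain
    in time. \<open>K3\<close> and \<open>K4\<close> treat products with a bounded factor and gain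
    (t - a)^(1/2). \<open>K5\<close> treats the buoyancy, whose gain exactly cancels the
    weight.\<close>
  obtain K1 where "duhamel_bound 4 (3/2) 3 0 (- 0) K1"
    using duhamel_endpoint[of "3/2" 3 0] by auto
  note K1 = duhamel_boundD[OF this]
  obtain K2 where "duhamel_bound 4 ?r q ?\<beta> (- ?\<beta>) K2"
    using duhamel_endpoint[of ?r q ?\<beta>] qf by auto
  note K2 = duhamel_boundD[OF this]
  obtain K3 where "duhamel_bound 4 3 3 0 ((3 - 2) / 2 - 0) K3"
    using duhamel_subcritical[of 3 3 4 2 0] by auto
  note K3 = duhamel_boundD[OF this]
  obtain K4 where "duhamel_bound 4 q q ?\<beta> ((3 - 2) / 2 - ?\<beta>) K4"
    using duhamel_subcritical[of q q 4 2 ?\<beta>] qf by auto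
  note K4 = duhamel_boundD[OF this]
  have g5: "3 / q = 3 - 2 + 3 * (1 / q - 1 / 3)" by simp
  obtain K5 where "duhamel_bound 3 q 3 ?\<beta> ((3 - 3 / q) / 2 - ?\<beta>) K5"
    using duhamel_subcritical[OF _ _ _ g5, of ?\<beta>] qf A.q by auto
  note K5 = duhamel_boundD[OF this]
  have e5: "(3 - 3 / q) / 2 - ?\<beta> = 0" by (simp add: decay_def field_simps)
  define K where "K = C * (4 * K1 * P1) + C * (2 * K3 * D3) + C * (K5 * Dq) + C * (2 * K2 * P2) + C * (K4 * Dq) + 1"
  have nn: "0 \<le> C * (4 * K1 * P1)" "0 \<le> C * (2 * K3 * D3)" "0 \<le> C * (K5 * Dq)" "0 \<le> C * (2 * K2 * P2)" "0 \<le> C * (K4 * Dq)"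
    using C K1(1) K2(1) K3(1) K4(1) K5(1) P1(1) P2(1) D by auto
  have K: "K > 0" "C * (4 * K1 * P1) \<le> K" "C * (2 * K3 * D3) \<le> K" "C * (K5 * Dq) \<le> K" "C * (2 * K2 * P2) \<le> K" "C * (K4 * Dq) \<le> K"
    using nn unfolding K_def by linarith+
  show ?thesis
  proof (intro exI[of _ K] conjI allI impI K(1))
    fix a h e M X Y
    assume adm: "admissible a h e M" and van: "vanish a" and X: "X > 0" and Y: "Y > 0" and val: "valid a h X Y"
    have a: "0 \<le> a" "h > 0" "a + h \<le> T" "e > 0" "M > 0" using adm by (auto simp: admissible_def)
    obtain v where v: "v \<in> borel_measurable borel" "\<And>x. norm (v x) \<le> M" "weak_bound 3 e (\<lambda>x. norm (u a x - v x))"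
      using adm unfolding admissible_def by blast
    obtain v' where v': "v' \<in> borel_measurable borel" "\<And>x. norm (v' x) \<le> M" "weak_bound 3 e (\<lambda>x. norm (u' a x - v' x))"
      using adm unfolding admissible_def by blast
    note [measurable] = v(1) v'(1)
    have un: "weak_bound 3 e (\<lambda>x. norm (u s x - u a x))" "weak_bound 3 e (\<lambda>x. norm (u' s x - u' a x))" if "a < s" "s < a + h" for s
      using adm that unfolding admissible_def by blast+
    have th': "AE s in lborel. a < s \<and> s < a + h \<longrightarrow> weak_bound q (e * (s - a) powr (- ?\<beta>)) (\<theta>' s)"
      using adm unfolding admissible_def by blast
    have key: "AE s in lborel. s \<noteq> a \<and> (s \<in> {0<..<a} \<longrightarrow> (AE x in lborel. w s x = 0 \<and> \<eta> s x = 0)) \<and>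
       (a < s \<and> s < a + h \<longrightarrow> weak_bound 3 X (w s) \<and> weak_bound q (Y * (s - a) powr (- ?\<beta>)) (\<eta> s) \<and> weak_bound q (e * (s - a) powr (- ?\<beta>)) (\<theta>' s))"
      using van val th' AE_lborel_singleton[of a] unfolding vanish_def valid_def by eventually_elim blast
    \<comment> \<open>Each velocity is its drift since \<open>a\<close>, plus the remainder above
      the truncation, plus a part bounded by \<open>M\<close>. \<open>G\<close> and
      \<open>G2\<close> collect the products with a small factor, \<open>L\<close> and
      \<open>L2\<close> those with the bounded part.\<close>
    define G where "G = (\<lambda>s y. ennreal (w s y * norm (u s y - u a y)) + ennreal (w s y * norm (u a y - v y))
       + (ennreal (w s y * norm (u' s y - u' a y)) + ennreal (w s y * norm (u' a y - v' y))))"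
    define G2 where "G2 = (\<lambda>s y. ennreal (\<eta> s y * norm (u s y - u a y)) + ennreal (\<eta> s y * norm (u a y - v y)) + ennreal (\<bar>\<theta>' s y\<bar> * w s y))"
    define L where "L = (\<lambda>s y. ennreal (2 * M) * ennreal (w s y))"
    define L2 where "L2 = (\<lambda>s y. ennreal M * ennreal (\<eta> s y))"
    have Gm[measurable]: "jointly_borel G" "jointly_borel G2"
       "jointly_borel L" "jointly_borel L2"
       "(\<lambda>(s, y). ennreal (\<eta> s y)) \<in> borel_measurable (borel \<Otimes>\<^sub>M borel)"
      unfolding G_def G2_def L_def L2_def by measurable
    have nu: "norm (u s y) \<le> norm (u s y - u a y) + norm (u a y - v y) + M" for s y
      using norm_triangle_ineq[of "u s y - u a y" "u a y"] norm_triangle_ineq[of "u a y - v y" "v y"] v(2)[of y] by simp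
    have nu': "norm (u' s y) \<le> norm (u' s y - u' a y) + norm (u' a y - v' y) + M" for s y
      using norm_triangle_ineq[of "u' s y - u' a y" "u' a y"] norm_triangle_ineq[of "u' a y - v' y" "v' y"] v'(2)[of y] by simp
    have fcG: "fc s y \<le> G s y + L s y" for s y
    proof -
      have "w s y * norm (u s y) + w s y * norm (u' s y) \<le> w s y * (norm (u s y - u a y) + norm (u a y - v y) + M) + w s y * (norm (u' s y - u' a y) + norm (u' a y - v' y) + M)"
        by (intro add_mono mult_left_mono nu nu') auto
      also have "\<dots> = (w s y * norm (u s y - u a y) + w s y * norm (u a y - v y)) + (w s y * norm (u' s y - u' a y) + w s y * norm (u' a y - v' y)) + 2 * M * w s y"
        by (simp add: algebra_simps)
      finally have "fc s y \<le> ennreal \<dots>" unfolding fc_def by (rule ennreal_leI)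
      also have "\<dots> = G s y + L s y" using a by (simp add: G_def L_def ennreal_mult)
      finally show ?thesis .
    qed
    have ftG: "ft s y \<le> G2 s y + L2 s y" for s y
    proof -
      have "\<eta> s y * norm (u s y) + \<bar>\<theta>' s y\<bar> * w s y \<le> \<eta> s y * (norm (u s y - u a y) + norm (u a y - v y) + M) + \<bar>\<theta>' s y\<bar> * w s y"
        by (intro add_right_mono mult_left_mono nu) auto
      also have "\<dots> = (\<eta> s y * norm (u s y - u a y) + \<eta> s y * norm (u a y - v y)) + \<bar>\<theta>' s y\<bar> * w s y + M * \<eta> s y"
        by (simp add: algebra_simps)
      finally have "ft s y \<le> ennreal \<dots>" unfolding ft_def by (rule ennreal_leI)
      also have "\<dots> = G2 s y + L2 s y" using a by (simp add: G2_def L2_def ennreal_mult)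
      finally show ?thesis .
    qed
    let ?bounded = "\<lambda>s. marcinkiewicz (3/2) (4 * P1 * X * e * time_weight a 0 s) (G s) \<and>
        marcinkiewicz 3 (2 * M * D3 * X * time_weight a 0 s) (L s) \<and>
        marcinkiewicz ?r ((2 * P2 * Y * e + P2 * e * X) * time_weight a ?\<beta> s) (G2 s) \<and>
        marcinkiewicz q (M * Dq * Y * time_weight a ?\<beta> s) (L2 s) \<and>
        marcinkiewicz q (Dq * Y * time_weight a ?\<beta> s) (\<lambda>y. ennreal (\<eta> s y))"
    have bounds: "AE s\<in>{0<..<a + h} in lborel.
        ?bounded s"
      using key
    proof eventually_elim
      case (elim s)
      show ?case
      proof
        assume s: "s \<in> {0<..<a + h}"
        show "?bounded s"
        \<comment> \<open>Before \<open>a\<close> the differences vanish by \<open>vanish a\<close>,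
          which matches the value 0 of \<open>time_weight\<close>; so the Duhamel integrals may
          start at 0 although the estimate is restarted at \<open>a\<close>.\<close>
        proof (cases "s < a")
          case True
          hence z: "AE x in lborel. w s x = 0 \<and> \<eta> s x = 0" using elim s by auto
          have tw: "time_weight a b s = 0" for b using True by (simp add: time_weight_def)
          show ?thesis unfolding tw mult_zero_right
            by (intro conjI marcinkiewicz_zero; use z in eventually_elim; simp add: G_def L_def G2_def L2_def)
        next
          case False
          hence s': "a < s" "s < a + h" using elim s by auto
          define \<sigma> where "\<sigma> = (s - a) powr (- ?\<beta>)"
          have \<sigma>: "\<sigma> > 0" using s' by (simp add: \<sigma>_def)
          have tw: "time_weight a 0 s = 1" "time_weight a ?\<beta> s = \<sigma>" using s' by (auto simp: time_weight_def \<sigma>_def)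
          have wX: "weak_bound 3 X (w s)" and hY: "weak_bound q (Y * \<sigma>) (\<eta> s)" and hT: "weak_bound q (e * \<sigma>) (\<theta>' s)"
            using elim s' by (auto simp: \<sigma>_def)
          have Y\<sigma>: "Y * \<sigma> > 0" and e\<sigma>: "e * \<sigma> > 0" using Y a \<sigma> by auto
          have p1: "marcinkiewicz (3/2) (P1 * X * e) (\<lambda>y. ennreal (w s y * norm (u s y - u a y)))"
            using P1(2)[OF wX un(1)[OF s'] X a(4)] by simp
          have p2: "marcinkiewicz (3/2) (P1 * X * e) (\<lambda>y. ennreal (w s y * norm (u a y - v y)))"
            using P1(2)[OF wX v(3) X a(4)] by simp
          have p3: "marcinkiewicz (3/2) (P1 * X * e) (\<lambda>y. ennreal (w s y * norm (u' s y - u' a y)))"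
            using P1(2)[OF wX un(2)[OF s'] X a(4)] by simp
          have p4: "marcinkiewicz (3/2) (P1 * X * e) (\<lambda>y. ennreal (w s y * norm (u' a y - v' y)))"
            using P1(2)[OF wX v'(3) X a(4)] by simp
          have P1n: "P1 * X * e \<ge> 0" using P1(1) X a by simp
          have b1: "marcinkiewicz (3/2) (P1 * X * e + P1 * X * e + (P1 * X * e + P1 * X * e)) (G s)"
            unfolding G_def by (intro marcinkiewicz_add p1 p2 p3 p4 add_nonneg_nonneg P1n) measurable
          have m3: "marcinkiewicz 3 (D3 * X) (\<lambda>y. ennreal (w s y))"
            using weak_bound_imp_marcinkiewicz[OF wX _ X] by (simp add: D3_def)
          have b2: "marcinkiewicz 3 (2 * M * (D3 * X)) (L s)"
            unfolding L_def by (intro marcinkiewicz_cmult m3) (use a in auto)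
          have r1: "marcinkiewicz ?r (P2 * (Y * \<sigma>) * e) (\<lambda>y. ennreal (\<eta> s y * norm (u s y - u a y)))"
            using P2(2)[OF hY un(1)[OF s'] Y\<sigma> a(4)] by simp
          have r2: "marcinkiewicz ?r (P2 * (Y * \<sigma>) * e) (\<lambda>y. ennreal (\<eta> s y * norm (u a y - v y)))"
            using P2(2)[OF hY v(3) Y\<sigma> a(4)] by simp
          have r3: "marcinkiewicz ?r (P2 * (e * \<sigma>) * X) (\<lambda>y. ennreal (\<bar>\<theta>' s y\<bar> * w s y))"
            using P2(2)[OF hT wX e\<sigma> X] by simp
          have P2n: "P2 * (Y * \<sigma>) * e \<ge> 0" "P2 * (e * \<sigma>) * X \<ge> 0" using P2(1) X a Y\<sigma> e\<sigma> by simp_all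
          have b3: "marcinkiewicz ?r (P2 * (Y * \<sigma>) * e + P2 * (Y * \<sigma>) * e + P2 * (e * \<sigma>) * X) (G2 s)"
            unfolding G2_def by (intro marcinkiewicz_add r1 r2 r3 add_nonneg_nonneg P2n) measurable
          have mq: "marcinkiewicz q (Dq * (Y * \<sigma>)) (\<lambda>y. ennreal (\<eta> s y))"
            using weak_bound_imp_marcinkiewicz[OF hY _ Y\<sigma>] qf by (simp add: Dq_def)
          have b4: "marcinkiewicz q (M * (Dq * (Y * \<sigma>))) (L2 s)"
            unfolding L2_def by (intro marcinkiewicz_cmult mq) (use a in auto)
          have e1: "P1 * X * e + P1 * X * e + (P1 * X * e + P1 * X * e) = 4 * P1 * X * e * 1" by simp
          have e2: "2 * M * (D3 * X) = 2 * M * D3 * X * 1" by simp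
          have e3: "P2 * (Y * \<sigma>) * e + P2 * (Y * \<sigma>) * e + P2 * (e * \<sigma>) * X = (2 * P2 * Y * e + P2 * e * X) * \<sigma>" by (simp add: algebra_simps)
          have e4: "M * (Dq * (Y * \<sigma>)) = M * Dq * Y * \<sigma>" "Dq * (Y * \<sigma>) = Dq * Y * \<sigma>" by simp_all
          show ?thesis unfolding tw
            using b1[unfolded e1] b2[unfolded e2] b3[unfolded e3] b4[unfolded e4(1)] mq[unfolded e4(2)] by blast
        qed
      qed
    qed
    show "valid a h (K * ((e + M * sqrt h) * X + Y)) (K * ((e + M * sqrt h) * Y + e * X))"
      unfolding valid_def using dom
    proof eventually_elim
      case (elim t)
      show ?case
      proof
        assume t: "a < t \<and> t < a + h"
        have tT: "t \<in> {0<..<T}" using t a by auto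
        have bt: "AE s\<in>{0<..<t} in lborel.
          ?bounded s"
          using bounds by eventually_elim (use t in auto)
        have bt1: "AE s\<in>{0<..<t} in lborel. marcinkiewicz (3/2) (4 * P1 * X * e * time_weight a 0 s) (G s)"
         and bt2: "AE s\<in>{0<..<t} in lborel. marcinkiewicz 3 (2 * M * D3 * X * time_weight a 0 s) (L s)"
         and bt3: "AE s\<in>{0<..<t} in lborel. marcinkiewicz ?r ((2 * P2 * Y * e + P2 * e * X) * time_weight a ?\<beta> s) (G2 s)"
         and bt4: "AE s\<in>{0<..<t} in lborel. marcinkiewicz q (M * Dq * Y * time_weight a ?\<beta> s) (L2 s)"
         and bt5: "AE s\<in>{0<..<t} in lborel. marcinkiewicz q (Dq * Y * time_weight a ?\<beta> s) (\<lambda>y. ennreal (\<eta> s y))"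
          using bt by (eventually_elim, blast)+
        define \<tau> where "\<tau> = (t - a) powr (- ?\<beta>)"
        have \<tau>: "\<tau> > 0" using t by (simp add: \<tau>_def)
        have ta: "(t - a) powr (1/2) \<le> sqrt h" using t by (simp add: powr_half_sqrt)
        have d1: "marcinkiewicz 3 (K1 * (4 * P1 * X * e)) (duhamel 4 t G)"
          using K1(2)[OF a(1) _ _ Gm(1) bt1] t P1(1) X a by simp
        have d2: "marcinkiewicz 3 (K3 * (2 * M * D3 * X) * sqrt h) (duhamel 4 t L)"
        proof (rule marcinkiewicz_mono)
          show "marcinkiewicz 3 (K3 * (2 * M * D3 * X) * (t - a) powr ((3 - 2) / 2 - 0)) (duhamel 4 t L)"
            using K3(2)[OF a(1) _ _ Gm(3) bt2] t D X a by simp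
          show "K3 * (2 * M * D3 * X) * (t - a) powr ((3 - 2) / 2 - 0) \<le> K3 * (2 * M * D3 * X) * sqrt h"
            using ta K3(1) a D X by (intro mult_left_mono) auto
        qed simp
        have d3: "marcinkiewicz q (K2 * (2 * P2 * Y * e + P2 * e * X) * \<tau>) (duhamel 4 t G2)"
          using K2(2)[OF a(1) _ _ Gm(2) bt3] t P2(1) X Y a by (simp add: \<tau>_def)
        have d4: "marcinkiewicz q (K4 * (M * Dq * Y) * (sqrt h * \<tau>)) (duhamel 4 t L2)"
        proof (rule marcinkiewicz_mono)
          show "marcinkiewicz q (K4 * (M * Dq * Y) * (t - a) powr ((3 - 2) / 2 - ?\<beta>)) (duhamel 4 t L2)"
            using K4(2)[OF a(1) _ _ Gm(4) bt4] t D Y a by simp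
          have "(t - a) powr ((3 - 2) / 2 - ?\<beta>) = (t - a) powr (1/2) * \<tau>"
            unfolding \<tau>_def powr_add[symmetric] by simp
          also have "\<dots> \<le> sqrt h * \<tau>" using ta \<tau> by (intro mult_right_mono) auto
          finally show "K4 * (M * Dq * Y) * (t - a) powr ((3 - 2) / 2 - ?\<beta>) \<le> K4 * (M * Dq * Y) * (sqrt h * \<tau>)"
            using K4(1) a D Y by (intro mult_left_mono) auto
        qed simp
        have d5: "marcinkiewicz 3 (K5 * (Dq * Y)) (duhamel 3 t (\<lambda>s y. ennreal (\<eta> s y)))"
          using K5(2)[OF a(1) _ _ Gm(5) bt5] t D Y unfolding e5 by simp
        have wm: "marcinkiewicz 3 (C * (K1 * (4 * P1 * X * e) + K3 * (2 * M * D3 * X) * sqrt h + K5 * (Dq * Y))) (\<lambda>x. ennreal C * (duhamel 4 t G x + duhamel 4 t L x + duhamel 3 t (\<lambda>s y. ennreal (\<eta> s y)) x))"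
          using C K1(1) K3(1) K5(1) P1(1) D X Y a
          by (intro marcinkiewicz_cmult marcinkiewicz_add d1 d2 d5 add_nonneg_nonneg borel_measurable_add borel_measurable_duhamel Gm) auto
        have hm: "marcinkiewicz q (C * (K2 * (2 * P2 * Y * e + P2 * e * X) * \<tau> + K4 * (M * Dq * Y) * (sqrt h * \<tau>))) (\<lambda>x. ennreal C * (duhamel 4 t G2 x + duhamel 4 t L2 x))"
          using C K2(1) K4(1) P2(1) D X Y a \<tau>
          by (intro marcinkiewicz_cmult marcinkiewicz_add d3 d4 borel_measurable_add borel_measurable_duhamel Gm) auto
        have domt: "dominated C t" using elim tT by blast
        have du1: "duhamel 4 t fc x \<le> duhamel 4 t G x + duhamel 4 t L x" for x
          using duhamel_mono[of fc "\<lambda>s y. G s y + L s y" 4 t x, OF fcG] unfolding duhamel_add[OF Gm(1) Gm(3)] .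
        have du2: "duhamel 4 t ft x \<le> duhamel 4 t G2 x + duhamel 4 t L2 x" for x
          using duhamel_mono[of ft "\<lambda>s y. G2 s y + L2 s y" 4 t x, OF ftG] unfolding duhamel_add[OF Gm(2) Gm(4)] .
        have w1: "marcinkiewicz 3 (K * ((e + M * sqrt h) * X + Y)) (\<lambda>x. ennreal \<bar>w t x\<bar>)"
        proof (rule marcinkiewicz_mono_AE[OF wm])
          show "AE x in lborel. ennreal \<bar>w t x\<bar> \<le> ennreal C * (duhamel 4 t G x + duhamel 4 t L x + duhamel 3 t (\<lambda>s y. ennreal (\<eta> s y)) x)"
            using domt
          proof eventually_elim
            case (elim x)
            have "ennreal (w t x) \<le> ennreal C * (duhamel 4 t fc x + duhamel 3 t (\<lambda>s y. ennreal (\<eta> s y)) x)" using elim by blast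
            also have "\<dots> \<le> ennreal C * (duhamel 4 t G x + duhamel 4 t L x + duhamel 3 t (\<lambda>s y. ennreal (\<eta> s y)) x)"
              by (intro mult_left_mono add_right_mono du1) simp
            finally show ?case by simp
          qed
          have "C * (K1 * (4 * P1 * X * e) + K3 * (2 * M * D3 * X) * sqrt h + K5 * (Dq * Y))
            = C * (4 * K1 * P1) * (e * X) + C * (2 * K3 * D3) * (M * sqrt h * X) + C * (K5 * Dq) * Y"
            by (simp add: algebra_simps)
          also have "\<dots> \<le> K * (e * X) + K * (M * sqrt h * X) + K * Y"
            using a X Y by (intro add_mono mult_right_mono K) auto
          also have "\<dots> = K * ((e + M * sqrt h) * X + Y)" by (simp add: algebra_simps)
          finally show "C * (K1 * (4 * P1 * X * e) + K3 * (2 * M * D3 * X) * sqrt h + K5 * (Dq * Y)) \<le> K * ((e + M * sqrt h) * X + Y)" .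
        qed
        have h1: "marcinkiewicz q (K * ((e + M * sqrt h) * Y + e * X) * \<tau>) (\<lambda>x. ennreal \<bar>\<eta> t x\<bar>)"
        proof (rule marcinkiewicz_mono_AE[OF hm])
          show "AE x in lborel. ennreal \<bar>\<eta> t x\<bar> \<le> ennreal C * (duhamel 4 t G2 x + duhamel 4 t L2 x)"
            using domt
          proof eventually_elim
            case (elim x)
            have "ennreal (\<eta> t x) \<le> ennreal C * duhamel 4 t ft x" using elim by blast
            also have "\<dots> \<le> ennreal C * (duhamel 4 t G2 x + duhamel 4 t L2 x)"
              by (intro mult_left_mono du2) simp
            finally show ?case by simp
          qed
          have "C * (K2 * (2 * P2 * Y * e + P2 * e * X) * \<tau> + K4 * (M * Dq * Y) * (sqrt h * \<tau>))
            = (C * (2 * K2 * P2) * (e * Y) + C * (2 * K2 * P2) * (e * X / 2) + C * (K4 * Dq) * (M * sqrt h * Y)) * \<tau>"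
            by (simp add: algebra_simps)
          also have "\<dots> \<le> (K * (e * Y) + K * (e * X / 2) + K * (M * sqrt h * Y)) * \<tau>"
            using a X Y \<tau> by (intro mult_right_mono add_mono K) auto
          also have "\<dots> \<le> (K * (e * Y) + K * (e * X) + K * (M * sqrt h * Y)) * \<tau>"
            using a X K(1) \<tau> by (intro mult_right_mono add_mono mult_left_mono) auto
          also have "\<dots> = K * ((e + M * sqrt h) * Y + e * X) * \<tau>" by (simp add: algebra_simps)
          finally show "C * (K2 * (2 * P2 * Y * e + P2 * e * X) * \<tau> + K4 * (M * Dq * Y) * (sqrt h * \<tau>)) \<le> K * ((e + M * sqrt h) * Y + e * X) * \<tau>" .
        qed
        show "weak_bound 3 (K * ((e + M * sqrt h) * X + Y)) (w t) \<and>
          weak_bound q (K * ((e + M * sqrt h) * Y + e * X) * (t - a) powr (- decay q)) (\<eta> t)"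
          using marcinkiewicz_imp_weak_bound[OF w1] marcinkiewicz_imp_weak_bound[OF h1] K(1) a X Y \<tau> qf
          by (simp add: \<tau>_def)
      qed
    qed
  qed
qed


text \<open>The order of choices matters: first \<open>e\<close>, then the height \<open>M\<close>
  needed to truncate up to \<open>e\<close>, and last \<open>h\<close>, at most (e / M)^2, so that M
  sqrt h is again at most \<open>e\<close>.\<close>

lemma admissible_exists:
  assumes a: "0 \<le> a" "a < T" and d: "\<delta> > 0"
  shows "\<exists>h e M. admissible a h e M \<and> e + M * sqrt h \<le> \<delta> \<and>
    (AE s in lborel. a < s \<and> s < a + h \<longrightarrow> weak_bound q (e * (s - a) powr (- decay q)) (\<theta> s))"
proof -
  define e where "e = \<delta> / 2"
  have e: "e > 0" using d by (simp add: e_def)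
  have aT: "a \<in> {0..T}" using a by auto
  obtain M1 v1 where M1: "M1 > 0" "v1 \<in> borel_measurable borel" "\<forall>x. norm (v1 x) \<le> M1" "weak_bound 3 e (\<lambda>x. norm (u a x - v1 x))"
    using L3_truncation[OF C_LpD(1)[OF A.u_C aT] e] by blast
  obtain M2 v2 where M2: "M2 > 0" "v2 \<in> borel_measurable borel" "\<forall>x. norm (v2 x) \<le> M2" "weak_bound 3 e (\<lambda>x. norm (u' a x - v2 x))"
    using L3_truncation[OF C_LpD(1)[OF B.u_C aT] e] by blast
  define M where "M = max M1 M2"
  have M: "M > 0" using M1 by (simp add: M_def)
  obtain d1 where d1: "d1 > 0" "\<forall>s\<in>{0..T}. \<bar>s - a\<bar> < d1 \<longrightarrow> weak_bound 3 e (\<lambda>x. norm (u s x - u a x))"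
    using A.u_near[OF aT e] by blast
  obtain d2 where d2: "d2 > 0" "\<forall>s\<in>{0..T}. \<bar>s - a\<bar> < d2 \<longrightarrow> weak_bound 3 e (\<lambda>x. norm (u' s x - u' a x))"
    using B.u_near[OF aT e] by blast
  obtain d3 where d3: "d3 > 0" "AE s in lborel. a < s \<and> s < a + d3 \<and> s < T \<longrightarrow> weak_bound q (e * (s - a) powr (- decay q)) (\<theta> s)"
    using A.\<theta>_small[OF a e] by blast
  obtain d4 where d4: "d4 > 0" "AE s in lborel. a < s \<and> s < a + d4 \<and> s < T \<longrightarrow> weak_bound q (e * (s - a) powr (- decay q)) (\<theta>' s)"
    using B.\<theta>_small[OF a e] by blast
  define h where "h = min (T - a) (min (min d1 d2) (min (min d3 d4) ((e / M)\<^sup>2)))"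
  have h: "h > 0" "h \<le> T - a" "h \<le> d1" "h \<le> d2" "h \<le> d3" "h \<le> d4" "h \<le> (e / M)\<^sup>2"
    using a d1(1) d2(1) d3(1) d4(1) e M by (auto simp: h_def)
  have "sqrt h \<le> sqrt ((e / M)\<^sup>2)" using h(7) by (rule real_sqrt_le_mono)
  hence "sqrt h \<le> e / M" using e M by simp
  hence "e + M * sqrt h \<le> \<delta>" using M by (simp add: field_simps e_def)
  moreover have "AE s in lborel. a < s \<and> s < a + h \<longrightarrow> weak_bound q (e * (s - a) powr (- decay q)) (\<theta> s)"
    using d3(2) by eventually_elim (use h in auto)
  moreover have "AE s in lborel. a < s \<and> s < a + h \<longrightarrow> weak_bound q (e * (s - a) powr (- decay q)) (\<theta>' s)"
    using d4(2) by eventually_elim (use h in auto)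
  moreover have "weak_bound 3 e (\<lambda>x. norm (u s x - u a x)) \<and> weak_bound 3 e (\<lambda>x. norm (u' s x - u' a x))" if "a < s" "s < a + h" for s
    using d1(2) d2(2) that h a by simp
  moreover have "\<forall>x. norm (v1 x) \<le> M" "\<forall>x. norm (v2 x) \<le> M" using M1(3) M2(3) by (auto simp: M_def le_max_iff_disj)
  moreover have "a + h \<le> T" using h(2) by simp
  ultimately show ?thesis
    unfolding admissible_def using a(1) h(1) e M M1(2,4) M2(2,4)
    by (intro exI[of _ h] exI[of _ e] exI[of _ M] conjI exI[of _ v1] exI[of _ v2] allI impI; blast)
qed

text \<open>Some finite \<open>X\<close> is enough, since the bound will be halved indefinitely. The
  8 is 4 (1 + 1), from adding the two small temperatures by \<open>weak_bound_add\<close>.\<close>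

lemma valid_start:
  assumes adm: "admissible a h e M" and th: "AE s in lborel. a < s \<and> s < a + h \<longrightarrow> weak_bound q (e * (s - a) powr (- decay q)) (\<theta> s)"
  shows "\<exists>X>0. valid a h X (8 * e)"
proof -
  note [measurable] = A.slice_measurable B.slice_measurable
  have a: "0 \<le> a" "h > 0" "a + h \<le> T" "e > 0" using adm by (auto simp: admissible_def)
  have un: "weak_bound 3 e (\<lambda>x. norm (u s x - u a x))" "weak_bound 3 e (\<lambda>x. norm (u' s x - u' a x))" if "a < s" "s < a + h" for s
    using adm that unfolding admissible_def by blast+
  have aT: "a \<in> {0..T}" using a by auto
  obtain A1 where A1: "A1 > 0" "weak_bound 3 A1 (\<lambda>x. norm (u a x))" using A.u_weak[OF aT] by blast
  obtain A2 where A2: "A2 > 0" "weak_bound 3 A2 (\<lambda>x. norm (u' a x))" using B.u_weak[OF aT] by blast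
  \<comment> \<open>Nested use of \<open>weak_bound_add\<close>: drifts, values at \<open>a\<close>,
    and their sum.\<close>
  define X where "X = 4 * (4 * (e + e) + 4 * (A1 + A2))"
  have X: "X > 0" using a A1 A2 by (simp add: X_def)
  have th': "AE s in lborel. a < s \<and> s < a + h \<longrightarrow> weak_bound q (e * (s - a) powr (- decay q)) (\<theta>' s)"
    using adm unfolding admissible_def by blast
  have "valid a h X (8 * e)"
    unfolding valid_def using th th'
  proof eventually_elim
    case (elim s)
    show ?case
    proof
      assume s: "a < s \<and> s < a + h"
      define \<sigma> where "\<sigma> = (s - a) powr (- decay q)"
      have \<sigma>: "\<sigma> > 0" using s by (simp add: \<sigma>_def)
      have b1: "weak_bound 3 (4 * (e + e)) (\<lambda>x. \<bar>norm (u s x - u a x)\<bar> + \<bar>norm (u' s x - u' a x)\<bar>)"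
        using un[of s] s a by (intro weak_bound_add) auto
      have b2: "weak_bound 3 (4 * (A1 + A2)) (\<lambda>x. \<bar>norm (u a x)\<bar> + \<bar>norm (u' a x)\<bar>)"
        using A1 A2 by (intro weak_bound_add) auto
      have b3: "weak_bound 3 X (\<lambda>x. \<bar>\<bar>norm (u s x - u a x)\<bar> + \<bar>norm (u' s x - u' a x)\<bar>\<bar> + \<bar>\<bar>norm (u a x)\<bar> + \<bar>norm (u' a x)\<bar>\<bar>)"
        unfolding X_def using a A1 A2 by (intro weak_bound_add b1 b2) auto
      have wX: "weak_bound 3 X (w s)"
      proof (rule weak_bound_mono_AE[OF b3])
        have "w s x \<le> norm (u s x - u a x) + norm (u' s x - u' a x) + (norm (u a x) + norm (u' a x))" for x
        proof -
          have "u s x - u' s x = (u s x - u a x) - (u' s x - u' a x) + (u a x - u' a x)" by simp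
          hence "w s x \<le> norm ((u s x - u a x) - (u' s x - u' a x)) + norm (u a x - u' a x)"
            unfolding w_def by (simp only: norm_triangle_ineq)
          also have "\<dots> \<le> (norm (u s x - u a x) + norm (u' s x - u' a x)) + (norm (u a x) + norm (u' a x))"
            by (intro add_mono norm_triangle_ineq4)
          finally show ?thesis .
        qed
        thus "AE x in lborel. \<bar>w s x\<bar> \<le> \<bar>\<bar>\<bar>norm (u s x - u a x)\<bar> + \<bar>norm (u' s x - u' a x)\<bar>\<bar> + \<bar>\<bar>norm (u a x)\<bar> + \<bar>norm (u' a x)\<bar>\<bar>\<bar>"
          by (intro AE_I2) (simp add: add_nonneg_nonneg)
      qed measurable
      have "weak_bound q (e * \<sigma>) (\<theta> s)" "weak_bound q (e * \<sigma>) (\<theta>' s)" using elim s by (auto simp: \<sigma>_def)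
      hence c1: "weak_bound q (4 * (e * \<sigma> + e * \<sigma>)) (\<lambda>x. \<bar>\<theta> s x\<bar> + \<bar>\<theta>' s x\<bar>)"
        using a \<sigma> A.q_facts by (intro weak_bound_add) auto
      have "weak_bound q (4 * (e * \<sigma> + e * \<sigma>)) (\<eta> s)"
        by (rule weak_bound_mono_AE[OF c1]) (auto simp: \<eta>_def)
      thus "weak_bound 3 X (w s) \<and> weak_bound q (8 * e * (s - a) powr (- decay q)) (\<eta> s)"
        using wX by (simp add: \<sigma>_def mult.assoc)
    qed
  qed
  thus ?thesis using X by blast
qed

lemma valid_mono:
  assumes "valid a h X Y" "X \<le> X'" "Y \<le> Y'" "X \<ge> 0" "Y \<ge> 0"
  shows "valid a h X' Y'"
  using assms(1) unfolding valid_def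
proof eventually_elim
  case (elim s)
  show ?case
  proof
    assume "a < s \<and> s < a + h"
    hence *: "weak_bound 3 X (w s)" "weak_bound q (Y * (s - a) powr (- decay q)) (\<eta> s)" using elim by blast+
    have le: "Y * (s - a) powr (- decay q) \<le> Y' * (s - a) powr (- decay q)" using assms(3) by (rule mult_right_mono) simp
    have "weak_bound 3 X' (w s)" by (rule weak_bound_mono[OF *(1)]) (use assms in simp_all)
    moreover have "weak_bound q (Y' * (s - a) powr (- decay q)) (\<eta> s)"
      by (rule weak_bound_mono[OF *(2) le]) (use assms A.q_facts in simp_all)
    ultimately show "weak_bound 3 X' (w s) \<and> weak_bound q (Y' * (s - a) powr (- decay q)) (\<eta> s)" by blast
  qed
qed

text \<open>The bounds are kept in the ratio Y = X / (4 K), so that the buoyancy contributes only X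
  / 4 to the next velocity bound; \<open>step\<close> then halves the pair.\<close>

lemma local_uniqueness:
  assumes a: "0 \<le> a" "a < T" and van: "vanish a"
  shows "\<exists>h>0. a + h \<le> T \<and> vanish (a + h)"
proof -
  obtain K where K: "K > 0" and step: "\<And>a h e M X Y. admissible a h e M \<Longrightarrow> vanish a \<Longrightarrow> X > 0 \<Longrightarrow> Y > 0 \<Longrightarrow> valid a h X Y \<Longrightarrow>
     valid a h (K * ((e + M * sqrt h) * X + Y)) (K * ((e + M * sqrt h) * Y + e * X))"
    using step by blast
  \<comment> \<open>Chosen for two purposes: K \<delta> <= 1/4 leaves X / 2 in the velocity bound,
    and \<delta> (1/4 + K) <= 1 / (8 K) halves the temperature bound.\<close>
  define \<delta> where "\<delta> = 1 / (8 * K * (K + 1))"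
  have \<delta>: "\<delta> > 0" using K by (simp add: \<delta>_def)
  have "K * \<delta> = 1 / (8 * (K + 1))" using K by (simp add: \<delta>_def)
  also have "\<dots> \<le> 1 / 4" using K by (intro divide_left_mono) auto
  finally have \<delta>K: "K * \<delta> \<le> 1/4" .
  have \<delta>K2: "\<delta> * (1/4 + K) \<le> 1 / (8 * K)"
  proof -
    have "\<delta> * (1/4 + K) \<le> \<delta> * (K + 1)" using \<delta> by (intro mult_left_mono) auto
    also have "\<dots> = 1 / (8 * K)" using K by (simp add: \<delta>_def)
    finally show ?thesis .
  qed
  obtain h e M where adm: "admissible a h e M" and sm: "e + M * sqrt h \<le> \<delta>"
    and th: "AE s in lborel. a < s \<and> s < a + h \<longrightarrow> weak_bound q (e * (s - a) powr (- decay q)) (\<theta> s)"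
    using admissible_exists[OF a \<delta>] by blast
  have h: "h > 0" "a + h \<le> T" "e > 0" "M > 0" using adm by (auto simp: admissible_def)
  have Mh: "M * sqrt h \<ge> 0" using h by simp
  have e\<delta>: "e \<le> \<delta>" "e + M * sqrt h \<ge> 0" using sm h(3) Mh by linarith+
  obtain X1 where X1: "X1 > 0" "valid a h X1 (8 * e)" using valid_start[OF adm th] by blast
  \<comment> \<open>The second entry makes 8 e at most X0 / (4 K), so the starting bounds have the
    required ratio.\<close>
  define X0 where "X0 = max X1 (32 * K * e)"
  have X0: "X0 > 0" using X1 by (simp add: X0_def)
  have halves: "valid a h (X0 / 2 ^ n) (X0 / 2 ^ n / (4 * K))" for n
  proof (induction n)
    case 0
    have "8 * e \<le> X0 / (4 * K)" using K by (simp add: X0_def field_simps le_max_iff_disj)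
    thus ?case using valid_mono[OF X1(2), of X0 "X0 / (4 * K)"] X1 h by (simp add: X0_def)
  next
    case (Suc n)
    define X where "X = X0 / 2 ^ n"
    have X: "X > 0" using X0 by (simp add: X_def)
    have v: "valid a h (K * ((e + M * sqrt h) * X + X / (4 * K))) (K * ((e + M * sqrt h) * (X / (4 * K)) + e * X))"
    proof (rule step[OF adm van X])
      show "X / (4 * K) > 0" using X K by (intro divide_pos_pos) simp_all
      show "valid a h X (X / (4 * K))" using Suc unfolding X_def .
    qed
    have "valid a h (X / 2) (X / (8 * K))"
    proof (rule valid_mono[OF v])
      have "(e + M * sqrt h) * X \<le> \<delta> * X" using sm X by (intro mult_right_mono) auto
      hence "K * ((e + M * sqrt h) * X + X / (4 * K)) \<le> K * (\<delta> * X + X / (4 * K))"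
        using K by (intro mult_left_mono add_right_mono) auto
      also have "\<dots> = (K * \<delta>) * X + X / 4" using K by (simp add: field_simps)
      also have "\<dots> \<le> 1/4 * X + X / 4" using \<delta>K X by (intro add_right_mono mult_right_mono) auto
      finally show "K * ((e + M * sqrt h) * X + X / (4 * K)) \<le> X / 2" by simp
      have "(e + M * sqrt h) * (X / (4 * K)) + e * X \<le> \<delta> * (X / (4 * K)) + \<delta> * X"
        using sm e\<delta> X K by (intro add_mono mult_right_mono) auto
      hence "K * ((e + M * sqrt h) * (X / (4 * K)) + e * X) \<le> K * (\<delta> * (X / (4 * K)) + \<delta> * X)"
        using K by (intro mult_left_mono) auto
      also have "\<dots> = (\<delta> * (1/4 + K)) * X" using K by (simp add: field_simps)
      also have "\<dots> \<le> 1 / (8 * K) * X" using \<delta>K2 X by (intro mult_right_mono) auto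
      finally show "K * ((e + M * sqrt h) * (X / (4 * K)) + e * X) \<le> X / (8 * K)" by simp
      have "X / (4 * K) \<ge> 0" using X K by simp
      moreover have "e * X \<ge> 0" using X h(3) by simp
      moreover have "(e + M * sqrt h) * X \<ge> 0" using e\<delta>(2) X by simp
      moreover have "(e + M * sqrt h) * (X / (4 * K)) \<ge> 0" using e\<delta>(2) \<open>X / (4 * K) \<ge> 0\<close> by (rule mult_nonneg_nonneg)
      ultimately have "(e + M * sqrt h) * X + X / (4 * K) \<ge> 0" "(e + M * sqrt h) * (X / (4 * K)) + e * X \<ge> 0"
        by linarith+
      thus "K * ((e + M * sqrt h) * X + X / (4 * K)) \<ge> 0" "K * ((e + M * sqrt h) * (X / (4 * K)) + e * X) \<ge> 0"
        using K by simp_all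
    qed
    moreover have "X / 2 = X0 / 2 ^ Suc n" by (simp add: X_def)
    moreover have "X / (8 * K) = X0 / 2 ^ Suc n / (4 * K)" by (simp add: X_def)
    ultimately show ?case by simp
  qed
  \<comment> \<open>The exceptional times for all n are united before n tends to infinity at a fixed
    time.\<close>
  have "AE s in lborel. \<forall>n. a < s \<and> s < a + h \<longrightarrow> weak_bound 3 (X0 / 2 ^ n) (w s) \<and> weak_bound q (X0 / 2 ^ n / (4 * K) * (s - a) powr (- decay q)) (\<eta> s)"
    unfolding AE_all_countable using halves unfolding valid_def by blast
  hence "AE s\<in>{0<..<a + h} in lborel. (AE x in lborel. w s x = 0 \<and> \<eta> s x = 0)"
    using van[unfolded vanish_def] AE_lborel_singleton[of a]
  proof eventually_elim
    case (elim s)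
    show ?case
    proof
      assume s: "s \<in> {0<..<a + h}"
      show "AE x in lborel. w s x = 0 \<and> \<eta> s x = 0"
      proof (cases "s < a")
        case True
        thus ?thesis using elim s by auto
      next
        case False
        hence s': "a < s" "s < a + h" using elim s by auto
        have small: "\<exists>n. c / 2 ^ n \<le> d" if "d > 0" "c > 0" for c d :: real
        proof -
          obtain n where "c / d < 2 ^ n" using real_arch_pow[of 2 "c / d"] by auto
          thus ?thesis using that by (intro exI[of _ n]) (simp add: field_simps)
        qed
        have "AE x in lborel. w s x = 0"
        proof (rule weak_bound_vanish)
          fix d :: real assume "d > 0"
          from small[OF this X0] obtain n where "X0 / 2 ^ n \<le> d" ..
          thus "\<exists>A\<le>d. A \<ge> 0 \<and> weak_bound 3 A (w s)" using elim s' X0 by (intro exI[of _ "X0 / 2 ^ n"]) auto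
        qed auto
        moreover have "AE x in lborel. \<eta> s x = 0"
        proof (rule weak_bound_vanish)
          fix d :: real assume d: "d > 0"
          define c where "c = X0 / (4 * K) * (s - a) powr (- decay q)"
          have c: "c > 0" using X0 K s' by (simp add: c_def)
          from small[OF d c] obtain n where "c / 2 ^ n \<le> d" ..
          moreover have eq: "X0 / 2 ^ n / (4 * K) * (s - a) powr (- decay q) = c / 2 ^ n" by (simp add: c_def)
          have "weak_bound q (X0 / 2 ^ n / (4 * K) * (s - a) powr (- decay q)) (\<eta> s)" using elim s' by blast
          hence "weak_bound q (c / 2 ^ n) (\<eta> s)" unfolding eq .
          moreover have "c / 2 ^ n \<ge> 0" using c by simp
          ultimately show "\<exists>A\<le>d. A \<ge> 0 \<and> weak_bound q A (\<eta> s)" by blast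
        qed (use A.q_facts in auto)
        ultimately show ?thesis by eventually_elim simp
      qed
    qed
  qed
  hence "vanish (a + h)" unfolding vanish_def .
  thus ?thesis using h by blast
qed

text \<open>Continuation: vanishing up to the supremum follows from countably many times approaching
  it, and \<open>local_uniqueness\<close> would pass beyond a supremum smaller than
  \<open>T\<close>.\<close>

lemma vanish_T: "vanish T"
proof -
  define S where "S = {a \<in> {0..T}. vanish a}"
  have "vanish 0" unfolding vanish_def by simp
  hence S0: "0 \<in> S" using A.T by (simp add: S_def)
  have bdd: "bdd_above S" by (rule bdd_aboveI[of _ T]) (simp add: S_def)
  define b where "b = Sup S"
  have b: "0 \<le> b" "b \<le> T"
  proof -
    show "0 \<le> b" unfolding b_def by (rule cSup_upper[OF S0 bdd])
    show "b \<le> T" unfolding b_def by (rule cSup_least) (use S0 in \<open>auto simp: S_def\<close>)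
  qed
  have "\<exists>c. c \<in> S \<and> b - 1 / real (Suc n) < c" for n
  proof -
    have "b - 1 / real (Suc n) < Sup S" unfolding b_def by simp
    moreover have "S \<noteq> {}" using S0 by blast
    ultimately show ?thesis using less_cSup_iff[of S] bdd by blast
  qed
  hence "\<forall>n. \<exists>c. c \<in> S \<and> b - 1 / real (Suc n) < c" ..
  from choice[OF this] obtain c where "\<forall>n. c n \<in> S \<and> b - 1 / real (Suc n) < c n" ..
  hence c: "\<And>n. c n \<in> S" "\<And>n. b - 1 / real (Suc n) < c n" by blast+
  have "\<forall>n. vanish (c n)" using c(1) by (auto simp: S_def)
  hence "AE s in lborel. \<forall>n. s \<in> {0<..<c n} \<longrightarrow> (AE x in lborel. w s x = 0 \<and> \<eta> s x = 0)"
    unfolding vanish_def AE_all_countable .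
  hence vb: "vanish b"
    unfolding vanish_def
  proof eventually_elim
    case (elim s)
    show ?case
    proof
      assume s: "s \<in> {0<..<b}"
      hence "0 < b - s" by simp
      from reals_Archimedean[OF this] obtain n where "inverse (real (Suc n)) < b - s" ..
      hence "s < c n" using c(2)[of n] unfolding inverse_eq_divide by linarith
      hence "s \<in> {0<..<c n}" using s by simp
      thus "AE x in lborel. w s x = 0 \<and> \<eta> s x = 0" using elim[rule_format, of n] by blast
    qed
  qed
  show ?thesis
  proof (cases "b = T")
    case False
    then obtain h where h: "h > 0" "b + h \<le> T" "vanish (b + h)"
      using local_uniqueness[OF b(1) _ vb] b(2) by (meson order.not_eq_order_implies_strict)
    hence "b + h \<in> S" using b by (simp add: S_def)
    hence "b + h \<le> b" unfolding b_def by (rule cSup_upper[OF _ bdd])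
    thus ?thesis using h by simp
  qed (use vb in simp)
qed

text \<open>\<open>vanish\<close> speaks of almost every time. Continuity in L^3 carries equality of
  the velocities to every time, the endpoints included; the temperature is determined only for
  almost every time by its space.\<close>

lemma uniqueness:
  "\<forall>t\<in>{0..T}. AE x in lborel. u' t x = u t x"
  "AE t\<in>{0<..<T} in lborel. (AE x in lborel. \<theta>' t x = \<theta> t x)"
proof -
  note [measurable] = A.slice_measurable B.slice_measurable
  have van: "AE s\<in>{0<..<T} in lborel. (AE x in lborel. w s x = 0 \<and> \<eta> s x = 0)"
    using vanish_T unfolding vanish_def .
  thus "AE t\<in>{0<..<T} in lborel. (AE x in lborel. \<theta>' t x = \<theta> t x)"
  proof eventually_elim
    case (elim t)
    show ?case
    proof
      assume "t \<in> {0<..<T}"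
      hence "AE x in lborel. w t x = 0 \<and> \<eta> t x = 0" using elim by blast
      thus "AE x in lborel. \<theta>' t x = \<theta> t x" by eventually_elim (simp add: \<eta>_def)
    qed
  qed
  show "\<forall>t\<in>{0..T}. AE x in lborel. u' t x = u t x"
  proof
    fix t assume t: "t \<in> {0..T}"
    have "AE x in lborel. w t x = 0"
    proof (rule weak_bound_vanish)
      fix d :: real assume d: "d > 0"
      \<comment> \<open>Two drifts of size \<open>e\<close> add up to 4 (e + e) = d.\<close>
      define e where "e = d / 8"
      have e: "e > 0" using d by (simp add: e_def)
      obtain d1 where d1: "d1 > 0" "\<forall>s\<in>{0..T}. \<bar>s - t\<bar> < d1 \<longrightarrow> weak_bound 3 e (\<lambda>x. norm (u s x - u t x))"
        using A.u_near[OF t e] by blast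
      obtain d2 where d2: "d2 > 0" "\<forall>s\<in>{0..T}. \<bar>s - t\<bar> < d2 \<longrightarrow> weak_bound 3 e (\<lambda>x. norm (u' s x - u' t x))"
        using B.u_near[OF t e] by blast
      \<comment> \<open>Clipping to the time interval leaves a nonempty one-sided interval even when
        \<open>t\<close> is 0 or \<open>T\<close>.\<close>
      define l where "l = max 0 (t - min d1 d2)"
      define r where "r = min T (t + min d1 d2)"
      have lr: "l < r" using t d1(1) d2(1) A.T by (auto simp: l_def r_def)
      have "AE s\<in>{l<..<r} in lborel. (AE x in lborel. w s x = 0)"
        using van
      proof eventually_elim
        case (elim s)
        show ?case
        proof
          assume "s \<in> {l<..<r}"
          hence "s \<in> {0<..<T}" by (auto simp: l_def r_def)
          hence "AE x in lborel. w s x = 0 \<and> \<eta> s x = 0" using elim by blast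
          thus "AE x in lborel. w s x = 0" by eventually_elim blast
        qed
      qed
      from AE_lborel_obtain[OF this lr] obtain s where s: "s \<in> {l<..<r}" "AE x in lborel. w s x = 0" .
      have s': "s \<in> {0..T}" "\<bar>s - t\<bar> < d1" "\<bar>s - t\<bar> < d2" using s(1) by (auto simp: l_def r_def)
      have b: "weak_bound 3 (4 * (e + e)) (\<lambda>x. \<bar>norm (u s x - u t x)\<bar> + \<bar>norm (u' s x - u' t x)\<bar>)"
        using d1(2) d2(2) s' e by (intro weak_bound_add) auto
      have "weak_bound 3 (4 * (e + e)) (w t)"
      proof (rule weak_bound_mono_AE[OF b])
        show "AE x in lborel. \<bar>w t x\<bar> \<le> \<bar>\<bar>norm (u s x - u t x)\<bar> + \<bar>norm (u' s x - u' t x)\<bar>\<bar>"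
          using s(2)
        proof eventually_elim
          case (elim x)
          hence "u s x = u' s x" by (simp add: w_def)
          hence "u t x - u' t x = (u' s x - u' t x) - (u s x - u t x)" by simp
          hence "w t x \<le> norm (u' s x - u' t x) + norm (u s x - u t x)" unfolding w_def by (simp only: norm_triangle_ineq4)
          thus ?case by simp
        qed
      qed measurable
      thus "\<exists>A\<le>d. A \<ge> 0 \<and> weak_bound 3 A (w t)" using d by (intro exI[of _ d]) (simp add: e_def)
    qed auto
    thus "AE x in lborel. u' t x = u t x" by eventually_elim (simp add: w_def)
  qed
qed

end

section \<open>Tempered distributions and the heat flow\<close>

lemma partials_Nil [simp]: "partials [] \<phi> = \<phi>"
  and partials_Cons [simp]: "partials (k # ks) \<phi> = partials ks (partial k \<phi>)"
  and partials_append: "partials (ks @ ks') \<phi> = partials ks' (partials ks \<phi>)"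
  by (simp_all add: partials_def)

lemma schwartzI:
  assumes "\<And>ks x. partials ks \<phi> differentiable (at x)" "\<And>ks n. \<exists>B. \<forall>x. (1 + norm x) ^ n * \<bar>partials ks \<phi> x\<bar> \<le> B"
  shows "\<phi> \<in> schwartz"
proof -
  have "bounded (range (\<lambda>x. (1 + norm x) ^ n * partials ks \<phi> x))" for ks n
  proof -
    obtain B where "\<forall>x. (1 + norm x) ^ n * \<bar>partials ks \<phi> x\<bar> \<le> B" using assms(2) by blast
    thus ?thesis unfolding bounded_iff by (intro exI[of _ B]) (auto simp: abs_mult)
  qed
  thus ?thesis using assms(1) by (simp add: schwartz_def)
qed

lemma schwartz_differentiable: "\<phi> \<in> schwartz \<Longrightarrow> \<phi> differentiable (at x)"
proof -
  assume "\<phi> \<in> schwartz"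
  hence "partials [] \<phi> differentiable (at x)" unfolding schwartz_def by blast
  thus ?thesis by simp
qed

lemma schwartz_partials: "\<phi> \<in> schwartz \<Longrightarrow> partials ks \<phi> \<in> schwartz"
  by (simp add: schwartz_def partials_append[symmetric])

lemma schwartz_partial: "\<phi> \<in> schwartz \<Longrightarrow> partial k \<phi> \<in> schwartz"
  using schwartz_partials[of \<phi> "[k]"] by simp

lemma schwartz_bound:
  assumes "\<phi> \<in> schwartz"
  obtains B where "B \<ge> 0" "\<And>x. (1 + norm x) ^ n * \<bar>\<phi> x\<bar> \<le> B"
proof -
  have "bounded (range (\<lambda>x. (1 + norm x) ^ n * partials [] \<phi> x))" using assms unfolding schwartz_def by blast
  then obtain B where B: "\<forall>x. norm ((1 + norm x) ^ n * \<phi> x) \<le> B" unfolding bounded_iff by auto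
  have "(1 + norm x) ^ n * \<bar>\<phi> x\<bar> \<le> max B 0" for x
    using B[rule_format, of x] by (simp add: abs_mult le_max_iff_disj)
  thus ?thesis using that[of "max B 0"] by simp
qed

lemma has_derivative_partial_sum:
  assumes "\<phi> differentiable (at x)"
  shows "(\<phi> has_derivative (\<lambda>h. \<Sum>k\<in>UNIV. h $ k * partial k \<phi> x)) (at x)"
proof -
  have d: "(\<phi> has_derivative frechet_derivative \<phi> (at x)) (at x)"
    using assms by (simp add: frechet_derivative_works)
  then interpret L: linear "frechet_derivative \<phi> (at x)" by (rule has_derivative_linear)
  have "frechet_derivative \<phi> (at x) h = (\<Sum>k\<in>UNIV. h $ k * partial k \<phi> x)" for h
  proof -
    have "h = (\<Sum>k\<in>UNIV. h $ k *\<^sub>R axis k 1)" using basis_expansion[of h] by (simp add: scalar_mult_eq_scaleR)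
    hence "frechet_derivative \<phi> (at x) h = frechet_derivative \<phi> (at x) (\<Sum>k\<in>UNIV. h $ k *\<^sub>R axis k 1)" by simp
    also have "\<dots> = (\<Sum>k\<in>UNIV. h $ k * partial k \<phi> x)"
      by (simp add: L.sum L.scaleR partial_def)
    finally show ?thesis .
  qed
  thus ?thesis using d by presburger
qed

lemma partial_eqI:
  assumes "(\<phi> has_derivative D) (at x)" shows "partial k \<phi> x = D (axis k 1)"
  unfolding partial_def frechet_derivative_at[OF assms, symmetric] ..

lemma schwartz_borel [measurable]: "\<phi> \<in> schwartz \<Longrightarrow> \<phi> \<in> borel_measurable borel"
  by (intro borel_measurable_continuous_onI differentiable_imp_continuous_on)
     (auto simp: differentiable_on_def intro: differentiable_at_withinI schwartz_differentiable)

lemma schwartz_line_derivative: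
  assumes "\<phi> \<in> schwartz"
  shows "((\<lambda>r. \<phi> (x + r *\<^sub>R h)) has_real_derivative (\<Sum>k\<in>UNIV. h $ k * partial k \<phi> (x + r *\<^sub>R h))) (at r)"
proof -
  have "((\<lambda>r. x + r *\<^sub>R h) has_derivative (\<lambda>r. r *\<^sub>R h)) (at r)" by (auto intro!: derivative_eq_intros)
  from has_derivative_compose[OF this has_derivative_partial_sum[OF schwartz_differentiable[OF assms]]]
  have D: "((\<lambda>r. \<phi> (x + r *\<^sub>R h)) has_derivative (\<lambda>d. \<Sum>k\<in>UNIV. (d *\<^sub>R h) $ k * partial k \<phi> (x + r *\<^sub>R h))) (at r)" .
  have "(\<Sum>k\<in>UNIV. (d *\<^sub>R h) $ k * partial k \<phi> (x + r *\<^sub>R h)) = d * (\<Sum>k\<in>UNIV. h $ k * partial k \<phi> (x + r *\<^sub>R h))" for d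
    by (simp add: sum_distrib_left mult_ac)
  thus ?thesis unfolding has_field_derivative_def
    by (intro has_derivative_eq_rhs[OF D]) (auto simp: fun_eq_iff mult.commute)
qed

text \<open>Submultiplicativity moves polynomial weights between y, x and y - x; all weighted bounds
  for translates and convolutions rest on it.\<close>

lemma weight_mult: "1 + norm (x + y) \<le> (1 + norm x) * (1 + norm y)" for x y :: "'a::real_normed_vector"
proof -
  have "(1 + norm x) * (1 + norm y) = 1 + norm x + norm y + norm x * norm y" by (simp add: ring_distribs)
  thus ?thesis using norm_triangle_ineq[of x y] mult_nonneg_nonneg[OF norm_ge_zero[of x] norm_ge_zero[of y]] by linarith
qed

lemma weight_power_mult: "(1 + norm (x + y)) ^ n \<le> (1 + norm x) ^ n * (1 + norm y) ^ n" for x y :: "'a::real_normed_vector"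
  unfolding power_mult_distrib[symmetric] by (intro power_mono weight_mult) auto

text \<open>The mean value theorem on the segment from x to x + h; moving the weight from x to the
  intermediate point costs (1 + |h|)^n.\<close>

lemma schwartz_lipschitz:
  assumes \<phi>: "\<phi> \<in> schwartz"
  obtains B where "B \<ge> 0" "\<And>x h. (1 + norm x) ^ n * \<bar>\<phi> (x + h) - \<phi> x\<bar> \<le> B * norm h * (1 + norm h) ^ n"
proof -
  have "\<exists>B. B \<ge> 0 \<and> (\<forall>x. (1 + norm x) ^ n * \<bar>partial k \<phi> x\<bar> \<le> B)" for k
    by (rule schwartz_bound[OF schwartz_partial[OF \<phi>], of n k]) blast
  hence "\<forall>k. \<exists>B. B \<ge> 0 \<and> (\<forall>x. (1 + norm x) ^ n * \<bar>partial k \<phi> x\<bar> \<le> B)" ..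
  from choice[OF this] obtain b where "\<forall>k. b k \<ge> 0 \<and> (\<forall>x. (1 + norm x) ^ n * \<bar>partial k \<phi> x\<bar> \<le> b k)" ..
  hence b: "\<And>k. b k \<ge> 0" "\<And>k x. (1 + norm x) ^ n * \<bar>partial k \<phi> x\<bar> \<le> b k" by blast+
  define B where "B = (\<Sum>k\<in>(UNIV::3 set). b k)"
  have "(1 + norm x) ^ n * \<bar>\<phi> (x + h) - \<phi> x\<bar> \<le> B * norm h * (1 + norm h) ^ n" for x h
  proof -
    obtain z where z: "0 < z" "z < 1" "\<phi> (x + 1 *\<^sub>R h) - \<phi> (x + 0 *\<^sub>R h) = (1 - 0) * (\<Sum>k\<in>UNIV. h $ k * partial k \<phi> (x + z *\<^sub>R h))"
      using MVT2[of 0 1 "\<lambda>r. \<phi> (x + r *\<^sub>R h)" "\<lambda>r. \<Sum>k\<in>UNIV. h $ k * partial k \<phi> (x + r *\<^sub>R h)"]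
        schwartz_line_derivative[OF \<phi>, of x h] by auto
    define y where "y = x + z *\<^sub>R h"
    have "(1 + norm x) ^ n \<le> (1 + norm y) ^ n * (1 + norm (- (z *\<^sub>R h))) ^ n"
      using weight_power_mult[of y "- (z *\<^sub>R h)" n] by (simp add: y_def)
    also have "\<dots> \<le> (1 + norm y) ^ n * (1 + norm h) ^ n"
      using z by (intro mult_left_mono power_mono add_left_mono) (auto simp: mult_left_le_one_le)
    finally have w: "(1 + norm x) ^ n \<le> (1 + norm y) ^ n * (1 + norm h) ^ n" .
    have "\<bar>\<phi> (x + h) - \<phi> x\<bar> = \<bar>\<Sum>k\<in>UNIV. h $ k * partial k \<phi> y\<bar>" using z by (simp add: y_def)
    also have "\<dots> \<le> (\<Sum>k\<in>UNIV. norm h * \<bar>partial k \<phi> y\<bar>)"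
      by (intro order_trans[OF sum_abs] sum_mono) (simp add: abs_mult mult_right_mono component_le_norm_cart)
    finally have "(1 + norm x) ^ n * \<bar>\<phi> (x + h) - \<phi> x\<bar> \<le> ((1 + norm y) ^ n * (1 + norm h) ^ n) * (\<Sum>k\<in>UNIV. norm h * \<bar>partial k \<phi> y\<bar>)"
      by (intro mult_mono w) auto
    also have "\<dots> = norm h * (1 + norm h) ^ n * (\<Sum>k\<in>UNIV. (1 + norm y) ^ n * \<bar>partial k \<phi> y\<bar>)"
      by (simp add: sum_distrib_left mult_ac)
    also have "\<dots> \<le> norm h * (1 + norm h) ^ n * B"
      unfolding B_def by (intro mult_left_mono sum_mono b) auto
    finally show ?thesis by (simp add: mult_ac)
  qed
  thus ?thesis using that[of B] b(1) by (simp add: B_def sum_nonneg)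
qed

text \<open>The mean value theorem again, followed by the unweighted Lipschitz bound for the partial
  derivatives at the intermediate point.\<close>

lemma schwartz_taylor:
  assumes \<phi>: "\<phi> \<in> schwartz"
  obtains B where "B \<ge> 0" "\<And>x h. \<bar>\<phi> (x + h) - \<phi> x - (\<Sum>k\<in>UNIV. h $ k * partial k \<phi> x)\<bar> \<le> B * (norm h)\<^sup>2"
proof -
  have "\<exists>B. B \<ge> 0 \<and> (\<forall>x h. \<bar>partial k \<phi> (x + h) - partial k \<phi> x\<bar> \<le> B * norm h)" for k
  proof -
    obtain B where "B \<ge> 0" "\<And>x h. (1 + norm x) ^ 0 * \<bar>partial k \<phi> (x + h) - partial k \<phi> x\<bar> \<le> B * norm h * (1 + norm h) ^ 0"
      by (rule schwartz_lipschitz[OF schwartz_partial[OF \<phi>, of k], of 0]) blast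
    thus ?thesis by (intro exI[of _ B]) simp
  qed
  hence "\<forall>k. \<exists>B. B \<ge> 0 \<and> (\<forall>x h. \<bar>partial k \<phi> (x + h) - partial k \<phi> x\<bar> \<le> B * norm h)" ..
  from choice[OF this] obtain b where "\<forall>k. b k \<ge> 0 \<and> (\<forall>x h. \<bar>partial k \<phi> (x + h) - partial k \<phi> x\<bar> \<le> b k * norm h)" ..
  hence b: "\<And>k. b k \<ge> 0" "\<And>k x h. \<bar>partial k \<phi> (x + h) - partial k \<phi> x\<bar> \<le> b k * norm h" by blast+
  define B where "B = (\<Sum>k\<in>(UNIV::3 set). b k)"
  have "\<bar>\<phi> (x + h) - \<phi> x - (\<Sum>k\<in>UNIV. h $ k * partial k \<phi> x)\<bar> \<le> B * (norm h)\<^sup>2" for x h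
  proof -
    obtain z where z: "0 < z" "z < 1" "\<phi> (x + 1 *\<^sub>R h) - \<phi> (x + 0 *\<^sub>R h) = (1 - 0) * (\<Sum>k\<in>UNIV. h $ k * partial k \<phi> (x + z *\<^sub>R h))"
      using MVT2[of 0 1 "\<lambda>r. \<phi> (x + r *\<^sub>R h)" "\<lambda>r. \<Sum>k\<in>UNIV. h $ k * partial k \<phi> (x + r *\<^sub>R h)"]
        schwartz_line_derivative[OF \<phi>, of x h] by auto
    have "\<phi> (x + h) - \<phi> x - (\<Sum>k\<in>UNIV. h $ k * partial k \<phi> x) = (\<Sum>k\<in>UNIV. h $ k * (partial k \<phi> (x + z *\<^sub>R h) - partial k \<phi> x))"
      using z by (simp add: sum_subtractf ring_distribs)
    also have "\<bar>\<dots>\<bar> \<le> (\<Sum>k\<in>UNIV. norm h * (b k * norm h))"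
    proof (intro order_trans[OF sum_abs] sum_mono)
      fix k
      have "\<bar>partial k \<phi> (x + z *\<^sub>R h) - partial k \<phi> x\<bar> \<le> b k * norm (z *\<^sub>R h)" by (rule b)
      also have "\<dots> \<le> b k * norm h" using z b(1) by (intro mult_left_mono) (auto simp: mult_left_le_one_le)
      finally show "\<bar>h $ k * (partial k \<phi> (x + z *\<^sub>R h) - partial k \<phi> x)\<bar> \<le> norm h * (b k * norm h)"
        unfolding abs_mult by (intro mult_mono component_le_norm_cart) auto
    qed
    also have "\<dots> = B * (norm h)\<^sup>2" by (simp add: B_def power2_eq_square sum_distrib_left sum_distrib_right mult_ac)
    finally show ?thesis .
  qed
  thus ?thesis using that[of B] b(1) by (simp add: B_def sum_nonneg)
qed

lemma partials_lincomb:
  assumes "\<phi> \<in> schwartz" "\<psi> \<in> schwartz"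
  shows "partials ks (\<lambda>x. a * \<phi> x + b * \<psi> x) = (\<lambda>x. a * partials ks \<phi> x + b * partials ks \<psi> x)"
  using assms
proof (induction ks arbitrary: \<phi> \<psi>)
  case (Cons k ks)
  have "partial k (\<lambda>x. a * \<phi> x + b * \<psi> x) = (\<lambda>x. a * partial k \<phi> x + b * partial k \<psi> x)"
  proof
    fix x
    have "((\<lambda>x. a * \<phi> x + b * \<psi> x) has_derivative (\<lambda>h. a * (\<Sum>k\<in>UNIV. h $ k * partial k \<phi> x) + b * (\<Sum>k\<in>UNIV. h $ k * partial k \<psi> x))) (at x)"
      by (intro has_derivative_add has_derivative_mult_right has_derivative_partial_sum schwartz_differentiable Cons.prems)
    from partial_eqI[OF this, of k] show "partial k (\<lambda>x. a * \<phi> x + b * \<psi> x) x = a * partial k \<phi> x + b * partial k \<psi> x"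
      by (simp add: axis_def if_distrib[of "\<lambda>c. c * _"] cong: if_cong)
  qed
  thus ?case using Cons.IH[OF schwartz_partial[OF Cons.prems(1), of k] schwartz_partial[OF Cons.prems(2), of k]] by simp
qed simp

lemma schwartz_lincomb:
  assumes \<phi>: "\<phi> \<in> schwartz" and \<psi>: "\<psi> \<in> schwartz"
  shows "(\<lambda>x. a * \<phi> x + b * \<psi> x) \<in> schwartz"
proof (rule schwartzI)
  fix ks
  show "partials ks (\<lambda>x. a * \<phi> x + b * \<psi> x) differentiable at x" for x
    unfolding partials_lincomb[OF assms]
    by (intro differentiable_add differentiable_mult differentiable_const schwartz_differentiable schwartz_partials assms)
  fix n
  obtain B1 where B1: "B1 \<ge> 0" "\<And>x. (1 + norm x) ^ n * \<bar>partials ks \<phi> x\<bar> \<le> B1" using schwartz_bound[OF schwartz_partials[OF \<phi>]] by blast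
  obtain B2 where B2: "B2 \<ge> 0" "\<And>x. (1 + norm x) ^ n * \<bar>partials ks \<psi> x\<bar> \<le> B2" using schwartz_bound[OF schwartz_partials[OF \<psi>]] by blast
  have "(1 + norm x) ^ n * \<bar>a * partials ks \<phi> x + b * partials ks \<psi> x\<bar> \<le> \<bar>a\<bar> * B1 + \<bar>b\<bar> * B2" for x
  proof -
    have "(1 + norm x) ^ n * \<bar>a * partials ks \<phi> x + b * partials ks \<psi> x\<bar> \<le> (1 + norm x) ^ n * (\<bar>a\<bar> * \<bar>partials ks \<phi> x\<bar> + \<bar>b\<bar> * \<bar>partials ks \<psi> x\<bar>)"
      by (intro mult_left_mono) (auto simp: abs_mult[symmetric] abs_triangle_ineq)
    also have "\<dots> = \<bar>a\<bar> * ((1 + norm x) ^ n * \<bar>partials ks \<phi> x\<bar>) + \<bar>b\<bar> * ((1 + norm x) ^ n * \<bar>partials ks \<psi> x\<bar>)" by (simp add: ring_distribs mult_ac)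
    also have "\<dots> \<le> \<bar>a\<bar> * B1 + \<bar>b\<bar> * B2" by (intro add_mono mult_left_mono B1 B2) auto
    finally show ?thesis .
  qed
  thus "\<exists>B. \<forall>x. (1 + norm x) ^ n * \<bar>partials ks (\<lambda>x. a * \<phi> x + b * \<psi> x) x\<bar> \<le> B"
    unfolding partials_lincomb[OF assms] by blast
qed

lemma partials_translate:
  assumes "\<phi> \<in> schwartz"
  shows "partials ks (\<lambda>y. \<phi> (y - x)) = (\<lambda>y. partials ks \<phi> (y - x))"
  using assms
proof (induction ks arbitrary: \<phi>)
  case (Cons k ks)
  have "partial k (\<lambda>y. \<phi> (y - x)) = (\<lambda>y. partial k \<phi> (y - x))"
  proof
    fix y
    have "((\<lambda>y. y - x) has_derivative (\<lambda>h. h)) (at y)" by (auto intro!: derivative_eq_intros)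
    from has_derivative_compose[OF this has_derivative_partial_sum[OF schwartz_differentiable[OF Cons.prems]]]
    have "((\<lambda>y. \<phi> (y - x)) has_derivative (\<lambda>h. \<Sum>k\<in>UNIV. h $ k * partial k \<phi> (y - x))) (at y)" .
    from partial_eqI[OF this, of k] show "partial k (\<lambda>y. \<phi> (y - x)) y = partial k \<phi> (y - x)"
      by (simp add: axis_def if_distrib[of "\<lambda>c. c * _"] cong: if_cong)
  qed
  thus ?case using Cons.IH[OF schwartz_partial[OF Cons.prems, of k]] by simp
qed simp

lemma schwartz_translate:
  assumes \<phi>: "\<phi> \<in> schwartz" shows "(\<lambda>y. \<phi> (y - x)) \<in> schwartz"
proof (rule schwartzI)
  fix ks
  show "partials ks (\<lambda>y. \<phi> (y - x)) differentiable at y" for y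
  proof -
    have "(\<lambda>y. y - x) differentiable (at y)" by simp
    from differentiable_chain_at[OF this schwartz_differentiable[OF schwartz_partials[OF \<phi>]]]
    show ?thesis unfolding partials_translate[OF \<phi>] by (simp add: o_def)
  qed
  fix n
  obtain B where B: "B \<ge> 0" "\<And>x. (1 + norm x) ^ n * \<bar>partials ks \<phi> x\<bar> \<le> B" using schwartz_bound[OF schwartz_partials[OF \<phi>]] by blast
  have "(1 + norm y) ^ n * \<bar>partials ks \<phi> (y - x)\<bar> \<le> (1 + norm x) ^ n * B" for y
  proof -
    have "(1 + norm y) ^ n * \<bar>partials ks \<phi> (y - x)\<bar> \<le> ((1 + norm x) ^ n * (1 + norm (y - x)) ^ n) * \<bar>partials ks \<phi> (y - x)\<bar>"
      using weight_power_mult[of x "y - x" n] by (intro mult_right_mono) auto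
    also have "\<dots> \<le> (1 + norm x) ^ n * B" unfolding mult.assoc by (intro mult_left_mono B) auto
    finally show ?thesis .
  qed
  thus "\<exists>B. \<forall>y. (1 + norm y) ^ n * \<bar>partials ks (\<lambda>y. \<phi> (y - x)) y\<bar> \<le> B"
    unfolding partials_translate[OF \<phi>] by blast
qed

text \<open>Continuity of a distribution without suprema: any common pointwise bound on the weighted
  derivatives up to order \<open>N\<close> controls its value.\<close>

definition seminorm_bound :: "dist \<Rightarrow> real \<Rightarrow> nat \<Rightarrow> bool" where
  "seminorm_bound f C N \<longleftrightarrow> C \<ge> 0 \<and> (\<forall>\<phi>\<in>schwartz. \<forall>B. (\<forall>ks x. length ks \<le> N \<longrightarrow> (1 + norm x) ^ N * \<bar>partials ks \<phi> x\<bar> \<le> B) \<longrightarrow> \<bar>f \<phi>\<bar> \<le> C * B)"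

lemmas seminorm_boundD = seminorm_bound_def[THEN iffD1, THEN conjunct1] seminorm_bound_def[THEN iffD1, THEN conjunct2, rule_format]

lemma tempered_bound:
  assumes "tempered f"
  shows "\<exists>C N. seminorm_bound f C N"
proof -
  obtain C N where CN: "\<And>\<phi>. \<phi> \<in> schwartz \<Longrightarrow> \<bar>f \<phi>\<bar> \<le> C * schwartz_seminorm N \<phi>"
    using assms unfolding tempered_def by blast
  have "\<bar>f \<phi>\<bar> \<le> \<bar>C\<bar> * B" if \<phi>: "\<phi> \<in> schwartz" and B: "\<And>ks x. length ks \<le> N \<Longrightarrow> (1 + norm x) ^ N * \<bar>partials ks \<phi> x\<bar> \<le> B" for \<phi> B
  proof -
    define g where "g = (\<lambda>(ks :: 3 list, x :: real^3). (1 + norm x) ^ N * \<bar>partials ks \<phi> x\<bar>)"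
    define S where "S = {ks :: 3 list. length ks \<le> N} \<times> (UNIV :: (real^3) set)"
    have sn: "schwartz_seminorm N \<phi> = Sup (g ` S)" by (simp add: schwartz_seminorm_def g_def S_def)
    have p: "([], 0) \<in> S" by (simp add: S_def)
    have le: "g p \<le> B" if "p \<in> S" for p using B that by (auto simp: g_def S_def)
    have "Sup (g ` S) \<le> B" using p le by (intro cSUP_least) auto
    moreover have "0 \<le> g ([], 0)" by (simp add: g_def)
    moreover have "g ([], 0) \<le> Sup (g ` S)" using le p by (intro cSUP_upper bdd_aboveI2[of _ _ B])
    ultimately have sb: "0 \<le> schwartz_seminorm N \<phi>" "schwartz_seminorm N \<phi> \<le> B" unfolding sn by linarith+
    have "\<bar>f \<phi>\<bar> \<le> C * schwartz_seminorm N \<phi>" by (rule CN[OF \<phi>])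
    also have "\<dots> \<le> \<bar>C\<bar> * schwartz_seminorm N \<phi>" using sb by (intro mult_right_mono) auto
    also have "\<dots> \<le> \<bar>C\<bar> * B" using sb by (intro mult_left_mono) auto
    finally show ?thesis .
  qed
  thus ?thesis unfolding seminorm_bound_def by (intro exI[of _ "\<bar>C\<bar>"] exI[of _ N] conjI ballI allI impI abs_ge_zero) blast
qed

lemma tempered_lincomb:
  "tempered f \<Longrightarrow> \<phi> \<in> schwartz \<Longrightarrow> \<psi> \<in> schwartz \<Longrightarrow> f (\<lambda>x. a * \<phi> x + b * \<psi> x) = a * f \<phi> + b * f \<psi>"
  unfolding tempered_def by blast

text \<open>A class containing the heat kernel and closed under derivatives in space and in time.
  Bounds for all derivatives follow by induction, without formulas for them.\<close>

inductive_set heat_family :: "(real \<Rightarrow> real^3 \<Rightarrow> real) set" where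
  base: "heat_kernel \<in> heat_family"
| coord: "g \<in> heat_family \<Longrightarrow> (\<lambda>t z. z $ k * g t z) \<in> heat_family"
| inv: "g \<in> heat_family \<Longrightarrow> (\<lambda>t z. inverse t * g t z) \<in> heat_family"
| scale: "g \<in> heat_family \<Longrightarrow> (\<lambda>t z. c * g t z) \<in> heat_family"
| add: "g \<in> heat_family \<Longrightarrow> g' \<in> heat_family \<Longrightarrow> (\<lambda>t z. g t z + g' t z) \<in> heat_family"

lemma heat_family_space_derivative:
  "g \<in> heat_family \<Longrightarrow> \<exists>d. (\<forall>k. d k \<in> heat_family) \<and> (\<forall>t>0. \<forall>z. (g t has_derivative (\<lambda>h. \<Sum>k\<in>UNIV. h $ k * d k t z)) (at z))"
proof (induction rule: heat_family.induct)
  case base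
  define d where "d = (\<lambda>(k::3) t z. (-1/2) * (inverse t * (z $ k * heat_kernel t z)))"
  have "d k \<in> heat_family" for k unfolding d_def by (intro heat_family.intros)
  moreover have "(heat_kernel t has_derivative (\<lambda>h. \<Sum>k\<in>UNIV. h $ k * d k t z)) (at z)" if "t > 0" for t z
  proof -
    have "(heat_kernel t has_derivative (\<lambda>h. (4 * pi * t) powr (-3/2) * (- (z \<bullet> h) / (2 * t) * exp (- (norm z)\<^sup>2 / (4 * t))))) (at z)"
      unfolding heat_kernel_def[abs_def] by (intro has_derivative_mult_right has_derivative_gauss)
    moreover have "(4 * pi * t) powr (-3/2) * (- (z \<bullet> h) / (2 * t) * exp (- (norm z)\<^sup>2 / (4 * t))) = (\<Sum>k\<in>UNIV. h $ k * d k t z)" for h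
    proof -
      have "(\<Sum>k\<in>UNIV. h $ k * d k t z) = (-1/2) * (inverse t * heat_kernel t z) * (\<Sum>k\<in>UNIV. z $ k * h $ k)"
        by (simp only: d_def sum_distrib_left mult_ac)
      also have "(\<Sum>k\<in>UNIV. z $ k * h $ k) = z \<bullet> h" by (simp add: inner_vec_def)
      finally show ?thesis using that by (simp add: heat_kernel_def field_simps)
    qed
    ultimately show ?thesis by (rule has_derivative_eq_rhs[OF _ ext])
  qed
  ultimately show ?case by blast
next
  case (coord g j)
  then obtain d where d: "\<And>k. d k \<in> heat_family" "\<And>t z. t > 0 \<Longrightarrow> (g t has_derivative (\<lambda>h. \<Sum>k\<in>UNIV. h $ k * d k t z)) (at z)" by blast
  define d' where "d' = (\<lambda>k t z. z $ j * d k t z + (if k = j then 1 else 0) * g t z)"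
  have "d' k \<in> heat_family" for k unfolding d'_def by (intro heat_family.intros d coord)
  moreover have "((\<lambda>z. z $ j * g t z) has_derivative (\<lambda>h. \<Sum>k\<in>UNIV. h $ k * d' k t z)) (at z)" if "t > 0" for t z
  proof -
    have "((\<lambda>z. z $ j * g t z) has_derivative (\<lambda>h. z $ j * (\<Sum>k\<in>UNIV. h $ k * d k t z) + h $ j * g t z)) (at z)"
      by (intro has_derivative_mult d that bounded_linear_imp_has_derivative bounded_linear_vec_nth)
    moreover have "z $ j * (\<Sum>k\<in>UNIV. h $ k * d k t z) + h $ j * g t z = (\<Sum>k\<in>UNIV. h $ k * d' k t z)" for h
      by (simp add: d'_def ring_distribs sum.distrib sum_distrib_left mult_ac if_distrib[of "\<lambda>c. c * _"] if_distrib[of "\<lambda>c. _ * c"] cong: if_cong)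
    ultimately show ?thesis by (rule has_derivative_eq_rhs[OF _ ext])
  qed
  ultimately show ?case by blast
next
  case (inv g)
  then obtain d where d: "\<And>k. d k \<in> heat_family" "\<And>t z. t > 0 \<Longrightarrow> (g t has_derivative (\<lambda>h. \<Sum>k\<in>UNIV. h $ k * d k t z)) (at z)" by blast
  have "(\<lambda>t z. inverse t * d k t z) \<in> heat_family" for k by (intro heat_family.intros d)
  moreover have "((\<lambda>z. inverse t * g t z) has_derivative (\<lambda>h. \<Sum>k\<in>UNIV. h $ k * (inverse t * d k t z))) (at z)" if "t > 0" for t z
    using has_derivative_mult_right[OF d(2)[OF that, of z], of "inverse t"] by (simp add: sum_distrib_left mult_ac)
  ultimately show ?case by (intro exI[of _ "\<lambda>k t z. inverse t * d k t z"]) auto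
next
  case (scale g c)
  then obtain d where d: "\<And>k. d k \<in> heat_family" "\<And>t z. t > 0 \<Longrightarrow> (g t has_derivative (\<lambda>h. \<Sum>k\<in>UNIV. h $ k * d k t z)) (at z)" by blast
  have "(\<lambda>t z. c * d k t z) \<in> heat_family" for k by (intro heat_family.intros d)
  moreover have "((\<lambda>z. c * g t z) has_derivative (\<lambda>h. \<Sum>k\<in>UNIV. h $ k * (c * d k t z))) (at z)" if "t > 0" for t z
    using has_derivative_mult_right[OF d(2)[OF that, of z], of c] by (simp add: sum_distrib_left mult_ac)
  ultimately show ?case by (intro exI[of _ "\<lambda>k t z. c * d k t z"]) auto
next
  case (add g g')
  then obtain d d' where d: "\<And>k. d k \<in> heat_family" "\<And>t z. t > 0 \<Longrightarrow> (g t has_derivative (\<lambda>h. \<Sum>k\<in>UNIV. h $ k * d k t z)) (at z)"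
     "\<And>k. d' k \<in> heat_family" "\<And>t z. t > 0 \<Longrightarrow> (g' t has_derivative (\<lambda>h. \<Sum>k\<in>UNIV. h $ k * d' k t z)) (at z)" by blast
  have "(\<lambda>t z. d k t z + d' k t z) \<in> heat_family" for k by (intro heat_family.intros d)
  moreover have "((\<lambda>z. g t z + g' t z) has_derivative (\<lambda>h. \<Sum>k\<in>UNIV. h $ k * (d k t z + d' k t z))) (at z)" if "t > 0" for t z
    using has_derivative_add[OF d(2)[OF that, of z] d(4)[OF that, of z]] by (simp add: ring_distribs sum.distrib)
  ultimately show ?case by (intro exI[of _ "\<lambda>k t z. d k t z + d' k t z"]) auto
qed

lemma heat_family_time_derivative:
  "g \<in> heat_family \<Longrightarrow> \<exists>d\<in>heat_family. \<forall>t>0. \<forall>z. ((\<lambda>t. g t z) has_real_derivative d t z) (at t)"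
proof (induction rule: heat_family.induct)
  case base
  \<comment> \<open>The factor |z|^2 / (4 t^2) - 3 / (2 t) times the kernel, spelt with the
    constructors of the family.\<close>
  define d where "d = (\<lambda>t z. (-3/2) * (inverse t * heat_kernel t z) + (1/4) * (inverse t * (inverse t * ((z $ 1 * (z $ 1 * heat_kernel t z) + z $ 2 * (z $ 2 * heat_kernel t z)) + z $ 3 * (z $ 3 * heat_kernel t z)))))"
  have "d \<in> heat_family" unfolding d_def by (intro heat_family.intros)
  moreover have "((\<lambda>t. heat_kernel t z) has_real_derivative d t z) (at t)" if t: "t > 0" for t z
  proof -
    have n: "(norm z)\<^sup>2 = z $ 1 * z $ 1 + z $ 2 * z $ 2 + z $ 3 * z $ 3"
      by (simp add: power2_norm_eq_inner inner_vec_def sum_3)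
    have d1: "((\<lambda>t. (4 * pi * t) powr (-3/2)) has_real_derivative ((-3/2) * (4 * pi * t) powr (-3/2 - of_nat 1) * (4 * pi))) (at t)"
      using t by (intro DERIV_fun_powr) (auto intro!: derivative_eq_intros)
    have eq: "(4 * pi * t) powr (-3/2 - of_nat 1) = (4 * pi * t) powr (-3/2) / (4 * pi * t)"
      unfolding powr_diff using t by simp
    have d1': "((\<lambda>t. (4 * pi * t) powr (-3/2)) has_real_derivative ((-3/2) * inverse t * (4 * pi * t) powr (-3/2))) (at t)"
      by (rule DERIV_cong[OF d1], unfold eq, use t in \<open>simp add: inverse_eq_divide\<close>)
    have d2: "((\<lambda>t. exp (- (norm z)\<^sup>2 / (4 * t))) has_real_derivative (exp (- (norm z)\<^sup>2 / (4 * t)) * ((norm z)\<^sup>2 / (4 * t\<^sup>2)))) (at t)"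
      using t by (auto intro!: derivative_eq_intros simp: power2_eq_square field_simps)
    have "((\<lambda>t. heat_kernel t z) has_real_derivative ((-3/2) * inverse t * (4 * pi * t) powr (-3/2) * exp (- (norm z)\<^sup>2 / (4 * t)) + exp (- (norm z)\<^sup>2 / (4 * t)) * ((norm z)\<^sup>2 / (4 * t\<^sup>2)) * (4 * pi * t) powr (-3/2))) (at t)"
      unfolding heat_kernel_def by (rule DERIV_mult[OF d1' d2])
    moreover have "(-3/2) * inverse t * (4 * pi * t) powr (-3/2) * exp (- (norm z)\<^sup>2 / (4 * t)) + exp (- (norm z)\<^sup>2 / (4 * t)) * ((norm z)\<^sup>2 / (4 * t\<^sup>2)) * (4 * pi * t) powr (-3/2) = d t z"
    proof -
      have "d t z = (-3/2) * inverse t * heat_kernel t z + heat_kernel t z * ((norm z)\<^sup>2 / (4 * t\<^sup>2))"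
        unfolding d_def n using t by (simp add: field_simps power2_eq_square)
      thus ?thesis by (simp add: heat_kernel_def mult_ac)
    qed
    ultimately show ?thesis by simp
  qed
  ultimately show ?case by blast
next
  case (coord g j)
  then obtain d where d: "d \<in> heat_family" "\<And>t z. t > 0 \<Longrightarrow> ((\<lambda>t. g t z) has_real_derivative d t z) (at t)" by blast
  show ?case using d by (intro bexI[of _ "\<lambda>t z. z $ j * d t z"]) (auto intro!: DERIV_cmult heat_family.intros)
next
  case (inv g)
  then obtain d where d: "d \<in> heat_family" "\<And>t z. t > 0 \<Longrightarrow> ((\<lambda>t. g t z) has_real_derivative d t z) (at t)" by blast
  define d' where "d' = (\<lambda>t z. inverse t * d t z + (-1) * (inverse t * (inverse t * g t z)))"
  have "d' \<in> heat_family" unfolding d'_def by (intro heat_family.intros d inv)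
  moreover have "((\<lambda>t. inverse t * g t z) has_real_derivative d' t z) (at t)" if t: "t > 0" for t z
    using DERIV_mult[OF DERIV_inverse[of t] d(2)[OF t, of z]] t by (simp add: d'_def power2_eq_square mult_ac)
  ultimately show ?case by blast
next
  case (scale g c)
  then obtain d where d: "d \<in> heat_family" "\<And>t z. t > 0 \<Longrightarrow> ((\<lambda>t. g t z) has_real_derivative d t z) (at t)" by blast
  show ?case using d by (intro bexI[of _ "\<lambda>t z. c * d t z"]) (auto intro!: DERIV_cmult heat_family.intros)
next
  case (add g g')
  then obtain d d' where d: "d \<in> heat_family" "\<And>t z. t > 0 \<Longrightarrow> ((\<lambda>t. g t z) has_real_derivative d t z) (at t)"
    "d' \<in> heat_family" "\<And>t z. t > 0 \<Longrightarrow> ((\<lambda>t. g' t z) has_real_derivative d' t z) (at t)" by blast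
  show ?case using d by (intro bexI[of _ "\<lambda>t z. d t z + d' t z"]) (auto intro!: DERIV_add heat_family.intros)
qed

text \<open>The exponent \<open>n\<close> must vary in the induction, because a coordinate factor is
  absorbed by one more power of the weight.\<close>

lemma heat_family_bound:
  assumes t: "0 < t1" "t1 \<le> t2"
  shows "g \<in> heat_family \<Longrightarrow> \<exists>B. \<forall>t\<in>{t1..t2}. \<forall>z. (1 + norm z) ^ n * \<bar>g t z\<bar> \<le> B"
proof (induction arbitrary: n rule: heat_family.induct)
  case base
  obtain C where C: "C \<ge> 0" "\<forall>u\<ge>0. (1 + u) ^ n * exp (- (1 / (4 * t2)) * u) \<le> C"
    using power_exp_bounded[of "1 / (4 * t2)" n] t by auto
  have "(1 + norm z) ^ n * \<bar>heat_kernel s z\<bar> \<le> (4 * pi * t1) powr (-3/2) * (2 ^ n * C)" if s: "s \<in> {t1..t2}" for s z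
  proof -
    have "norm z \<le> 1 + (norm z)\<^sup>2" using zero_le_power2[of "norm z - 1"] norm_ge_zero[of z] unfolding power2_diff by (simp; linarith)
    hence "1 + norm z \<le> 1 + (1 + (norm z)\<^sup>2)" by simp
    also have "\<dots> \<le> 2 * (1 + (norm z)\<^sup>2)" by simp
    finally have "1 + norm z \<le> 2 * (1 + (norm z)\<^sup>2)" .
    hence "(1 + norm z) ^ n \<le> (2 * (1 + (norm z)\<^sup>2)) ^ n" by (intro power_mono) auto
    hence w: "(1 + norm z) ^ n \<le> 2 ^ n * (1 + (norm z)\<^sup>2) ^ n" by (simp only: power_mult_distrib)
    have "(norm z)\<^sup>2 / (4 * t2) \<le> (norm z)\<^sup>2 / (4 * s)" using s t by (intro divide_left_mono) auto
    hence e: "exp (- (norm z)\<^sup>2 / (4 * s)) \<le> exp (- (1 / (4 * t2)) * (norm z)\<^sup>2)" by simp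
    have p: "(4 * pi * s) powr (-3/2) \<le> (4 * pi * t1) powr (-3/2)" using s t by (intro powr_mono2') auto
    have "(1 + norm z) ^ n * \<bar>heat_kernel s z\<bar> = (4 * pi * s) powr (-3/2) * ((1 + norm z) ^ n * exp (- (norm z)\<^sup>2 / (4 * s)))"
      by (simp add: heat_kernel_def abs_mult)
    also have "\<dots> \<le> (4 * pi * t1) powr (-3/2) * ((2 ^ n * (1 + (norm z)\<^sup>2) ^ n) * exp (- (1 / (4 * t2)) * (norm z)\<^sup>2))"
      by (intro mult_mono p w e) auto
    also have "\<dots> \<le> (4 * pi * t1) powr (-3/2) * (2 ^ n * C)"
      unfolding mult.assoc by (intro mult_left_mono C(2)[rule_format]) auto
    finally show ?thesis .
  qed
  thus ?case by blast
next
  case (coord g k)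
  obtain B where B: "\<forall>t\<in>{t1..t2}. \<forall>z. (1 + norm z) ^ Suc n * \<bar>g t z\<bar> \<le> B" using coord.IH[of "Suc n"] by blast
  have "(1 + norm z) ^ n * \<bar>z $ k * g s z\<bar> \<le> B" if "s \<in> {t1..t2}" for s z
  proof -
    have "\<bar>z $ k\<bar> \<le> 1 + norm z" using component_le_norm_cart[of z k] by linarith
    hence "(1 + norm z) ^ n * (\<bar>z $ k\<bar> * \<bar>g s z\<bar>) \<le> (1 + norm z) ^ n * ((1 + norm z) * \<bar>g s z\<bar>)"
      by (intro mult_left_mono mult_right_mono) auto
    also have "\<dots> \<le> B" using B that by (simp add: mult_ac)
    finally show ?thesis by (simp add: abs_mult)
  qed
  thus ?case by blast
next
  case (inv g)
  obtain B where B: "\<forall>t\<in>{t1..t2}. \<forall>z. (1 + norm z) ^ n * \<bar>g t z\<bar> \<le> B" using inv.IH[of n] by blast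
  have "(1 + norm z) ^ n * \<bar>inverse s * g s z\<bar> \<le> inverse t1 * B" if s: "s \<in> {t1..t2}" for s z
  proof -
    have "(1 + norm z) ^ n * \<bar>inverse s * g s z\<bar> = inverse s * ((1 + norm z) ^ n * \<bar>g s z\<bar>)" using s t by (simp add: abs_mult)
    also have "\<dots> \<le> inverse t1 * B" using s t B by (intro mult_mono) (auto intro: le_imp_inverse_le)
    finally show ?thesis .
  qed
  thus ?case by blast
next
  case (scale g c)
  obtain B where B: "\<forall>t\<in>{t1..t2}. \<forall>z. (1 + norm z) ^ n * \<bar>g t z\<bar> \<le> B" using scale.IH[of n] by blast
  have "(1 + norm z) ^ n * \<bar>c * g s z\<bar> \<le> \<bar>c\<bar> * B" if s: "s \<in> {t1..t2}" for s z
    using mult_left_mono[OF B[rule_format, OF s, of z], of "\<bar>c\<bar>"] by (simp add: abs_mult mult_ac)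
  thus ?case by blast
next
  case (add g g')
  obtain B where B: "\<forall>t\<in>{t1..t2}. \<forall>z. (1 + norm z) ^ n * \<bar>g t z\<bar> \<le> B" using add.IH(1)[of n] by blast
  obtain B' where B': "\<forall>t\<in>{t1..t2}. \<forall>z. (1 + norm z) ^ n * \<bar>g' t z\<bar> \<le> B'" using add.IH(2)[of n] by blast
  have "(1 + norm z) ^ n * \<bar>g s z + g' s z\<bar> \<le> B + B'" if s: "s \<in> {t1..t2}" for s z
  proof -
    have "(1 + norm z) ^ n * \<bar>g s z + g' s z\<bar> \<le> (1 + norm z) ^ n * (\<bar>g s z\<bar> + \<bar>g' s z\<bar>)"
      by (intro mult_left_mono abs_triangle_ineq) auto
    also have "\<dots> \<le> B + B'" unfolding distrib_left using B B' s by (intro add_mono) auto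
    finally show ?thesis .
  qed
  thus ?case by blast
qed

lemma heat_family_partials:
  "g \<in> heat_family \<Longrightarrow> \<exists>g'\<in>heat_family. \<forall>t>0. partials ks (g t) = g' t"
proof (induction ks arbitrary: g)
  case (Cons k ks)
  obtain d where d: "\<And>k. d k \<in> heat_family" "\<And>t z. t > 0 \<Longrightarrow> (g t has_derivative (\<lambda>h. \<Sum>k\<in>UNIV. h $ k * d k t z)) (at z)"
    using heat_family_space_derivative[OF Cons.prems] by blast
  have "partial k (g t) = d k t" if "t > 0" for t
    using partial_eqI[OF d(2)[OF that], of k] by (auto simp: axis_def if_distrib[of "\<lambda>c. c * _"] fun_eq_iff cong: if_cong)
  moreover obtain g' where "g' \<in> heat_family" "\<forall>t>0. partials ks (d k t) = g' t" using Cons.IH[OF d(1)[of k]] by blast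
  ultimately show ?case by (intro bexI[of _ g']) auto
qed auto

lemma heat_kernel_schwartz:
  assumes t: "t > 0" shows "heat_kernel t \<in> schwartz"
proof (rule schwartzI)
  fix ks
  obtain g where g: "g \<in> heat_family" "\<forall>t>0. partials ks (heat_kernel t) = g t"
    using heat_family_partials[OF heat_family.base] by blast
  show "partials ks (heat_kernel t) differentiable at x" for x
  proof -
    obtain d where "\<forall>t>0. \<forall>z. (g t has_derivative (\<lambda>h. \<Sum>k\<in>UNIV. h $ k * d k t z)) (at z)"
      using heat_family_space_derivative[OF g(1)] by blast
    thus ?thesis unfolding differentiable_def g(2)[rule_format, OF t] using t by blast
  qed
  show "\<exists>B. \<forall>x. (1 + norm x) ^ n * \<bar>partials ks (heat_kernel t) x\<bar> \<le> B" for n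
    using heat_family_bound[OF t order_refl g(1), of n] unfolding g(2)[rule_format, OF t] by simp
qed

section \<open>Convolutions with rapidly decreasing weights\<close>

definition conv :: "(real^3 \<Rightarrow> real) \<Rightarrow> (real^3 \<Rightarrow> real) \<Rightarrow> real^3 \<Rightarrow> real" where
  "conv \<psi> \<phi> y = (\<integral>x. \<psi> x * \<phi> (y - x) \<partial>lborel)"

abbreviation cut :: "(real^3) set \<Rightarrow> (real^3 \<Rightarrow> real) \<Rightarrow> real^3 \<Rightarrow> real" where
  "cut S \<psi> \<equiv> \<lambda>x. indicator S x * \<psi> x"

text \<open>Weaker than Schwartz so that cutting by indicators stays inside the class; the
  decomposition into small pieces relies on this.\<close>

definition rapid :: "(real^3 \<Rightarrow> real) \<Rightarrow> bool" where
  "rapid \<psi> \<longleftrightarrow> \<psi> \<in> borel_measurable borel \<and> (\<forall>n. integrable lborel (\<lambda>x. (1 + norm x) ^ n * \<bar>\<psi> x\<bar>))"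

lemma rapidD: "rapid \<psi> \<Longrightarrow> \<psi> \<in> borel_measurable borel" "rapid \<psi> \<Longrightarrow> integrable lborel (\<lambda>x. (1 + norm x) ^ n * \<bar>\<psi> x\<bar>)"
  by (auto simp: rapid_def)

lemma rapid_integrable: "rapid \<psi> \<Longrightarrow> integrable lborel \<psi>"
  using rapidD(2)[of \<psi> 0] rapidD(1)[of \<psi>] by (simp add: integrable_abs_iff)

lemma schwartz_bounded:
  assumes "\<phi> \<in> schwartz" obtains B where "B \<ge> 0" "\<And>x. \<bar>\<phi> x\<bar> \<le> B"
proof -
  obtain B where "B \<ge> 0" "\<And>x. (1 + norm x) ^ 0 * \<bar>\<phi> x\<bar> \<le> B" by (rule schwartz_bound[OF assms, of 0]) blast
  thus thesis using that by simp
qed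

lemma integrable_mult_bounded:
  fixes \<psi> g :: "real^3 \<Rightarrow> real"
  assumes \<psi>: "integrable lborel \<psi>" and [measurable]: "g \<in> borel_measurable borel" and g: "\<And>x. \<bar>g x\<bar> \<le> B"
  shows "integrable lborel (\<lambda>x. \<psi> x * g x)"
proof (rule Bochner_Integration.integrable_bound)
  show "integrable lborel (\<lambda>x. B * \<psi> x)" using \<psi> by simp
  show "(\<lambda>x. \<psi> x * g x) \<in> borel_measurable lborel" using borel_measurable_integrable[OF \<psi>] by simp
  show "AE x in lborel. norm (\<psi> x * g x) \<le> norm (B * \<psi> x)"
  proof (rule AE_I2)
    fix x
    have "\<bar>\<psi> x\<bar> * \<bar>g x\<bar> \<le> \<bar>\<psi> x\<bar> * \<bar>B\<bar>" using g[of x] by (intro mult_left_mono) auto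
    thus "norm (\<psi> x * g x) \<le> norm (B * \<psi> x)" by (simp add: abs_mult mult.commute)
  qed
qed

lemma conv_integrable:
  assumes \<psi>: "integrable lborel \<psi>" and \<phi>: "\<phi> \<in> schwartz"
  shows "integrable lborel (\<lambda>x. \<psi> x * \<phi> (y - x))"
proof -
  note [measurable] = schwartz_borel[OF \<phi>]
  obtain B where B: "B \<ge> 0" "\<And>x. \<bar>\<phi> x\<bar> \<le> B" by (rule schwartz_bounded[OF \<phi>]) blast
  show ?thesis by (rule integrable_mult_bounded[OF \<psi> _ B(2)]) measurable
qed

text \<open>All derivatives fall on \<phi>, whose Taylor remainder is quadratic uniformly in the
  base point and may therefore be integrated against an arbitrary integrable \<psi>.\<close>

lemma conv_has_derivative:
  assumes \<psi>: "integrable lborel \<psi>" and \<phi>: "\<phi> \<in> schwartz"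
  shows "(conv \<psi> \<phi> has_derivative (\<lambda>h. \<Sum>k\<in>UNIV. h $ k * conv \<psi> (partial k \<phi>) y)) (at y)"
proof -
  obtain B where B: "B \<ge> 0" "\<And>x h. \<bar>\<phi> (x + h) - \<phi> x - (\<Sum>k\<in>UNIV. h $ k * partial k \<phi> x)\<bar> \<le> B * (norm h)\<^sup>2"
    by (rule schwartz_taylor[OF \<phi>]) blast
  note ci = conv_integrable[OF \<psi> \<phi>] conv_integrable[OF \<psi> schwartz_partial[OF \<phi>]]
  show ?thesis
  proof (rule has_derivative_quadratic_remainder)
    show "bounded_linear (\<lambda>h. \<Sum>k\<in>UNIV. h $ k * conv \<psi> (partial k \<phi>) y)"
      by (intro bounded_linear_sum bounded_linear_mult_const bounded_linear_vec_nth)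
    fix h :: "real^3"
    have i: "integrable lborel (\<lambda>x. \<psi> x * (\<phi> (y - x + h) - \<phi> (y - x) - (\<Sum>k\<in>UNIV. h $ k * partial k \<phi> (y - x))))"
    proof -
      have "integrable lborel (\<lambda>x. \<psi> x * \<phi> (y + h - x) - \<psi> x * \<phi> (y - x) - (\<Sum>k\<in>UNIV. h $ k * (\<psi> x * partial k \<phi> (y - x))))"
        using ci by (intro Bochner_Integration.integrable_diff Bochner_Integration.integrable_sum integrable_mult_right) auto
      thus ?thesis by (simp add: ring_distribs sum_distrib_left mult_ac add_diff_eq algebra_simps)
    qed
    have "conv \<psi> \<phi> (y + h) - conv \<psi> \<phi> y - (\<Sum>k\<in>UNIV. h $ k * conv \<psi> (partial k \<phi>) y)
      = (\<integral>x. \<psi> x * \<phi> (y + h - x) - \<psi> x * \<phi> (y - x) - (\<Sum>k\<in>UNIV. h $ k * (\<psi> x * partial k \<phi> (y - x))) \<partial>lborel)"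
      unfolding conv_def using ci by (simp add: Bochner_Integration.integral_sum)
    also have "\<dots> = (\<integral>x. \<psi> x * (\<phi> (y - x + h) - \<phi> (y - x) - (\<Sum>k\<in>UNIV. h $ k * partial k \<phi> (y - x))) \<partial>lborel)"
      by (intro Bochner_Integration.integral_cong) (simp_all add: ring_distribs sum_distrib_left mult_ac add_diff_eq algebra_simps)
    also have "norm \<dots> \<le> (\<integral>x. \<bar>\<psi> x\<bar> * (B * (norm h)\<^sup>2) \<partial>lborel)"
    proof (rule order_trans[OF integral_norm_bound integral_mono])
      show "integrable lborel (\<lambda>x. norm (\<psi> x * (\<phi> (y - x + h) - \<phi> (y - x) - (\<Sum>k\<in>UNIV. h $ k * partial k \<phi> (y - x)))))"
        using i by (rule integrable_norm)
      show "integrable lborel (\<lambda>x. \<bar>\<psi> x\<bar> * (B * (norm h)\<^sup>2))" using \<psi> by simp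
      show "norm (\<psi> x * (\<phi> (y - x + h) - \<phi> (y - x) - (\<Sum>k\<in>UNIV. h $ k * partial k \<phi> (y - x)))) \<le> \<bar>\<psi> x\<bar> * (B * (norm h)\<^sup>2)" for x
        unfolding real_norm_def abs_mult by (intro mult_left_mono B) auto
    qed
    also have "\<dots> = (\<integral>x. \<bar>\<psi> x\<bar> \<partial>lborel) * B * (norm h)\<^sup>2" by simp
    finally show "norm (conv \<psi> \<phi> (y + h) - conv \<psi> \<phi> y - (\<Sum>k\<in>UNIV. h $ k * conv \<psi> (partial k \<phi>) y)) \<le> (\<integral>x. \<bar>\<psi> x\<bar> \<partial>lborel) * B * (norm h)\<^sup>2" .
  qed
qed

lemma partials_conv:
  assumes \<psi>: "integrable lborel \<psi>"
  shows "\<phi> \<in> schwartz \<Longrightarrow> partials ks (conv \<psi> \<phi>) = conv \<psi> (partials ks \<phi>)"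
proof (induction ks arbitrary: \<phi>)
  case (Cons k ks)
  have "partial k (conv \<psi> \<phi>) = conv \<psi> (partial k \<phi>)"
  proof
    fix y
    from partial_eqI[OF conv_has_derivative[OF \<psi> Cons.prems], of k]
    show "partial k (conv \<psi> \<phi>) y = conv \<psi> (partial k \<phi>) y"
      by (simp add: axis_def if_distrib[of "\<lambda>c. c * _"] cong: if_cong)
  qed
  thus ?case using Cons.IH[OF schwartz_partial[OF Cons.prems, of k]] by simp
qed simp

lemma weighted_integral_bound:
  assumes \<psi>: "rapid \<psi>" and [measurable]: "g \<in> borel_measurable borel"
    and g: "\<And>x. a * \<bar>g x\<bar> \<le> B * (1 + norm x) ^ n" and a: "a \<ge> 0" and i: "integrable lborel (\<lambda>x. \<psi> x * g x)"
  shows "a * \<bar>\<integral>x. \<psi> x * g x \<partial>lborel\<bar> \<le> B * (\<integral>x. (1 + norm x) ^ n * \<bar>\<psi> x\<bar> \<partial>lborel)"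
proof -
  have "a * \<bar>\<integral>x. \<psi> x * g x \<partial>lborel\<bar> \<le> a * (\<integral>x. \<bar>\<psi> x * g x\<bar> \<partial>lborel)"
    using a by (intro mult_left_mono integral_abs_bound)
  also have "\<dots> = (\<integral>x. a * \<bar>\<psi> x * g x\<bar> \<partial>lborel)" by simp
  also have "\<dots> \<le> (\<integral>x. B * ((1 + norm x) ^ n * \<bar>\<psi> x\<bar>) \<partial>lborel)"
  proof (rule integral_mono)
    show "integrable lborel (\<lambda>x. a * \<bar>\<psi> x * g x\<bar>)" using i by simp
    show "integrable lborel (\<lambda>x. B * ((1 + norm x) ^ n * \<bar>\<psi> x\<bar>))" by (intro integrable_mult_right rapidD(2) \<psi>)
    show "a * \<bar>\<psi> x * g x\<bar> \<le> B * ((1 + norm x) ^ n * \<bar>\<psi> x\<bar>)" for x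
      using mult_right_mono[OF g[of x], of "\<bar>\<psi> x\<bar>"] by (simp add: abs_mult mult_ac)
  qed
  finally show ?thesis by simp
qed

lemma conv_weighted_bound:
  assumes \<psi>: "rapid \<psi>" and \<phi>: "\<phi> \<in> schwartz" and B: "\<And>z. (1 + norm z) ^ n * \<bar>\<phi> z\<bar> \<le> B"
  shows "(1 + norm y) ^ n * \<bar>conv \<psi> \<phi> y\<bar> \<le> B * (\<integral>x. (1 + norm x) ^ n * \<bar>\<psi> x\<bar> \<partial>lborel)"
  unfolding conv_def
proof (rule weighted_integral_bound[OF \<psi>])
  note [measurable] = schwartz_borel[OF \<phi>]
  show "(\<lambda>x. \<phi> (y - x)) \<in> borel_measurable borel" by measurable
  show "integrable lborel (\<lambda>x. \<psi> x * \<phi> (y - x))" by (rule conv_integrable[OF rapid_integrable[OF \<psi>] \<phi>])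
  fix x
  have "(1 + norm y) ^ n * \<bar>\<phi> (y - x)\<bar> \<le> ((1 + norm x) ^ n * (1 + norm (y - x)) ^ n) * \<bar>\<phi> (y - x)\<bar>"
    using weight_power_mult[of x "y - x" n] by (intro mult_right_mono) auto
  also have "\<dots> \<le> (1 + norm x) ^ n * B" unfolding mult.assoc by (intro mult_left_mono B) auto
  finally show "(1 + norm y) ^ n * \<bar>\<phi> (y - x)\<bar> \<le> B * (1 + norm x) ^ n" by (simp add: mult.commute)
qed auto

lemma conv_schwartz:
  assumes \<psi>: "rapid \<psi>" and \<phi>: "\<phi> \<in> schwartz"
  shows "conv \<psi> \<phi> \<in> schwartz"
proof (rule schwartzI)
  fix ks
  note pc = partials_conv[OF rapid_integrable[OF \<psi>] \<phi>]
  show "partials ks (conv \<psi> \<phi>) differentiable at y" for y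
    unfolding pc differentiable_def using conv_has_derivative[OF rapid_integrable[OF \<psi>] schwartz_partials[OF \<phi>]] by blast
  fix n
  obtain B where B: "B \<ge> 0" "\<And>x. (1 + norm x) ^ n * \<bar>partials ks \<phi> x\<bar> \<le> B" by (rule schwartz_bound[OF schwartz_partials[OF \<phi>]]) blast
  show "\<exists>B. \<forall>y. (1 + norm y) ^ n * \<bar>partials ks (conv \<psi> \<phi>) y\<bar> \<le> B"
    unfolding pc using conv_weighted_bound[OF \<psi> schwartz_partials[OF \<phi>] B(2)] by blast
qed

lemma integrable_inverse_weight: "integrable lborel (\<lambda>x::real^3. ball_kernel 4 1 x)"
proof -
  \<comment> \<open>With p = 0 the exponent 1 - 1 / p is 1, since 1 / 0 = 0, and the condition is
    that of a bounded function; the potential of the constant 1 is the integral wanted.\<close>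
  have "marcinkiewicz 0 1 (\<lambda>_. 1)"
    unfolding marcinkiewicz_def by (auto simp: emeasure_eq_ennreal_measure)
  hence "ball_potential 4 1 (\<lambda>_. 1) 0 < \<infinity>"
    by (rule nn_integral_ball_kernel_finite) auto
  hence "(\<integral>\<^sup>+y. ennreal (ball_kernel 4 1 (y :: real^3)) \<partial>lborel) < \<infinity>" by (simp add: ball_kernel_def)
  thus ?thesis by (intro integrableI_bounded) auto
qed

lemma ball_kernel_weight: "(1 + norm x) ^ 4 * ball_kernel 4 1 x \<ge> 1"
proof -
  have "1 + (norm x)\<^sup>2 \<le> (1 + norm x)\<^sup>2" by (simp add: power2_sum)
  hence "(1 + (norm x)\<^sup>2)\<^sup>2 \<le> ((1 + norm x)\<^sup>2)\<^sup>2" by (intro power_mono) auto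
  hence "(1 + (norm x)\<^sup>2)\<^sup>2 \<le> (1 + norm x) ^ 4" by simp
  moreover have p: "1 + (norm x)\<^sup>2 > 0" by (simp add: add_pos_nonneg)
  moreover have "ball_kernel 4 1 x = 1 / (1 + (norm x)\<^sup>2)\<^sup>2"
    using p by (simp add: ball_kernel_def powr_minus_divide)
  ultimately show ?thesis by (simp add: le_divide_eq)
qed

text \<open>Four further powers of the weight buy the factor \<open>ball_kernel 4 1\<close>, which
  is integrable on three-dimensional space.\<close>

lemma schwartz_le_ball_kernel:
  assumes \<phi>: "\<phi> \<in> schwartz"
  obtains B where "B \<ge> 0" "\<And>x. (1 + norm x) ^ n * \<bar>\<phi> x\<bar> \<le> B * ball_kernel 4 1 x"
proof -
  obtain B where B: "B \<ge> 0" "\<And>x. (1 + norm x) ^ (n + 4) * \<bar>\<phi> x\<bar> \<le> B" by (rule schwartz_bound[OF \<phi>]) blast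
  have "(1 + norm x) ^ n * \<bar>\<phi> x\<bar> \<le> B * ball_kernel 4 1 x" for x
  proof -
    have "(1 + norm x) ^ n * \<bar>\<phi> x\<bar> * 1 \<le> (1 + norm x) ^ n * \<bar>\<phi> x\<bar> * ((1 + norm x) ^ 4 * ball_kernel 4 1 x)"
      by (intro mult_left_mono ball_kernel_weight) auto
    also have "\<dots> = ((1 + norm x) ^ (n + 4) * \<bar>\<phi> x\<bar>) * ball_kernel 4 1 x" by (simp add: power_add mult_ac)
    also have "\<dots> \<le> B * ball_kernel 4 1 x" by (intro mult_right_mono B) auto
    finally show ?thesis by simp
  qed
  thus thesis using that B(1) by blast
qed

lemma schwartz_rapid:
  assumes \<phi>: "\<phi> \<in> schwartz" shows "rapid \<phi>"
  unfolding rapid_def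
proof (intro conjI allI schwartz_borel \<phi>)
  fix n
  note [measurable] = schwartz_borel[OF \<phi>]
  obtain B where B: "B \<ge> 0" "\<And>x. (1 + norm x) ^ n * \<bar>\<phi> x\<bar> \<le> B * ball_kernel 4 1 x" by (rule schwartz_le_ball_kernel[OF \<phi>]) blast
  show "integrable lborel (\<lambda>x. (1 + norm x) ^ n * \<bar>\<phi> x\<bar>)"
  proof (rule Bochner_Integration.integrable_bound)
    show "integrable lborel (\<lambda>x::real^3. B * ball_kernel 4 1 x)" by (intro integrable_mult_right integrable_inverse_weight)
    show "AE x in lborel. norm ((1 + norm x) ^ n * \<bar>\<phi> x\<bar>) \<le> norm (B * ball_kernel 4 1 x)"
      using B by (intro AE_I2) (simp add: abs_mult)
  qed measurable
qed

text \<open>A seminorm of order \<open>N\<close> involves finitely many lists of indices, so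
  constants found for each list may be summed.\<close>

lemma uniform_over_short_lists:
  fixes P :: "('a::finite) list \<Rightarrow> 'b \<Rightarrow> real"
  assumes "\<And>ks. \<exists>B\<ge>0. \<forall>x. P ks x \<le> B * g x" and g: "\<And>x. g x \<ge> 0"
  obtains B where "B \<ge> 0" "\<And>ks x. length ks \<le> N \<Longrightarrow> P ks x \<le> B * g x"
proof -
  have "\<forall>ks. \<exists>B. B \<ge> 0 \<and> (\<forall>x. P ks x \<le> B * g x)" using assms(1) by blast
  from choice[OF this] obtain b where "\<forall>ks. b ks \<ge> 0 \<and> (\<forall>x. P ks x \<le> b ks * g x)" ..
  hence b: "\<And>ks. b ks \<ge> 0" "\<And>ks x. P ks x \<le> b ks * g x" by blast+
  define S where "S = {ks :: 'a list. set ks \<subseteq> UNIV \<and> length ks \<le> N}"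
  have S: "finite S" unfolding S_def by (rule finite_lists_length_le) simp
  have "P ks x \<le> (\<Sum>ks\<in>S. b ks) * g x" if "length ks \<le> N" for ks x
  proof -
    have "P ks x \<le> b ks * g x" by (rule b)
    also have "\<dots> \<le> (\<Sum>ks\<in>S. b ks) * g x"
      using S that b(1) by (intro mult_right_mono g member_le_sum) (auto simp: S_def)
    finally show ?thesis .
  qed
  thus thesis using that[of "\<Sum>ks\<in>S. b ks"] b(1) by (simp add: sum_nonneg)
qed

text \<open>A tempered distribution may be applied under the integral sign.  After cutting \<open>\<psi>\<close> into finitely many pieces
  of diameter \<open>\<delta>\<close>, each translate may be frozen at the cost of \<open>O(\<delta>)\<close> in the Schwartz seminorm.\<close>

lemma
  assumes f: "tempered f" and \<phi>: "\<phi> \<in> schwartz" and \<psi>: "rapid \<psi>"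
  shows tempered_conv: "f (conv \<psi> \<phi>) = (\<integral>x. \<psi> x * f (\<lambda>y. \<phi> (y - x)) \<partial>lborel)"
    and tempered_conv_integrable: "integrable lborel (\<lambda>x. \<psi> x * f (\<lambda>y. \<phi> (y - x)))"
    and continuous_tempered_translate: "continuous_on UNIV (\<lambda>x. f (\<lambda>y. \<phi> (y - x)))"
proof -
  obtain C N where "seminorm_bound f C N" using tempered_bound[OF f] by blast
  note C = seminorm_boundD(1)[OF this] and CN = seminorm_boundD(2)[OF this]
  define W where "W = (\<lambda>x::real^3. (1 + norm x) ^ N)"
  have W: "W x \<ge> 1" for x by (simp add: W_def one_le_power)
  have W0: "W x \<ge> 0" for x using W[of x] by linarith
  obtain B where B: "B \<ge> 0" "\<And>ks x. length ks \<le> N \<Longrightarrow> W x * \<bar>partials ks \<phi> x\<bar> \<le> B * 1"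
  proof (rule uniform_over_short_lists[of "\<lambda>ks x. W x * \<bar>partials ks \<phi> x\<bar>" "\<lambda>_. 1" N])
    fix ks
    show "\<exists>B\<ge>0. \<forall>x. W x * \<bar>partials ks \<phi> x\<bar> \<le> B * 1"
      unfolding W_def by (rule schwartz_bound[OF schwartz_partials[OF \<phi>, of ks], of N]) auto
  qed auto
  obtain L where L: "L \<ge> 0" "\<And>ks p. length ks \<le> N \<Longrightarrow> W (fst p) * \<bar>partials ks \<phi> (fst p + snd p) - partials ks \<phi> (fst p)\<bar> \<le> L * (norm (snd p) * (1 + norm (snd p)) ^ N)"
  proof (rule uniform_over_short_lists[of "\<lambda>ks p. W (fst p) * \<bar>partials ks \<phi> (fst p + snd p) - partials ks \<phi> (fst p)\<bar>" "\<lambda>p. norm (snd p) * (1 + norm (snd p)) ^ N" N])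
    fix ks
    obtain B where "B \<ge> 0" "\<And>x h. (1 + norm x) ^ N * \<bar>partials ks \<phi> (x + h) - partials ks \<phi> x\<bar> \<le> B * norm h * (1 + norm h) ^ N"
      by (rule schwartz_lipschitz[OF schwartz_partials[OF \<phi>, of ks], of N]) blast
    thus "\<exists>B\<ge>0. \<forall>p. W (fst p) * \<bar>partials ks \<phi> (fst p + snd p) - partials ks \<phi> (fst p)\<bar> \<le> B * (norm (snd p) * (1 + norm (snd p)) ^ N)"
      unfolding W_def by (intro exI[of _ B]) (simp add: mult.assoc)
  qed auto
  define K where "K = L * 2 ^ N"
  have K: "K \<ge> 0" using L by (simp add: K_def)
  \<comment> \<open>Freezing a translate: a shift of the centre by \<delta> changes the weighted
    derivatives by O(\<delta>), up to the weight at the centre.\<close>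
  have trans: "W y * \<bar>partials ks \<phi> (y - x') - partials ks \<phi> (y - x)\<bar> \<le> K * \<delta> * W x"
    if "length ks \<le> N" "norm (x' - x) \<le> \<delta>" "\<delta> \<le> 1" for ks x x' y \<delta>
  proof -
    have "W y \<le> W x * W (y - x)" using weight_power_mult[of x "y - x" N] by (simp add: W_def)
    hence "W y * \<bar>partials ks \<phi> (y - x') - partials ks \<phi> (y - x)\<bar> \<le> W x * (W (y - x) * \<bar>partials ks \<phi> (y - x + (x - x')) - partials ks \<phi> (y - x)\<bar>)"
      unfolding mult.assoc[symmetric] by (simp add: mult_right_mono)
    also have "\<dots> \<le> W x * (L * (norm (x - x') * (1 + norm (x - x')) ^ N))"
      using L(2)[OF that(1), of "(y - x, x - x')"] W0 by (intro mult_left_mono) auto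
    also have "\<dots> \<le> W x * (L * (\<delta> * 2 ^ N))"
      using that(2,3) L(1) W0[of x] by (intro mult_left_mono mult_mono power_mono) (auto simp: norm_minus_commute intro: order_trans[OF norm_ge_zero])
    finally show ?thesis by (simp add: K_def mult_ac)
  qed
  define h where "h = (\<lambda>x. f (\<lambda>y. \<phi> (y - x)))"
  have hL: "\<bar>h x' - h x\<bar> \<le> C * (K * \<delta> * W x)" if "norm (x' - x) \<le> \<delta>" "\<delta> \<le> 1" for x x' \<delta>
  proof -
    have s: "(\<lambda>y. 1 * \<phi> (y - x') + (-1) * \<phi> (y - x)) \<in> schwartz" by (intro schwartz_lincomb schwartz_translate \<phi>)
    have "h x' - h x = f (\<lambda>y. 1 * \<phi> (y - x') + (-1) * \<phi> (y - x))"
      unfolding tempered_lincomb[OF f schwartz_translate[OF \<phi>] schwartz_translate[OF \<phi>]] h_def by simp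
    moreover have "\<bar>f (\<lambda>y. 1 * \<phi> (y - x') + (-1) * \<phi> (y - x))\<bar> \<le> C * (K * \<delta> * W x)"
    proof (rule CN[OF s])
      fix ks y assume "length (ks :: 3 list) \<le> N"
      from trans[OF this that, of y] show "(1 + norm y) ^ N * \<bar>partials ks (\<lambda>y. 1 * \<phi> (y - x') + (-1) * \<phi> (y - x)) y\<bar> \<le> K * \<delta> * W x"
        unfolding partials_lincomb[OF schwartz_translate[OF \<phi>] schwartz_translate[OF \<phi>]] partials_translate[OF \<phi>] by (simp add: W_def)
    qed
    ultimately show ?thesis by simp
  qed
  have hB: "\<bar>h x\<bar> \<le> C * (B * W x)" for x
    unfolding h_def
  proof (rule CN[OF schwartz_translate[OF \<phi>]])
    fix ks y assume ks: "length (ks :: 3 list) \<le> N"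
    have "W y \<le> W x * W (y - x)" using weight_power_mult[of x "y - x" N] by (simp add: W_def)
    hence "W y * \<bar>partials ks \<phi> (y - x)\<bar> \<le> W x * (W (y - x) * \<bar>partials ks \<phi> (y - x)\<bar>)"
      unfolding mult.assoc[symmetric] by (rule mult_right_mono) simp
    also have "\<dots> \<le> W x * B" using B(2)[OF ks, of "y - x"] W0 by (intro mult_left_mono) auto
    finally show "(1 + norm y) ^ N * \<bar>partials ks (\<lambda>y. \<phi> (y - x)) y\<bar> \<le> B * W x"
      unfolding partials_translate[OF \<phi>] by (simp add: W_def mult.commute)
  qed
  have h_cont: "continuous_on UNIV h"
    unfolding continuous_on_iff
  proof (intro ballI allI impI)
    fix x :: "real^3" and e :: real assume e: "e > 0"
    define D where "D = C * (K * W x) + 1"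
    have D: "D > 0" using C K W0[of x] by (simp add: D_def add_nonneg_pos)
    define d where "d = min 1 (e / D)"
    have d: "d > 0" "d \<le> 1" "d \<le> e / D" using e D by (auto simp: d_def)
    have "dist (h x') (h x) < e" if "dist x' x < d" for x'
    proof -
      have n: "norm (x' - x) \<le> norm (x' - x)" "norm (x' - x) \<le> 1" using that d by (auto simp: dist_norm)
      have "\<bar>h x' - h x\<bar> \<le> C * (K * norm (x' - x) * W x)" by (rule hL[OF n])
      also have "\<dots> = (C * (K * W x)) * norm (x' - x)" by (simp add: mult_ac)
      also have "\<dots> \<le> D * norm (x' - x)" by (intro mult_right_mono) (auto simp: D_def)
      also have "\<dots> < D * d" using that D by (intro mult_strict_left_mono) (auto simp: dist_norm)
      also have "\<dots> \<le> e" using d(3) D by (simp add: field_simps)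
      finally show ?thesis by (simp add: dist_real_def)
    qed
    thus "\<exists>d>0. \<forall>x'\<in>UNIV. dist x' x < d \<longrightarrow> dist (h x') (h x) < e" using d(1) by blast
  qed
  show "continuous_on UNIV (\<lambda>x. f (\<lambda>y. \<phi> (y - x)))" using h_cont by (simp add: h_def)
  have hm[measurable]: "h \<in> borel_measurable borel" using h_cont by (rule borel_measurable_continuous_onI)
  have hi: "integrable lborel (\<lambda>x. \<psi> x * h x)" if \<psi>: "rapid \<psi>" for \<psi>
  proof (rule Bochner_Integration.integrable_bound)
    note [measurable] = rapidD(1)[OF \<psi>]
    show "integrable lborel (\<lambda>x. C * B * ((1 + norm x) ^ N * \<bar>\<psi> x\<bar>))" by (intro integrable_mult_right rapidD \<psi>)
    show "(\<lambda>x. \<psi> x * h x) \<in> borel_measurable lborel" by measurable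
    show "AE x in lborel. norm (\<psi> x * h x) \<le> norm (C * B * ((1 + norm x) ^ N * \<bar>\<psi> x\<bar>))"
    proof (rule AE_I2)
      fix x
      have "\<bar>\<psi> x\<bar> * \<bar>h x\<bar> \<le> \<bar>\<psi> x\<bar> * (C * (B * W x))" by (intro mult_left_mono hB) auto
      thus "norm (\<psi> x * h x) \<le> norm (C * B * ((1 + norm x) ^ N * \<bar>\<psi> x\<bar>))"
        using C B(1) by (simp add: abs_mult W_def mult_ac)
    qed
  qed
  show "integrable lborel (\<lambda>x. \<psi> x * f (\<lambda>y. \<phi> (y - x)))" using hi[OF \<psi>] by (simp add: h_def)
  \<comment> \<open>\<open>E\<close> is the defect of the identity to be shown and \<open>J\<close>
    a weighted L^1 norm. \<open>E\<close> will be bounded by \<open>J\<close> in general and by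
    \<delta> \<open>J\<close> on pieces of diameter \<delta>, and both are additive under
    cutting.\<close>
  define E where "E = (\<lambda>\<psi>. f (conv \<psi> \<phi>) - (\<integral>x. \<psi> x * h x \<partial>lborel))"
  define J where "J = (\<lambda>\<psi>::real^3 \<Rightarrow> real. \<integral>x. (1 + norm x) ^ N * \<bar>\<psi> x\<bar> \<partial>lborel)"
  have J0: "J \<psi> \<ge> 0" for \<psi> unfolding J_def by (intro integral_nonneg_AE AE_I2) simp
  have crude: "\<bar>E \<psi>\<bar> \<le> 2 * C * B * J \<psi>" if \<psi>: "rapid \<psi>" for \<psi>
  proof -
    have "\<bar>f (conv \<psi> \<phi>)\<bar> \<le> C * (B * J \<psi>)"
    proof (rule CN[OF conv_schwartz[OF \<psi> \<phi>]])
      fix ks y assume ks: "length (ks :: 3 list) \<le> N"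
      show "(1 + norm y) ^ N * \<bar>partials ks (conv \<psi> \<phi>) y\<bar> \<le> B * J \<psi>"
        unfolding partials_conv[OF rapid_integrable[OF \<psi>] \<phi>] J_def
        using B(2)[OF ks] by (intro conv_weighted_bound \<psi> schwartz_partials \<phi>) (simp add: W_def)
    qed
    moreover have "1 * \<bar>\<integral>x. \<psi> x * h x \<partial>lborel\<bar> \<le> C * B * J \<psi>"
      unfolding J_def using hB by (intro weighted_integral_bound \<psi> hi) (auto simp: W_def mult_ac)
    ultimately show ?thesis unfolding E_def by (simp add: mult_ac)
  qed
  have loc: "\<bar>E \<psi>\<bar> \<le> 2 * C * K * \<delta> * J \<psi>" if \<psi>: "rapid \<psi>" and supp: "\<And>x. \<psi> x \<noteq> 0 \<Longrightarrow> norm (x - p) \<le> \<delta>" and \<delta>: "0 < \<delta>" "\<delta> \<le> 1" for \<psi> p \<delta>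
  proof -
    note [measurable] = rapidD(1)[OF \<psi>] schwartz_borel[OF schwartz_partials[OF \<phi>]]
    \<comment> \<open>Freezing every translate at \<open>p\<close> turns the convolution into
      \<open>c\<close> times one translate; both terms of the defect are compared with
      \<open>c * h p\<close>.\<close>
    define c where "c = (\<integral>x. \<psi> x \<partial>lborel)"
    have Fs: "(\<lambda>y. 1 * conv \<psi> \<phi> y + (- c) * \<phi> (y - p)) \<in> schwartz" by (intro schwartz_lincomb schwartz_translate \<phi> conv_schwartz \<psi>)
    have "\<bar>f (\<lambda>y. 1 * conv \<psi> \<phi> y + (- c) * \<phi> (y - p))\<bar> \<le> C * (K * \<delta> * J \<psi>)"
    proof (rule CN[OF Fs])
      fix ks y assume ks: "length (ks :: 3 list) \<le> N"
      \<comment> \<open>Cutting off outside the small ball makes the bound hold at every point; the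
        integral does not change, because \<psi> vanishes there.\<close>
      define g where "g = (\<lambda>x. if norm (x - p) \<le> \<delta> then partials ks \<phi> (y - x) - partials ks \<phi> (y - p) else 0)"
      have gm: "g \<in> borel_measurable borel" unfolding g_def by measurable
      have ip: "integrable lborel (\<lambda>x. \<psi> x * partials ks \<phi> (y - x))"
        by (rule conv_integrable[OF rapid_integrable[OF \<psi>] schwartz_partials[OF \<phi>]])
      have eqg: "\<psi> x * g x = \<psi> x * partials ks \<phi> (y - x) - \<psi> x * partials ks \<phi> (y - p)" for x
        using supp[of x] by (cases "\<psi> x = 0") (auto simp: g_def ring_distribs)
      have gi: "integrable lborel (\<lambda>x. \<psi> x * g x)"
        unfolding eqg using ip rapid_integrable[OF \<psi>] by simp
      have "partials ks (\<lambda>y. 1 * conv \<psi> \<phi> y + (- c) * \<phi> (y - p)) y = (\<integral>x. \<psi> x * g x \<partial>lborel)"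
        unfolding partials_lincomb[OF conv_schwartz[OF \<psi> \<phi>] schwartz_translate[OF \<phi>]] partials_translate[OF \<phi>] partials_conv[OF rapid_integrable[OF \<psi>] \<phi>] eqg
        using ip rapid_integrable[OF \<psi>] by (simp add: conv_def c_def)
      moreover have "(1 + norm y) ^ N * \<bar>\<integral>x. \<psi> x * g x \<partial>lborel\<bar> \<le> K * \<delta> * J \<psi>"
        unfolding J_def
      proof (rule weighted_integral_bound[OF \<psi> gm _ _ gi])
        fix x
        show "(1 + norm y) ^ N * \<bar>g x\<bar> \<le> K * \<delta> * (1 + norm x) ^ N"
        proof (cases "norm (x - p) \<le> \<delta>")
          case True
          have "\<bar>g x\<bar> = \<bar>partials ks \<phi> (y - p) - partials ks \<phi> (y - x)\<bar>" using True by (simp add: g_def abs_minus_commute)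
          thus ?thesis using trans[OF ks _ \<delta>(2), of p x y] True by (simp add: W_def norm_minus_commute)
        qed (use K \<delta> in \<open>simp add: g_def\<close>)
      qed simp
      ultimately show "(1 + norm y) ^ N * \<bar>partials ks (\<lambda>y. 1 * conv \<psi> \<phi> y + (- c) * \<phi> (y - p)) y\<bar> \<le> K * \<delta> * J \<psi>" by simp
    qed
    moreover have "f (\<lambda>y. 1 * conv \<psi> \<phi> y + (- c) * \<phi> (y - p)) = f (conv \<psi> \<phi>) - c * h p"
      unfolding tempered_lincomb[OF f conv_schwartz[OF \<psi> \<phi>] schwartz_translate[OF \<phi>]] by (simp add: h_def)
    moreover have "\<bar>c * h p - (\<integral>x. \<psi> x * h x \<partial>lborel)\<bar> \<le> C * K * \<delta> * J \<psi>"
    proof -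
      define g where "g = (\<lambda>x. if norm (x - p) \<le> \<delta> then h p - h x else 0)"
      have gm: "g \<in> borel_measurable borel" unfolding g_def by measurable
      have eqg: "\<psi> x * g x = \<psi> x * h p - \<psi> x * h x" for x
        using supp[of x] by (cases "\<psi> x = 0") (auto simp: g_def ring_distribs)
      have gi: "integrable lborel (\<lambda>x. \<psi> x * g x)"
        unfolding eqg using hi[OF \<psi>] rapid_integrable[OF \<psi>] by simp
      have "c * h p - (\<integral>x. \<psi> x * h x \<partial>lborel) = (\<integral>x. \<psi> x * g x \<partial>lborel)"
        unfolding eqg using hi[OF \<psi>] rapid_integrable[OF \<psi>] by (simp add: c_def)
      moreover have "1 * \<bar>\<integral>x. \<psi> x * g x \<partial>lborel\<bar> \<le> C * K * \<delta> * J \<psi>"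
        unfolding J_def
      proof (rule weighted_integral_bound[OF \<psi> gm _ _ gi])
        fix x
        show "1 * \<bar>g x\<bar> \<le> C * K * \<delta> * (1 + norm x) ^ N"
          using hL[of p x \<delta>] \<delta> C K by (auto simp: g_def W_def norm_minus_commute mult_ac)
      qed simp
      ultimately show ?thesis by simp
    qed
    ultimately show ?thesis unfolding E_def by (simp add: mult_ac)
  qed
  have rapid_cut: "rapid (cut S \<psi>)" if "rapid \<psi>" "S \<in> sets borel" for \<psi> S
  proof -
    note [measurable] = rapidD(1)[OF that(1)] that(2)
    have "integrable lborel (\<lambda>x. (1 + norm x) ^ n * \<bar>indicator S x * \<psi> x\<bar>)" for n
      by (rule Bochner_Integration.integrable_bound[OF rapidD(2)[OF that(1), of n]]) (auto simp: indicator_def)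
    moreover have "(cut S \<psi>) \<in> borel_measurable borel" by measurable
    ultimately show ?thesis unfolding rapid_def by blast
  qed
  have split: "E \<psi> = E (cut S \<psi>) + E (cut (- S) \<psi>)"
    "J \<psi> = J (cut S \<psi>) + J (cut (- S) \<psi>)" if \<psi>: "rapid \<psi>" and S: "S \<in> sets borel" for \<psi> S
  proof -
    have r: "rapid (cut S \<psi>)" "rapid (cut (- S) \<psi>)" using S by (auto intro!: rapid_cut \<psi>)
    have "conv \<psi> \<phi> y = 1 * conv (cut S \<psi>) \<phi> y + 1 * conv (cut (- S) \<psi>) \<phi> y" for y
    proof -
      have "conv \<psi> \<phi> y = (\<integral>x. (indicator S x * \<psi> x) * \<phi> (y - x) + (indicator (- S) x * \<psi> x) * \<phi> (y - x) \<partial>lborel)"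
        unfolding conv_def by (intro Bochner_Integration.integral_cong) (auto simp: indicator_def)
      thus ?thesis unfolding conv_def using conv_integrable[OF rapid_integrable[OF r(1)] \<phi>] conv_integrable[OF rapid_integrable[OF r(2)] \<phi>]
        by simp
    qed
    hence "conv \<psi> \<phi> = (\<lambda>y. 1 * conv (cut S \<psi>) \<phi> y + 1 * conv (cut (- S) \<psi>) \<phi> y)" by (rule ext)
    hence 1: "f (conv \<psi> \<phi>) = f (conv (cut S \<psi>) \<phi>) + f (conv (cut (- S) \<psi>) \<phi>)"
      using tempered_lincomb[OF f conv_schwartz[OF r(1) \<phi>] conv_schwartz[OF r(2) \<phi>], of 1 1] by simp
    have "(\<integral>x. \<psi> x * h x \<partial>lborel) = (\<integral>x. (indicator S x * \<psi> x) * h x + (indicator (- S) x * \<psi> x) * h x \<partial>lborel)"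
      by (intro Bochner_Integration.integral_cong) (auto simp: indicator_def)
    also have "\<dots> = (\<integral>x. (indicator S x * \<psi> x) * h x \<partial>lborel) + (\<integral>x. (indicator (- S) x * \<psi> x) * h x \<partial>lborel)"
      by (rule Bochner_Integration.integral_add[OF hi[OF r(1)] hi[OF r(2)]])
    finally show "E \<psi> = E (cut S \<psi>) + E (cut (- S) \<psi>)" using 1 by (simp add: E_def)
    have "J \<psi> = (\<integral>x. (1 + norm x) ^ N * \<bar>indicator S x * \<psi> x\<bar> + (1 + norm x) ^ N * \<bar>indicator (- S) x * \<psi> x\<bar> \<partial>lborel)"
      unfolding J_def by (intro Bochner_Integration.integral_cong) (auto simp: indicator_def)
    also have "\<dots> = J (cut S \<psi>) + J (cut (- S) \<psi>)"
      unfolding J_def by (rule Bochner_Integration.integral_add[OF rapidD(2)[OF r(1)] rapidD(2)[OF r(2)]])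
    finally show "J \<psi> = J (cut S \<psi>) + J (cut (- S) \<psi>)" .
  qed
  \<comment> \<open>One ball is cut off at a time, so the pieces are disjoint and their norms
    \<open>J\<close> add up exactly, whatever the number of balls.\<close>
  have cover: "\<bar>E \<psi>\<bar> \<le> 2 * C * K * \<delta> * J \<psi>" if "finite P" "rapid \<psi>" "\<And>x. \<psi> x \<noteq> 0 \<Longrightarrow> \<exists>p\<in>P. norm (x - p) \<le> \<delta>" "0 < \<delta>" "\<delta> \<le> 1" for P \<psi> \<delta>
    using that
  proof (induction P arbitrary: \<psi> rule: finite_induct)
    case empty
    hence "\<psi> x = 0" for x by blast
    hence "E \<psi> = E (\<lambda>_. 0)" by presburger
    also have "E (\<lambda>_. 0) = 0"
    proof -
      have "\<bar>E (\<lambda>_. 0)\<bar> \<le> 2 * C * B * J (\<lambda>_. 0)" by (rule crude) (simp add: rapid_def)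
      thus ?thesis by (simp add: J_def)
    qed
    finally show ?case using C K J0[of \<psi>] empty by simp
  next
    case (insert p P)
    define S where "S = cball p \<delta>"
    have S: "S \<in> sets borel" by (simp add: S_def)
    define \<psi>1 where "\<psi>1 = (cut S \<psi>)"
    define \<psi>2 where "\<psi>2 = (cut (- S) \<psi>)"
    have r: "rapid \<psi>1" "rapid \<psi>2" unfolding \<psi>1_def \<psi>2_def using S insert.prems by (auto intro!: rapid_cut)
    have "\<bar>E \<psi>1\<bar> \<le> 2 * C * K * \<delta> * J \<psi>1"
      by (rule loc[OF r(1), of p]) (use insert.prems in \<open>auto simp: \<psi>1_def S_def indicator_def dist_norm norm_minus_commute split: if_splits\<close>)
    moreover have "\<bar>E \<psi>2\<bar> \<le> 2 * C * K * \<delta> * J \<psi>2"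
    proof (rule insert.IH[OF r(2)])
      fix x assume "\<psi>2 x \<noteq> 0"
      hence "x \<notin> S" "\<psi> x \<noteq> 0" by (auto simp: \<psi>2_def indicator_def split: if_splits)
      thus "\<exists>p\<in>P. norm (x - p) \<le> \<delta>" using insert.prems(2)[of x] by (auto simp: S_def dist_norm norm_minus_commute)
    qed (use insert.prems in auto)
    ultimately show ?case
      unfolding split(1)[OF insert.prems(1) S] split(2)[OF insert.prems(1) S] \<psi>1_def[symmetric] \<psi>2_def[symmetric]
      by (simp add: ring_distribs)
  qed
  define tail where "tail = (\<lambda>n::nat. J (cut (- cball 0 (real n)) \<psi>))"
  have tail: "tail \<longlonglongrightarrow> 0"
  proof -
    note [measurable] = rapidD(1)[OF \<psi>]
    have "tail \<longlonglongrightarrow> (\<integral>x. 0 \<partial>(lborel :: (real^3) measure))"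
      unfolding tail_def J_def
    proof (rule integral_dominated_convergence)
      show "integrable lborel (\<lambda>x. (1 + norm x) ^ N * \<bar>\<psi> x\<bar>)" by (rule rapidD(2)[OF \<psi>])
      show "AE x in lborel. (\<lambda>n. (1 + norm x) ^ N * \<bar>indicator (- cball 0 (real n)) x * \<psi> x\<bar>) \<longlonglongrightarrow> 0"
      proof (rule AE_I2)
        fix x :: "real^3"
        obtain n0 where n0: "norm x \<le> real n0" using real_arch_simple by blast
        have "\<forall>\<^sub>F n in sequentially. (1 + norm x) ^ N * \<bar>indicator (- cball 0 (real n)) x * \<psi> x\<bar> = 0"
          using eventually_ge_at_top[of n0] by eventually_elim (use n0 in auto)
        thus "(\<lambda>n. (1 + norm x) ^ N * \<bar>indicator (- cball 0 (real n)) x * \<psi> x\<bar>) \<longlonglongrightarrow> 0" by (rule tendsto_eventually)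
      qed
      show "AE x in lborel. norm ((1 + norm x) ^ N * \<bar>indicator (- cball 0 (real n)) x * \<psi> x\<bar>) \<le> (1 + norm x) ^ N * \<bar>\<psi> x\<bar>" for n
        by (intro AE_I2) (auto simp: indicator_def)
    qed measurable
    thus ?thesis by simp
  qed
  \<comment> \<open>Pieces of size 1 / (n + 1) are used inside the ball of radius n, and the crude
    bound with the vanishing tail outside.\<close>
  have final: "\<bar>E \<psi>\<bar> \<le> 2 * C * K * (1 / real (Suc n)) * J \<psi> + 2 * C * B * tail n" for n
  proof -
    define \<delta> where "\<delta> = 1 / real (Suc n)"
    have \<delta>: "0 < \<delta>" "\<delta> \<le> 1" by (auto simp: \<delta>_def)
    define S where "S = cball (0 :: real^3) (real n)"
    have S: "S \<in> sets borel" by (simp add: S_def)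
    have "compact S" by (simp add: S_def)
    moreover have "S \<subseteq> (\<Union>p\<in>S. ball p \<delta>)" using \<delta> by auto
    ultimately obtain P where P: "P \<subseteq> S" "finite P" "S \<subseteq> (\<Union>p\<in>P. ball p \<delta>)"
      by (rule compactE_image[OF _ open_ball])
    have r: "rapid (cut S \<psi>)" "rapid (cut (- S) \<psi>)" using S by (auto intro!: rapid_cut \<psi>)
    have "\<bar>E (cut S \<psi>)\<bar> \<le> 2 * C * K * \<delta> * J (cut S \<psi>)"
    proof (rule cover[OF P(2) r(1) _ \<delta>])
      fix x assume "indicator S x * \<psi> x \<noteq> 0"
      hence "x \<in> S" by (auto simp: indicator_def split: if_splits)
      then obtain p where "p \<in> P" "x \<in> ball p \<delta>" using P(3) by blast
      thus "\<exists>p\<in>P. norm (x - p) \<le> \<delta>" by (intro bexI[of _ p]) (auto simp: dist_norm norm_minus_commute)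
    qed
    also have "\<dots> \<le> 2 * C * K * \<delta> * J \<psi>"
      using split(2)[OF \<psi> S] J0[of "\<lambda>x. indicator (- S) x * \<psi> x"] C K \<delta> by (intro mult_left_mono) auto
    finally have "\<bar>E (cut S \<psi>)\<bar> \<le> 2 * C * K * \<delta> * J \<psi>" .
    moreover have "\<bar>E (cut (- S) \<psi>)\<bar> \<le> 2 * C * B * tail n" unfolding tail_def S_def[symmetric] by (rule crude[OF r(2)])
    ultimately show ?thesis unfolding split(1)[OF \<psi> S] \<delta>_def by linarith
  qed
  have "(\<lambda>n. 2 * C * K * (1 / real (Suc n)) * J \<psi> + 2 * C * B * tail n) \<longlonglongrightarrow> 2 * C * K * 0 * J \<psi> + 2 * C * B * 0"
    by (intro tendsto_intros tail LIMSEQ_Suc[OF lim_1_over_n])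
  hence "\<bar>E \<psi>\<bar> \<le> 0" using final by (intro LIMSEQ_le_const[where X = "\<lambda>n. 2 * C * K * (1 / real (Suc n)) * J \<psi> + 2 * C * B * tail n"]) auto
  thus "f (conv \<psi> \<phi>) = (\<integral>x. \<psi> x * f (\<lambda>y. \<phi> (y - x)) \<partial>lborel)" by (simp add: E_def h_def)
qed

section \<open>Mollification by the heat kernel and the heat flow of a distribution\<close>

lemma conv_commute:
  assumes [measurable]: "\<psi> \<in> borel_measurable borel" "\<phi> \<in> borel_measurable borel"
  shows "conv \<psi> \<phi> y = conv \<phi> \<psi> y"
proof -
  have u: "distr lborel borel uminus = (lborel :: (real^3) measure)"
    using lborel_affine[of "-1" "0 :: real^3"] by (simp add: one_ennreal_def[symmetric] density_1)
  have "conv \<psi> \<phi> y = (\<integral>x. \<psi> (y + x) * \<phi> (y - (y + x)) \<partial>lborel)"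
    unfolding conv_def by (rule integral_lborel_translate[symmetric]) measurable
  also have "\<dots> = (\<integral>x. \<psi> (y + x) * \<phi> (- x) \<partial>lborel)" by simp
  also have "\<dots> = (\<integral>x. \<psi> (y + x) * \<phi> (- x) \<partial>(distr lborel borel uminus))" unfolding u ..
  also have "\<dots> = (\<integral>x. \<psi> (y + - x) * \<phi> (- (- x)) \<partial>lborel)" by (rule integral_distr) measurable
  finally show ?thesis by (simp add: conv_def mult.commute)
qed

text \<open>Read off from the Fourier transform at frequency 0.\<close>

lemma integral_heat_kernel:
  assumes t: "t > 0"
  shows "(\<integral>z. heat_kernel t z \<partial>lborel) = 1"
proof -
  have "complex_of_real (\<integral>z. heat_kernel t (0 - z) \<partial>lborel) = fourier (heat_kernel_at t 0) 0"
    unfolding fourier_def by simp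
  also have "\<dots> = 1" unfolding fourier_heat_kernel[OF t] by (simp add: gaussian_def)
  finally have "(\<integral>z. heat_kernel t (0 - z) \<partial>lborel) = 1" by (simp only: of_real_eq_1_iff)
  thus ?thesis by (simp add: heat_kernel_def)
qed

text \<open>Half of the Gaussian exponent absorbs the polynomial factor, and the rest is the kernel
  at time 2 t, again of mass one; |z| contributes sqrt t. The restriction t <= 1 compares |z| with
  |z| / sqrt t.\<close>

lemma heat_kernel_moment_pointwise:
  obtains C where "C \<ge> 0" "\<And>t z. 0 < t \<Longrightarrow> t \<le> 1 \<Longrightarrow> heat_kernel t z * (norm z * (1 + norm z) ^ n) \<le> C * sqrt t * heat_kernel (2 * t) z"
proof -
  obtain C where C: "C \<ge> 0" "\<forall>u\<ge>0. (1 + u) ^ (n + 1) * exp (- (1/8::real) * u) \<le> C"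
    using power_exp_bounded[of "1/8" "n + 1"] by (meson zero_less_divide_1_iff zero_less_numeral)
  \<comment> \<open>2^n comes from 1 + |z| <= 2 (1 + u), and 2^(3/2) from the normalising factors at
    times t and 2 t.\<close>
  define D where "D = 2 ^ n * C * 2 powr (3/2)"
  have "heat_kernel t z * (norm z * (1 + norm z) ^ n) \<le> D * sqrt t * heat_kernel (2 * t) z" if t: "0 < t" "t \<le> 1" for t z
  proof -
    define v where "v = norm z / sqrt t"
    define u where "u = v\<^sup>2"
    have v: "v \<ge> 0" "norm z = sqrt t * v" "u = (norm z)\<^sup>2 / t" using t by (auto simp: v_def u_def power_divide)
    have u: "u \<ge> 0" by (simp add: u_def)
    have vu: "v \<le> 1 + u" using zero_le_power2[of "v - 1"] v(1) unfolding power2_diff u_def by simp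
    have "sqrt t * v \<le> 1 * v" using t v(1) by (intro mult_right_mono) auto
    hence "norm z \<le> v" using v(2) by simp
    hence "1 + norm z \<le> 2 * (1 + u)" using vu u by simp
    hence w: "(1 + norm z) ^ n \<le> (2 * (1 + u)) ^ n" by (intro power_mono) auto
    have "norm z * (1 + norm z) ^ n \<le> (sqrt t * (1 + u)) * (2 * (1 + u)) ^ n"
      using w vu t u v by (intro mult_mono) auto
    also have "\<dots> = sqrt t * 2 ^ n * (1 + u) ^ (n + 1)" unfolding power_mult_distrib power_add power_one_right by (simp only: mult_ac)
    finally have le: "norm z * (1 + norm z) ^ n \<le> sqrt t * 2 ^ n * (1 + u) ^ (n + 1)" .
    have e: "exp (- (norm z)\<^sup>2 / (4 * t)) = exp (- (1/8) * u) * exp (- (1/8) * u)"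
      unfolding v(3) exp_add[symmetric] by simp
    have p: "(4 * pi * t) powr (-3/2) = 2 powr (3/2) * (4 * pi * (2 * t)) powr (-3/2)"
    proof -
      have "(4 * pi * (2 * t)) powr (-3/2) = (2 * (4 * pi * t)) powr (-3/2)" by (simp add: mult_ac)
      also have "\<dots> = 2 powr (-3/2) * (4 * pi * t) powr (-3/2)" by (rule powr_mult)
      finally have "2 powr (3/2) * (4 * pi * (2 * t)) powr (-3/2) = (2 powr (3/2) * 2 powr (-3/2)) * (4 * pi * t) powr (-3/2)" by (simp only: mult.assoc)
      also have "2 powr (3/2) * 2 powr (-3/2) = (1::real)" by (simp add: powr_add[symmetric])
      finally show ?thesis by simp
    qed
    have h2: "heat_kernel (2 * t) z = (4 * pi * (2 * t)) powr (-3/2) * exp (- (1/8) * u)"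
      unfolding heat_kernel_def v(3) by simp
    have "heat_kernel t z * (norm z * (1 + norm z) ^ n) \<le> heat_kernel t z * (sqrt t * 2 ^ n * (1 + u) ^ (n + 1))"
      by (intro mult_left_mono le) simp
    also have "\<dots> = (4 * pi * t) powr (-3/2) * (sqrt t * 2 ^ n) * exp (- (1/8) * u) * ((1 + u) ^ (n + 1) * exp (- (1/8) * u))"
      unfolding heat_kernel_def e by (simp only: mult_ac)
    also have "\<dots> \<le> (4 * pi * t) powr (-3/2) * (sqrt t * 2 ^ n) * exp (- (1/8) * u) * C"
      using t C(2) u by (intro mult_left_mono) auto
    also have "\<dots> = D * sqrt t * heat_kernel (2 * t) z" unfolding h2 p D_def by (simp only: mult_ac)
    finally show ?thesis .
  qed
  moreover have "D \<ge> 0" using C(1) by (simp add: D_def)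
  ultimately show thesis using that by blast
qed

text \<open>The kernel has mass one, so the error is an average of increments of \<phi>, each
  bounded in the seminorm by |z| (1 + |z|)^N; the moment bound gives the rate sqrt t.\<close>

lemma mollify:
  assumes f: "tempered f" and \<phi>: "\<phi> \<in> schwartz"
  obtains M where "M \<ge> 0" "\<And>t. 0 < t \<Longrightarrow> t \<le> 1 \<Longrightarrow> \<bar>f (conv \<phi> (heat_kernel t)) - f \<phi>\<bar> \<le> M * sqrt t"
proof -
  obtain C N where "seminorm_bound f C N" using tempered_bound[OF f] by blast
  note C = seminorm_boundD(1)[OF this] and CN = seminorm_boundD(2)[OF this]
  obtain L where L: "L \<ge> 0" "\<And>ks p. length ks \<le> N \<Longrightarrow> (1 + norm (fst p)) ^ N * \<bar>partials ks \<phi> (fst p + snd p) - partials ks \<phi> (fst p)\<bar> \<le> L * (norm (snd p) * (1 + norm (snd p)) ^ N)"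
  proof (rule uniform_over_short_lists[of "\<lambda>ks p. (1 + norm (fst p)) ^ N * \<bar>partials ks \<phi> (fst p + snd p) - partials ks \<phi> (fst p)\<bar>" "\<lambda>p. norm (snd p) * (1 + norm (snd p)) ^ N" N])
    fix ks
    obtain B where "B \<ge> 0" "\<And>x h. (1 + norm x) ^ N * \<bar>partials ks \<phi> (x + h) - partials ks \<phi> x\<bar> \<le> B * norm h * (1 + norm h) ^ N"
      by (rule schwartz_lipschitz[OF schwartz_partials[OF \<phi>, of ks], of N]) blast
    thus "\<exists>B\<ge>0. \<forall>p. (1 + norm (fst p)) ^ N * \<bar>partials ks \<phi> (fst p + snd p) - partials ks \<phi> (fst p)\<bar> \<le> B * (norm (snd p) * (1 + norm (snd p)) ^ N)"
      by (intro exI[of _ B]) (simp add: mult.assoc)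
  qed auto
  obtain G where G: "G \<ge> 0" "\<And>t z. 0 < t \<Longrightarrow> t \<le> 1 \<Longrightarrow> heat_kernel t z * (norm z * (1 + norm z) ^ N) \<le> G * sqrt t * heat_kernel (2 * t) z"
    by (rule heat_kernel_moment_pointwise[of N]) blast
  have "\<bar>f (conv \<phi> (heat_kernel t)) - f \<phi>\<bar> \<le> (C * (L * G)) * sqrt t" if t: "0 < t" "t \<le> 1" for t
  proof -
    note [measurable] = schwartz_borel[OF \<phi>] schwartz_borel[OF schwartz_partials[OF \<phi>]]
    have hk: "rapid (heat_kernel t)" "rapid (heat_kernel (2 * t))" using t by (auto intro!: schwartz_rapid heat_kernel_schwartz)
    note hi = rapid_integrable[OF hk(1)] rapid_integrable[OF hk(2)]
    have comm: "conv \<phi> (heat_kernel t) = conv (heat_kernel t) \<phi>"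
      by (rule ext, rule conv_commute) measurable
    note cs = conv_schwartz[OF hk(1) \<phi>]
    have s: "(\<lambda>y. 1 * conv (heat_kernel t) \<phi> y + (-1) * \<phi> y) \<in> schwartz" by (intro schwartz_lincomb cs \<phi>)
    have "\<bar>f (\<lambda>y. 1 * conv (heat_kernel t) \<phi> y + (-1) * \<phi> y)\<bar> \<le> C * (L * (G * sqrt t))"
    proof (rule CN[OF s])
      fix ks y assume ks: "length (ks :: 3 list) \<le> N"
      define g where "g = (\<lambda>z. partials ks \<phi> (y - z) - partials ks \<phi> y)"
      have ip: "integrable lborel (\<lambda>x. heat_kernel t x * partials ks \<phi> (y - x))"
        by (rule conv_integrable[OF hi(1) schwartz_partials[OF \<phi>]])
      have gi: "integrable lborel (\<lambda>z. heat_kernel t z * g z)"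
        unfolding g_def right_diff_distrib using ip hi(1) by simp
      have "partials ks (\<lambda>y. 1 * conv (heat_kernel t) \<phi> y + (-1) * \<phi> y) y = conv (heat_kernel t) (partials ks \<phi>) y - partials ks \<phi> y * (\<integral>z. heat_kernel t z \<partial>lborel)"
        unfolding partials_lincomb[OF cs \<phi>] partials_conv[OF hi(1) \<phi>] integral_heat_kernel[OF t(1)] by simp
      also have "\<dots> = (\<integral>z. heat_kernel t z * g z \<partial>lborel)"
        unfolding g_def right_diff_distrib conv_def using ip hi(1) by (simp add: mult.commute)
      finally have "(1 + norm y) ^ N * \<bar>partials ks (\<lambda>y. 1 * conv (heat_kernel t) \<phi> y + (-1) * \<phi> y) y\<bar> \<le> (1 + norm y) ^ N * (\<integral>z. \<bar>heat_kernel t z * g z\<bar> \<partial>lborel)"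
        using integral_abs_bound[of lborel "\<lambda>z. heat_kernel t z * g z"] by (simp add: mult_left_mono)
      also have "\<dots> = (\<integral>z. (1 + norm y) ^ N * \<bar>heat_kernel t z * g z\<bar> \<partial>lborel)" by simp
      also have "\<dots> \<le> (\<integral>z. L * (G * sqrt t) * heat_kernel (2 * t) z \<partial>lborel)"
      proof (rule integral_mono)
        show "integrable lborel (\<lambda>z. (1 + norm y) ^ N * \<bar>heat_kernel t z * g z\<bar>)" using gi by simp
        show "integrable lborel (\<lambda>z. L * (G * sqrt t) * heat_kernel (2 * t) z)" using hi(2) by simp
        fix z
        have "(1 + norm y) ^ N * \<bar>heat_kernel t z * g z\<bar> = heat_kernel t z * ((1 + norm y) ^ N * \<bar>g z\<bar>)" by (simp add: abs_mult)
        also have "\<dots> \<le> heat_kernel t z * (L * (norm z * (1 + norm z) ^ N))"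
          using L(2)[OF ks, of "(y, - z)"] by (intro mult_left_mono) (auto simp: g_def)
        also have "\<dots> = L * (heat_kernel t z * (norm z * (1 + norm z) ^ N))" by simp
        also have "\<dots> \<le> L * (G * sqrt t * heat_kernel (2 * t) z)" by (intro mult_left_mono G t L)
        finally show "(1 + norm y) ^ N * \<bar>heat_kernel t z * g z\<bar> \<le> L * (G * sqrt t) * heat_kernel (2 * t) z" by (simp add: mult_ac)
      qed
      also have "\<dots> = L * (G * sqrt t)" using t integral_heat_kernel[of "2 * t"] by simp
      finally show "(1 + norm y) ^ N * \<bar>partials ks (\<lambda>y. 1 * conv (heat_kernel t) \<phi> y + (-1) * \<phi> y) y\<bar> \<le> L * (G * sqrt t)" .
    qed
    moreover have "f (\<lambda>y. 1 * conv (heat_kernel t) \<phi> y + (-1) * \<phi> y) = f (conv \<phi> (heat_kernel t)) - f \<phi>"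
      unfolding tempered_lincomb[OF f cs \<phi>] comm by simp
    ultimately show ?thesis by (simp add: mult_ac)
  qed
  moreover have "C * (L * G) \<ge> 0" using C L G by simp
  ultimately show thesis using that by blast
qed

lemma heat_eq_translate: "heat t f x = f (\<lambda>y. heat_kernel t (y - x))"
  unfolding heat_def heat_kernel_commute[of t x] ..

text \<open>The kernel is even, so the heat flow at x is the distribution applied to the translated
  kernel. The claims are then cases of \<open>tempered_conv\<close> and its companions, with the
  kernel as the translated function and \<phi> as the weight.\<close>

lemma
  assumes f: "tempered f" and t: "t > 0"
  shows continuous_heat: "continuous_on UNIV (heat t f)"
    and heat_dual: "\<phi> \<in> schwartz \<Longrightarrow> f (conv \<phi> (heat_kernel t)) = (\<integral>x. \<phi> x * heat t f x \<partial>lborel)"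
    and heat_dual_integrable: "\<phi> \<in> schwartz \<Longrightarrow> integrable lborel (\<lambda>x. \<phi> x * heat t f x)"
proof -
  show "continuous_on UNIV (heat t f)"
    using continuous_tempered_translate[OF f heat_kernel_schwartz[OF t] schwartz_rapid[OF heat_kernel_schwartz[OF t]]] by (simp add: heat_eq_translate[abs_def])
  assume \<phi>: "\<phi> \<in> schwartz"
  show "f (conv \<phi> (heat_kernel t)) = (\<integral>x. \<phi> x * heat t f x \<partial>lborel)" "integrable lborel (\<lambda>x. \<phi> x * heat t f x)"
    using tempered_conv[OF f heat_kernel_schwartz[OF t] schwartz_rapid[OF \<phi>]] tempered_conv_integrable[OF f heat_kernel_schwartz[OF t] schwartz_rapid[OF \<phi>]]
    by (simp_all add: heat_eq_translate)
qed

text \<open>By the mean value theorem in time, with the time derivative again in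
  \<open>heat_family\<close>, the kernel is Lipschitz in every seminorm on a compact interval around
  t.\<close>

lemma heat_time_continuous:
  assumes f: "tempered f" and t: "t > 0"
  shows "isCont (\<lambda>t. heat t f x) t"
proof -
  obtain C N where "seminorm_bound f C N" using tempered_bound[OF f] by blast
  note C = seminorm_boundD(1)[OF this] and CN = seminorm_boundD(2)[OF this]
  define I where "I = {t / 2..2 * t}"
  \<comment> \<open>The value 0 for times outside \<open>I\<close> makes the inequality hold for all
    pairs, as \<open>uniform_over_short_lists\<close> requires.\<close>
  obtain B where B: "B \<ge> 0" "\<And>ks p. length ks \<le> N \<Longrightarrow> (if snd p \<in> I then (1 + norm (fst p)) ^ N * \<bar>partials ks (heat_kernel (snd p)) (fst p) - partials ks (heat_kernel t) (fst p)\<bar> else 0) \<le> B * \<bar>snd p - t\<bar>"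
  proof (rule uniform_over_short_lists[of "\<lambda>ks p. (if snd p \<in> I then (1 + norm (fst p)) ^ N * \<bar>partials ks (heat_kernel (snd p)) (fst p) - partials ks (heat_kernel t) (fst p)\<bar> else 0)" "\<lambda>p. \<bar>snd p - t\<bar>" N])
    fix ks
    obtain g where g: "g \<in> heat_family" "\<forall>t>0. partials ks (heat_kernel t) = g t"
      using heat_family_partials[OF heat_family.base] by blast
    obtain d where d: "d \<in> heat_family" "\<forall>t>0. \<forall>z. ((\<lambda>t. g t z) has_real_derivative d t z) (at t)"
      using heat_family_time_derivative[OF g(1)] by blast
    obtain B where B: "\<forall>t\<in>I. \<forall>z. (1 + norm z) ^ N * \<bar>d t z\<bar> \<le> B"
      using heat_family_bound[of "t / 2" "2 * t" d N] d(1) t unfolding I_def by auto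
    have "(1 + norm z) ^ N * \<bar>g s z - g t z\<bar> \<le> B * \<bar>s - t\<bar>" if s: "s \<in> I" for s z
    proof (cases "s = t")
      case False
      define a where "a = min s t"
      define b where "b = max s t"
      have ab: "a < b" "a \<ge> t / 2" "b \<le> 2 * t" "a > 0" using False s t by (auto simp: a_def b_def I_def min_def max_def)
      obtain r where r: "a < r" "r < b" "g b z - g a z = (b - a) * d r z"
        using MVT2[of a b "\<lambda>t. g t z" "\<lambda>t. d t z"] ab d(2) by force
      have "\<bar>g s z - g t z\<bar> = \<bar>s - t\<bar> * \<bar>d r z\<bar>"
      proof -
        have "\<bar>g s z - g t z\<bar> = \<bar>g b z - g a z\<bar>" by (auto simp: a_def b_def min_def max_def)
        moreover have "\<bar>b - a\<bar> = \<bar>s - t\<bar>" by (auto simp: a_def b_def min_def max_def)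
        ultimately show ?thesis unfolding r(3) abs_mult by simp
      qed
      hence "(1 + norm z) ^ N * \<bar>g s z - g t z\<bar> = \<bar>s - t\<bar> * ((1 + norm z) ^ N * \<bar>d r z\<bar>)" by simp
      also have "\<dots> \<le> \<bar>s - t\<bar> * B" using B r ab by (intro mult_left_mono) (auto simp: I_def)
      finally show ?thesis by (simp add: mult.commute)
    qed simp
    hence "(if snd p \<in> I then (1 + norm (fst p)) ^ N * \<bar>partials ks (heat_kernel (snd p)) (fst p) - partials ks (heat_kernel t) (fst p)\<bar> else 0) \<le> \<bar>B\<bar> * \<bar>snd p - t\<bar>" for p
      using g(2) t mult_right_mono[OF abs_ge_self[of B], of "\<bar>snd p - t\<bar>"] by (auto simp: I_def intro: order_trans)
    thus "\<exists>B\<ge>0. \<forall>p. (if snd p \<in> I then (1 + norm (fst p)) ^ N * \<bar>partials ks (heat_kernel (snd p)) (fst p) - partials ks (heat_kernel t) (fst p)\<bar> else 0) \<le> B * \<bar>snd p - t\<bar>"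
      by (intro exI[of _ "\<bar>B\<bar>"]) auto
  qed auto
  define K where "K = C * ((1 + norm x) ^ N * B)"
  have lip: "\<bar>heat s f x - heat t f x\<bar> \<le> K * \<bar>s - t\<bar>" if s: "s \<in> I" for s
  proof -
    have s0: "s > 0" using s t by (simp add: I_def)
    note hs = heat_kernel_schwartz[OF s0] heat_kernel_schwartz[OF t]
    note ts = schwartz_translate[OF hs(1), of x] schwartz_translate[OF hs(2), of x]
    have "\<bar>f (\<lambda>y. 1 * heat_kernel s (y - x) + (-1) * heat_kernel t (y - x))\<bar> \<le> C * ((1 + norm x) ^ N * (B * \<bar>s - t\<bar>))"
    proof (rule CN[OF schwartz_lincomb[OF ts]])
      fix ks y assume ks: "length (ks :: 3 list) \<le> N"
      have "(1 + norm y) ^ N * \<bar>partials ks (heat_kernel s) (y - x) - partials ks (heat_kernel t) (y - x)\<bar>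
        \<le> ((1 + norm x) ^ N * (1 + norm (y - x)) ^ N) * \<bar>partials ks (heat_kernel s) (y - x) - partials ks (heat_kernel t) (y - x)\<bar>"
        using weight_power_mult[of x "y - x" N] by (intro mult_right_mono) auto
      also have "\<dots> \<le> (1 + norm x) ^ N * (B * \<bar>s - t\<bar>)"
        unfolding mult.assoc using B(2)[OF ks, of "(y - x, s)"] s by (intro mult_left_mono) auto
      finally show "(1 + norm y) ^ N * \<bar>partials ks (\<lambda>y. 1 * heat_kernel s (y - x) + (-1) * heat_kernel t (y - x)) y\<bar> \<le> (1 + norm x) ^ N * (B * \<bar>s - t\<bar>)"
        unfolding partials_lincomb[OF ts] partials_translate[OF hs(1)] partials_translate[OF hs(2)] by simp
    qed
    moreover have "f (\<lambda>y. 1 * heat_kernel s (y - x) + (-1) * heat_kernel t (y - x)) = heat s f x - heat t f x"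
      unfolding tempered_lincomb[OF f ts] heat_eq_translate by simp
    ultimately show ?thesis by (simp add: K_def mult_ac)
  qed
  show ?thesis
    unfolding isCont_def
  proof (rule LIM_zero_cancel)
    show "((\<lambda>s. heat s f x - heat t f x) \<longlongrightarrow> 0) (at t)"
    proof (rule Lim_null_comparison)
      have "\<forall>\<^sub>F s in at t. s \<in> {t / 2<..<2 * t}" using t by (intro eventually_at_in_open') auto
      thus "\<forall>\<^sub>F s in at t. norm (heat s f x - heat t f x) \<le> K * \<bar>s - t\<bar>"
        by eventually_elim (use lip in \<open>auto simp: I_def\<close>)
      show "((\<lambda>s. K * \<bar>s - t\<bar>) \<longlongrightarrow> 0) (at t)" by (auto intro!: tendsto_eq_intros)
    qed
  qed
qed

text \<open>A Schwartz function lies below a multiple of \<open>ball_kernel 4 1\<close>, so the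
  pairing is controlled by a potential at time 1 evaluated at the origin.\<close>

lemma marcinkiewicz_test_integral:
  assumes \<phi>: "\<phi> \<in> schwartz" and r: "r > 0"
  obtains C where "C \<ge> 0" "\<And>A f. marcinkiewicz r A f \<Longrightarrow> f \<in> borel_measurable borel \<Longrightarrow> A \<ge> 0 \<Longrightarrow>
    (\<integral>\<^sup>+x. ennreal \<bar>\<phi> x\<bar> * f x \<partial>lborel) \<le> ennreal (C * A)"
proof -
  obtain B where B: "B \<ge> 0" "\<And>x. (1 + norm x) ^ 0 * \<bar>\<phi> x\<bar> \<le> B * ball_kernel 4 1 x" by (rule schwartz_le_ball_kernel[OF \<phi>]) blast
  have "4 + 3 / r > 3" using r by (simp add: add_pos_pos)
  then obtain C where C: "C \<ge> 0" "\<And>A f x. marcinkiewicz r A f \<Longrightarrow> f \<in> borel_measurable borel \<Longrightarrow> A \<ge> 0 \<Longrightarrow>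
    ball_potential 4 1 f x \<le> ennreal (C * A)"
    using nn_integral_ball_kernel_le[of 1 4 r] by auto
  have "(\<integral>\<^sup>+x. ennreal \<bar>\<phi> x\<bar> * f x \<partial>lborel) \<le> ennreal (B * C * A)"
    if f: "marcinkiewicz r A f" and [measurable]: "f \<in> borel_measurable borel" and A: "A \<ge> 0" for A f
  proof -
    have "(\<integral>\<^sup>+x. ennreal \<bar>\<phi> x\<bar> * f x \<partial>lborel) \<le> (\<integral>\<^sup>+x. ennreal B * (ennreal (ball_kernel 4 1 (0 - x)) * f x) \<partial>lborel)"
    proof (rule nn_integral_mono)
      fix x
      have "ennreal \<bar>\<phi> x\<bar> \<le> ennreal (B * ball_kernel 4 1 (0 - x))" using B(2)[of x] by (intro ennreal_leI) (simp add: ball_kernel_def)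
      also have "\<dots> = ennreal B * ennreal (ball_kernel 4 1 (0 - x))" using B(1) by (simp add: ennreal_mult)
      finally show "ennreal \<bar>\<phi> x\<bar> * f x \<le> ennreal B * (ennreal (ball_kernel 4 1 (0 - x)) * f x)"
        unfolding mult.assoc[symmetric] by (rule mult_right_mono) simp
    qed
    also have "\<dots> = ennreal B * (\<integral>\<^sup>+x. ennreal (ball_kernel 4 1 (0 - x)) * f x \<partial>lborel)" by (rule nn_integral_cmult) measurable
    also have "\<dots> \<le> ennreal B * ennreal (C * A)" using f A by (intro mult_left_mono C(2)) auto
    also have "\<dots> = ennreal (B * C * A)" using B(1) C(1) A by (simp add: ennreal_mult[symmetric] mult.assoc)
    finally show ?thesis .
  qed
  moreover have "B * C \<ge> 0" using B C by simp
  ultimately show thesis using that by blast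
qed

section \<open>The initial data\<close>

text \<open>Comparison with this solution turns the estimates for two flows into estimates for a
  single one.\<close>

lemma mild_solution_zero: "mild_solution T (\<lambda>_ _. 0) (\<lambda>_. 0) (\<lambda>_ _. 0) (\<lambda>_ _. 0)"
proof -
  have t: "tempered (\<lambda>_. 0)" unfolding tempered_def by (auto intro!: exI[of _ 0])
  have h: "heat t (\<lambda>_. 0) x = 0" for t x by (simp add: heat_def)
  have c: "transport_term (\<lambda>_ _. 0) (\<lambda>_ _. 0) t s x = 0" "convection_term (\<lambda>_ _. 0) i t s x = 0" "buoyancy_term (\<lambda>_ _. 0) i t s x = 0" for t s x i
    by (simp_all add: transport_term_def convection_term_def buoyancy_term_def heat_def leray_def dist_div_def dist_partial_def regular_def)
  show ?thesis
    unfolding mild_solution_def c h using t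
    by (simp add: divergence_free_def dist_div_def dist_partial_def set_integrable_def)
qed

lemma C_Lp_zero: "(\<lambda>_ _. 0) \<in> C_Lp T p"
  by (simp add: C_Lp_def Lp_space_def Lp_norm_def)

lemma weak_norm_zero: "q > 0 \<Longrightarrow> weak_norm q (\<lambda>_. 0) = 0"
  using weak_bound_imp_weak_norm_le[of q 0 "\<lambda>_. 0"] by (simp add: weak_bound_def)

lemma Y_space_zero: "q > 0 \<Longrightarrow> (\<lambda>_ _. 0) \<in> Y_space T q"
  unfolding Y_space_def L_inf_loc_weak_def by (auto simp: weak_norm_zero intro!: exI[of _ 0] exI[of _ 1])

section \<open>The temperature datum\<close>

context mild_flow
begin

abbreviation heat_close :: "real \<Rightarrow> real \<Rightarrow> bool" where
  "heat_close C t \<equiv> (AE x in lborel.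
     (\<forall>i. ennreal \<bar>u t x $ i - heat t (u0 i) x\<bar> \<le> ennreal C *
        (duhamel 4 t (\<lambda>s y. ennreal (norm (u s y) * norm (u s y))) x + duhamel 3 t (\<lambda>s y. ennreal \<bar>\<theta> s y\<bar>) x)) \<and>
     ennreal \<bar>\<theta> t x - heat t \<theta>0 x\<bar> \<le> ennreal C * duhamel 4 t (\<lambda>s y. ennreal (\<bar>\<theta> s y\<bar> * norm (u s y))) x)"

text \<open>\<open>deviation\<close> applied against the zero solution: the difference of the heat
  flows of the data reduces to that of the given data.\<close>

lemma heat_deviation:
  "\<exists>C>0. AE t\<in>{0<..<T} in lborel. heat_close C t"
proof -
  interpret Z: mild_flows T q u0 \<theta>0 u \<theta> "\<lambda>_ _. 0" "\<lambda>_. 0" "\<lambda>_ _. 0" "\<lambda>_ _. 0"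
    using T q q_facts by unfold_locales (auto intro: mild_solution_zero C_Lp_zero Y_space_zero)
  have d: "Z.fc = (\<lambda>s y. ennreal (norm (u s y) * norm (u s y)))" "Z.ft = (\<lambda>s y. ennreal (\<bar>\<theta> s y\<bar> * norm (u s y)))" "Z.\<eta> = (\<lambda>s y. \<bar>\<theta> s y\<bar>)"
    by (simp_all add: fun_eq_iff Z.fc_def Z.ft_def Z.w_def Z.\<eta>_def)
  have h: "heat t (\<lambda>_. 0) x = 0" for t x by (simp add: heat_def)
  show ?thesis using Z.deviation unfolding d h by simp
qed

lemma u_weak_near_0: "\<exists>A>0. \<exists>d>0. d \<le> T \<and> (\<forall>s. 0 \<le> s \<and> s < d \<longrightarrow> weak_bound 3 A (\<lambda>x. norm (u s x)))"
proof -
  obtain A where A: "A > 0" "weak_bound 3 A (\<lambda>x. norm (u 0 x))" using u_weak[of 0] T by auto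
  obtain d where d: "d > 0" "\<forall>s\<in>{0..T}. \<bar>s - 0\<bar> < d \<longrightarrow> weak_bound 3 1 (\<lambda>x. norm (u s x - u 0 x))"
    using u_near[of 0 1] T by auto
  have "weak_bound 3 (4 * (1 + A)) (\<lambda>x. norm (u s x))" if s: "0 \<le> s" "s < min d T" for s
  proof -
    have "weak_bound 3 (4 * (1 + A)) (\<lambda>x. \<bar>norm (u s x - u 0 x)\<bar> + \<bar>norm (u 0 x)\<bar>)"
      using d s A by (intro weak_bound_add) auto
    thus ?thesis
    proof (rule weak_bound_mono_AE)
      show "AE x in lborel. \<bar>norm (u s x)\<bar> \<le> \<bar>\<bar>norm (u s x - u 0 x)\<bar> + \<bar>norm (u 0 x)\<bar>\<bar>"
        using norm_triangle_sub[of "u s _" "u 0 _"] by (intro AE_I2) (simp add: add.commute)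
    qed measurable
  qed
  thus ?thesis using A d T by (intro exI[of _ "4 * (1 + A)"] conjI exI[of _ "min d T"]) auto
qed

text \<open>The heat flow of the datum is the temperature plus its Duhamel term, and the endpoint
  estimate with a = 0 gives the latter the same weight in t as the former.\<close>

lemma heat_initial_AE:
  "\<exists>K>0. \<exists>d>0. AE t\<in>{0<..<d} in lborel. marcinkiewicz q (K * t powr (- decay q)) (\<lambda>x. ennreal \<bar>heat t \<theta>0 x\<bar>)"
proof -
  obtain A d where A: "A > 0" "d > 0" "d \<le> T" "\<forall>s. 0 \<le> s \<and> s < d \<longrightarrow> weak_bound 3 A (\<lambda>x. norm (u s x))"
    using u_weak_near_0 by blast
  obtain Q where Q: "Q > 0" "AE s\<in>{0<..<T} in lborel. weak_bound q (Q * s powr (- decay q)) (\<theta> s)" using \<theta>_decay by blast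
  obtain P where "product_bound q 3 (prod_exponent q) P" using weak_bound_mult[of "prod_exponent q" q 3] q_facts by auto
  note P = product_boundD[OF this]
  let ?F = "\<lambda>s y. ennreal (\<bar>\<theta> s y\<bar> * norm (u s y))"
  have prod: "AE s\<in>{0<..<d} in lborel. marcinkiewicz (prod_exponent q) (P * Q * A * time_weight 0 (decay q) s) (?F s)"
    using Q(2)
  proof eventually_elim
    case (elim s)
    show ?case
    proof
      assume s: "s \<in> {0<..<d}"
      have "marcinkiewicz (prod_exponent q) (P * (Q * s powr (- decay q)) * A) (\<lambda>y. ennreal (\<bar>\<theta> s y\<bar> * \<bar>norm (u s y)\<bar>))"
        using elim s A Q(1) by (intro P) auto
      thus "marcinkiewicz (prod_exponent q) (P * Q * A * time_weight 0 (decay q) s) (?F s)"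
        using s by (simp add: time_weight_def mult_ac)
    qed
  qed
  obtain E where "duhamel_bound 4 (prod_exponent q) q (decay q) (- decay q) E"
    using duhamel_endpoint[OF q_facts(4,5,8) q_facts(1,2)] by blast
  note E = duhamel_boundD[OF this]
  obtain C where C: "C > 0" "AE t\<in>{0<..<T} in lborel. heat_close C t"
    using heat_deviation by blast
  define K where "K = dyadic_const 1 q * Q + C * (E * (P * Q * A))"
  have dc: "dyadic_const 1 q > 0" using q_facts by (intro dyadic_const_pos) auto
  have "AE t\<in>{0<..<d} in lborel. marcinkiewicz q (K * t powr (- decay q)) (\<lambda>x. ennreal \<bar>heat t \<theta>0 x\<bar>)"
    using C(2) Q(2)
  proof eventually_elim
    case (elim t)
    show ?case
    proof
      assume t: "t \<in> {0<..<d}"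
      have "AE s\<in>{0<..<t} in lborel. marcinkiewicz (prod_exponent q) (P * Q * A * time_weight 0 (decay q) s) (?F s)"
        using prod by eventually_elim (use t in auto)
      hence m1: "marcinkiewicz q (E * (P * Q * A) * (t - 0) powr (- decay q)) (duhamel 4 t ?F)"
        using t P(1) Q(1) A by (intro E) auto
      have m2: "marcinkiewicz q (dyadic_const 1 q * (Q * t powr (- decay q))) (\<lambda>x. ennreal \<bar>\<theta> t x\<bar>)"
        using elim t A Q(1) q_facts by (intro weak_bound_imp_marcinkiewicz) auto
      have "marcinkiewicz q (dyadic_const 1 q * (Q * t powr (- decay q)) + C * (E * (P * Q * A) * (t - 0) powr (- decay q)))
        (\<lambda>x. ennreal \<bar>\<theta> t x\<bar> + ennreal C * duhamel 4 t ?F x)"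
        using C(1) dc Q(1) E(1) P(1) A by (intro marcinkiewicz_add m2 marcinkiewicz_cmult m1) auto
      thus "marcinkiewicz q (K * t powr (- decay q)) (\<lambda>x. ennreal \<bar>heat t \<theta>0 x\<bar>)"
      proof (rule marcinkiewicz_mono_AE)
        have "AE x in lborel. ennreal \<bar>\<theta> t x - heat t \<theta>0 x\<bar> \<le> ennreal C * duhamel 4 t ?F x" using elim t A by auto
        thus "AE x in lborel. ennreal \<bar>heat t \<theta>0 x\<bar> \<le> ennreal \<bar>\<theta> t x\<bar> + ennreal C * duhamel 4 t ?F x"
        proof eventually_elim
          case (elim x)
          have "ennreal \<bar>heat t \<theta>0 x\<bar> \<le> ennreal (\<bar>\<theta> t x\<bar> + \<bar>\<theta> t x - heat t \<theta>0 x\<bar>)" by (intro ennreal_leI) simp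
          also have "\<dots> = ennreal \<bar>\<theta> t x\<bar> + ennreal \<bar>\<theta> t x - heat t \<theta>0 x\<bar>" by simp
          also have "\<dots> \<le> ennreal \<bar>\<theta> t x\<bar> + ennreal C * duhamel 4 t ?F x" using elim by (intro add_left_mono)
          finally show ?case .
        qed
      qed (simp add: K_def algebra_simps)
    qed
  qed
  moreover have "K > 0" using dc Q(1) C(1) E(1) P(1) A by (simp add: K_def add_pos_nonneg)
  ultimately show ?thesis using A(2) by blast
qed

lemma initial_tempered: "tempered \<theta>0" "tempered (u0 i)"
  using mild by (auto simp: mild_solution_def)

text \<open>The heat flow is continuous in time, so Fatou's lemma carries the bound from almost every time to all times.\<close>

lemma heat_initial:
  "\<exists>K>0. \<exists>d>0. \<forall>t. 0 < t \<and> t < d \<longrightarrow> marcinkiewicz q (K * t powr (- decay q)) (\<lambda>x. ennreal \<bar>heat t \<theta>0 x\<bar>)"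
proof -
  obtain K d where K: "K > 0" "d > 0" "AE t\<in>{0<..<d} in lborel. marcinkiewicz q (K * t powr (- decay q)) (\<lambda>x. ennreal \<bar>heat t \<theta>0 x\<bar>)"
    using heat_initial_AE by blast
  have "marcinkiewicz q ((K * 2 powr decay q) * t powr (- decay q)) (\<lambda>x. ennreal \<bar>heat t \<theta>0 x\<bar>)" if t: "0 < t" "t < d" for t
  proof -
    \<comment> \<open>The approximating times stay above t / 2, which limits the loss in the weight
      to the factor 2^(decay).\<close>
    define L where "L n = max (t / 2) (t - 1 / real (Suc n))" for n
    have L: "L n < t" "L n \<ge> t / 2" for n using t by (auto simp: L_def)
    have "\<forall>n. \<exists>s. s \<in> {L n<..<t} \<and> marcinkiewicz q (K * s powr (- decay q)) (\<lambda>x. ennreal \<bar>heat s \<theta>0 x\<bar>)"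
    proof (rule allI, rule AE_lborel_obtain[OF _ L(1)])
      fix n
      show "AE s\<in>{L n<..<t} in lborel. marcinkiewicz q (K * s powr (- decay q)) (\<lambda>x. ennreal \<bar>heat s \<theta>0 x\<bar>)"
        using K(3) by eventually_elim (use L(2)[of n] t in auto)
    qed blast
    from choice[OF this] obtain \<tau> where \<tau>: "\<And>n. \<tau> n \<in> {L n<..<t}" "\<And>n. marcinkiewicz q (K * \<tau> n powr (- decay q)) (\<lambda>x. ennreal \<bar>heat (\<tau> n) \<theta>0 x\<bar>)" by blast
    have \<tau>2: "\<tau> n > t / 2" "\<tau> n > 0" for n using \<tau>(1)[of n] L(2)[of n] t by auto
    have lim: "\<tau> \<longlonglongrightarrow> t"
    proof (rule real_tendsto_sandwich[where f = "\<lambda>n. t - 1 / real (Suc n)" and h = "\<lambda>_. t"])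
      show "\<forall>\<^sub>F n in sequentially. t - 1 / real (Suc n) \<le> \<tau> n"
        using \<tau>(1) by (intro always_eventually allI) (auto simp: L_def intro: less_imp_le)
      show "\<forall>\<^sub>F n in sequentially. \<tau> n \<le> t" using \<tau>(1) by (intro always_eventually allI) (auto intro: less_imp_le)
      show "(\<lambda>n. t - 1 / real (Suc n)) \<longlonglongrightarrow> t" using tendsto_diff[OF tendsto_const LIMSEQ_Suc[OF lim_1_over_n], of t] by simp
    qed simp
    have m: "heat s \<theta>0 \<in> borel_measurable borel" if "s > 0" for s
      by (rule borel_measurable_continuous_onI[OF continuous_heat[OF initial_tempered(1) that]])
    note [measurable] = m[OF t(1)] m[OF \<tau>2(2)]
    show ?thesis
      unfolding marcinkiewicz_def
    proof (intro ballI impI)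
      fix E :: "(real^3) set" assume [measurable]: "E \<in> sets borel" and fin: "emeasure lborel E < \<infinity>"
      have "mass E (\<lambda>x. ennreal \<bar>heat t \<theta>0 x\<bar>) = (\<integral>\<^sup>+x. liminf (\<lambda>n. indicator E x * ennreal \<bar>heat (\<tau> n) \<theta>0 x\<bar>) \<partial>lborel)"
      proof (rule nn_integral_cong, rule lim_imp_Liminf[symmetric])
        fix x
        have "(\<lambda>n. heat (\<tau> n) \<theta>0 x) \<longlonglongrightarrow> heat t \<theta>0 x"
          using isCont_tendsto_compose[OF heat_time_continuous[OF initial_tempered(1) t(1)] lim] .
        hence "(\<lambda>n. ennreal \<bar>heat (\<tau> n) \<theta>0 x\<bar>) \<longlonglongrightarrow> ennreal \<bar>heat t \<theta>0 x\<bar>" by (intro tendsto_ennrealI tendsto_rabs)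
        thus "(\<lambda>n. indicator E x * ennreal \<bar>heat (\<tau> n) \<theta>0 x\<bar>) \<longlonglongrightarrow> indicator E x * ennreal \<bar>heat t \<theta>0 x\<bar>"
          by (cases "x \<in> E") auto
      qed simp
      also have "\<dots> \<le> liminf (\<lambda>n. \<integral>\<^sup>+x. indicator E x * ennreal \<bar>heat (\<tau> n) \<theta>0 x\<bar> \<partial>lborel)"
        by (rule nn_integral_liminf) measurable
      also have "\<dots> \<le> liminf (\<lambda>n. ennreal (K * 2 powr decay q * t powr (- decay q) * measure lborel E powr (1 - 1 / q)))"
      proof (intro Liminf_mono always_eventually allI)
        fix n
        have "mass E (\<lambda>x. ennreal \<bar>heat (\<tau> n) \<theta>0 x\<bar>) \<le> ennreal (K * \<tau> n powr (- decay q) * measure lborel E powr (1 - 1 / q))"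
          by (rule marcinkiewiczD[OF \<tau>(2) _ fin]) simp
        also have "\<dots> \<le> ennreal (K * 2 powr decay q * t powr (- decay q) * measure lborel E powr (1 - 1 / q))"
        proof (rule ennreal_leI, rule mult_right_mono)
          have "\<tau> n powr (- decay q) \<le> (t / 2) powr (- decay q)" using \<tau>2(1)[of n] t q_facts by (intro powr_mono2') auto
          also have "\<dots> = 2 powr decay q * t powr (- decay q)" using t powr_divide[of t 2 "- decay q"] by (simp add: powr_minus_divide)
          finally show "K * \<tau> n powr (- decay q) \<le> K * 2 powr decay q * t powr (- decay q)"
            unfolding mult.assoc using K(1) by (intro mult_left_mono) auto
        qed simp
        finally show "mass E (\<lambda>x. ennreal \<bar>heat (\<tau> n) \<theta>0 x\<bar>) \<le> ennreal (K * 2 powr decay q * t powr (- decay q) * measure lborel E powr (1 - 1 / q))" .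
      qed
      also have "\<dots> = ennreal (K * 2 powr decay q * t powr (- decay q) * measure lborel E powr (1 - 1 / q))" by (rule Liminf_const) simp
      finally show "mass E (\<lambda>x. ennreal \<bar>heat t \<theta>0 x\<bar>) \<le> ennreal (K * 2 powr decay q * t powr (- decay q) * measure lborel E powr (1 - 1 / q))" .
    qed
  qed
  thus ?thesis using K by (intro exI[of _ "K * 2 powr decay q"] conjI exI[of _ d]) auto
qed

text \<open>The exponents match because half of 3 (1 - 1/q) is \<open>decay q\<close>.\<close>

lemma initial_Besov: "\<theta>0 \<in> Besov_Lorentz (3 * (1 - 1/q)) q"
proof -
  obtain K d where K: "K > 0" "d > 0" "\<forall>t. 0 < t \<and> t < d \<longrightarrow> marcinkiewicz q (K * t powr (- decay q)) (\<lambda>x. ennreal \<bar>heat t \<theta>0 x\<bar>)"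
    using heat_initial by blast
  have "ennreal (t powr (3 * (1 - 1/q) / 2)) * weak_norm q (heat t \<theta>0) \<le> ennreal K" if t: "t \<in> {0<..<d}" for t
  proof -
    have m: "heat t \<theta>0 \<in> borel_measurable borel"
      using t by (intro borel_measurable_continuous_onI continuous_heat initial_tempered) auto
    have "weak_bound q (K * t powr (- decay q)) (heat t \<theta>0)"
      using K t m q_facts by (intro marcinkiewicz_imp_weak_bound) auto
    hence "weak_norm q (heat t \<theta>0) \<le> ennreal (K * t powr (- decay q))"
      using K(1) q_facts by (intro weak_bound_imp_weak_norm_le) auto
    hence "ennreal (t powr decay q) * weak_norm q (heat t \<theta>0) \<le> ennreal (t powr decay q) * ennreal (K * t powr (- decay q))"
      by (intro mult_left_mono) auto
    also have "\<dots> = ennreal K" using t K(1) by (simp add: ennreal_mult[symmetric] powr_minus)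
    finally show ?thesis by (simp add: decay_def)
  qed
  hence "(SUP t\<in>{0<..<d}. ennreal (t powr (3 * (1 - 1/q) / 2)) * weak_norm q (heat t \<theta>0)) \<le> ennreal K"
    by (intro SUP_least)
  also have "\<dots> < top" by simp
  finally show ?thesis unfolding Besov_Lorentz_def using K(2) initial_tempered(1) by blast
qed

end

section \<open>The velocity datum\<close>

lemma integrable_test:
  fixes g :: "real^3 \<Rightarrow> real"
  assumes \<phi>: "\<phi> \<in> schwartz" and [measurable]: "g \<in> borel_measurable borel" and g: "weak_bound 3 A g" "A > 0"
  shows "integrable lborel (\<lambda>x. \<phi> x * g x)"
proof (rule integrableI_bounded)
  have [measurable]: "\<phi> \<in> borel_measurable borel" by (rule rapidD(1)[OF schwartz_rapid[OF \<phi>]])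
  show "(\<lambda>x. \<phi> x * g x) \<in> borel_measurable lborel" by measurable
  have m: "marcinkiewicz 3 (dyadic_const 1 3 * A) (\<lambda>x. ennreal \<bar>g x\<bar>)" using g by (intro weak_bound_imp_marcinkiewicz) auto
  have "dyadic_const 1 3 > 0" by (rule dyadic_const_pos) auto
  moreover obtain C where "C \<ge> 0" "\<And>A f. marcinkiewicz 3 A f \<Longrightarrow> f \<in> borel_measurable borel \<Longrightarrow> A \<ge> 0 \<Longrightarrow>
    (\<integral>\<^sup>+x. ennreal \<bar>\<phi> x\<bar> * f x \<partial>lborel) \<le> ennreal (C * A)"
    by (rule marcinkiewicz_test_integral[OF \<phi>, of 3]) auto
  ultimately have "(\<integral>\<^sup>+x. ennreal \<bar>\<phi> x\<bar> * ennreal \<bar>g x\<bar> \<partial>lborel) \<le> ennreal (C * (dyadic_const 1 3 * A))"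
    using m g by auto
  also have "\<dots> < \<infinity>" by simp
  finally show "(\<integral>\<^sup>+x. ennreal (norm (\<phi> x * g x)) \<partial>lborel) < \<infinity>" by (simp add: ennreal_mult abs_mult)
qed

context mild_flow
begin

text \<open>Four errors are of size \<open>e\<close> at a small time t: mollification of the datum,
  the drift of u in L^3, the convection term, and the buoyancy term. Convection gains sqrt t when
  measured in weak L^(3/2); buoyancy gains nothing in weak L^3 and is small through the weighted
  norm of \<theta> near 0.\<close>

lemma initial_velocity_close:
  assumes \<phi>: "\<phi> \<in> schwartz"
  shows "\<exists>K. \<forall>e>0. \<bar>u0 i \<phi> - regular (\<lambda>x. u 0 x $ i) \<phi>\<bar> \<le> K * e"
proof -
  obtain A d1 where A: "A > 0" "d1 > 0" "d1 \<le> T" "\<forall>s. 0 \<le> s \<and> s < d1 \<longrightarrow> weak_bound 3 A (\<lambda>x. norm (u s x))"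
    using u_weak_near_0 by blast
  let ?D1 = "\<lambda>t. duhamel 4 t (\<lambda>s y. ennreal (norm (u s y) * norm (u s y)))"
  let ?D2 = "\<lambda>t. duhamel 3 t (\<lambda>s y. ennreal \<bar>\<theta> s y\<bar>)"
  obtain M where M: "M \<ge> 0" "\<And>t. 0 < t \<Longrightarrow> t \<le> 1 \<Longrightarrow> \<bar>u0 i (conv \<phi> (heat_kernel t)) - u0 i \<phi>\<bar> \<le> M * sqrt t"
    using mollify[OF initial_tempered(2) \<phi>] by blast
  obtain P where "product_bound 3 3 (3/2) P" using weak_bound_mult[of "3/2" 3 3] by auto
  note P = product_boundD[OF this]
  obtain E1 where "duhamel_bound 4 (3/2) (3/2) 0 ((3 - 2) / 2 - 0) E1"
    using duhamel_subcritical[of "3/2" "3/2" 4 2 0] by auto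
  note E1 = duhamel_boundD[OF this]
  obtain E2 where "duhamel_bound 3 q 3 (decay q) ((3 - 3 / q) / 2 - decay q) E2"
    using duhamel_subcritical[of q 3 3 "3 / q" "decay q"] q q_facts by (auto simp: right_diff_distrib)
  note E2 = duhamel_boundD[OF this]
  obtain C where C: "C > 0" "AE t\<in>{0<..<T} in lborel. heat_close C t"
    using heat_deviation by blast
  obtain R3 where R3: "R3 \<ge> 0" "\<And>A f. marcinkiewicz 3 A f \<Longrightarrow> f \<in> borel_measurable borel \<Longrightarrow> A \<ge> 0 \<Longrightarrow>
    (\<integral>\<^sup>+x. ennreal \<bar>\<phi> x\<bar> * f x \<partial>lborel) \<le> ennreal (R3 * A)"
    by (rule marcinkiewicz_test_integral[OF \<phi>, of 3]) auto
  obtain R2 where R2: "R2 \<ge> 0" "\<And>A f. marcinkiewicz (3/2) A f \<Longrightarrow> f \<in> borel_measurable borel \<Longrightarrow> A \<ge> 0 \<Longrightarrow>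
    (\<integral>\<^sup>+x. ennreal \<bar>\<phi> x\<bar> * f x \<partial>lborel) \<le> ennreal (R2 * A)"
    by (rule marcinkiewicz_test_integral[OF \<phi>, of "3/2"]) auto
  define c3 cq where "c3 = dyadic_const 1 3" and "cq = dyadic_const 1 q"
  have dc: "c3 > 0" "cq > 0" unfolding c3_def cq_def using q_facts by (auto intro: dyadic_const_pos)
  define B where "B = R3 * c3 + C * (R2 * (E1 * (P * A * A)) + R3 * (E2 * cq))"
  have B: "B \<ge> 0" using R3(1) R2(1) C(1) E1(1) E2(1) P(1) A(1) dc by (simp add: B_def)
  have "\<bar>u0 i \<phi> - regular (\<lambda>x. u 0 x $ i) \<phi>\<bar> \<le> (M + B) * e" if e: "e > 0" for e
  proof -
    obtain d2 where d2: "d2 > 0" "\<forall>s\<in>{0..T}. \<bar>s - 0\<bar> < d2 \<longrightarrow> weak_bound 3 e (\<lambda>x. norm (u s x - u 0 x))"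
      using u_near[of 0 e] T e by auto
    obtain d3 where d3: "d3 > 0" "AE s in lborel. 0 < s \<and> s < 0 + d3 \<and> s < T \<longrightarrow> weak_bound q (e * (s - 0) powr (- decay q)) (\<theta> s)"
      using \<theta>_small[of 0 e] T e by auto
    \<comment> \<open>The entry 1 is the range of \<open>mollify\<close>, and e^2 turns sqrt t into
      \<open>e\<close>; the others are the ranges of the uniform bound, the drift and the small
      temperature.\<close>
    define d where "d = min (min d1 d2) (min d3 (min 1 (e\<^sup>2)))"
    have d: "d > 0" "d \<le> d1" "d \<le> d2" "d \<le> d3" "d \<le> 1" "d \<le> e\<^sup>2" using A d2 d3 e by (auto simp: d_def)
    have "AE t\<in>{0<..<d} in lborel. (AE x in lborel. \<forall>i. ennreal \<bar>u t x $ i - heat t (u0 i) x\<bar> \<le> ennreal C * (?D1 t x + ?D2 t x))"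
      using C(2) by eventually_elim (use d A in auto)
    \<comment> \<open>A single time suffices, because the quantity to be bounded does not depend on
      time.\<close>
    from AE_lborel_obtain[OF this d(1)] obtain t where t: "t \<in> {0<..<d}" "AE x in lborel. \<forall>i. ennreal \<bar>u t x $ i - heat t (u0 i) x\<bar> \<le> ennreal C * (?D1 t x + ?D2 t x)"
      by blast
    have tT: "0 < t" "t < T" "t < d1" "t < d2" "t < d3" "t \<le> 1" "t \<le> e\<^sup>2" using t d A by auto
    have st: "sqrt t \<le> e" using real_sqrt_le_mono[OF tT(7)] e by simp
    have m1: "marcinkiewicz (3/2) (E1 * (P * A * A) * (t - 0) powr ((3 - 2) / 2 - 0)) (?D1 t)"
    proof (rule E1)
      show "AE s\<in>{0<..<t} in lborel. marcinkiewicz (3/2) (P * A * A * time_weight 0 0 s) (\<lambda>y. ennreal (norm (u s y) * norm (u s y)))"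
      proof (intro AE_I2 impI)
        fix s assume s: "s \<in> {0<..<t}"
        have "marcinkiewicz (3/2) (P * A * A) (\<lambda>y. ennreal (\<bar>norm (u s y)\<bar> * \<bar>norm (u s y)\<bar>))"
          using A s tT by (intro P) auto
        thus "marcinkiewicz (3/2) (P * A * A * time_weight 0 0 s) (\<lambda>y. ennreal (norm (u s y) * norm (u s y)))"
          using s by (simp add: time_weight_def)
      qed
    qed (use tT P A in auto)
    have m2: "marcinkiewicz 3 (E2 * (cq * e) * (t - 0) powr ((3 - 3 / q) / 2 - decay q)) (?D2 t)"
    proof (rule E2)
      show "AE s\<in>{0<..<t} in lborel. marcinkiewicz q (cq * e * time_weight 0 (decay q) s) (\<lambda>y. ennreal \<bar>\<theta> s y\<bar>)"
        using d3(2)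
      proof eventually_elim
        case (elim s)
        show ?case
        proof
          assume s: "s \<in> {0<..<t}"
          have "marcinkiewicz q (dyadic_const 1 q * (e * s powr (- decay q))) (\<lambda>y. ennreal \<bar>\<theta> s y\<bar>)"
            using elim s tT e q_facts by (intro weak_bound_imp_marcinkiewicz) auto
          thus "marcinkiewicz q (cq * e * time_weight 0 (decay q) s) (\<lambda>y. ennreal \<bar>\<theta> s y\<bar>)"
            using s by (simp add: time_weight_def cq_def mult.assoc)
        qed
      qed
    qed (use tT dc e in auto)
    have m3: "marcinkiewicz 3 (c3 * e) (\<lambda>x. ennreal \<bar>norm (u t x - u 0 x)\<bar>)"
      unfolding c3_def using d2 tT e by (intro weak_bound_imp_marcinkiewicz) auto
    have p1: "(t - 0) powr ((3 - 2) / 2 - 0) = sqrt t" using tT by (simp add: powr_half_sqrt)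
    have p2: "(t - 0) powr ((3 - 3 / q) / 2 - decay q) = 1"
    proof -
      have "(3 - 3 / q) / 2 - decay q = 0" by (simp add: decay_def field_simps)
      thus ?thesis using tT by simp
    qed
    have m1': "marcinkiewicz (3/2) (E1 * (P * A * A) * e) (?D1 t)"
      using m1 unfolding p1 by (rule marcinkiewicz_mono) (use st E1(1) P(1) A(1) in \<open>auto intro: mult_left_mono\<close>)
    have m2': "marcinkiewicz 3 (E2 * (cq * e)) (?D2 t)" using m2 unfolding p2 by simp
    have [measurable]: "\<phi> \<in> borel_measurable borel" by (rule rapidD(1)[OF schwartz_rapid[OF \<phi>]])
    have [measurable]: "heat t (u0 i) \<in> borel_measurable borel"
      by (rule borel_measurable_continuous_onI[OF continuous_heat[OF initial_tempered(2) tT(1)]])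
    have i1: "integrable lborel (\<lambda>x. \<phi> x * heat t (u0 i) x)" by (rule heat_dual_integrable[OF initial_tempered(2) tT(1) \<phi>])
    have i2: "integrable lborel (\<lambda>x. \<phi> x * u 0 x $ i)"
    proof (rule integrable_test[OF \<phi> _ _ A(1)])
      show "weak_bound 3 A (\<lambda>x. u 0 x $ i)"
        by (rule weak_bound_mono_AE[of 3 A "\<lambda>x. norm (u 0 x)"]) (use A in \<open>auto simp: component_le_norm_cart\<close>)
    qed measurable
    have "\<bar>u0 i (conv \<phi> (heat_kernel t)) - regular (\<lambda>x. u 0 x $ i) \<phi>\<bar> = \<bar>\<integral>x. \<phi> x * heat t (u0 i) x - \<phi> x * u 0 x $ i \<partial>lborel\<bar>"
      unfolding heat_dual[OF initial_tempered(2) tT(1) \<phi>] regular_def using Bochner_Integration.integral_diff[OF i1 i2] by (simp add: mult.commute)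
    hence "ennreal \<bar>u0 i (conv \<phi> (heat_kernel t)) - regular (\<lambda>x. u 0 x $ i) \<phi>\<bar> \<le> (\<integral>\<^sup>+x. ennreal \<bar>\<phi> x * heat t (u0 i) x - \<phi> x * u 0 x $ i\<bar> \<partial>lborel)"
      using integral_norm_bound_ennreal[OF Bochner_Integration.integrable_diff[OF i1 i2]] by simp
    also have "\<dots> \<le> (\<integral>\<^sup>+x. ennreal \<bar>\<phi> x\<bar> * ennreal \<bar>norm (u t x - u 0 x)\<bar> + ennreal C * (ennreal \<bar>\<phi> x\<bar> * ?D1 t x + ennreal \<bar>\<phi> x\<bar> * ?D2 t x) \<partial>lborel)"
    proof (rule nn_integral_mono_AE, use t(2) in eventually_elim)
      case (elim x)
      have "\<bar>heat t (u0 i) x - u 0 x $ i\<bar> \<le> \<bar>u t x $ i - heat t (u0 i) x\<bar> + \<bar>(u t x - u 0 x) $ i\<bar>" by simp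
      hence "\<bar>heat t (u0 i) x - u 0 x $ i\<bar> \<le> \<bar>norm (u t x - u 0 x)\<bar> + \<bar>u t x $ i - heat t (u0 i) x\<bar>"
        using component_le_norm_cart[of "u t x - u 0 x" i] by linarith
      hence "ennreal \<bar>heat t (u0 i) x - u 0 x $ i\<bar> \<le> ennreal (\<bar>norm (u t x - u 0 x)\<bar> + \<bar>u t x $ i - heat t (u0 i) x\<bar>)" by (rule ennreal_leI)
      also have "\<dots> = ennreal \<bar>norm (u t x - u 0 x)\<bar> + ennreal \<bar>u t x $ i - heat t (u0 i) x\<bar>" by (rule ennreal_plus) auto
      also have "\<dots> \<le> ennreal \<bar>norm (u t x - u 0 x)\<bar> + ennreal C * (?D1 t x + ?D2 t x)" using elim by (intro add_left_mono) auto
      finally have "ennreal \<bar>\<phi> x\<bar> * ennreal \<bar>heat t (u0 i) x - u 0 x $ i\<bar> \<le> ennreal \<bar>\<phi> x\<bar> * (ennreal \<bar>norm (u t x - u 0 x)\<bar> + ennreal C * (?D1 t x + ?D2 t x))"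
        by (intro mult_left_mono) auto
      moreover have "ennreal \<bar>\<phi> x * heat t (u0 i) x - \<phi> x * u 0 x $ i\<bar> = ennreal \<bar>\<phi> x\<bar> * ennreal \<bar>heat t (u0 i) x - u 0 x $ i\<bar>"
        unfolding right_diff_distrib[symmetric] abs_mult by (rule ennreal_mult) auto
      ultimately show ?case by (simp only: distrib_left mult.left_commute[of _ "ennreal C"])
    qed
    also have "\<dots> = (\<integral>\<^sup>+x. ennreal \<bar>\<phi> x\<bar> * ennreal \<bar>norm (u t x - u 0 x)\<bar> \<partial>lborel)
        + ennreal C * ((\<integral>\<^sup>+x. ennreal \<bar>\<phi> x\<bar> * ?D1 t x \<partial>lborel) + (\<integral>\<^sup>+x. ennreal \<bar>\<phi> x\<bar> * ?D2 t x \<partial>lborel))"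
      by (simp add: nn_integral_add nn_integral_cmult)
    also have "\<dots> \<le> ennreal (R3 * (c3 * e)) + ennreal C * (ennreal (R2 * (E1 * (P * A * A) * e)) + ennreal (R3 * (E2 * (cq * e))))"
      using dc e E1(1) E2(1) P(1) A(1) by (intro add_mono mult_left_mono R3 R2 m1' m2' m3) auto
    also have "\<dots> = ennreal (R3 * (c3 * e) + C * (R2 * (E1 * (P * A * A) * e) + R3 * (E2 * (cq * e))))"
      using dc e E1(1) E2(1) P(1) A(1) C(1) R2(1) R3(1) by (simp add: ennreal_plus[symmetric] ennreal_mult[symmetric] del: ennreal_plus)
    also have "\<dots> = ennreal (B * e)" by (simp add: B_def algebra_simps)
    finally have "\<bar>u0 i (conv \<phi> (heat_kernel t)) - regular (\<lambda>x. u 0 x $ i) \<phi>\<bar> \<le> B * e"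
      using B e by simp
    moreover have "\<bar>u0 i (conv \<phi> (heat_kernel t)) - u0 i \<phi>\<bar> \<le> M * e"
      using M(2)[OF tT(1,6)] mult_left_mono[OF st M(1)] by linarith
    ultimately show ?thesis unfolding distrib_right by linarith
  qed
  thus ?thesis by blast
qed

lemma initial_velocity: "dist_in_Lp 3 u0"
proof -
  have "u0 i \<phi> = regular (\<lambda>x. u 0 x $ i) \<phi>" if \<phi>: "\<phi> \<in> schwartz" for i \<phi>
  proof -
    obtain K where K: "\<forall>e>0. \<bar>u0 i \<phi> - regular (\<lambda>x. u 0 x $ i) \<phi>\<bar> \<le> K * e" using initial_velocity_close[OF \<phi>] by blast
    have "\<bar>u0 i \<phi> - regular (\<lambda>x. u 0 x $ i) \<phi>\<bar> \<le> 0 + e" if e: "e > 0" for e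
    proof -
      \<comment> \<open>Dividing by |K| + 1 keeps the denominator positive whatever the sign of
        \<open>K\<close>.\<close>
      have "K * (e / (\<bar>K\<bar> + 1)) \<le> (\<bar>K\<bar> + 1) * (e / (\<bar>K\<bar> + 1))" using e by (intro mult_right_mono) auto
      also have "\<dots> = e" by (simp add: add_nonneg_eq_0_iff)
      finally show ?thesis using K[rule_format, of "e / (\<bar>K\<bar> + 1)"] e by (simp add: add_nonneg_pos)
    qed
    hence "\<bar>u0 i \<phi> - regular (\<lambda>x. u 0 x $ i) \<phi>\<bar> \<le> 0" by (rule field_le_epsilon)
    thus ?thesis by simp
  qed
  moreover have "u 0 \<in> Lp_space 3" using C_LpD(1)[OF u_C, of 0] T by auto
  ultimately show ?thesis unfolding dist_in_Lp_def by blast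
qed

end

section \<open>Passing to representatives, and the conclusion\<close>

lemma C_Lp_cong:
  assumes u: "u \<in> C_Lp T 3" and v: "\<And>s. s \<in> {0..T} \<Longrightarrow> v s \<in> borel_measurable borel" "\<And>s. s \<in> {0..T} \<Longrightarrow> AE x in lborel. v s x = u s x"
  shows "v \<in> C_Lp T 3"
proof -
  have "v t \<in> Lp_space 3" if t: "t \<in> {0..T}" for t
  proof -
    note [measurable] = C_LpD(2)[OF u t] v(1)[OF t]
    have "integrable lborel (\<lambda>x. norm (v t x) powr 3) \<longleftrightarrow> integrable lborel (\<lambda>x. norm (u t x) powr 3)"
    proof (rule integrable_cong_AE)
      show "AE x in lborel. norm (v t x) powr 3 = norm (u t x) powr 3" using v(2)[OF t] by eventually_elim simp
    qed measurable
    thus ?thesis using C_LpD(1)[OF u t] by (simp add: Lp_space_def)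
  qed
  moreover have "((\<lambda>s. Lp_norm 3 (\<lambda>x. v s x - v t x)) \<longlongrightarrow> 0) (at t within {0..T})" if t: "t \<in> {0..T}" for t
  proof (rule Lim_transform_eventually[OF C_LpD(3)[OF u t]])
    have "Lp_norm 3 (\<lambda>x. u s x - u t x) = Lp_norm 3 (\<lambda>x. v s x - v t x)" if s: "s \<in> {0..T}" for s
    proof -
      note [measurable] = C_LpD(2)[OF u t] v(1)[OF t] C_LpD(2)[OF u s] v(1)[OF s]
      have "(\<integral>x. norm (u s x - u t x) powr 3 \<partial>lborel) = (\<integral>x. norm (v s x - v t x) powr 3 \<partial>lborel)"
      proof (rule integral_cong_AE)
        show "AE x in lborel. norm (u s x - u t x) powr 3 = norm (v s x - v t x) powr 3"
          using v(2)[OF t] v(2)[OF s] by eventually_elim simp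
      qed measurable
      thus ?thesis by (simp add: Lp_norm_def)
    qed
    thus "\<forall>\<^sub>F s in at t within {0..T}. Lp_norm 3 (\<lambda>x. u s x - u t x) = Lp_norm 3 (\<lambda>x. v s x - v t x)"
      by (auto simp: eventually_at_filter)
  qed
  ultimately show ?thesis by (simp add: C_Lp_def)
qed

lemma Y_space_cong:
  assumes \<theta>: "\<theta> \<in> Y_space T q" and eq: "\<And>t. t \<in> {0<..<T} \<Longrightarrow> \<theta>' t = \<theta> t"
    and m: "(\<lambda>(t, x). \<theta>' t x) \<in> borel_measurable (borel \<Otimes>\<^sub>M borel)"
  shows "\<theta>' \<in> Y_space T q"
proof -
  have m': "(\<lambda>(t, x). \<theta>' t x) \<in> borel_measurable (restrict_space borel ({0<..<T} \<times> UNIV))"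
    using m by (intro measurable_restrict_space1) (simp add: borel_prod)
  have L: "\<theta> \<in> L_inf_loc_weak T q" using \<theta> by (simp add: Y_space_def)
  have "\<exists>C::real. AE t\<in>{a..b} in lborel. weak_norm q (\<theta>' t) \<le> ennreal C" if ab: "0 < a \<and> a \<le> b \<and> b < T" for a b
  proof -
    obtain C :: real where C: "AE t\<in>{a..b} in lborel. weak_norm q (\<theta> t) \<le> ennreal C"
      using L ab unfolding L_inf_loc_weak_def by blast
    have "AE t\<in>{a..b} in lborel. weak_norm q (\<theta>' t) \<le> ennreal C"
      using C by eventually_elim (use ab eq in auto)
    thus ?thesis by blast
  qed
  hence L': "\<theta>' \<in> L_inf_loc_weak T q" using m' by (simp add: L_inf_loc_weak_def)
  obtain C :: real where C: "AE t\<in>{0<..<T} in lborel. ennreal (t powr (3/2 * (1 - 1/q))) * weak_norm q (\<theta> t) \<le> ennreal C"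
    using \<theta> unfolding Y_space_def by blast
  have "AE t\<in>{0<..<T} in lborel. ennreal (t powr (3/2 * (1 - 1/q))) * weak_norm q (\<theta>' t) \<le> ennreal C"
    using C by eventually_elim (use eq in auto)
  moreover have "\<exists>\<delta>>0. AE t in lborel. t \<in> {0<..<T} \<and> t < \<delta> \<longrightarrow> ennreal (t powr (3/2 * (1 - 1/q))) * weak_norm q (\<theta>' t) \<le> ennreal e"
    if e: "e > 0" for e :: real
  proof -
    obtain \<delta> where \<delta>: "\<delta> > 0" "AE t in lborel. t \<in> {0<..<T} \<and> t < \<delta> \<longrightarrow> ennreal (t powr (3/2 * (1 - 1/q))) * weak_norm q (\<theta> t) \<le> ennreal e"
      using \<theta> e unfolding Y_space_def by blast
    have "AE t in lborel. t \<in> {0<..<T} \<and> t < \<delta> \<longrightarrow> ennreal (t powr (3/2 * (1 - 1/q))) * weak_norm q (\<theta>' t) \<le> ennreal e"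
      using \<delta>(2) by eventually_elim (use eq in auto)
    thus ?thesis using \<delta>(1) by blast
  qed
  ultimately show ?thesis using L' unfolding Y_space_def by blast
qed

text \<open>The velocity changes only on null sets of space at each time, and the temperature is
  only set to 0 outside (0, T); both changes are invisible to the hypotheses and to the
  conclusion.\<close>

lemma mild_flow_representative:
  assumes T: "T > 0" "3/2 < q" "q < 3" and mild: "mild_solution T u0 \<theta>0 u \<theta>" and u: "u \<in> C_Lp T 3" and \<theta>: "\<theta> \<in> Y_space T q"
  obtains v \<eta> where "mild_flow T q u0 \<theta>0 v \<eta>" "\<And>s. s \<in> {0..T} \<Longrightarrow> AE x in lborel. v s x = u s x" "\<And>s. s \<in> {0<..<T} \<Longrightarrow> \<eta> s = \<theta> s"
proof -
  obtain v where v: "jointly_borel v" "\<And>s. s \<in> {0..T} \<Longrightarrow> AE x in lborel. v s x = u s x"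
    using C_Lp_representative[OF u] by blast
  define \<eta> where "\<eta> s x = (if s \<in> {0<..<T} then \<theta> s x else 0)" for s x
  have \<eta>: "jointly_borel \<eta>"
    unfolding \<eta>_def using \<theta> by (intro L_inf_loc_weak_extend_measurable[of \<theta> T q]) (simp add: Y_space_def)
  have eq: "\<eta> s = \<theta> s" if "s \<in> {0<..<T}" for s using that by (simp add: \<eta>_def fun_eq_iff)
  have m: "v s \<in> borel_measurable borel" "\<eta> s \<in> borel_measurable borel" for s using v(1) \<eta> by measurable
  have "mild_flow T q u0 \<theta>0 v \<eta>"
  proof
    show "mild_solution T u0 \<theta>0 v \<eta>"
    proof (rule mild_solution_cong[OF mild])
      fix s assume s: "s \<in> {0<..<T}"
      show "u s \<in> borel_measurable borel" using C_LpD(2)[OF u, of s] s by auto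
      show "v s \<in> borel_measurable borel" by (rule m)
      show "AE x in lborel. v s x = u s x" using v(2)[of s] s by auto
      show "\<theta> s \<in> borel_measurable borel" using m(2)[of s] eq[OF s] by simp
      show "\<eta> s = \<theta> s" by (rule eq[OF s])
    qed
    show "v \<in> C_Lp T 3" by (rule C_Lp_cong[OF u m(1) v(2)])
    show "\<eta> \<in> Y_space T q" by (rule Y_space_cong[OF \<theta> eq \<eta>])
  qed (use T v \<eta> in auto)
  thus thesis using that v(2) eq by blast
qed

theorem theorem1p3:
  fixes T q :: real
    and u0 :: "3 \<Rightarrow> dist" and \<theta>0 :: dist
    and u :: "real \<Rightarrow> real^3 \<Rightarrow> real^3" and \<theta> :: "real \<Rightarrow> real^3 \<Rightarrow> real"
  assumes "T > 0" and "3/2 < q" and "q < 3"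
    and "mild_solution T u0 \<theta>0 u \<theta>"
    and "u \<in> C_Lp T 3" and "\<theta> \<in> Y_space T q"
  shows "dist_in_Lp 3 u0 \<and> \<theta>0 \<in> Besov_Lorentz (3 * (1 - 1/q)) q \<and>
    (\<forall>u' \<theta>'. mild_solution T u0 \<theta>0 u' \<theta>' \<and> u' \<in> C_Lp T 3 \<and> \<theta>' \<in> Y_space T q \<longrightarrow>
       (\<forall>t\<in>{0..T}. AE x in lborel. u' t x = u t x) \<and>
       (AE t in lborel. t \<in> {0<..<T} \<longrightarrow> (AE x in lborel. \<theta>' t x = \<theta> t x)))"
proof -
  obtain v \<eta> where v: "mild_flow T q u0 \<theta>0 v \<eta>" "\<And>s. s \<in> {0..T} \<Longrightarrow> AE x in lborel. v s x = u s x" "\<And>s. s \<in> {0<..<T} \<Longrightarrow> \<eta> s = \<theta> s"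
    using mild_flow_representative[OF assms] by blast
  have "(\<forall>t\<in>{0..T}. AE x in lborel. u' t x = u t x) \<and> (AE t\<in>{0<..<T} in lborel. (AE x in lborel. \<theta>' t x = \<theta> t x))"
    if u': "mild_solution T u0 \<theta>0 u' \<theta>'" "u' \<in> C_Lp T 3" "\<theta>' \<in> Y_space T q" for u' \<theta>'
  proof -
    obtain v' \<eta>' where v': "mild_flow T q u0 \<theta>0 v' \<eta>'" "\<And>s. s \<in> {0..T} \<Longrightarrow> AE x in lborel. v' s x = u' s x" "\<And>s. s \<in> {0<..<T} \<Longrightarrow> \<eta>' s = \<theta>' s"
      using mild_flow_representative[OF assms(1-3) u'] by blast
    interpret mild_pair T q u0 \<theta>0 v \<eta> v' \<eta>'
      by (intro mild_pair.intro mild_flows.intro v(1) v'(1))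
    have "AE x in lborel. u' t x = u t x" if t: "t \<in> {0..T}" for t
      using v(2)[OF t] v'(2)[OF t] uniqueness(1)[rule_format, OF t] by eventually_elim simp
    moreover have "AE t\<in>{0<..<T} in lborel. (AE x in lborel. \<theta>' t x = \<theta> t x)"
      using uniqueness(2) by eventually_elim (use v(3) v'(3) in auto)
    ultimately show ?thesis by blast
  qed
  thus ?thesis using mild_flow.initial_velocity[OF v(1)] mild_flow.initial_Besov[OF v(1)] by blast
qed

end
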